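(* For any Hopf algebra $B$ with bijective antipode $S$, the smash product $\mathcal H(B^* )\#\mathcal D(B)$ of the Heisenberg double $\mathcal H(B^* )$ with the Drinfeld double $\mathcal D(B)$, defined with respect to the action $$(\mu\otimes m)\triangleright(\beta\# b)=\mu'''(m'\rightharpoonup\beta)\,{S^*}^{-1}(\mu'')\ \#\ \bigl((m''\,b\,S(m'''))\leftharpoonup {S^*}^{-1}(\mu')\bigr),\qquad \mu\otimes m\in\mathcal D(B),\ \beta\# b\in\mathcal H(B^* ),$$ is a Hopf algebroid over $\mathcal H(B^* )$.
   Context: Notation. Primes denote Sweedler components of the coproduct. $\langle\ ,\ \rangle$ is evaluation; $B^*$ is the dual Hopf algebra of $B$, with product $\langle\alpha\beta,b\rangle=\langle\alpha,b'\rangle\langle\beta,b''\rangle$, coproduct $\beta\mapsto\beta'\otimes\beta''$ with $\langle\beta',a\rangle\langle\beta'',b\rangle=\langle\beta,ab\rangle$, unit $\varepsilon$ (the counit of $B$), and antipode $S^*$. Regular actions: $b\rightharpoonup\beta=\langle\beta'',b\rangle\beta'$, $\ \beta\leftharpoonup m=\langle\beta',m\rangle\beta''$, $\ b\leftharpoonup\mu=\langle\mu,b'\rangle b''$ ($b,m\in B$, $\beta,\mu\in B^*$). Heisenberg double: $\mathcal H(B^* )=B^*\# B$ is the vector space $B^*\otimes B$ with product $(\alpha\# a)(\beta\# b)=\alpha(a'\rightharpoonup\beta)\# a''b$. Drinfeld double: $\mathcal D(B)$ is the vector space $B^*\otimes B$ with product $(\mu\otimes m)(\nu\otimes n)=\mu(m'\rightharpoonup\nu\leftharpoonup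 S^{-1}(m'''))\otimes m''n$ and coproduct $\Delta(\mu\otimes m)=(\mu''\otimes m')\otimes(\mu'\otimes m'')$. Smash product: for a left $H$-module algebra $A$, $A\# H$ is $A\otimes H$ with product $(a\# h)(c\# g)=a(h'\triangleright c)\# h''g$. Hopf algebroid (in the sense of Lu and Brzezi\'nski--Militaru) over an algebra $A$: an algebra $\mathcal X$ with an algebra map $s:A\to\mathcal X$ and an algebra antihomomorphism $t:A\to\mathcal X$ with $s(a)t(b)=t(b)s(a)$; regard $\mathcal X$ as an $A$-bimodule by $a.x.b=s(a)t(b)x$. It is equipped with $A$-bimodule maps $\Delta:\mathcal X\to\mathcal X\otimes_A\mathcal X$ and $\epsilon:\mathcal X\to A$ making $\mathcal X$ an $A$-coring (coassociative and counital), such that: the image of $\Delta$ lies in $\mathcal X\times_A\mathcal X=\{\sum x_i\otimes_A y_i:\sum x_it(a)\otimes_A y_i=\sum x_i\otimes_A y_is(a)\ \forall a\in A\}$ and $\Delta:\mathcal X\to\mathcal X\times_A\mathcal X$ is an algebra map (with componentwise product); $\epsilon(1)=1$ and $\epsilon(xy)=\epsilon(x\,s(\epsilon(y)))=\epsilon(x\,t(\epsilon(y)))$. Further, there is an antipode: an algebra anti-automorphism $\tau$ of $\mathcal X$ with $\tau\circ t=s$, $m\circ(\tau\otimes\mathrm{id})\circ\Delta=t\circ\epsilon\circ\tau$, and such that there exists a section $\gamma:\mathcal X\otimes_A\mathcal X\to\mathcal X\otimes\mathcal X$ of the natural projection $\mathcal X\otimes\mathcal X\to\mathcal X\otimes_A\mathcal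 X$ with $m\circ(\mathrm{id}\otimes\tau)\circ\gamma\circ\Delta=s\circ\epsilon$ ($m$ is multiplication in $\mathcal X$). *)

theory Defs
  imports Complex_Main "HOL-Library.Poly_Mapping" "HOL-Library.Function_Algebras"
begin

section \<open>Vector spaces, bimodules, algebras, Hopf algebras\<close>

text \<open>
  The ground field is the type \<open>'k\<close>. A vector space is a subspace \<open>car V\<close> of a vector space whose
  underlying set is a whole type; addition is always the addition of the type class.
\<close>

record ('k, 'v) space =
  car :: "'v set"
  scl :: "'k \<Rightarrow> 'v \<Rightarrow> 'v"

record ('a, 'k, 'v) bimod = "('k, 'v) space" +
  lact :: "'a \<Rightarrow> 'v \<Rightarrow> 'v"
  ract :: "'v \<Rightarrow> 'a \<Rightarrow> 'v"

record ('k, 'v) alg = "('k, 'v) space" +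
  mul :: "'v \<Rightarrow> 'v \<Rightarrow> 'v"  (infixl "\<cdot>\<index>" 70)
  unt :: "'v"

text \<open>A coproduct takes values in the tensor square, whose elements are formal sums (see below).\<close>

record (overloaded) ('k :: zero, 'v) bialg = "('k :: zero, 'v) alg" +
  cop :: "'v \<Rightarrow> ('v \<times> 'v \<Rightarrow>\<^sub>0 'k :: zero)"
  cou :: "'v \<Rightarrow> 'k :: zero"

record (overloaded) ('k :: zero, 'v) hopf = "('k :: zero, 'v) bialg" +
  ant :: "'v \<Rightarrow> 'v"

locale kspace =
  fixes V :: "('k :: field, 'v :: ab_group_add, 'm) space_scheme"
  assumes ambient: "vector_space (scl V)"
    and subspace: "module.subspace (scl V) (car V)"

definition lin :: "('k :: field, 'v :: ab_group_add, 'm) space_scheme \<Rightarrow>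
    ('k, 'w :: ab_group_add, 'n) space_scheme \<Rightarrow> ('v \<Rightarrow> 'w) \<Rightarrow> bool" where
  "lin V W f \<longleftrightarrow> (\<forall>x\<in>car V. f x \<in> car W) \<and>
     (\<forall>x\<in>car V. \<forall>y\<in>car V. f (x + y) = f x + f y) \<and>
     (\<forall>c. \<forall>x\<in>car V. f (scl V c x) = scl W c (f x))"

lemma lin_zero: "lin V W f \<Longrightarrow> 0 \<in> car V \<Longrightarrow> f 0 = 0"
  unfolding lin_def by (metis add_cancel_right_right)

definition ground :: "('k :: field, 'k) space" where
  "ground = \<lparr>car = UNIV, scl = (*)\<rparr>"

locale kalgebra = kspace A
  for A :: "('k :: field, 'v :: ab_group_add, 'm) alg_scheme" +
  assumes mul_left: "y \<in> car A \<Longrightarrow> lin A A (\<lambda>x. x \<cdot>\<^bsub>A\<^esub> y)"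
    and mul_right: "x \<in> car A \<Longrightarrow> lin A A (\<lambda>y. x \<cdot>\<^bsub>A\<^esub> y)"
    and assoc: "\<lbrakk>x \<in> car A; y \<in> car A; z \<in> car A\<rbrakk> \<Longrightarrow> (x \<cdot>\<^bsub>A\<^esub> y) \<cdot>\<^bsub>A\<^esub> z = x \<cdot>\<^bsub>A\<^esub> (y \<cdot>\<^bsub>A\<^esub> z)"
    and unt_closed: "unt A \<in> car A"
    and unt_left: "x \<in> car A \<Longrightarrow> unt A \<cdot>\<^bsub>A\<^esub> x = x"
    and unt_right: "x \<in> car A \<Longrightarrow> x \<cdot>\<^bsub>A\<^esub> unt A = x"

definition algebra_map ::
  "('k :: field, 'v :: ab_group_add, 'm) alg_scheme \<Rightarrow>
   ('k, 'w :: ab_group_add, 'n) alg_scheme \<Rightarrow> ('v \<Rightarrow> 'w) \<Rightarrow> bool" where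
  "algebra_map A X f \<longleftrightarrow> lin A X f \<and> f (unt A) = unt X \<and>
     (\<forall>a\<in>car A. \<forall>b\<in>car A. f (a \<cdot>\<^bsub>A\<^esub> b) = f a \<cdot>\<^bsub>X\<^esub> f b)"

definition algebra_antimap ::
  "('k :: field, 'v :: ab_group_add, 'm) alg_scheme \<Rightarrow>
   ('k, 'w :: ab_group_add, 'n) alg_scheme \<Rightarrow> ('v \<Rightarrow> 'w) \<Rightarrow> bool" where
  "algebra_antimap A X f \<longleftrightarrow> lin A X f \<and> f (unt A) = unt X \<and>
     (\<forall>a\<in>car A. \<forall>b\<in>car A. f (a \<cdot>\<^bsub>A\<^esub> b) = f b \<cdot>\<^bsub>X\<^esub> f a)"


section \<open>Tensor products\<close>

text \<open>
  \<open>V \<otimes>\<^sub>A W\<close> is the free vector space on \<open>V \<times> W\<close> modulo bilinearity and \<open>A\<close>-balancedness. The quotient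
  by the span \<open>R\<close> of the relations is realised on a linear complement of \<open>R\<close>: \<open>quot_proj\<close> is a
  linear projection with kernel \<open>R\<close>, and a class is represented by its image under it. So an element
  of a tensor product is itself a formal sum of pairs, and equality in the tensor product is equality
  of these normal forms.
\<close>

definition fscl :: "'k :: field \<Rightarrow> ('x \<Rightarrow>\<^sub>0 'k) \<Rightarrow> ('x \<Rightarrow>\<^sub>0 'k)" where
  "fscl c p = Poly_Mapping.map ((*) c) p"

lemma lookup_fscl: "Poly_Mapping.lookup (fscl c p) x = c * Poly_Mapping.lookup p x"
  unfolding fscl_def by transfer (auto simp: when_def)

lemma vector_space_fscl: "vector_space fscl"
  by unfold_locales (auto intro!: poly_mapping_eqI simp: lookup_fscl lookup_add algebra_simps)

definition quot_proj :: "('x \<Rightarrow>\<^sub>0 'k :: field) set \<Rightarrow> ('x \<Rightarrow>\<^sub>0 'k) \<Rightarrow> ('x \<Rightarrow>\<^sub>0 'k)" where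
  "quot_proj R = (SOME N. Vector_Spaces.linear fscl fscl N \<and> (\<forall>p. N (N p) = N p) \<and>
     {p. N p = 0} = module.span fscl R)"

text \<open>
  The linear extension of \<open>f\<close> to formal sums, with values in a space with scalar multiplication \<open>sc\<close>.
  On a tensor product it is the map \<open>v \<otimes> w \<mapsto> f v w\<close> whenever \<open>f\<close> is bilinear and balanced.
\<close>

definition ext :: "('k :: field \<Rightarrow> 'u \<Rightarrow> 'u :: ab_group_add) \<Rightarrow> ('v \<Rightarrow> 'w \<Rightarrow> 'u) \<Rightarrow>
    ('v \<times> 'w \<Rightarrow>\<^sub>0 'k) \<Rightarrow> 'u" where
  "ext sc f p = (\<Sum>x \<in> Poly_Mapping.keys p. sc (Poly_Mapping.lookup p x) (f (fst x) (snd x)))"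

definition pair :: "'v \<Rightarrow> 'w \<Rightarrow> ('v \<times> 'w \<Rightarrow>\<^sub>0 'k :: field)" where
  "pair v w = Poly_Mapping.single (v, w) 1"

definition tensor_rels :: "'a set \<Rightarrow> ('a, 'k :: field, 'v :: ab_group_add, 'm) bimod_scheme \<Rightarrow>
    ('a, 'k, 'w :: ab_group_add, 'n) bimod_scheme \<Rightarrow> ('v \<times> 'w \<Rightarrow>\<^sub>0 'k) set" where
  "tensor_rels A V W =
     {pair (v + v') w - pair v w - pair v' w | v v' w. v \<in> car V \<and> v' \<in> car V \<and> w \<in> car W} \<union>
     {pair v (w + w') - pair v w - pair v w' | v w w'. v \<in> car V \<and> w \<in> car W \<and> w' \<in> car W} \<union>
     {pair (scl V c v) w - fscl c (pair v w) | c v w. v \<in> car V \<and> w \<in> car W} \<union>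
     {pair v (scl W c w) - fscl c (pair v w) | c v w. v \<in> car V \<and> w \<in> car W} \<union>
     {pair (ract V v a) w - pair v (lact W a w) | a v w. a \<in> A \<and> v \<in> car V \<and> w \<in> car W}"

definition ptens_over :: "'a set \<Rightarrow> ('a, 'k :: field, 'v :: ab_group_add, 'm) bimod_scheme \<Rightarrow>
    ('a, 'k, 'w :: ab_group_add, 'n) bimod_scheme \<Rightarrow> 'v \<Rightarrow> 'w \<Rightarrow> ('v \<times> 'w \<Rightarrow>\<^sub>0 'k)" where
  "ptens_over A V W v w = quot_proj (tensor_rels A V W) (pair v w)"

definition tensor_over :: "'a set \<Rightarrow> ('a, 'k :: field, 'v :: ab_group_add, 'm) bimod_scheme \<Rightarrow>
    ('a, 'k, 'w :: ab_group_add, 'n) bimod_scheme \<Rightarrow> ('a, 'k, 'v \<times> 'w \<Rightarrow>\<^sub>0 'k) bimod" where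
  "tensor_over A V W =
     \<lparr>car = quot_proj (tensor_rels A V W) ` {p. Poly_Mapping.keys p \<subseteq> car V \<times> car W},
      scl = fscl,
      lact = (\<lambda>a. ext fscl (\<lambda>v w. ptens_over A V W (lact V a v) w)),
      ract = (\<lambda>p a. ext fscl (\<lambda>v w. ptens_over A V W v (ract W w a)) p)\<rparr>"

text \<open>The tensor product of vector spaces is the case \<open>A = 'k\<close>.\<close>

definition over_k :: "('k :: field, 'v, 'm) space_scheme \<Rightarrow> ('k, 'k, 'v) bimod" where
  "over_k V = \<lparr>car = car V, scl = scl V, lact = scl V, ract = (\<lambda>v c. scl V c v)\<rparr>"

definition tens :: "('k :: field, 'v :: ab_group_add, 'm) space_scheme \<Rightarrow>
    ('k, 'w :: ab_group_add, 'n) space_scheme \<Rightarrow> ('k, 'k, 'v \<times> 'w \<Rightarrow>\<^sub>0 'k) bimod" where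
  "tens V W = tensor_over UNIV (over_k V) (over_k W)"

definition ptens :: "('k :: field, 'v :: ab_group_add, 'm) space_scheme \<Rightarrow>
    ('k, 'w :: ab_group_add, 'n) space_scheme \<Rightarrow> 'v \<Rightarrow> 'w \<Rightarrow> ('v \<times> 'w \<Rightarrow>\<^sub>0 'k)" where
  "ptens V W = ptens_over UNIV (over_k V) (over_k W)"

lemma quot_proj_spec:
  fixes R :: "('x \<Rightarrow>\<^sub>0 'k :: field) set"
  shows "Vector_Spaces.linear fscl fscl (quot_proj R)"
    and "quot_proj R (quot_proj R p) = quot_proj R p"
    and "quot_proj R p = 0 \<longleftrightarrow> p \<in> module.span fscl R"
proof -
  interpret vs: vector_space "fscl :: 'k \<Rightarrow> ('x \<Rightarrow>\<^sub>0 'k) \<Rightarrow> _"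
    by (rule vector_space_fscl)
  interpret vp: vector_space_pair "fscl :: 'k \<Rightarrow> ('x \<Rightarrow>\<^sub>0 'k) \<Rightarrow> _" "fscl :: 'k \<Rightarrow> ('x \<Rightarrow>\<^sub>0 'k) \<Rightarrow> _" ..
  obtain C where C: "C \<subseteq> R" "vs.independent C" "R \<subseteq> vs.span C"
    using vs.maximal_independent_subset by blast
  then have span_C: "vs.span C = vs.span R"
    by (metis vs.span_mono vs.span_span subset_antisym)
  define P where "P = vp.construct C (\<lambda>b. b)"
  interpret P: Vector_Spaces.linear fscl fscl P
    unfolding P_def by (rule vp.linear_construct[OF C(2)])
  have P_in: "P p \<in> vs.span C" for p
    unfolding P_def using vp.construct_in_span[OF C(2), of "\<lambda>b. b"] by simp
  have P_id: "P p = p" if "p \<in> vs.span C" for p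
  proof -
    have "P p = id p"
      by (rule vp.linear_eq_on[OF P.linear_axioms vs.linear_id that])
         (simp add: P_def vp.construct_basis[OF C(2)])
    then show ?thesis by simp
  qed
  have lin_id: "Vector_Spaces.linear fscl fscl (\<lambda>p :: 'x \<Rightarrow>\<^sub>0 'k. p)"
    using vs.linear_id by (simp add: id_def)
  let ?N = "\<lambda>p. p - P p"
  have "Vector_Spaces.linear fscl fscl ?N"
    by (rule vp.linear_compose_sub[OF lin_id P.linear_axioms])
  moreover have "\<forall>p. ?N (?N p) = ?N p"
    using P_in P_id by (simp add: P.diff)
  moreover have "{p. ?N p = 0} = vs.span R"
    using P_in P_id span_C by (metis (mono_tags, lifting) Collect_cong Collect_mem_eq eq_iff_diff_eq_0)
  ultimately have "\<exists>N. Vector_Spaces.linear fscl fscl N \<and> (\<forall>p. N (N p) = N p) \<and>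
      {p. N p = 0} = vs.span R"
    by blast
  from someI_ex[OF this, folded quot_proj_def]
  show "Vector_Spaces.linear fscl fscl (quot_proj R)"
    "quot_proj R (quot_proj R p) = quot_proj R p"
    "quot_proj R p = 0 \<longleftrightarrow> p \<in> vs.span R"
    by auto
qed


section \<open>Bialgebras, Hopf algebras and the dual Hopf algebra\<close>

text \<open>\<open>sw2 H sc f h\<close> is \<open>f h' h''\<close> and \<open>sw3 H sc f h\<close> is \<open>f h' h'' h'''\<close> in Sweedler notation.\<close>

definition sw2 :: "('k :: field, 'v, 'm) bialg_scheme \<Rightarrow> ('k \<Rightarrow> 'u \<Rightarrow> 'u :: ab_group_add) \<Rightarrow>
    ('v \<Rightarrow> 'v \<Rightarrow> 'u) \<Rightarrow> 'v \<Rightarrow> 'u" where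
  "sw2 H sc f h = ext sc f (cop H h)"

definition sw3 :: "('k :: field, 'v, 'm) bialg_scheme \<Rightarrow> ('k \<Rightarrow> 'u \<Rightarrow> 'u :: ab_group_add) \<Rightarrow>
    ('v \<Rightarrow> 'v \<Rightarrow> 'v \<Rightarrow> 'u) \<Rightarrow> 'v \<Rightarrow> 'u" where
  "sw3 H sc f h = sw2 H sc (\<lambda>x y. sw2 H sc (f x) y) h"

locale kbialgebra = kalgebra H
  for H :: "('k :: field, 'v :: ab_group_add, 'm) bialg_scheme" +
  assumes cop_lin: "lin H (tens H H) (cop H)"
    and cou_lin: "lin H ground (cou H)"
    and coassoc: "h \<in> car H \<Longrightarrow>
      sw2 H fscl (\<lambda>x z. sw2 H fscl (\<lambda>x' x''. ptens H (tens H H) x' (ptens H H x'' z)) x) h =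
      sw2 H fscl (\<lambda>x y. ptens H (tens H H) x (cop H y)) h"
    and counit_left: "h \<in> car H \<Longrightarrow> sw2 H (scl H) (\<lambda>x y. scl H (cou H x) y) h = h"
    and counit_right: "h \<in> car H \<Longrightarrow> sw2 H (scl H) (\<lambda>x y. scl H (cou H y) x) h = h"
    and cop_mul: "\<lbrakk>h \<in> car H; g \<in> car H\<rbrakk> \<Longrightarrow> cop H (h \<cdot>\<^bsub>H\<^esub> g) =
      sw2 H fscl (\<lambda>h' h''. sw2 H fscl (\<lambda>g' g''. ptens H H (h' \<cdot>\<^bsub>H\<^esub> g') (h'' \<cdot>\<^bsub>H\<^esub> g'')) g) h"
    and cop_unt: "cop H (unt H) = ptens H H (unt H) (unt H)"
    and cou_mul: "\<lbrakk>h \<in> car H; g \<in> car H\<rbrakk> \<Longrightarrow> cou H (h \<cdot>\<^bsub>H\<^esub> g) = cou H h * cou H g"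
    and cou_unt: "cou H (unt H) = 1"

locale khopf_algebra = kbialgebra H
  for H :: "('k :: field, 'v :: ab_group_add, 'm) hopf_scheme" +
  assumes ant_lin: "lin H H (ant H)"
    and ant_left: "h \<in> car H \<Longrightarrow> sw2 H (scl H) (\<lambda>x y. ant H x \<cdot>\<^bsub>H\<^esub> y) h = scl H (cou H h) (unt H)"
    and ant_right: "h \<in> car H \<Longrightarrow> sw2 H (scl H) (\<lambda>x y. x \<cdot>\<^bsub>H\<^esub> ant H y) h = scl H (cou H h) (unt H)"

definition ant_inv :: "('k :: field, 'v, 'm) hopf_scheme \<Rightarrow> 'v \<Rightarrow> 'v" where
  "ant_inv H = inv_into (car H) (ant H)"

text \<open>Linear functionals on \<open>car B\<close> are represented by functions that vanish off \<open>car B\<close>.\<close>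

definition functionals :: "('k :: field, 'b :: ab_group_add, 'm) space_scheme \<Rightarrow> ('b \<Rightarrow> 'k) set" where
  "functionals B = {\<beta>. lin B ground \<beta> \<and> (\<forall>x. x \<notin> car B \<longrightarrow> \<beta> x = 0)}"

text \<open>\<open>splits B \<beta> p\<close>: the formal sum \<open>p = \<beta>' \<otimes> \<beta>''\<close> satisfies \<open>\<langle>\<beta>',a\<rangle>\<langle>\<beta>'',b\<rangle> = \<langle>\<beta>,ab\<rangle>\<close>.\<close>

definition splits :: "('k :: field, 'b, 'm) alg_scheme \<Rightarrow> ('b \<Rightarrow> 'k) \<Rightarrow>
    (('b \<Rightarrow> 'k) \<times> ('b \<Rightarrow> 'k) \<Rightarrow>\<^sub>0 'k) \<Rightarrow> bool" where
  "splits B \<beta> p \<longleftrightarrow>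
     (\<forall>a\<in>car B. \<forall>b\<in>car B. ext (*) (\<lambda>\<phi> \<psi>. \<phi> a * \<psi> b) p = \<beta> (a \<cdot>\<^bsub>B\<^esub> b))"

text \<open>
  The dual Hopf algebra consists of the functionals that have a coproduct: the finite (Sweedler)
  dual. If \<open>B\<close> is finite-dimensional this is the space of all functionals (lemma \<open>dual_space_finite_dim\<close>).
\<close>

definition dual_space :: "('k :: field, 'b :: ab_group_add, 'm) alg_scheme \<Rightarrow> ('k, 'b \<Rightarrow> 'k) space" where
  "dual_space B =
     \<lparr>car = {\<beta> \<in> functionals B.
        \<exists>p. Poly_Mapping.keys p \<subseteq> functionals B \<times> functionals B \<and> splits B \<beta> p},
      scl = (\<lambda>c \<beta> b. c * \<beta> b)\<rparr>"

definition dual :: "('k :: field, 'b :: ab_group_add) hopf \<Rightarrow> ('k, 'b \<Rightarrow> 'k) hopf" where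
  "dual B =
     \<lparr>car = car (dual_space B),
      scl = scl (dual_space B),
      mul = (\<lambda>\<alpha> \<beta> b. if b \<in> car B then sw2 B (*) (\<lambda>b' b''. \<alpha> b' * \<beta> b'') b else 0),
      unt = (\<lambda>b. if b \<in> car B then cou B b else 0),
      cop = (\<lambda>\<beta>. THE p. p \<in> car (tens (dual_space B) (dual_space B)) \<and> splits B \<beta> p),
      cou = (\<lambda>\<beta>. \<beta> (unt B)),
      ant = (\<lambda>\<beta> b. if b \<in> car B then \<beta> (ant B b) else 0)\<rparr>"

text \<open>The regular actions \<open>b \<rightharpoonup> \<beta>\<close>, \<open>\<beta> \<leftharpoonup> m\<close> and \<open>b \<leftharpoonup> \<mu>\<close>.\<close>

definition act_left :: "('k :: field, 'b :: ab_group_add) hopf \<Rightarrow> 'b \<Rightarrow> ('b \<Rightarrow> 'k) \<Rightarrow> ('b \<Rightarrow> 'k)" where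
  "act_left B b \<beta> = sw2 (dual B) (scl (dual B)) (\<lambda>\<beta>' \<beta>''. scl (dual B) (\<beta>'' b) \<beta>') \<beta>"

definition act_right :: "('k :: field, 'b :: ab_group_add) hopf \<Rightarrow> ('b \<Rightarrow> 'k) \<Rightarrow> 'b \<Rightarrow> ('b \<Rightarrow> 'k)" where
  "act_right B \<beta> m = sw2 (dual B) (scl (dual B)) (\<lambda>\<beta>' \<beta>''. scl (dual B) (\<beta>' m) \<beta>'') \<beta>"

definition coact_right :: "('k :: field, 'b :: ab_group_add) hopf \<Rightarrow> 'b \<Rightarrow> ('b \<Rightarrow> 'k) \<Rightarrow> 'b" where
  "coact_right B b \<mu> = sw2 B (scl B) (\<lambda>b' b''. scl B (\<mu> b') b'') b"

lemma ext_pair: "ext (*) f (pair v w) = f v w"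
  by (simp add: ext_def pair_def)

lemma ext_sum:
  fixes p :: "'i \<Rightarrow> ('v \<times> 'w \<Rightarrow>\<^sub>0 'k :: field)"
  assumes "finite I"
  shows "ext (*) f (\<Sum>i\<in>I. p i) = (\<Sum>i\<in>I. ext (*) f (p i))"
proof -
  have ext_eq: "ext (*) f q = (\<Sum>x\<in>K. Poly_Mapping.lookup q x * f (fst x) (snd x))"
    if "finite K" "Poly_Mapping.keys q \<subseteq> K" for q :: "'v \<times> 'w \<Rightarrow>\<^sub>0 'k" and K
    unfolding ext_def using that by (intro sum.mono_neutral_left) (auto simp: in_keys_iff)
  have add: "ext (*) f (q + r) = ext (*) f q + ext (*) f r" for q r :: "'v \<times> 'w \<Rightarrow>\<^sub>0 'k"
    using Poly_Mapping.keys_add[of q r]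
    by (simp add: ext_eq[of "Poly_Mapping.keys q \<union> Poly_Mapping.keys r"] lookup_add distrib_right sum.distrib)
  have zero: "ext (*) f 0 = 0"
    by (simp add: ext_def)
  show ?thesis
    using assms by (induction I rule: finite_induct) (simp_all add: add zero)
qed

lemma dual_space_finite_dim:
  fixes B :: "('k :: field, 'b :: ab_group_add, 'm) alg_scheme"
  assumes "kalgebra B" and fin: "finite F" "F \<subseteq> car B" "car B \<subseteq> module.span (scl B) F"
  shows "car (dual_space B) = functionals B"
proof -
  interpret B: kalgebra B by fact
  interpret vs: vector_space "scl B" by (rule B.ambient)
  have sub: "vs.subspace (car B)" by (rule B.subspace)
  obtain E where E: "E \<subseteq> F" "vs.independent E" "F \<subseteq> vs.span E"
    using vs.maximal_independent_subset by blast
  have finE: "finite E" using E(1) fin(1) finite_subset by blast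
  have EB: "E \<subseteq> car B" using E(1) fin(2) by blast
  have span_E: "vs.span E = car B"
    using vs.span_minimal[OF EB sub] E(3) fin(3) vs.span_minimal[OF E(3) vs.subspace_span] by blast
  define crd where "crd e v = (if v \<in> car B then vs.representation E v e else 0)" for e v
  have crd: "crd e \<in> functionals B" for e
    using E(2) sub
    by (auto simp: functionals_def lin_def ground_def crd_def span_E vs.representation_add
        vs.representation_scale vs.subspace_add vs.subspace_scale)
  have "\<exists>p. Poly_Mapping.keys p \<subseteq> functionals B \<times> functionals B \<and> splits B \<beta> p" if \<beta>: "\<beta> \<in> functionals B" for \<beta>
  proof -
    define h where "h e b = (if b \<in> car B then \<beta> (e \<cdot>\<^bsub>B\<^esub> b) else 0)" for e b
    have h: "h e \<in> functionals B" if "e \<in> E" for e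
    proof -
      have "lin B B (\<lambda>y. e \<cdot>\<^bsub>B\<^esub> y)" using that EB B.mul_right by blast
      then show ?thesis
        using \<beta> sub by (auto simp: functionals_def lin_def ground_def h_def
            vs.subspace_add vs.subspace_scale)
    qed
    define p where "p = (\<Sum>e\<in>E. pair (crd e) (h e) :: _ \<Rightarrow>\<^sub>0 'k)"
    have "Poly_Mapping.keys p \<subseteq> (\<Union>e\<in>E. Poly_Mapping.keys (pair (crd e) (h e) :: _ \<Rightarrow>\<^sub>0 'k))"
      unfolding p_def by (rule Poly_Mapping.keys_sum)
    also have "\<dots> \<subseteq> functionals B \<times> functionals B"
      using crd h by (auto simp: pair_def)
    finally have "Poly_Mapping.keys p \<subseteq> functionals B \<times> functionals B" .
    moreover have "splits B \<beta> p"
      unfolding splits_def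
    proof (intro ballI)
      fix a b assume ab: "a \<in> car B" "b \<in> car B"
      have lb: "lin B B (\<lambda>x. x \<cdot>\<^bsub>B\<^esub> b)" using ab B.mul_left by blast
      have "\<beta> ((\<Sum>e\<in>G. scl B (c e) e) \<cdot>\<^bsub>B\<^esub> b) = (\<Sum>e\<in>G. c e * \<beta> (e \<cdot>\<^bsub>B\<^esub> b)) \<and>
          (\<Sum>e\<in>G. scl B (c e) e) \<in> car B" if "G \<subseteq> E" for G c
        using finite_subset[OF that finE] that
      proof (induction G rule: finite_induct)
        case empty
        have "0 \<in> car B" using sub by (rule vs.subspace_0)
        moreover have "\<beta> 0 = 0"
          using \<beta> lin_zero[of B ground \<beta>] calculation by (simp add: functionals_def)
        ultimately have "0 \<in> car B" "0 \<cdot>\<^bsub>B\<^esub> b = 0" "\<beta> 0 = 0"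
          using lin_zero[OF lb] by auto
        then show ?case by simp
      next
        case (insert e G)
        then have e: "e \<in> car B" "scl B (c e) e \<in> car B"
          using EB vs.subspace_scale[OF sub] by auto
        moreover from e have "e \<cdot>\<^bsub>B\<^esub> b \<in> car B"
          using lb by (simp add: lin_def)
        moreover from this have "scl B (c e) (e \<cdot>\<^bsub>B\<^esub> b) \<in> car B"
          using vs.subspace_scale[OF sub] by blast
        moreover have "(\<Sum>e\<in>G. scl B (c e) e) \<cdot>\<^bsub>B\<^esub> b \<in> car B"
          using insert lb by (simp add: lin_def)
        ultimately show ?case
          using insert lb \<beta> vs.subspace_add[OF sub]
          by (simp add: functionals_def lin_def ground_def)
      qed
      from this[of E "vs.representation E a"]
      have "\<beta> (a \<cdot>\<^bsub>B\<^esub> b) = (\<Sum>e\<in>E. vs.representation E a e * \<beta> (e \<cdot>\<^bsub>B\<^esub> b))"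
        using vs.sum_representation_eq[OF E(2), of a E] ab span_E finE by simp
      then show "ext (*) (\<lambda>\<phi> \<psi>. \<phi> a * \<psi> b) p = \<beta> (a \<cdot>\<^bsub>B\<^esub> b)"
        using ab by (simp add: p_def ext_sum[OF finE] ext_pair crd_def h_def)
    qed
    ultimately show ?thesis by blast
  qed
  then show ?thesis by (auto simp: dual_space_def)
qed


section \<open>Heisenberg double, Drinfeld double and smash product\<close>

definition heisenberg :: "('k :: field, 'b :: ab_group_add) hopf \<Rightarrow>
    ('k, ('b \<Rightarrow> 'k) \<times> 'b \<Rightarrow>\<^sub>0 'k) alg" where
  "heisenberg B =
     \<lparr>car = car (tens (dual B) B),
      scl = fscl,
      mul = (\<lambda>x y. ext fscl (\<lambda>\<alpha> a. ext fscl (\<lambda>\<beta> b.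
        sw2 B fscl (\<lambda>a' a''. ptens (dual B) B (\<alpha> \<cdot>\<^bsub>dual B\<^esub> act_left B a' \<beta>) (a'' \<cdot>\<^bsub>B\<^esub> b)) a) y) x),
      unt = ptens (dual B) B (unt (dual B)) (unt B)\<rparr>"

definition drinfeld_space :: "('k :: field, 'b :: ab_group_add) hopf \<Rightarrow>
    ('k, 'k, ('b \<Rightarrow> 'k) \<times> 'b \<Rightarrow>\<^sub>0 'k) bimod" where
  "drinfeld_space B = tens (dual B) B"

definition drinfeld :: "('k :: field, 'b :: ab_group_add) hopf \<Rightarrow>
    ('k, ('b \<Rightarrow> 'k) \<times> 'b \<Rightarrow>\<^sub>0 'k) bialg" where
  "drinfeld B =
     \<lparr>car = car (drinfeld_space B),
      scl = fscl,
      mul = (\<lambda>x y. ext fscl (\<lambda>\<mu> m. ext fscl (\<lambda>\<nu> n.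
        sw3 B fscl (\<lambda>m' m'' m'''. ptens (dual B) B
          (\<mu> \<cdot>\<^bsub>dual B\<^esub> act_right B (act_left B m' \<nu>) (ant_inv B m''')) (m'' \<cdot>\<^bsub>B\<^esub> n)) m) y) x),
      unt = ptens (dual B) B (unt (dual B)) (unt B),
      cop = ext fscl (\<lambda>\<mu> m. sw2 (dual B) fscl (\<lambda>\<mu>' \<mu>''. sw2 B fscl (\<lambda>m' m''.
        ptens (drinfeld_space B) (drinfeld_space B)
          (ptens (dual B) B \<mu>'' m') (ptens (dual B) B \<mu>' m'')) m) \<mu>),
      cou = ext (*) (\<lambda>\<mu> m. cou (dual B) \<mu> * cou B m)\<rparr>"

text \<open>
  The action \<open>(\<mu> \<otimes> m) \<triangleright> (\<beta> # b) = \<mu>'''(m' \<rightharpoonup> \<beta>) S\<^sup>*\<^sup>-\<^sup>1(\<mu>'') # ((m'' b S(m''')) \<leftharpoonup> S\<^sup>*\<^sup>-\<^sup>1(\<mu>'))\<close>.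
\<close>

definition drinfeld_action :: "('k :: field, 'b :: ab_group_add) hopf \<Rightarrow>
    (('b \<Rightarrow> 'k) \<times> 'b \<Rightarrow>\<^sub>0 'k) \<Rightarrow> (('b \<Rightarrow> 'k) \<times> 'b \<Rightarrow>\<^sub>0 'k) \<Rightarrow> (('b \<Rightarrow> 'k) \<times> 'b \<Rightarrow>\<^sub>0 'k)" where
  "drinfeld_action B h x = ext fscl (\<lambda>\<mu> m. ext fscl (\<lambda>\<beta> b.
     sw3 (dual B) fscl (\<lambda>\<mu>' \<mu>'' \<mu>'''. sw3 B fscl (\<lambda>m' m'' m'''. ptens (dual B) B
       (\<mu>''' \<cdot>\<^bsub>dual B\<^esub> act_left B m' \<beta> \<cdot>\<^bsub>dual B\<^esub> ant_inv (dual B) \<mu>'')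
       (coact_right B (m'' \<cdot>\<^bsub>B\<^esub> b \<cdot>\<^bsub>B\<^esub> ant B m''') (ant_inv (dual B) \<mu>'))) m) \<mu>) x) h"

locale module_algebra = H: kbialgebra H + A: kalgebra A
  for H :: "('k :: field, 'h :: ab_group_add, 'm) bialg_scheme"
    and A :: "('k, 'v :: ab_group_add, 'n) alg_scheme"
    and act :: "'h \<Rightarrow> 'v \<Rightarrow> 'v" +
  assumes act_lin_left: "a \<in> car A \<Longrightarrow> lin H A (\<lambda>h. act h a)"
    and act_lin_right: "h \<in> car H \<Longrightarrow> lin A A (act h)"
    and act_mul: "\<lbrakk>h \<in> car H; g \<in> car H; a \<in> car A\<rbrakk> \<Longrightarrow> act (h \<cdot>\<^bsub>H\<^esub> g) a = act h (act g a)"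
    and act_unt: "a \<in> car A \<Longrightarrow> act (unt H) a = a"
    and act_on_mul: "\<lbrakk>h \<in> car H; a \<in> car A; c \<in> car A\<rbrakk> \<Longrightarrow>
      act h (a \<cdot>\<^bsub>A\<^esub> c) = sw2 H (scl A) (\<lambda>h' h''. act h' a \<cdot>\<^bsub>A\<^esub> act h'' c) h"
    and act_on_unt: "h \<in> car H \<Longrightarrow> act h (unt A) = scl A (cou H h) (unt A)"

definition smash :: "('k :: field, 'v :: ab_group_add, 'n) alg_scheme \<Rightarrow>
    ('k, 'h :: ab_group_add, 'm) bialg_scheme \<Rightarrow> ('h \<Rightarrow> 'v \<Rightarrow> 'v) \<Rightarrow> ('k, 'v \<times> 'h \<Rightarrow>\<^sub>0 'k) alg" where
  "smash A H act =
     \<lparr>car = car (tens A H),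
      scl = fscl,
      mul = (\<lambda>x y. ext fscl (\<lambda>a h. ext fscl (\<lambda>c g.
        sw2 H fscl (\<lambda>h' h''. ptens A H (a \<cdot>\<^bsub>A\<^esub> act h' c) (h'' \<cdot>\<^bsub>H\<^esub> g)) h) y) x),
      unt = ptens A H (unt A) (unt H)\<rparr>"


section \<open>Hopf algebroids\<close>

text \<open>\<open>X\<close> as an \<open>A\<close>-bimodule: \<open>a.x.b = s(a) t(b) x\<close>.\<close>

definition st_bimod :: "('k :: field, 'x :: ab_group_add, 'm) alg_scheme \<Rightarrow> ('a \<Rightarrow> 'x) \<Rightarrow> ('a \<Rightarrow> 'x) \<Rightarrow>
    ('a, 'k, 'x) bimod" where
  "st_bimod X s t = \<lparr>car = car X, scl = scl X,
     lact = (\<lambda>a x. s a \<cdot>\<^bsub>X\<^esub> x), ract = (\<lambda>x b. t b \<cdot>\<^bsub>X\<^esub> x)\<rparr>"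

text \<open>\<open>X \<otimes>\<^sub>A X\<close>, and the classes of a pair in \<open>X \<otimes>\<^sub>A X\<close> and in \<open>X \<otimes>\<^sub>A (X \<otimes>\<^sub>A X)\<close>.\<close>

definition st_tens :: "('k :: field, 'a :: ab_group_add, 'm) alg_scheme \<Rightarrow>
    ('k, 'x :: ab_group_add, 'n) alg_scheme \<Rightarrow> ('a \<Rightarrow> 'x) \<Rightarrow> ('a \<Rightarrow> 'x) \<Rightarrow>
    ('a, 'k, 'x \<times> 'x \<Rightarrow>\<^sub>0 'k) bimod" where
  "st_tens A X s t = tensor_over (car A) (st_bimod X s t) (st_bimod X s t)"

definition st_ptens :: "('k :: field, 'a :: ab_group_add, 'm) alg_scheme \<Rightarrow>
    ('k, 'x :: ab_group_add, 'n) alg_scheme \<Rightarrow> ('a \<Rightarrow> 'x) \<Rightarrow> ('a \<Rightarrow> 'x) \<Rightarrow>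
    'x \<Rightarrow> 'x \<Rightarrow> ('x \<times> 'x \<Rightarrow>\<^sub>0 'k)" where
  "st_ptens A X s t = ptens_over (car A) (st_bimod X s t) (st_bimod X s t)"

definition st_ptens3 :: "('k :: field, 'a :: ab_group_add, 'm) alg_scheme \<Rightarrow>
    ('k, 'x :: ab_group_add, 'n) alg_scheme \<Rightarrow> ('a \<Rightarrow> 'x) \<Rightarrow> ('a \<Rightarrow> 'x) \<Rightarrow>
    'x \<Rightarrow> ('x \<times> 'x \<Rightarrow>\<^sub>0 'k) \<Rightarrow> ('x \<times> ('x \<times> 'x \<Rightarrow>\<^sub>0 'k) \<Rightarrow>\<^sub>0 'k)" where
  "st_ptens3 A X s t = ptens_over (car A) (st_bimod X s t) (st_tens A X s t)"

text \<open>
  The componentwise product in \<open>delta_mul\<close> depends on the representing formal sums in general, but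
  not for elements of \<open>X \<times>\<^sub>A X\<close>, where \<open>\<Delta>\<close> takes its values by \<open>takeuchi\<close>.
\<close>

locale bialgebroid = A: kalgebra A + X: kalgebra X
  for A :: "('k :: field, 'a :: ab_group_add, 'm) alg_scheme"
    and X :: "('k, 'x :: ab_group_add, 'n) alg_scheme"
    and s :: "'a \<Rightarrow> 'x" and t :: "'a \<Rightarrow> 'x"
    and \<Delta> :: "'x \<Rightarrow> ('x \<times> 'x \<Rightarrow>\<^sub>0 'k)" and \<epsilon> :: "'x \<Rightarrow> 'a" +
  assumes source: "algebra_map A X s"
    and target: "algebra_antimap A X t"
    and commute: "\<lbrakk>a \<in> car A; b \<in> car A\<rbrakk> \<Longrightarrow> s a \<cdot>\<^bsub>X\<^esub> t b = t b \<cdot>\<^bsub>X\<^esub> s a"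
    and delta_lin: "lin X (st_tens A X s t) \<Delta>"
    and delta_bimod: "\<lbrakk>a \<in> car A; b \<in> car A; x \<in> car X\<rbrakk> \<Longrightarrow>
      \<Delta> (s a \<cdot>\<^bsub>X\<^esub> (t b \<cdot>\<^bsub>X\<^esub> x)) = lact (st_tens A X s t) a (ract (st_tens A X s t) (\<Delta> x) b)"
    and eps_lin: "lin X A \<epsilon>"
    and eps_bimod: "\<lbrakk>a \<in> car A; b \<in> car A; x \<in> car X\<rbrakk> \<Longrightarrow>
      \<epsilon> (s a \<cdot>\<^bsub>X\<^esub> (t b \<cdot>\<^bsub>X\<^esub> x)) = a \<cdot>\<^bsub>A\<^esub> (\<epsilon> x \<cdot>\<^bsub>A\<^esub> b)"
    and coassoc: "x \<in> car X \<Longrightarrow>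
      ext fscl (\<lambda>y z. ext fscl (\<lambda>y' y''. st_ptens3 A X s t y' (st_ptens A X s t y'' z)) (\<Delta> y)) (\<Delta> x) =
      ext fscl (\<lambda>y z. st_ptens3 A X s t y (\<Delta> z)) (\<Delta> x)"
    and counit_left: "x \<in> car X \<Longrightarrow> ext (scl X) (\<lambda>y z. s (\<epsilon> y) \<cdot>\<^bsub>X\<^esub> z) (\<Delta> x) = x"
    and counit_right: "x \<in> car X \<Longrightarrow> ext (scl X) (\<lambda>y z. t (\<epsilon> z) \<cdot>\<^bsub>X\<^esub> y) (\<Delta> x) = x"
    and takeuchi: "\<lbrakk>x \<in> car X; a \<in> car A\<rbrakk> \<Longrightarrow>
      ext fscl (\<lambda>y z. st_ptens A X s t (y \<cdot>\<^bsub>X\<^esub> t a) z) (\<Delta> x) = ext fscl (\<lambda>y z. st_ptens A X s t y (z \<cdot>\<^bsub>X\<^esub> s a)) (\<Delta> x)"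
    and delta_mul: "\<lbrakk>x \<in> car X; y \<in> car X\<rbrakk> \<Longrightarrow> \<Delta> (x \<cdot>\<^bsub>X\<^esub> y) =
      ext fscl (\<lambda>x' x''. ext fscl (\<lambda>y' y''. st_ptens A X s t (x' \<cdot>\<^bsub>X\<^esub> y') (x'' \<cdot>\<^bsub>X\<^esub> y'')) (\<Delta> y)) (\<Delta> x)"
    and delta_unt: "\<Delta> (unt X) = st_ptens A X s t (unt X) (unt X)"
    and eps_unt: "\<epsilon> (unt X) = unt A"
    and eps_mul_s: "\<lbrakk>x \<in> car X; y \<in> car X\<rbrakk> \<Longrightarrow> \<epsilon> (x \<cdot>\<^bsub>X\<^esub> y) = \<epsilon> (x \<cdot>\<^bsub>X\<^esub> s (\<epsilon> y))"
    and eps_mul_t: "\<lbrakk>x \<in> car X; y \<in> car X\<rbrakk> \<Longrightarrow> \<epsilon> (x \<cdot>\<^bsub>X\<^esub> y) = \<epsilon> (x \<cdot>\<^bsub>X\<^esub> t (\<epsilon> y))"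

locale hopf_algebroid = bialgebroid A X s t \<Delta> \<epsilon>
  for A :: "('k :: field, 'a :: ab_group_add, 'm) alg_scheme"
    and X :: "('k, 'x :: ab_group_add, 'n) alg_scheme"
    and s t \<Delta> \<epsilon> and \<tau> :: "'x \<Rightarrow> 'x" +
  assumes tau_antimap: "algebra_antimap X X \<tau>"
    and tau_bij: "bij_betw \<tau> (car X) (car X)"
    and tau_t: "a \<in> car A \<Longrightarrow> \<tau> (t a) = s a"
    and tau_left: "x \<in> car X \<Longrightarrow> ext (scl X) (\<lambda>y z. \<tau> y \<cdot>\<^bsub>X\<^esub> z) (\<Delta> x) = t (\<epsilon> (\<tau> x))"
    and section_right: "\<exists>\<gamma>. lin (st_tens A X s t) (tens X X) \<gamma> \<and>
      (\<forall>p\<in>car (st_tens A X s t). ext fscl (st_ptens A X s t) (\<gamma> p) = p) \<and>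
      (\<forall>x\<in>car X. ext (scl X) (\<lambda>y z. y \<cdot>\<^bsub>X\<^esub> \<tau> z) (\<gamma> (\<Delta> x)) = s (\<epsilon> x))"

definition is_hopf_algebroid_over ::
  "('k :: field, 'x :: ab_group_add, 'n) alg_scheme \<Rightarrow>
   ('k, 'a :: ab_group_add, 'm) alg_scheme \<Rightarrow> bool" where
  "is_hopf_algebroid_over X A \<longleftrightarrow> (\<exists>s t \<Delta> \<epsilon> \<tau>. hopf_algebroid A X s t \<Delta> \<epsilon> \<tau>)"

end

(* On the common space B* \<otimes> B, let A be the Heisenberg double, D the Drinfeld double and \<phi> : D \<rightarrow> A the
   identity map. It is not multiplicative, but it has the convolution inverse
   \<phi>'(\<mu> \<otimes> m) = (1 # S m) (S*^-1(\<mu>) # 1), and the action is inner: h \<triangleright> c = \<phi>(h') c \<phi>'(h'').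
   The map h \<mapsto> \<phi>(h') \<otimes> \<phi>'(h'') into the enveloping algebra of A is injective and multiplicative; hence D
   is an associative algebra and \<triangleright> is an action. As \<phi>' is bijective, a # h \<mapsto> a \<phi>(h') \<otimes> \<phi>'(h'') is an algebra
   isomorphism from A # D onto the enveloping algebra, which carries the Hopf algebroid structure
   \<Delta>(s(a) t(b)) = s(a) \<otimes> t(b), \<epsilon>(s(a) t(b)) = a b, \<tau>(s(a) t(b)) = s(b) t(a).
   The algebra A itself is associative because it acts faithfully on B from the right. *)

theory Submission
  imports Defs
begin

section \<open>Linear maps and formal sums\<close>

text \<open>The inverse \<open>S*^-1\<close> is forced by the coproduct of the double, which is
  opposite on the factor \<open>B*\<close>. In the Heisenberg double \<open>mu # m\<close> is the
  product of \<open>mu # 1\<close> and \<open>1 # m\<close>; a convolution inverse must reverse this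
  product, and the antipode belonging to the opposite coproduct of \<open>B*\<close> is
  \<open>S*^-1\<close>. Both doubles are determined by a rule that rewrites \<open>m nu\<close> with
  the functional in front. A linear map out of either is multiplicative as soon as it is so on
  \<open>B*\<close> and on \<open>B\<close> and respects this rule. The same reduction yields the
  coproduct and counit axioms of the Drinfeld double, which an embedding into an enveloping algebra
  cannot supply. Two obstacles shape the rest. \<open>B\<close> may be infinite-dimensional, so the
  coproduct of a functional must be shown to have both factors in the finite dual; this rests on
  rewriting tensors with independent factors. And elements of tensor products are chosen normal
  forms, so a map given on pairs can be evaluated on a class only after it is known to be bilinear
  and, over \<open>A\<close>, balanced.\<close>

context kspace
begin

sublocale vs: vector_space "scl V" by (rule ambient)

lemma zero_closed [simp]: "0 \<in> car V"
  using subspace by (rule vs.subspace_0)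

lemma add_closed [simp]: "x \<in> car V \<Longrightarrow> y \<in> car V \<Longrightarrow> x + y \<in> car V"
  using subspace by (rule vs.subspace_add)

lemma diff_closed [simp]: "x \<in> car V \<Longrightarrow> y \<in> car V \<Longrightarrow> x - y \<in> car V"
  using subspace by (rule vs.subspace_diff)

lemma scl_closed [simp]: "x \<in> car V \<Longrightarrow> scl V c x \<in> car V"
  using subspace by (rule vs.subspace_scale)

lemma sum_closed: "(\<And>i. i \<in> I \<Longrightarrow> f i \<in> car V) \<Longrightarrow> sum f I \<in> car V"
  using subspace by (rule vs.subspace_sum)

end

lemma kspaceI:
  assumes "vector_space (scl V)" "0 \<in> car V"
    and "\<And>x y. x \<in> car V \<Longrightarrow> y \<in> car V \<Longrightarrow> x + y \<in> car V"
    and "\<And>c x. x \<in> car V \<Longrightarrow> scl V c x \<in> car V"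
  shows "kspace V"
proof -
  interpret vector_space "scl V" by fact
  show ?thesis using assms by unfold_locales (auto simp: subspace_def)
qed

lemma kspace_ground [simp]: "kspace (ground :: ('k :: field, 'k) space)"
  by (rule kspaceI) (unfold_locales, auto simp: ground_def algebra_simps)

lemma scl_ground [simp]: "scl ground = (*)" and car_ground [simp]: "car ground = UNIV"
  by (simp_all add: ground_def)

lemma lin_closed: "lin V W f \<Longrightarrow> x \<in> car V \<Longrightarrow> f x \<in> car W"
  and lin_add: "lin V W f \<Longrightarrow> x \<in> car V \<Longrightarrow> y \<in> car V \<Longrightarrow> f (x + y) = f x + f y"
  and lin_scl: "lin V W f \<Longrightarrow> x \<in> car V \<Longrightarrow> f (scl V c x) = scl W c (f x)"
  by (auto simp: lin_def)

lemma linI: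
  assumes "\<And>x. x \<in> car V \<Longrightarrow> f x \<in> car W"
    and "\<And>x y. x \<in> car V \<Longrightarrow> y \<in> car V \<Longrightarrow> f (x + y) = f x + f y"
    and "\<And>c x. x \<in> car V \<Longrightarrow> f (scl V c x) = scl W c (f x)"
  shows "lin V W f"
  using assms by (auto simp: lin_def)

lemma lin_0 [simp]: "lin V W f \<Longrightarrow> kspace V \<Longrightarrow> f 0 = 0"
  using lin_zero kspace.zero_closed by blast

lemma lin_diff:
  assumes "lin V W f" "kspace V" "x \<in> car V" "y \<in> car V"
  shows "f (x - y) = f x - f y"
proof -
  have "f (x - y) + f y = f (x - y + y)"
    using assms by (intro lin_add[symmetric]) (auto intro: kspace.diff_closed)
  then show ?thesis by (simp add: algebra_simps)
qed

lemma lin_sum: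
  assumes "lin V W f" "kspace V" "\<And>i. i \<in> I \<Longrightarrow> g i \<in> car V"
  shows "f (sum g I) = (\<Sum>i\<in>I. f (g i))"
  using assms(3)
proof (induction I rule: infinite_finite_induct)
  case (insert i I)
  then show ?case
    using assms(1,2) kspace.sum_closed[OF assms(2), of I g] by (simp add: lin_add)
qed (use assms(1,2) in auto)

lemma lin_cong:
  assumes "kspace V" "\<And>x. x \<in> car V \<Longrightarrow> f x = g x"
  shows "lin V W f \<longleftrightarrow> lin V W g"
proof -
  interpret kspace V by fact
  show ?thesis using assms(2) by (simp add: lin_def)
qed

lemma lin_id: "lin V V (\<lambda>x. x)"
  by (simp add: lin_def)

lemma lin_comp: "lin V W g \<Longrightarrow> lin U V f \<Longrightarrow> lin U W (\<lambda>x. g (f x))"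
  by (simp add: lin_def)

lemma lin_plus:
  assumes "kspace W" "lin V W f" "lin V W g"
  shows "lin V W (\<lambda>x. f x + g x)"
proof -
  interpret kspace W by fact
  show ?thesis using assms(2,3) by (simp add: lin_def algebra_simps vs.scale_right_distrib)
qed

lemma lin_scale:
  assumes "kspace W" "lin V W f"
  shows "lin V W (\<lambda>x. scl W c (f x))"
proof -
  interpret kspace W by fact
  show ?thesis using assms(2) by (simp add: lin_def vs.scale_right_distrib mult.commute)
qed

lemma lin_scale_left:
  assumes "kspace W" "w \<in> car W" "lin V ground f"
  shows "lin V W (\<lambda>x. scl W (f x) w)"
proof -
  interpret kspace W by fact
  show ?thesis using assms(2,3) by (simp add: lin_def vs.scale_left_distrib)
qed

lemma lin_mult_left: "lin V ground f \<Longrightarrow> lin V ground (\<lambda>x. c * f x)"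
  and lin_mult_right: "lin V ground f \<Longrightarrow> lin V ground (\<lambda>x. f x * c)"
  by (simp_all add: lin_def algebra_simps)

lemma inj_on_lin:
  assumes "lin V W f" "kspace V" "\<And>x. x \<in> car V \<Longrightarrow> f x = 0 \<Longrightarrow> x = 0"
  shows "inj_on f (car V)"
proof (rule inj_onI)
  fix x y assume "x \<in> car V" "y \<in> car V" "f x = f y"
  then have "f (x - y) = 0" using assms(1,2) by (simp add: lin_diff)
  then show "x = y"
    using assms(3)[of "x - y"] kspace.diff_closed[OF assms(2)] \<open>x \<in> car V\<close> \<open>y \<in> car V\<close> by simp
qed

lemma lin_inv_into:
  assumes "lin V W f" "kspace V" "bij_betw f (car V) (car W)"
  shows "lin W V (inv_into (car V) f)"
proof -
  interpret kspace V by fact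
  have *: "inv_into (car V) f y \<in> car V" "f (inv_into (car V) f y) = y" if "y \<in> car W" for y
    using that assms(3) by (auto simp: bij_betw_def f_inv_into_f inv_into_into)
  have inj: "x = y" if "f x = f y" "x \<in> car V" "y \<in> car V" for x y
    using that assms(3) by (auto simp: bij_betw_def inj_on_def)
  \<comment> \<open>\<open>car W\<close> is the image of \<open>car V\<close>, so its closure under
    the operations is read off from \<open>V\<close>.\<close>
  have W: "x + y \<in> car W" "scl W c x \<in> car W" if "x \<in> car W" "y \<in> car W" for x y c
    using *[OF that(1)] *[OF that(2)] lin_closed[OF assms(1)] lin_add[OF assms(1)] lin_scl[OF assms(1)]
    by (metis add_closed, metis scl_closed)
  show ?thesis
    by (rule linI; (intro inj)?) (simp_all add: * W lin_add[OF assms(1)] lin_scl[OF assms(1)])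
qed

definition bil :: "('k :: field, 'v :: ab_group_add, 'm) space_scheme \<Rightarrow>
    ('k, 'w :: ab_group_add, 'n) space_scheme \<Rightarrow> ('k, 'u :: ab_group_add, 'l) space_scheme \<Rightarrow>
    ('v \<Rightarrow> 'w \<Rightarrow> 'u) \<Rightarrow> bool" where
  "bil V W U f \<longleftrightarrow> (\<forall>w\<in>car W. lin V U (\<lambda>v. f v w)) \<and> (\<forall>v\<in>car V. lin W U (\<lambda>w. f v w))"

lemma bilI:
  assumes "\<And>w. w \<in> car W \<Longrightarrow> lin V U (\<lambda>v. f v w)" "\<And>v. v \<in> car V \<Longrightarrow> lin W U (\<lambda>w. f v w)"
  shows "bil V W U f"
  using assms by (simp add: bil_def)

lemma bil_left: "bil V W U f \<Longrightarrow> w \<in> car W \<Longrightarrow> lin V U (\<lambda>v. f v w)"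
  and bil_right: "bil V W U f \<Longrightarrow> v \<in> car V \<Longrightarrow> lin W U (\<lambda>w. f v w)"
  and bil_closed: "bil V W U f \<Longrightarrow> v \<in> car V \<Longrightarrow> w \<in> car W \<Longrightarrow> f v w \<in> car U"
  by (auto simp: bil_def lin_def)

interpretation fs: vector_space "fscl :: 'k :: field \<Rightarrow> ('x \<Rightarrow>\<^sub>0 'k) \<Rightarrow> _"
  by (rule vector_space_fscl)

text \<open>Pairs outside the support contribute zero, so formal sums of different support can be
  compared over one common index set.\<close>

lemma ext_eq_sum:
  assumes "vector_space sc" "finite K" "Poly_Mapping.keys p \<subseteq> K"
  shows "ext sc f p = (\<Sum>x\<in>K. sc (Poly_Mapping.lookup p x) (f (fst x) (snd x)))"
proof -
  interpret vector_space sc by fact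
  show ?thesis
    unfolding ext_def using assms(2,3)
    by (intro sum.mono_neutral_left) (auto simp: in_keys_iff)
qed

text \<open>Linearity in the formal sum comes from its coefficients, for arbitrary \<open>f\<close>.
  Bilinearity of \<open>f\<close> matters only once formal sums are reduced modulo the tensor
  relations.\<close>

lemma ext_linear:
  fixes f :: "'v \<Rightarrow> 'w \<Rightarrow> 'u :: ab_group_add"
  assumes "vector_space sc"
  shows "Vector_Spaces.linear fscl sc (ext sc f)"
proof -
  interpret vector_space sc by fact
  interpret vp: vector_space_pair "fscl :: 'a \<Rightarrow> ('v \<times> 'w \<Rightarrow>\<^sub>0 'a) \<Rightarrow> _" sc ..
  show ?thesis
  proof (unfold_locales)
    fix p q :: "'v \<times> 'w \<Rightarrow>\<^sub>0 'a"
    let ?K = "Poly_Mapping.keys p \<union> Poly_Mapping.keys q"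
    show "ext sc f (p + q) = ext sc f p + ext sc f q"
      using Poly_Mapping.keys_add[of p q]
      by (simp add: ext_eq_sum[OF assms, of ?K] lookup_add scale_left_distrib sum.distrib)
  next
    fix c and p :: "'v \<times> 'w \<Rightarrow>\<^sub>0 'a"
    have "Poly_Mapping.keys (fscl c p) \<subseteq> Poly_Mapping.keys p"
      by (auto simp: in_keys_iff lookup_fscl)
    then show "ext sc f (fscl c p) = sc c (ext sc f p)"
      by (simp add: ext_eq_sum[OF assms, of "Poly_Mapping.keys p"] lookup_fscl scale_sum_right)
  qed
qed

lemma ext_add: "vector_space sc \<Longrightarrow> ext sc f (p + q) = ext sc f p + ext sc f q"
  by (metis ext_linear Vector_Spaces.linear_iff)

lemma ext_fscl: "vector_space sc \<Longrightarrow> ext sc f (fscl c p) = sc c (ext sc f p)"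
  by (metis ext_linear Vector_Spaces.linear_iff)

lemma ext_zero [simp]: "ext sc f 0 = 0"
  by (simp add: ext_def)

lemma ext_diff: "vector_space sc \<Longrightarrow> ext sc f (p - q) = ext sc f p - ext sc f q"
  by (metis ext_add add_diff_cancel diff_add_cancel)

lemma ext_setsum: "vector_space sc \<Longrightarrow> ext sc f (sum p I) = (\<Sum>i\<in>I. ext sc f (p i))"
  by (induction I rule: infinite_finite_induct) (simp_all add: ext_add)

lemma ext_pair_sc: "vector_space sc \<Longrightarrow> ext sc f (pair v w) = f v w"
  by (simp add: ext_def pair_def vector_space.vector_space_assms(4))

lemma ext_cong:
  "(\<And>x y. (x, y) \<in> Poly_Mapping.keys p \<Longrightarrow> f x y = g x y) \<Longrightarrow> ext sc f p = ext sc g p"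
  unfolding ext_def by (rule sum.cong) auto

lemma ext_pair_id: "ext fscl pair p = p"
proof -
  have "p = (\<Sum>x\<in>Poly_Mapping.keys p. fscl (Poly_Mapping.lookup p x) (Poly_Mapping.single x 1))"
    by (rule poly_mapping_eqI) (auto simp: lookup_sum lookup_fscl lookup_single when_def in_keys_iff if_distrib cong: if_cong)
  then show ?thesis by (simp add: ext_def pair_def)
qed

lemma ext_closed:
  assumes "kspace U" "\<And>x y. (x, y) \<in> Poly_Mapping.keys p \<Longrightarrow> f x y \<in> car U"
  shows "ext (scl U) f p \<in> car U"
  unfolding ext_def using assms
  by (intro kspace.sum_closed kspace.scl_closed) auto

lemma ext_lin_out:
  assumes "lin U W g" "kspace U" "\<And>x y. (x, y) \<in> Poly_Mapping.keys p \<Longrightarrow> f x y \<in> car U"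
  shows "g (ext (scl U) f p) = ext (scl W) (\<lambda>x y. g (f x y)) p"
proof -
  interpret kspace U by fact
  have "g (ext (scl U) f p) = (\<Sum>x\<in>Poly_Mapping.keys p. g (scl U (Poly_Mapping.lookup p x) (f (fst x) (snd x))))"
    unfolding ext_def using assms by (intro lin_sum[OF assms(1,2)]) auto
  also have "\<dots> = ext (scl W) (\<lambda>x y. g (f x y)) p"
    unfolding ext_def using assms by (intro sum.cong) (auto simp: lin_scl)
  finally show ?thesis .
qed

lemma ext_fun_add: "vector_space sc \<Longrightarrow> ext sc (\<lambda>x y. f x y + g x y) p = ext sc f p + ext sc g p"
  by (simp add: ext_def vector_space.vector_space_assms(1) sum.distrib)

lemma ext_fun_scl: "vector_space sc \<Longrightarrow> ext sc (\<lambda>x y. sc c (f x y)) p = sc c (ext sc f p)"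
proof -
  assume "vector_space sc"
  then interpret vector_space sc .
  show ?thesis by (simp add: ext_def scale_sum_right mult.commute)
qed

lemma ext_swap:
  assumes "vector_space sc"
  shows "ext sc (\<lambda>x y. ext sc (\<lambda>u v. f x y u v) q) p = ext sc (\<lambda>u v. ext sc (\<lambda>x y. f x y u v) p) q"
proof -
  interpret vector_space sc by fact
  show ?thesis
    unfolding ext_def scale_sum_right
    by (subst sum.swap) (simp add: mult.commute)
qed

text \<open>Used whenever a coproduct is known as a formal sum of pure tensors: extending over it
  becomes an iterated sum.\<close>

lemma ext_comp:
  assumes "vector_space sc"
  shows "ext sc g (ext fscl f p) = ext sc (\<lambda>x y. ext sc g (f x y)) p"
  by (simp add: ext_def[of fscl] ext_setsum[OF assms] ext_fscl[OF assms])
     (simp add: ext_def[of sc "\<lambda>x y. ext sc g (f x y)"])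


section \<open>Tensor products\<close>

lemma keys_fscl: "Poly_Mapping.keys (fscl c p) \<subseteq> Poly_Mapping.keys p"
  by (auto simp: in_keys_iff lookup_fscl)

lemma subspace_keys: "fs.subspace {p :: 'x \<Rightarrow>\<^sub>0 'k :: field. Poly_Mapping.keys p \<subseteq> K}"
  unfolding fs.subspace_def
  using Poly_Mapping.keys_add keys_fscl by (fastforce simp: subset_iff)

lemma keys_pair [simp]: "Poly_Mapping.keys (pair v w :: _ \<Rightarrow>\<^sub>0 'k :: field) = {(v, w)}"
  by (simp add: pair_def)

lemma keys_diff_sub:
  fixes p q :: "'x \<Rightarrow>\<^sub>0 'k :: field"
  shows "Poly_Mapping.keys p \<subseteq> K \<Longrightarrow> Poly_Mapping.keys q \<subseteq> K \<Longrightarrow> Poly_Mapping.keys (p - q) \<subseteq> K"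
  using fs.subspace_diff[OF subspace_keys, of p K q] by simp

text \<open>Closure under the two inner actions keeps the relations, and hence the normal forms,
  inside the formal sums supported on \<open>car V \<times> car W\<close>.\<close>

locale balanced_pair = V: kspace V + W: kspace W
  for A :: "'a set" and V :: "('a, 'k :: field, 'v :: ab_group_add, 'm) bimod_scheme"
    and W :: "('a, 'k, 'w :: ab_group_add, 'n) bimod_scheme" +
  assumes ract_closed: "a \<in> A \<Longrightarrow> v \<in> car V \<Longrightarrow> ract V v a \<in> car V"
    and lact_closed: "a \<in> A \<Longrightarrow> w \<in> car W \<Longrightarrow> lact W a w \<in> car W"
begin

abbreviation "N \<equiv> quot_proj (tensor_rels A V W)"
abbreviation "T \<equiv> tensor_over A V W"
abbreviation "supported p \<equiv> Poly_Mapping.keys p \<subseteq> car V \<times> car W"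

lemma N_linear: "Vector_Spaces.linear fscl fscl N"
  by (rule quot_proj_spec)

lemma N_add: "N (p + q) = N p + N q" and N_fscl: "N (fscl c p) = fscl c (N p)"
  using N_linear by (simp_all add: Vector_Spaces.linear_iff)

lemma N_diff: "N (p - q) = N p - N q"
  by (metis N_add add_diff_cancel diff_add_cancel)

lemma N_sum: "N (sum p I) = (\<Sum>i\<in>I. N (p i))"
proof (induction I rule: infinite_finite_induct)
  case empty show ?case using N_diff[of 0 0] by simp
next
  case (infinite I) show ?case using N_diff[of 0 0] infinite by simp
qed (simp add: N_add)

lemma N_idem [simp]: "N (N p) = N p"
  by (rule quot_proj_spec)

lemma N_diff_span: "p - N p \<in> fs.span (tensor_rels A V W)"
  using quot_proj_spec(3)[of "tensor_rels A V W" "p - N p"] by (simp add: N_diff)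

lemma rels_supported: "p \<in> tensor_rels A V W \<Longrightarrow> supported p"
  unfolding tensor_rels_def
  apply (elim UnE CollectE exE conjE)
      apply (simp_all)
      apply (intro keys_diff_sub order_trans[OF keys_fscl]; simp add: ract_closed lact_closed)+
  done

lemma span_supported: "p \<in> fs.span (tensor_rels A V W) \<Longrightarrow> supported p"
  using fs.span_minimal[OF _ subspace_keys, of "tensor_rels A V W" "car V \<times> car W"] rels_supported
  by blast

text \<open>The projection is an arbitrary choice on all formal sums. It preserves the support
  condition because \<open>p\<close> and \<open>N p\<close> differ by a combination of relations,
  all of which are supported.\<close>

lemma N_supported:
  assumes "supported p"
  shows "supported (N p)"
proof -
  have "N p = p - (p - N p)" by simp
  then show ?thesis using keys_diff_sub assms span_supported[OF N_diff_span] by metis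
qed

lemma car_T: "car T = N ` {p. supported p}" and scl_T [simp]: "scl T = fscl"
  by (simp_all add: tensor_over_def)

lemma T_supported: "p \<in> car T \<Longrightarrow> supported p"
  using N_supported by (auto simp: car_T)

lemma T_keys: "p \<in> car T \<Longrightarrow> (x, y) \<in> Poly_Mapping.keys p \<Longrightarrow> x \<in> car V \<and> y \<in> car W"
  using T_supported by blast

lemma N_T: "p \<in> car T \<Longrightarrow> N p = p"
  by (auto simp: car_T)

lemma N_in_T: "supported p \<Longrightarrow> N p \<in> car T"
  by (auto simp: car_T)

lemma kspace_T: "kspace T"
proof (rule kspaceI)
  show "vector_space (scl T)" by (simp add: vector_space_fscl)
  show "0 \<in> car T" using N_in_T[of 0] N_diff[of 0 0] by simp
  fix x y :: "'v \<times> 'w \<Rightarrow>\<^sub>0 'k" and c assume x: "x \<in> car T"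
  then have "N (fscl c x) \<in> car T"
    by (intro N_in_T order_trans[OF keys_fscl T_supported])
  then show "scl T c x \<in> car T" using x by (simp add: N_T N_fscl)
  assume y: "y \<in> car T"
  have "N (x + y) \<in> car T"
    by (intro N_in_T order_trans[OF Poly_Mapping.keys_add] Un_least T_supported x y)
  then show "x + y \<in> car T" using x y by (simp add: N_T N_add)
qed

lemma ptens_closed: "v \<in> car V \<Longrightarrow> w \<in> car W \<Longrightarrow> ptens_over A V W v w \<in> car T"
  unfolding ptens_over_def by (rule N_in_T) simp

text \<open>The projection applied to the expansion of \<open>p\<close> in basis pairs.\<close>

lemma expand: "p \<in> car T \<Longrightarrow> ext fscl (ptens_over A V W) p = p"
  using arg_cong[OF ext_pair_id[of p], of N]
  by (simp add: ext_def N_sum N_fscl N_T ptens_over_def[abs_def])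

lemma N_eqI:
  assumes "p \<in> tensor_rels A V W"
  shows "N p = 0"
  using assms fs.span_base quot_proj_spec(3) by blast

lemma ptens_bil: "bil V W T (ptens_over A V W)"
proof -
  note [simp] = ptens_closed
  have 1: "ptens_over A V W (v + v') w = ptens_over A V W v w + ptens_over A V W v' w"
    if "v \<in> car V" "v' \<in> car V" "w \<in> car W" for v v' w
  proof -
    have "N (pair (v + v') w - pair v w - pair v' w) = 0"
      by (rule N_eqI) (unfold tensor_rels_def, use that in blast)
    then show ?thesis by (simp add: ptens_over_def N_diff) (simp add: algebra_simps)
  qed
  have 2: "ptens_over A V W v (w + w') = ptens_over A V W v w + ptens_over A V W v w'"
    if "v \<in> car V" "w' \<in> car W" "w \<in> car W" for v w' w
  proof -
    have "N (pair v (w + w') - pair v w - pair v w') = 0"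
      by (rule N_eqI) (unfold tensor_rels_def, use that in blast)
    then show ?thesis by (simp add: ptens_over_def N_diff) (simp add: algebra_simps)
  qed
  have 3: "ptens_over A V W (scl V c v) w = fscl c (ptens_over A V W v w)"
    if "v \<in> car V" "w \<in> car W" for v w c
  proof -
    have "N (pair (scl V c v) w - fscl c (pair v w)) = 0"
      by (rule N_eqI) (unfold tensor_rels_def, use that in blast)
    then show ?thesis by (simp add: ptens_over_def N_diff N_fscl)
  qed
  have 4: "ptens_over A V W v (scl W c w) = fscl c (ptens_over A V W v w)"
    if "v \<in> car V" "w \<in> car W" for v w c
  proof -
    have "N (pair v (scl W c w) - fscl c (pair v w)) = 0"
      by (rule N_eqI) (unfold tensor_rels_def, use that in blast)
    then show ?thesis by (simp add: ptens_over_def N_diff N_fscl)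
  qed
  show ?thesis by (intro bilI linI) (simp_all add: 1 2 3 4)
qed

lemma ptens_balanced:
  assumes "a \<in> A" "v \<in> car V" "w \<in> car W"
  shows "ptens_over A V W (ract V v a) w = ptens_over A V W v (lact W a w)"
proof -
  have "N (pair (ract V v a) w - pair v (lact W a w)) = 0"
    by (rule N_eqI) (unfold tensor_rels_def, use assms in blast)
  then show ?thesis by (simp add: ptens_over_def N_diff)
qed

text \<open>The universal property of the tensor product: a pair and its normal form differ by a
  combination of relations, and a bilinear balanced \<open>f\<close> sends every relation to
  0.\<close>

lemma ext_ptens:
  assumes U: "kspace U" and f: "bil V W U f"
    and bal: "\<And>a v w. a \<in> A \<Longrightarrow> v \<in> car V \<Longrightarrow> w \<in> car W \<Longrightarrow> f (ract V v a) w = f v (lact W a w)"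
    and vw: "v \<in> car V" "w \<in> car W"
  shows "ext (scl U) f (ptens_over A V W v w) = f v w"
proof -
  interpret U: kspace U by fact
  interpret vp: vector_space_pair "fscl :: 'k \<Rightarrow> ('v \<times> 'w \<Rightarrow>\<^sub>0 'k) \<Rightarrow> _" "scl U" ..
  note e = ext_diff[OF U.ambient] ext_add[OF U.ambient] ext_fscl[OF U.ambient] ext_pair_sc[OF U.ambient]
  have 0: "ext (scl U) f p = 0" if "p \<in> tensor_rels A V W" for p
    using that unfolding tensor_rels_def
    by (auto simp: e lin_add[OF bil_left[OF f]] lin_add[OF bil_right[OF f]]
        lin_scl[OF bil_left[OF f]] lin_scl[OF bil_right[OF f]] bal)
  have "ext (scl U) f p = 0" if "p \<in> fs.span (tensor_rels A V W)" for p
    by (rule vp.linear_eq_0_on_span[OF ext_linear[OF U.ambient] 0 that])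
  from this[OF N_diff_span[of "pair v w"]] show ?thesis
    by (simp add: e ptens_over_def)
qed

lemma lin_ext:
  assumes "kspace U" "\<And>v w. v \<in> car V \<Longrightarrow> w \<in> car W \<Longrightarrow> f v w \<in> car U"
  shows "lin T U (ext (scl U) f)"
proof -
  interpret U: kspace U by fact
  show ?thesis
    by (rule linI)
       (auto simp: ext_add[OF U.ambient] ext_fscl[OF U.ambient] intro!: ext_closed assms dest: T_keys)
qed

text \<open>Pure tensors span, by \<open>expand\<close>. Identities between linear maps are reduced
  to generators by this principle throughout.\<close>

lemma lin_eqI:
  assumes "lin T U f" "lin T U g" "p \<in> car T"
    and "\<And>v w. v \<in> car V \<Longrightarrow> w \<in> car W \<Longrightarrow> f (ptens_over A V W v w) = g (ptens_over A V W v w)"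
  shows "f p = g p"
proof -
  have *: "h p = ext (scl U) (\<lambda>v w. h (ptens_over A V W v w)) p" if "lin T U h" for h
    using ext_lin_out[OF that kspace_T, of p "ptens_over A V W"] ptens_closed T_keys[OF assms(3)]
      expand[OF assms(3)] by simp
  show ?thesis
    unfolding *[OF assms(1)] *[OF assms(2)] using T_keys[OF assms(3)]
    by (intro ext_cong assms(4)) auto
qed

lemma induct [consumes 1, case_names pure add scl]:
  assumes "p \<in> car T" and pure: "\<And>v w. v \<in> car V \<Longrightarrow> w \<in> car W \<Longrightarrow> P (ptens_over A V W v w)"
    and add: "\<And>p q. p \<in> car T \<Longrightarrow> q \<in> car T \<Longrightarrow> P p \<Longrightarrow> P q \<Longrightarrow> P (p + q)"
    and scl: "\<And>c p. p \<in> car T \<Longrightarrow> P p \<Longrightarrow> P (fscl c p)"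
  shows "P p"
proof -
  interpret T: kspace T by (rule kspace_T)
  have "P 0" using scl[OF ptens_closed pure, of 0 0 0] by simp
  have 1: "P (fscl c (ptens_over A V W (fst x) (snd x)))" "fscl c (ptens_over A V W (fst x) (snd x)) \<in> car T"
    if "x \<in> Poly_Mapping.keys p" for x c
    using that T_keys[OF assms(1), of "fst x" "snd x"] pure scl ptens_closed T.scl_closed by auto
  have "P (\<Sum>x\<in>K. fscl (Poly_Mapping.lookup p x) (ptens_over A V W (fst x) (snd x))) \<and>
     (\<Sum>x\<in>K. fscl (Poly_Mapping.lookup p x) (ptens_over A V W (fst x) (snd x))) \<in> car T"
    if "finite K" "K \<subseteq> Poly_Mapping.keys p" for K
    using that
  proof (induction K rule: finite_induct)
    case (insert x K)
    then show ?case using 1[of x] by (auto intro!: add T.add_closed)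
  qed (use \<open>P 0\<close> in simp)
  from this[of "Poly_Mapping.keys p"] show ?thesis
    using expand[OF assms(1)] by (simp add: ext_def)
qed

end

lemma over_k_simps [simp]: "car (over_k V) = car V" "scl (over_k V) = scl V"
  "lact (over_k V) = scl V" "ract (over_k V) = (\<lambda>v c. scl V c v)"
  by (simp_all add: over_k_def)

lemma lin_over_k [simp]: "lin (over_k V) U f = lin V U f"
  and bil_over_k [simp]: "bil (over_k V) (over_k W) U g = bil V W U g"
  by (simp_all add: lin_def bil_def)

lemma kspace_over_k [simp]: "kspace (over_k V) = kspace V"
  by (simp add: kspace_def)

locale kpair = V: kspace V + W: kspace W
  for V :: "('k :: field, 'v :: ab_group_add, 'm) space_scheme"
    and W :: "('k, 'w :: ab_group_add, 'n) space_scheme"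
begin

sublocale b: balanced_pair UNIV "over_k V" "over_k W"
  unfolding balanced_pair_def balanced_pair_axioms_def
  using V.kspace_axioms W.kspace_axioms by simp

end

lemma scl_tens [simp]: "scl (tens V W) = fscl"
  by (simp add: tens_def tensor_over_def)

context
  fixes V :: "('k :: field, 'v :: ab_group_add, 'm) space_scheme"
    and W :: "('k, 'w :: ab_group_add, 'n) space_scheme"
  assumes VW: "kspace V" "kspace W"
begin

interpretation kpair V W using VW by (rule kpair.intro)

lemma kspace_tens: "kspace (tens V W)"
  using b.kspace_T by (simp add: tens_def)

lemma ptens_closed: "v \<in> car V \<Longrightarrow> w \<in> car W \<Longrightarrow> ptens V W v w \<in> car (tens V W)"
  using b.ptens_closed by (simp add: tens_def ptens_def)

lemma tens_keys: "p \<in> car (tens V W) \<Longrightarrow> (x, y) \<in> Poly_Mapping.keys p \<Longrightarrow> x \<in> car V \<and> y \<in> car W"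
  using b.T_keys by (simp add: tens_def)

lemma ptens_bil: "bil V W (tens V W) (ptens V W)"
  using b.ptens_bil by (simp add: tens_def ptens_def)

lemma tens_expand: "p \<in> car (tens V W) \<Longrightarrow> ext fscl (ptens V W) p = p"
  using b.expand by (simp add: tens_def ptens_def)

lemma ext_ptens:
  assumes "kspace U" "bil V W U f" "v \<in> car V" "w \<in> car W" "sc = scl U"
  shows "ext sc f (ptens V W v w) = f v w"
proof -
  \<comment> \<open>Over the field, balancedness is part of bilinearity.\<close>
  have "f (scl V a v) w = f v (scl W a w)" if "v \<in> car V" "w \<in> car W" for a v w
    using that lin_scl[OF bil_left[OF assms(2)]] lin_scl[OF bil_right[OF assms(2)]] by simp
  then show ?thesis
    using b.ext_ptens[OF assms(1) _ _ , of f v w] assms by (simp add: tens_def ptens_def)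
qed

lemma lin_tens_ext:
  assumes "kspace U" "\<And>v w. v \<in> car V \<Longrightarrow> w \<in> car W \<Longrightarrow> f v w \<in> car U" "sc = scl U"
  shows "lin (tens V W) U (ext sc f)"
  using b.lin_ext[OF assms(1), of f] assms by (simp add: tens_def)

lemma tens_lin_eqI:
  assumes "p \<in> car (tens V W)" "lin (tens V W) U f" "lin (tens V W) U g"
    and "\<And>v w. v \<in> car V \<Longrightarrow> w \<in> car W \<Longrightarrow> f (ptens V W v w) = g (ptens V W v w)"
  shows "f p = g p"
  using b.lin_eqI[of U f g p] assms by (simp add: tens_def ptens_def)

lemma ptens_class:
  assumes "Poly_Mapping.keys p \<subseteq> car V \<times> car W"
  shows "ext fscl (ptens V W) p \<in> car (tens V W)"
  using ext_closed[OF kspace_tens, of p "ptens V W"] assms ptens_closed by auto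

end

lemma lin_ext_body:
  assumes "kspace U" "kspace V"
    and f: "\<And>x y. (x, y) \<in> Poly_Mapping.keys p \<Longrightarrow> lin V U (\<lambda>v. f v x y)"
  shows "lin V U (\<lambda>v. ext (scl U) (f v) p)"
proof -
  interpret U: kspace U by fact
  interpret V: kspace V by fact
  show ?thesis
  proof (rule linI)
    fix v v' c assume v: "v \<in> car V"
    show "ext (scl U) (f v) p \<in> car U"
      using v by (intro ext_closed assms lin_closed[OF f]) auto
    have "ext (scl U) (f (scl V c v)) p = ext (scl U) (\<lambda>x y. scl U c (f v x y)) p"
      by (rule ext_cong) (use lin_scl[OF f] v in auto)
    then show "ext (scl U) (f (scl V c v)) p = scl U c (ext (scl U) (f v) p)"
      by (simp add: ext_fun_scl[OF U.ambient])
    assume v': "v' \<in> car V"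
    have "ext (scl U) (f (v + v')) p = ext (scl U) (\<lambda>x y. f v x y + f v' x y) p"
      by (rule ext_cong) (use lin_add[OF f] v v' in auto)
    then show "ext (scl U) (f (v + v')) p = ext (scl U) (f v) p + ext (scl U) (f v') p"
      by (simp add: ext_fun_add[OF U.ambient])
  qed
qed

section \<open>Sweedler calculus\<close>

text \<open>The function is the last argument of \<open>sw\<close>: nested sums are then not eta-contracted, so that the
  simplifier can use \<open>sw_cong\<close> below as a congruence rule.\<close>

definition sw :: "('k :: field, 'v, 'm) bialg_scheme \<Rightarrow> ('k \<Rightarrow> 'u \<Rightarrow> 'u :: ab_group_add) \<Rightarrow>
    'v \<Rightarrow> ('v \<Rightarrow> 'v \<Rightarrow> 'u) \<Rightarrow> 'u" where
  "sw H sc h f = sw2 H sc f h"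

lemma sw2_eq_sw: "sw2 H sc f h = sw H sc h f"
  by (simp add: sw_def)

text \<open>A linear coproduct without coassociativity: for the dual and the Drinfeld double the
  Sweedler rules are already used while the coalgebra axioms are being proved.\<close>

locale kcoprod = kspace H
  for H :: "('k :: field, 'v :: ab_group_add, 'm) bialg_scheme" +
  assumes cop_lin: "lin H (tens H H) (cop H)"

context kcoprod
begin

lemma cop_closed: "h \<in> car H \<Longrightarrow> cop H h \<in> car (tens H H)"
  using cop_lin by (rule lin_closed)

lemma cop_keys: "h \<in> car H \<Longrightarrow> (x, y) \<in> Poly_Mapping.keys (cop H h) \<Longrightarrow> x \<in> car H \<and> y \<in> car H"
  using tens_keys[OF kspace_axioms kspace_axioms cop_closed] .

lemma sw_cong:
  "h \<in> car H \<Longrightarrow> (\<And>x y. x \<in> car H \<Longrightarrow> y \<in> car H \<Longrightarrow> f x y = g x y) \<Longrightarrow>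
    sw H sc h f = sw H sc h g"
  unfolding sw_def sw2_def by (rule ext_cong) (auto dest: cop_keys)

lemma sw_closed:
  "kspace U \<Longrightarrow> sc = scl U \<Longrightarrow> h \<in> car H \<Longrightarrow>
    (\<And>x y. x \<in> car H \<Longrightarrow> y \<in> car H \<Longrightarrow> f x y \<in> car U) \<Longrightarrow> sw H sc h f \<in> car U"
  unfolding sw_def sw2_def by (auto intro!: ext_closed dest: cop_keys)

lemma sw_lin_arg:
  assumes "kspace U" "sc = scl U" "lin V H g"
    and "\<And>x y. x \<in> car H \<Longrightarrow> y \<in> car H \<Longrightarrow> f x y \<in> car U"
  shows "lin V U (\<lambda>v. sw H sc (g v) f)"
  unfolding sw_def sw2_def
  by (rule lin_comp[OF lin_tens_ext[OF kspace_axioms kspace_axioms assms(1,4,2)] lin_comp[OF cop_lin assms(3)]])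

lemma sw_lin_body:
  assumes "kspace U" "sc = scl U" "h \<in> car H" "kspace V"
    and f: "\<And>x y. x \<in> car H \<Longrightarrow> y \<in> car H \<Longrightarrow> lin V U (\<lambda>v. f v x y)"
  shows "lin V U (\<lambda>v. sw H sc h (f v))"
proof -
  have "lin V U (\<lambda>v. ext (scl U) (f v) (cop H h))"
    by (rule lin_ext_body[OF assms(1,4)]) (use f cop_keys[OF assms(3)] in blast)
  then show ?thesis by (simp add: sw_def sw2_def assms(2))
qed

lemma sw_out:
  assumes "lin U W g" "kspace U" "sc = scl U" "sc' = scl W" "h \<in> car H"
    and "\<And>x y. x \<in> car H \<Longrightarrow> y \<in> car H \<Longrightarrow> f x y \<in> car U"
  shows "g (sw H sc h f) = sw H sc' h (\<lambda>x y. g (f x y))"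
  unfolding sw_def sw2_def assms(3,4) using assms
  by (intro ext_lin_out) (auto dest: cop_keys)

end

text \<open>Separated from \<open>kbialgebra\<close> because the Drinfeld double is a coalgebra
  before its product is known to be associative; \<open>inner_action\<close> starts at this
  stage.\<close>

locale kcoalgebra = kcoprod H
  for H :: "('k :: field, 'v :: ab_group_add, 'm) bialg_scheme" +
  assumes cou_lin: "lin H ground (cou H)"
    and coassoc: "h \<in> car H \<Longrightarrow>
      sw H fscl h (\<lambda>x z. sw H fscl x (\<lambda>x' x''. ptens H (tens H H) x' (ptens H H x'' z))) =
      sw H fscl h (\<lambda>x y. ptens H (tens H H) x (cop H y))"
    and counit_left: "h \<in> car H \<Longrightarrow> sw H (scl H) h (\<lambda>x y. scl H (cou H x) y) = h"
    and counit_right: "h \<in> car H \<Longrightarrow> sw H (scl H) h (\<lambda>x y. scl H (cou H y) x) = h"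
begin

text \<open>\<open>coassoc\<close> is an equation in \<open>H \<otimes> (H \<otimes> H)\<close>. A
  summand linear in each of three variables extends to a linear map on that space, and applying this
  map to both sides gives the claim.\<close>

lemma sw_coassoc:
  assumes U: "kspace U" "sc = scl U" and h: "h \<in> car H"
    and 1: "\<And>y z. y \<in> car H \<Longrightarrow> z \<in> car H \<Longrightarrow> lin H U (\<lambda>x. f x y z)"
    and 2: "\<And>x z. x \<in> car H \<Longrightarrow> z \<in> car H \<Longrightarrow> lin H U (\<lambda>y. f x y z)"
    and 3: "\<And>x y. x \<in> car H \<Longrightarrow> y \<in> car H \<Longrightarrow> lin H U (\<lambda>z. f x y z)"
  shows "sw H sc h (\<lambda>x z. sw H sc x (\<lambda>x' x''. f x' x'' z)) =
    sw H sc h (\<lambda>x y. sw H sc y (\<lambda>y' y''. f x y' y''))"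
proof -
  note K = kspace_axioms
  note TT = kspace_tens[OF K K]
  note TTT = kspace_tens[OF K TT]
  have fc: "f x y z \<in> car U" if "x \<in> car H" "y \<in> car H" "z \<in> car H" for x y z
    using lin_closed[OF 1] that by blast
  have b: "bil H H U (f x)" if "x \<in> car H" for x
    using 2 3 that by (auto intro: bilI)
  have inner: "lin (tens H H) U (ext sc (f x))" if "x \<in> car H" for x
    using that by (intro lin_tens_ext K U fc)
  have bG: "bil H (tens H H) U (\<lambda>x q. ext sc (f x) q)"
  proof (rule bilI)
    fix q assume q: "q \<in> car (tens H H)"
    interpret Uk: kspace U by fact
    show "lin H U (\<lambda>x. ext sc (f x) q)"
    proof (rule linI)
      fix x y c assume x: "x \<in> car H"
      show "ext sc (f x) q \<in> car U" using inner[OF x] q by (rule lin_closed)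
      show "ext sc (f (scl H c x)) q = scl U c (ext sc (f x) q)"
        unfolding U ext_fun_scl[OF Uk.ambient, symmetric]
        by (rule ext_cong) (use tens_keys[OF K K q] x lin_scl[OF 1] in auto)
      assume y: "y \<in> car H"
      show "ext sc (f (x + y)) q = ext sc (f x) q + ext sc (f y) q"
        unfolding U ext_fun_add[OF Uk.ambient, symmetric]
        by (rule ext_cong) (use tens_keys[OF K K q] x y lin_add[OF 1] in auto)
    qed
  qed (rule inner)
  \<comment> \<open>The linear extension of \<open>f\<close> to the triple tensor product, built
    from the inner tensor factor outwards.\<close>
  define G where "G = ext sc (\<lambda>x q. ext sc (f x) q)"
  have G_lin: "lin (tens H (tens H H)) U G"
    unfolding G_def by (rule lin_tens_ext[OF K TT U(1) _ U(2)]) (rule bil_closed[OF bG])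
  have G: "G (ptens H (tens H H) x q) = ext sc (f x) q" if "x \<in> car H" "q \<in> car (tens H H)" for x q
    unfolding G_def using ext_ptens[OF K TT U(1) bG that U(2)] by simp
  have G': "G (ptens H (tens H H) x (ptens H H y z)) = f x y z" if "x \<in> car H" "y \<in> car H" "z \<in> car H" for x y z
    using that G ptens_closed[OF K K] ext_ptens[OF K K U(1) b _ _ U(2)] by simp
  note pc = ptens_closed[OF K TT] ptens_closed[OF K K]
  note out = sw_out[OF G_lin TTT _ U(2), where sc=fscl, simplified]
  have "G (sw H fscl h (\<lambda>x z. sw H fscl x (\<lambda>x' x''. ptens H (tens H H) x' (ptens H H x'' z)))) =
    sw H sc h (\<lambda>x z. sw H sc x (\<lambda>x' x''. f x' x'' z))"
    by (subst out[OF h]; (intro sw_closed[OF TTT] sw_cong[OF h])?)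
       (auto simp: pc out G' intro!: sw_cong)
  moreover have "G (sw H fscl h (\<lambda>x y. ptens H (tens H H) x (cop H y))) =
     sw H sc h (\<lambda>x y. sw H sc y (\<lambda>y' y''. f x y' y''))"
    by (subst out[OF h]; (intro sw_cong[OF h])?) (auto simp: pc cop_closed G sw_def sw2_def)
  ultimately show ?thesis using coassoc[OF h] by simp
qed

lemma sw_counit_left:
  assumes "lin H U f" "kspace U" "sc = scl U" "h \<in> car H"
  shows "sw H sc h (\<lambda>x y. sc (cou H x) (f y)) = f h"
proof -
  have "f h = f (sw H (scl H) h (\<lambda>x y. scl H (cou H x) y))"
    using assms by (simp add: counit_left)
  also have "\<dots> = sw H sc h (\<lambda>x y. f (scl H (cou H x) y))"
    using assms by (intro sw_out[OF assms(1) kspace_axioms]) auto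
  also have "\<dots> = sw H sc h (\<lambda>x y. sc (cou H x) (f y))"
    using assms by (intro sw_cong) (auto simp: lin_scl)
  finally show ?thesis ..
qed

lemma sw_counit_right:
  assumes "lin H U f" "kspace U" "sc = scl U" "h \<in> car H"
  shows "sw H sc h (\<lambda>x y. sc (cou H y) (f x)) = f h"
proof -
  have "f h = f (sw H (scl H) h (\<lambda>x y. scl H (cou H y) x))"
    using assms by (simp add: counit_right)
  also have "\<dots> = sw H sc h (\<lambda>x y. f (scl H (cou H y) x))"
    using assms by (intro sw_out[OF assms(1) kspace_axioms]) auto
  also have "\<dots> = sw H sc h (\<lambda>x y. sc (cou H y) (f x))"
    using assms by (intro sw_cong) (auto simp: lin_scl)
  finally show ?thesis ..
qed

end

lemma sw_swap:
  "vector_space sc \<Longrightarrow> sw H sc h (\<lambda>x y. sw G sc g (\<lambda>u v. f x y u v)) =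
    sw G sc g (\<lambda>u v. sw H sc h (\<lambda>x y. f x y u v))"
  unfolding sw_def sw2_def by (rule ext_swap)

context kbialgebra
begin

sublocale kcoalgebra H
  using coassoc counit_left counit_right
  by unfold_locales (simp_all add: cop_lin cou_lin sw2_eq_sw)

end

context kalgebra
begin

lemma mul_closed [simp]: "x \<in> car A \<Longrightarrow> y \<in> car A \<Longrightarrow> x \<cdot>\<^bsub>A\<^esub> y \<in> car A"
  using mul_left lin_closed by blast

declare unt_closed [simp] unt_left [simp] unt_right [simp]

lemma lin_mul_left: "lin V A f \<Longrightarrow> y \<in> car A \<Longrightarrow> lin V A (\<lambda>x. f x \<cdot>\<^bsub>A\<^esub> y)"
  using lin_comp[OF mul_left] .

lemma lin_mul_right: "lin V A f \<Longrightarrow> y \<in> car A \<Longrightarrow> lin V A (\<lambda>x. y \<cdot>\<^bsub>A\<^esub> f x)"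
  using lin_comp[OF mul_right] .

lemma scl_mul_left: "x \<in> car A \<Longrightarrow> y \<in> car A \<Longrightarrow> scl A c x \<cdot>\<^bsub>A\<^esub> y = scl A c (x \<cdot>\<^bsub>A\<^esub> y)"
  and scl_mul_right: "x \<in> car A \<Longrightarrow> y \<in> car A \<Longrightarrow> x \<cdot>\<^bsub>A\<^esub> scl A c y = scl A c (x \<cdot>\<^bsub>A\<^esub> y)"
  using lin_scl[OF mul_left] lin_scl[OF mul_right] by auto

end

lemma lin_ptens_left:
  assumes "kspace V" "kspace W" "lin U V f" "w \<in> car W"
  shows "lin U (tens V W) (\<lambda>x. ptens V W (f x) w)"
  using lin_comp[OF bil_left[OF ptens_bil[OF assms(1,2)] assms(4)] assms(3)] .

lemma lin_ptens_right:
  assumes "kspace V" "kspace W" "lin U W f" "v \<in> car V"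
  shows "lin U (tens V W) (\<lambda>x. ptens V W v (f x))"
  using lin_comp[OF bil_right[OF ptens_bil[OF assms(1,2)] assms(4)] assms(3)] .

text \<open>Every axiom is an equation between elements of \<open>X\<close> and may be checked after
  the injective \<open>f\<close>. Associativity of the Heisenberg double, the Drinfeld double and
  the smash product is obtained in this way.\<close>

lemma kalgebra_pullback:
  assumes "kspace X" "kalgebra Y" and f: "lin X Y f" "inj_on f (car X)"
    and mul: "\<And>x y. x \<in> car X \<Longrightarrow> y \<in> car X \<Longrightarrow> x \<cdot>\<^bsub>X\<^esub> y \<in> car X"
      "\<And>x y. x \<in> car X \<Longrightarrow> y \<in> car X \<Longrightarrow> f (x \<cdot>\<^bsub>X\<^esub> y) = f x \<cdot>\<^bsub>Y\<^esub> f y"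
    and unt: "unt X \<in> car X" "f (unt X) = unt Y"
  shows "kalgebra X"
proof -
  interpret X: kspace X by fact
  interpret Y: kalgebra Y by fact
  have eq: "x = y" if "f x = f y" "x \<in> car X" "y \<in> car X" for x y
    using that f(2) by (auto dest: inj_onD)
  note [simp] = mul unt lin_closed[OF f(1)] lin_add[OF f(1)] lin_scl[OF f(1)] lin_add[OF Y.mul_left]
    lin_add[OF Y.mul_right] Y.scl_mul_left Y.scl_mul_right Y.assoc
  show ?thesis
    by unfold_locales ((rule linI)?; ((rule eq)?; simp); fail)+
qed


text \<open>\<open>lins\<close> and \<open>clo\<close> collect the side conditions of the Sweedler
  rules, linearity and membership in carriers, for the simplifier to discharge; the collection
  \<open>outs\<close> below moves products, scalars and pure tensors into a Sweedler sum.\<close>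

named_theorems lins
declare lin_id [lins] lin_ptens_left [lins] lin_ptens_right [lins] kalgebra.lin_mul_left [lins]
  kalgebra.lin_mul_right [lins] lin_scale [lins] lin_scale_left [lins] lin_mult_left [lins]
  lin_mult_right [lins] kcoprod.sw_lin_arg [lins] kcoprod.sw_lin_body [lins] lin_plus [lins]

named_theorems clo
declare kspace.zero_closed [clo] kspace.add_closed [clo] kspace.diff_closed [clo]
  kspace.scl_closed [clo] ptens_closed [clo] kspace_tens [clo] kalgebra.mul_closed [clo]
  kalgebra.unt_closed [clo] kcoprod.sw_closed [clo]

lemma kalgebra_kspace: "kalgebra A \<Longrightarrow> kspace A"
  and kcoprod_kspace: "kcoprod H \<Longrightarrow> kspace H"
  by (simp_all add: kalgebra_def kcoprod_def)

lemma fscl_closed [clo]: "kspace V \<Longrightarrow> kspace W \<Longrightarrow> p \<in> car (tens V W) \<Longrightarrow> fscl c p \<in> car (tens V W)"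
  using kspace.scl_closed[OF kspace_tens, of V W p c] by simp

lemma lin_fscl [lins]:
  "kspace V \<Longrightarrow> kspace W \<Longrightarrow> lin U (tens V W) f \<Longrightarrow> lin U (tens V W) (\<lambda>x. fscl c (f x))"
  using lin_scale[OF kspace_tens, of V W U f c] by simp

lemma lin_fscl_left [lins]:
  "kspace V \<Longrightarrow> kspace W \<Longrightarrow> p \<in> car (tens V W) \<Longrightarrow> lin U ground f \<Longrightarrow>
    lin U (tens V W) (\<lambda>x. fscl (f x) p)"
  using lin_scale_left[OF kspace_tens, of V W p U f] by simp

section \<open>Sweedler rules for products and antipodes\<close>

context kbialgebra
begin

declare cou_mul [simp] cou_unt [simp]

lemma sw_mul:
  assumes "kspace U" "sc = scl U" "bil H H U f" "h \<in> car H" "g \<in> car H"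
  shows "sw H sc (h \<cdot>\<^bsub>H\<^esub> g) f =
    sw H sc h (\<lambda>h' h''. sw H sc g (\<lambda>g' g''. f (h' \<cdot>\<^bsub>H\<^esub> g') (h'' \<cdot>\<^bsub>H\<^esub> g'')))"
proof -
  interpret U: kspace U by fact
  have "sw H sc (h \<cdot>\<^bsub>H\<^esub> g) f = sw H sc h (\<lambda>h' h''. sw H sc g (\<lambda>g' g''.
      ext sc f (ptens H H (h' \<cdot>\<^bsub>H\<^esub> g') (h'' \<cdot>\<^bsub>H\<^esub> g''))))"
    by (simp add: sw_def sw2_def[of _ _ f] cop_mul[OF assms(4,5)])
       (simp add: sw2_def assms(2) ext_comp[OF U.ambient])
  also have "\<dots> = sw H sc h (\<lambda>h' h''. sw H sc g (\<lambda>g' g''. f (h' \<cdot>\<^bsub>H\<^esub> g') (h'' \<cdot>\<^bsub>H\<^esub> g'')))"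
    using assms by (intro sw_cong ext_ptens kspace_axioms) auto
  finally show ?thesis .
qed

lemma sw_unt:
  assumes "kspace U" "sc = scl U" "bil H H U f"
  shows "sw H sc (unt H) f = f (unt H) (unt H)"
  using ext_ptens[OF kspace_axioms kspace_axioms assms(1,3) unt_closed unt_closed assms(2)]
  by (simp add: sw_def sw2_def cop_unt)

end

context khopf_algebra
begin

lemma S_closed [simp]: "x \<in> car H \<Longrightarrow> ant H x \<in> car H"
  using ant_lin lin_closed by blast

lemma lin_S: "lin V H f \<Longrightarrow> lin V H (\<lambda>x. ant H (f x))"
  using lin_comp[OF ant_lin] .

lemma S_left: "h \<in> car H \<Longrightarrow> sw H (scl H) h (\<lambda>x y. ant H x \<cdot>\<^bsub>H\<^esub> y) = scl H (cou H h) (unt H)"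
  and S_right: "h \<in> car H \<Longrightarrow> sw H (scl H) h (\<lambda>x y. x \<cdot>\<^bsub>H\<^esub> ant H y) = scl H (cou H h) (unt H)"
  using ant_left ant_right by (simp_all add: sw2_eq_sw)

lemma S_unt [simp]: "ant H (unt H) = unt H"
  using S_left[of "unt H"] sw_unt[of H "scl H" "\<lambda>x y. ant H x \<cdot>\<^bsub>H\<^esub> y"] kspace_axioms
  by (simp add: bilI lin_mul_left lin_mul_right lin_S lin_id)

end

named_theorems outs

lemma mul_sw_right [outs]:
  assumes "kalgebra A" "kcoprod C" "sc = scl A" "h \<in> car C" "x \<in> car A"
    "\<And>u v. u \<in> car C \<Longrightarrow> v \<in> car C \<Longrightarrow> f u v \<in> car A"
  shows "x \<cdot>\<^bsub>A\<^esub> sw C sc h f = sw C sc h (\<lambda>u v. x \<cdot>\<^bsub>A\<^esub> f u v)"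
  using assms by (intro kcoprod.sw_out[of C A A]) (auto simp: kalgebra.mul_right kalgebra_kspace)

lemma mul_sw_left [outs]:
  assumes "kalgebra A" "kcoprod C" "sc = scl A" "h \<in> car C" "x \<in> car A"
    "\<And>u v. u \<in> car C \<Longrightarrow> v \<in> car C \<Longrightarrow> f u v \<in> car A"
  shows "sw C sc h f \<cdot>\<^bsub>A\<^esub> x = sw C sc h (\<lambda>u v. f u v \<cdot>\<^bsub>A\<^esub> x)"
  using assms by (intro kcoprod.sw_out[of C A A]) (auto simp: kalgebra.mul_left kalgebra_kspace)

lemma scl_sw [outs]:
  assumes "kspace U" "kcoprod C" "sc = scl U" "h \<in> car C"
    "\<And>u v. u \<in> car C \<Longrightarrow> v \<in> car C \<Longrightarrow> f u v \<in> car U"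
  shows "scl U c (sw C sc h f) = sw C sc h (\<lambda>u v. scl U c (f u v))"
  using assms by (intro kcoprod.sw_out[of C U U]) (auto intro: lin_scale lin_id)

lemma ptens_sw_right [outs]:
  assumes "kspace V" "kspace W" "kcoprod C" "sc = scl W" "h \<in> car C" "x \<in> car V"
    "\<And>u v. u \<in> car C \<Longrightarrow> v \<in> car C \<Longrightarrow> f u v \<in> car W"
  shows "ptens V W x (sw C sc h f) = sw C fscl h (\<lambda>u v. ptens V W x (f u v))"
  using assms by (intro kcoprod.sw_out[of C W "tens V W"]) (auto intro: lin_ptens_right lin_id)

lemma ptens_sw_left [outs]:
  assumes "kspace V" "kspace W" "kcoprod C" "sc = scl V" "h \<in> car C" "x \<in> car W"
    "\<And>u v. u \<in> car C \<Longrightarrow> v \<in> car C \<Longrightarrow> f u v \<in> car V"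
  shows "ptens V W (sw C sc h f) x = sw C fscl h (\<lambda>u v. ptens V W (f u v) x)"
  using assms by (intro kcoprod.sw_out[of C V "tens V W"]) (auto intro: lin_ptens_left lin_id)

context khopf_algebra
begin

text \<open>Both sides are convolution inverse to the multiplication map
  \<open>H \<otimes> H \<rightarrow> H\<close>. The chain writes out the uniqueness of such
  inverses: \<open>S(b) S(a)\<close> is multiplied by \<open>(a2 b2) S(a3 b3)\<close>, which amounts
  to a counit, and the inner factors then cancel.\<close>

lemma S_mul:
  assumes a: "a \<in> car H" and b: "b \<in> car H"
  shows "ant H (a \<cdot>\<^bsub>H\<^esub> b) = ant H b \<cdot>\<^bsub>H\<^esub> ant H a"
proof -
  let ?s = "scl H" and ?S = "ant H"
  note K = kspace_axioms and A = kalgebra_axioms and C = kcoprod_axioms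
  note [simp] = lins clo K A C lin_S cou_lin
  \<comment> \<open>Merging the two counit scalars into one would hide them from
    \<open>sw_counit_right\<close>.\<close>
  note [simp del] = vs.scale_scale
  have "?S b \<cdot>\<^bsub>H\<^esub> ?S a = 
    sw H ?s a (\<lambda>a1 a'. sw H ?s b (\<lambda>b1 b'. ?s (cou H b') (?s (cou H a') (?S b1 \<cdot>\<^bsub>H\<^esub> ?S a1))))"
    using a b by (simp add: sw_counit_right[of H _ "scl H"] cong: sw_cong)
  \<comment> \<open>The counits of \<open>a'\<close> and \<open>b'\<close> are replaced by the right
    antipode identity for the product of \<open>a'\<close> and \<open>b'\<close>.\<close>
  also have "\<dots> = sw H ?s a (\<lambda>a1 a'. sw H ?s b (\<lambda>b1 b'. ?S b1 \<cdot>\<^bsub>H\<^esub> ?S a1 \<cdot>\<^bsub>H\<^esub>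
      (sw H ?s a' (\<lambda>a2 a3. sw H ?s b' (\<lambda>b2 b3. (a2 \<cdot>\<^bsub>H\<^esub> b2) \<cdot>\<^bsub>H\<^esub> ?S (a3 \<cdot>\<^bsub>H\<^esub> b3))))))"
    apply (intro sw_cong a b)
    apply (simp add: bilI S_right scl_mul_right vs.scale_scale mult.commute flip: sw_mul[of H ?s "\<lambda>x y. x \<cdot>\<^bsub>H\<^esub> ?S y"])
    done
  also have "\<dots> = sw H ?s a (\<lambda>a1 a'. sw H ?s a' (\<lambda>a2 a3. sw H ?s b (\<lambda>b1 b'.
      (sw H ?s b' (\<lambda>b2 b3. ?S b1 \<cdot>\<^bsub>H\<^esub> ?S a1 \<cdot>\<^bsub>H\<^esub> ((a2 \<cdot>\<^bsub>H\<^esub> b2) \<cdot>\<^bsub>H\<^esub> ?S (a3 \<cdot>\<^bsub>H\<^esub> b3)))))))"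
    using a b by (subst sw_swap[OF vs.vector_space_axioms]) (simp add: outs cong: sw_cong)
  also have "\<dots> = sw H ?s a (\<lambda>a1 a'. sw H ?s a' (\<lambda>a2 a3. sw H ?s b (\<lambda>b' b3.
      (sw H ?s b' (\<lambda>b1 b2. ?S b1 \<cdot>\<^bsub>H\<^esub> (?S a1 \<cdot>\<^bsub>H\<^esub> a2) \<cdot>\<^bsub>H\<^esub> (b2 \<cdot>\<^bsub>H\<^esub> ?S (a3 \<cdot>\<^bsub>H\<^esub> b3)))))))"
    using a b by (simp add: sw_coassoc[of H ?s] assoc cong: sw_cong)
  \<comment> \<open>The legs of \<open>a\<close> are regrouped so that \<open>S(a1) a2\<close>
    becomes a counit; after that \<open>S(b1)\<close> and \<open>b2\<close> are adjacent and
    collapse as well.\<close>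
  also have "\<dots> = sw H ?s a (\<lambda>a' a3. sw H ?s a' (\<lambda>a1 a2. sw H ?s b (\<lambda>b' b3.
      (sw H ?s b' (\<lambda>b1 b2. ?S b1 \<cdot>\<^bsub>H\<^esub> (?S a1 \<cdot>\<^bsub>H\<^esub> a2) \<cdot>\<^bsub>H\<^esub> (b2 \<cdot>\<^bsub>H\<^esub> ?S (a3 \<cdot>\<^bsub>H\<^esub> b3)))))))"
    using a b by (simp add: sw_coassoc[of H ?s])
  also have "\<dots> = sw H ?s a (\<lambda>a' a3. sw H ?s b (\<lambda>b' b3. sw H ?s b' (\<lambda>b1 b2.
      ?S b1 \<cdot>\<^bsub>H\<^esub> (sw H ?s a' (\<lambda>a1 a2. ?S a1 \<cdot>\<^bsub>H\<^esub> a2)) \<cdot>\<^bsub>H\<^esub> (b2 \<cdot>\<^bsub>H\<^esub> ?S (a3 \<cdot>\<^bsub>H\<^esub> b3)))))"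
    using a b by (simp add: outs sw_swap[OF vs.vector_space_axioms, of H _ H b] cong: sw_cong)
      (intro sw_cong sw_swap[OF vs.vector_space_axioms]; simp)
  also have "\<dots> = sw H ?s a (\<lambda>a' a3. sw H ?s b (\<lambda>b' b3. sw H ?s b' (\<lambda>b1 b2.
      ?s (cou H a') (?S b1 \<cdot>\<^bsub>H\<^esub> b2 \<cdot>\<^bsub>H\<^esub> ?S (a3 \<cdot>\<^bsub>H\<^esub> b3)))))"
    using a b by (simp add: S_left assoc scl_mul_left scl_mul_right cong: sw_cong)
  also have "\<dots> = sw H ?s a (\<lambda>a' a3. ?s (cou H a') (sw H ?s b (\<lambda>b' b3. sw H ?s b' (\<lambda>b1 b2.
      ?S b1 \<cdot>\<^bsub>H\<^esub> b2) \<cdot>\<^bsub>H\<^esub> ?S (a3 \<cdot>\<^bsub>H\<^esub> b3))))"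
    using a b by (simp add: outs cong: sw_cong)
  also have "\<dots> = ?S (a \<cdot>\<^bsub>H\<^esub> b)"
    using a b by (simp add: S_left scl_mul_left sw_counit_left[of H _ ?s] cong: sw_cong)
  finally show ?thesis ..
qed

text \<open>Apply the counit to the left antipode identity and absorb \<open>cou H y\<close> by the
  counit law.\<close>

lemma cou_S [simp]:
  assumes "h \<in> car H"
  shows "cou H (ant H h) = cou H h"
proof -
  note [simp] = lins clo kspace_axioms kalgebra_axioms kcoprod_axioms lin_S cou_lin
  have "cou H (ant H h) = sw H (*) h (\<lambda>x y. cou H (ant H x) * cou H y)"
    using assms sw_counit_right[of ground "\<lambda>x. cou H (ant H x)" "(*)" h]
    by (simp add: mult.commute lin_comp[OF cou_lin ant_lin])
  also have "\<dots> = cou H (sw H (scl H) h (\<lambda>x y. ant H x \<cdot>\<^bsub>H\<^esub> y))"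
    using assms by (simp add: sw_out[OF cou_lin, where sc'="(*)"] cong: sw_cong)
  also have "\<dots> = cou H h"
    using assms by (simp add: S_left lin_scl[OF cou_lin])
  finally show ?thesis .
qed

end

section \<open>Hopf algebras with bijective antipode\<close>

locale khopf_bij = khopf_algebra H
  for H :: "('k :: field, 'v :: ab_group_add, 'm) hopf_scheme" +
  assumes ant_bij: "bij_betw (ant H) (car H) (car H)"
begin

abbreviation "Si \<equiv> ant_inv H"

lemma S_inj: "x \<in> car H \<Longrightarrow> y \<in> car H \<Longrightarrow> ant H x = ant H y \<Longrightarrow> x = y"
  using ant_bij by (auto simp: bij_betw_def dest: inj_onD)

lemma Si_closed [simp]: "x \<in> car H \<Longrightarrow> Si x \<in> car H"
  and S_Si [simp]: "x \<in> car H \<Longrightarrow> ant H (Si x) = x"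
  using ant_bij by (auto simp: bij_betw_def ant_inv_def f_inv_into_f inv_into_into)

lemma Si_S [simp]: "x \<in> car H \<Longrightarrow> Si (ant H x) = x"
  using ant_bij by (simp add: bij_betw_def ant_inv_def)

lemma Si_lin: "lin H H Si"
  unfolding ant_inv_def by (rule lin_inv_into[OF ant_lin kspace_axioms ant_bij])

lemma lin_Si: "lin V H f \<Longrightarrow> lin V H (\<lambda>x. Si (f x))"
  using lin_comp[OF Si_lin] .

lemma Si_mul: "x \<in> car H \<Longrightarrow> y \<in> car H \<Longrightarrow> Si (x \<cdot>\<^bsub>H\<^esub> y) = Si y \<cdot>\<^bsub>H\<^esub> Si x"
  by (rule S_inj) (simp_all add: S_mul)

lemma Si_unt [simp]: "Si (unt H) = unt H"
  by (rule S_inj) simp_all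

lemma cou_Si [simp]: "x \<in> car H \<Longrightarrow> cou H (Si x) = cou H x"
  using cou_S[of "Si x"] by simp

text \<open>Checked after the injective \<open>S\<close>, which turns \<open>Si y \<cdot> x\<close>
  into \<open>S x \<cdot> y\<close>. The inverse antipode is an antipode for the opposite coproduct,
  hence the crossed legs here and in \<open>Si_right\<close>.\<close>

lemma Si_left:
  assumes "h \<in> car H"
  shows "sw H (scl H) h (\<lambda>x y. Si y \<cdot>\<^bsub>H\<^esub> x) = scl H (cou H h) (unt H)"
proof (rule S_inj)
  note [simp] = lins clo kspace_axioms kalgebra_axioms kcoprod_axioms
  have "ant H (sw H (scl H) h (\<lambda>x y. Si y \<cdot>\<^bsub>H\<^esub> x)) = sw H (scl H) h (\<lambda>x y. ant H x \<cdot>\<^bsub>H\<^esub> y)"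
    using assms by (simp add: sw_out[OF ant_lin, where sc'="scl H"] S_mul cong: sw_cong)
  then show "ant H (sw H (scl H) h (\<lambda>x y. Si y \<cdot>\<^bsub>H\<^esub> x)) = ant H (scl H (cou H h) (unt H))"
    using assms by (simp add: S_left lin_scl[OF ant_lin])
qed (use assms in \<open>auto intro!: sw_closed kspace_axioms\<close>)

lemma Si_right:
  assumes "h \<in> car H"
  shows "sw H (scl H) h (\<lambda>x y. y \<cdot>\<^bsub>H\<^esub> Si x) = scl H (cou H h) (unt H)"
proof (rule S_inj)
  note [simp] = lins clo kspace_axioms kalgebra_axioms kcoprod_axioms
  have "ant H (sw H (scl H) h (\<lambda>x y. y \<cdot>\<^bsub>H\<^esub> Si x)) = sw H (scl H) h (\<lambda>x y. x \<cdot>\<^bsub>H\<^esub> ant H y)"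
    using assms by (simp add: sw_out[OF ant_lin, where sc'="scl H"] S_mul cong: sw_cong)
  then show "ant H (sw H (scl H) h (\<lambda>x y. y \<cdot>\<^bsub>H\<^esub> Si x)) = ant H (scl H (cou H h) (unt H))"
    using assms by (simp add: S_right lin_scl[OF ant_lin])
qed (use assms in \<open>auto intro!: sw_closed kspace_axioms\<close>)

end

section \<open>The dual Hopf algebra\<close>

abbreviation (input) psc :: "'k :: field \<Rightarrow> ('b \<Rightarrow> 'k) \<Rightarrow> 'b \<Rightarrow> 'k" where
  "psc \<equiv> \<lambda>c \<beta> b. c * \<beta> b"

lemma vector_space_psc: "vector_space (psc :: 'k :: field \<Rightarrow> ('b \<Rightarrow> 'k) \<Rightarrow> _)"
  by unfold_locales (auto simp: fun_eq_iff algebra_simps)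

lemma sum_fun_apply: "(sum f I :: 'b \<Rightarrow> 'k :: ab_group_add) b = (\<Sum>i\<in>I. f i b)"
  by (induction I rule: infinite_finite_induct) auto

lemma ext_apply: "ext psc f p b = ext (*) (\<lambda>x y. f x y b) p"
  by (simp add: ext_def sum_fun_apply)

lemma sw_apply: "sw H psc h f b = sw H (*) h (\<lambda>x y. f x y b)"
  by (simp add: sw_def sw2_def ext_apply)

text \<open>Choose a maximal independent subset among the right factors that occur in
  \<open>p\<close>, expand every right factor in it, and collect the left factors belonging to each
  basis element.\<close>

lemma tens_indep_repr:
  fixes V :: "('k :: field, 'v :: ab_group_add, 'm) space_scheme"
    and W :: "('k, 'w :: ab_group_add, 'n) space_scheme"
  assumes V: "kspace V" and W: "kspace W" and p: "p \<in> car (tens V W)"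
  obtains E g where "finite E" "E \<subseteq> car W" "\<not> module.dependent (scl W) E"
    "\<And>e. e \<in> E \<Longrightarrow> g e \<in> car V" "p = (\<Sum>e\<in>E. ptens V W (g e) e)"
proof -
  interpret V: kspace V by fact
  interpret W: kspace W by fact
  interpret fs: vector_space "fscl :: 'k \<Rightarrow> ('v \<times> 'w \<Rightarrow>\<^sub>0 'k) \<Rightarrow> _" by (rule vector_space_fscl)
  let ?K = "Poly_Mapping.keys p" and ?c = "Poly_Mapping.lookup p"
  have K: "fst x \<in> car V" "snd x \<in> car W" if "x \<in> ?K" for x
    using tens_keys[OF V W p, of "fst x" "snd x"] that by auto
  obtain E where E: "E \<subseteq> snd ` ?K" "W.vs.independent E" "snd ` ?K \<subseteq> W.vs.span E"
    using W.vs.maximal_independent_subset by blast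
  have fin: "finite E" by (rule finite_subset[OF E(1)]) simp
  have EW: "E \<subseteq> car W" using E(1) K by auto
  define r where "r = W.vs.representation E"
  define g where "g e = (\<Sum>x\<in>?K. scl V (?c x * r (snd x) e) (fst x))" for e
  have g: "g e \<in> car V" for e
    unfolding g_def using K by (intro V.sum_closed) simp
  have snd_eq: "(\<Sum>e\<in>E. scl W (r (snd x) e) e) = snd x" if "x \<in> ?K" for x
    unfolding r_def by (rule W.vs.sum_representation_eq) (use E that fin in auto)
  have "p = (\<Sum>x\<in>?K. fscl (?c x) (ptens V W (fst x) (snd x)))"
    using tens_expand[OF V W p] by (simp add: ext_def)
  also have "\<dots> = (\<Sum>x\<in>?K. \<Sum>e\<in>E. ptens V W (scl V (?c x * r (snd x) e) (fst x)) e)"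
  proof (rule sum.cong)
    fix x assume x: "x \<in> ?K"
    have l: "lin W (tens V W) (\<lambda>w. ptens V W (fst x) w)"
      by (rule bil_right[OF ptens_bil[OF V W] K(1)[OF x]])
    have "ptens V W (fst x) (snd x) = (\<Sum>e\<in>E. ptens V W (fst x) (scl W (r (snd x) e) e))"
      by (subst snd_eq[OF x, symmetric], rule lin_sum[OF l W]) (use EW in auto)
    also have "\<dots> = (\<Sum>e\<in>E. fscl (r (snd x) e) (ptens V W (fst x) e))"
      using EW by (intro sum.cong) (auto simp: lin_scl[OF l])
    finally have "fscl (?c x) (ptens V W (fst x) (snd x)) =
        (\<Sum>e\<in>E. fscl (?c x) (fscl (r (snd x) e) (ptens V W (fst x) e)))"
      by (simp add: fs.scale_sum_right)
    also have "\<dots> = (\<Sum>e\<in>E. ptens V W (scl V (?c x * r (snd x) e) (fst x)) e)"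
      using EW K[OF x] lin_scl[OF bil_left[OF ptens_bil[OF V W]]] by (intro sum.cong) auto
    finally show "fscl (?c x) (ptens V W (fst x) (snd x)) =
        (\<Sum>e\<in>E. ptens V W (scl V (?c x * r (snd x) e) (fst x)) e)" .
  qed simp
  also have "\<dots> = (\<Sum>e\<in>E. \<Sum>x\<in>?K. ptens V W (scl V (?c x * r (snd x) e) (fst x)) e)"
    by (rule sum.swap)
  also have "\<dots> = (\<Sum>e\<in>E. ptens V W (g e) e)"
  proof (rule sum.cong)
    fix e assume "e \<in> E"
    then have l: "lin V (tens V W) (\<lambda>v. ptens V W v e)"
      using EW by (intro bil_left[OF ptens_bil[OF V W]]) auto
    show "(\<Sum>x\<in>?K. ptens V W (scl V (?c x * r (snd x) e) (fst x)) e) = ptens V W (g e) e"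
      unfolding g_def by (rule lin_sum[OF l V, symmetric]) (use K in auto)
  qed simp
  finally show ?thesis by (rule that[OF fin EW E(2) g])
qed

text \<open>With independent right factors \<open>e\<close>, evaluation at \<open>y\<close> gives
  the relation with coefficients \<open>g e y\<close> among them. All of these vanish, and a
  function with all values zero is zero.\<close>

lemma tens_eval_inj:
  fixes V :: "('k :: field, 'b \<Rightarrow> 'k, 'm) space_scheme" and W :: "('k, 'w :: ab_group_add, 'n) space_scheme"
  assumes V: "kspace V" "scl V = psc" and W: "kspace W" and p: "p \<in> car (tens V W)"
    and ev: "\<And>y. ext (scl W) (\<lambda>\<beta> w. scl W (\<beta> y) w) p = 0"
  shows "p = 0"
proof -
  interpret V: kspace V by fact
  interpret W: kspace W by fact
  obtain E g where E: "finite E" "E \<subseteq> car W" "W.vs.independent E" "\<And>e. e \<in> E \<Longrightarrow> g e \<in> car V"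
    "p = (\<Sum>e\<in>E. ptens V W (g e) e)"
    by (rule tens_indep_repr[OF V(1) W p]) (rule that)
  have b: "bil V W W (\<lambda>\<beta> w. scl W (\<beta> y) w)" for y
    by (intro bilI linI) (auto simp: V(2) W.vs.scale_left_distrib W.vs.scale_right_distrib mult.commute)
  have "g e y = 0" if "e \<in> E" for e y
  proof -
    have "0 = ext (scl W) (\<lambda>\<beta> w. scl W (\<beta> y) w) p" using ev by simp
    also have "\<dots> = (\<Sum>e\<in>E. ext (scl W) (\<lambda>\<beta> w. scl W (\<beta> y) w) (ptens V W (g e) e))"
      unfolding E(5) by (rule ext_setsum[OF W.ambient])
    also have "\<dots> = (\<Sum>e\<in>E. scl W (g e y) e)"
      using E by (intro sum.cong ext_ptens[OF V(1) W W b]) auto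
    finally show ?thesis
      using W.vs.independentD[OF E(3) E(1) subset_refl _ that, of "\<lambda>e. g e y"] by simp
  qed
  then have "g e = 0" if "e \<in> E" for e using that by (auto simp: fun_eq_iff)
  then have "p = (\<Sum>e\<in>E. ptens V W 0 e)" using E(5) by simp
  also have "\<dots> = 0"
    using E(2) lin_0[OF bil_left[OF ptens_bil[OF V(1) W]] V(1)] by (intro sum.neutral) auto
  finally show ?thesis .
qed

lemma tens_eval_eqI:
  fixes V :: "('k :: field, 'b \<Rightarrow> 'k, 'm) space_scheme" and W :: "('k, 'w :: ab_group_add, 'n) space_scheme"
  assumes V: "kspace V" "scl V = psc" and W: "kspace W" and p: "p \<in> car (tens V W)" "q \<in> car (tens V W)"
    and ev: "\<And>y. ext (scl W) (\<lambda>\<beta> w. scl W (\<beta> y) w) p = ext (scl W) (\<lambda>\<beta> w. scl W (\<beta> y) w) q"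
  shows "p = q"
  using tens_eval_inj[OF V W, of "p - q"] kspace.diff_closed[OF kspace_tens[OF V(1) W] p] ev
  by (simp add: ext_diff[OF kspace.ambient[OF W]])

text \<open>The left factors of a separated form of \<open>\<beta>\<close> with independent right factors are
  combinations of the sections \<open>\<beta> (_, b)\<close>.\<close>

lemma separated_left_span:
  fixes \<beta> :: "'b \<Rightarrow> 'b \<Rightarrow> 'k :: field"
  assumes E: "finite E" "\<not> module.dependent psc E"
    and eq: "\<And>b. (\<lambda>a. \<beta> a b) = (\<Sum>e\<in>E. psc (e b) (g e))" and e: "e0 \<in> E"
  shows "g e0 \<in> module.span psc (range (\<lambda>b a. \<beta> a b))"
proof (rule ccontr)
  interpret vs: vector_space "psc :: 'k \<Rightarrow> ('b \<Rightarrow> 'k) \<Rightarrow> _" by (rule vector_space_psc)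
  interpret k: vector_space "(*) :: 'k \<Rightarrow> 'k \<Rightarrow> 'k" by unfold_locales (auto simp: algebra_simps)
  interpret vp: vector_space_pair "psc :: 'k \<Rightarrow> ('b \<Rightarrow> 'k) \<Rightarrow> _" "(*) :: 'k \<Rightarrow> 'k \<Rightarrow> 'k" ..
  let ?W = "range (\<lambda>b a. \<beta> a b)"
  assume not: "g e0 \<notin> vs.span ?W"
  obtain C where C: "C \<subseteq> ?W" "vs.independent C" "?W \<subseteq> vs.span C"
    using vs.maximal_independent_subset by blast
  have span: "vs.span C = vs.span ?W"
    using C by (metis vs.span_mono vs.span_span subset_antisym)
  have ind: "vs.independent (insert (g e0) C)"
    using not C(2) span by (auto simp: vs.independent_insert)
  \<comment> \<open>A functional that kills all sections but not \<open>g e0\<close>. Applied to the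
    separated form of the sections, it produces a nontrivial linear relation among the independent
    \<open>E\<close>.\<close>
  obtain \<theta> where th: "Vector_Spaces.linear psc (*) \<theta>" "\<forall>x\<in>insert (g e0) C. \<theta> x = (if x = g e0 then 1 else 0)"
    using vp.linear_independent_extend[OF ind, of "\<lambda>x. if x = g e0 then 1 else 0"] by blast
  interpret th: Vector_Spaces.linear psc "(*)" \<theta> by fact
  have "\<theta> x = 0" if "x \<in> C" for x using th(2) not span vs.span_base that by auto
  then have th0: "\<theta> x = 0" if "x \<in> vs.span ?W" for x
    using vp.linear_eq_0_on_span[OF th(1), of C] span that by blast
  have "(\<Sum>e\<in>E. \<theta> (g e) * e b) = 0" for b
  proof -
    have "0 = \<theta> (\<lambda>a. \<beta> a b)" by (rule th0[symmetric]) (rule vs.span_base, blast)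
    also have "\<dots> = (\<Sum>e\<in>E. e b * \<theta> (g e))" unfolding eq by (simp add: th.sum th.scale)
    finally show ?thesis by (simp add: mult.commute)
  qed
  then have "(\<Sum>e\<in>E. psc (\<theta> (g e)) e) = 0" by (auto simp: fun_eq_iff sum_fun_apply)
  then have "\<theta> (g e0) = 0"
    using vs.independentD[OF E(2,1) subset_refl _ e, of "\<lambda>e. \<theta> (g e)"] by simp
  then show False using th(2) by simp
qed

locale dual_setup = khopf_algebra B
  for B :: "('k :: field, 'b :: ab_group_add) hopf"
begin

text \<open>The full linear dual. By definition the finite dual asks only for a splitting with
  factors in \<open>Fs\<close>; \<open>dual_split\<close> later moves both factors into the finite
  dual.\<close>

abbreviation Fs :: "('k, 'b \<Rightarrow> 'k) space" where "Fs \<equiv> \<lparr>car = functionals B, scl = psc\<rparr>"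
abbreviation "Bd \<equiv> dual B"

lemma functionalsI:
  "(\<And>x. x \<notin> car B \<Longrightarrow> f x = 0) \<Longrightarrow> lin B ground f \<Longrightarrow> f \<in> functionals B"
  by (simp add: functionals_def)

lemma functionals_lin: "f \<in> functionals B \<Longrightarrow> lin B ground f"
  and functionals_off: "f \<in> functionals B \<Longrightarrow> x \<notin> car B \<Longrightarrow> f x = 0"
  by (simp_all add: functionals_def)

lemma functionals_restrict: "lin B ground f \<Longrightarrow> (\<lambda>y. if y \<in> car B then f y else 0) \<in> functionals B"
  by (rule functionalsI) (simp_all add: lin_def)

lemma functionals_eqI:
  assumes "f \<in> functionals B" "g \<in> functionals B" "\<And>y. y \<in> car B \<Longrightarrow> f y = g y"
  shows "f = g"
proof
  fix y show "f y = g y" using assms by (cases "y \<in> car B") (simp_all add: functionals_off)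
qed

lemma kspace_Fs: "kspace Fs"
proof (rule kspaceI)
  show "vector_space (scl Fs)" using vector_space_psc by simp
qed (auto simp: functionals_def lin_def algebra_simps)

lemma car_dual: "car Bd = {\<beta> \<in> functionals B.
    \<exists>p. Poly_Mapping.keys p \<subseteq> functionals B \<times> functionals B \<and> splits B \<beta> p}"
  and scl_dual [simp]: "scl Bd = psc"
  by (simp_all add: dual_def dual_space_def)

lemma dual_functional: "\<beta> \<in> car Bd \<Longrightarrow> \<beta> \<in> functionals B"
  by (simp add: car_dual)

lemma dualI: "\<beta> \<in> functionals B \<Longrightarrow> Poly_Mapping.keys p \<subseteq> functionals B \<times> functionals B \<Longrightarrow>
    splits B \<beta> p \<Longrightarrow> \<beta> \<in> car Bd"
  by (auto simp: car_dual)

lemma vector_space_mult: "vector_space ((*) :: 'k \<Rightarrow> 'k \<Rightarrow> 'k)"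
  using kspace.ambient[OF kspace_ground] by simp

lemma kspace_dual: "kspace Bd"
proof (rule kspaceI)
  show "vector_space (scl Bd)" using vector_space_psc by simp
  interpret F: kspace Fs by (rule kspace_Fs)
  show "0 \<in> car Bd"
    using F.zero_closed by (intro dualI[of _ 0]) (auto simp: splits_def)
  fix \<beta> \<gamma> c assume b: "\<beta> \<in> car Bd"
  then obtain p where p: "Poly_Mapping.keys p \<subseteq> functionals B \<times> functionals B" "splits B \<beta> p"
    by (auto simp: car_dual)
  show "scl Bd c \<beta> \<in> car Bd"
    using F.scl_closed[of \<beta> c] p dual_functional[OF b] order_trans[OF keys_fscl p(1)]
    by (intro dualI[of _ "fscl c p"]) (auto simp: splits_def ext_fscl[OF vector_space_mult])
  assume g: "\<gamma> \<in> car Bd"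
  then obtain q where q: "Poly_Mapping.keys q \<subseteq> functionals B \<times> functionals B" "splits B \<gamma> q"
    by (auto simp: car_dual)
  show "\<beta> + \<gamma> \<in> car Bd"
    using F.add_closed[of \<beta> \<gamma>] p q dual_functional[OF b] dual_functional[OF g]
      order_trans[OF Poly_Mapping.keys_add[of p q]]
    by (intro dualI[of _ "p + q"]) (auto simp: splits_def ext_add[OF vector_space_mult])
qed

text \<open>Translations of a functional. They are available before the coproduct of the dual is
  known to exist, whereas \<open>act_left\<close> and \<open>act_right\<close> are defined through
  that coproduct; the two forms are identified in \<open>act_left_eq\<close> and
  \<open>act_right_eq\<close>.\<close>

definition aL :: "'b \<Rightarrow> ('b \<Rightarrow> 'k) \<Rightarrow> 'b \<Rightarrow> 'k" where
  "aL b \<beta> = (\<lambda>y. if y \<in> car B then \<beta> (y \<cdot>\<^bsub>B\<^esub> b) else 0)"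

definition aR :: "('b \<Rightarrow> 'k) \<Rightarrow> 'b \<Rightarrow> 'b \<Rightarrow> 'k" where
  "aR \<beta> b = (\<lambda>y. if y \<in> car B then \<beta> (b \<cdot>\<^bsub>B\<^esub> y) else 0)"

lemma aL_functional: "\<beta> \<in> functionals B \<Longrightarrow> b \<in> car B \<Longrightarrow> aL b \<beta> \<in> functionals B"
  unfolding aL_def by (intro functionals_restrict lin_comp[OF functionals_lin] lin_mul_left lin_id)

lemma aR_functional: "\<beta> \<in> functionals B \<Longrightarrow> b \<in> car B \<Longrightarrow> aR \<beta> b \<in> functionals B"
  unfolding aR_def by (intro functionals_restrict lin_comp[OF functionals_lin] lin_mul_right lin_id)

text \<open>The pairing with \<open>a \<otimes> b\<close>. By \<open>dual_tens_eqI\<close> it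
  separates the elements of the tensor square of the dual.\<close>

definition ev2 :: "(('b \<Rightarrow> 'k) \<times> ('b \<Rightarrow> 'k) \<Rightarrow>\<^sub>0 'k) \<Rightarrow> 'b \<Rightarrow> 'b \<Rightarrow> 'k" where
  "ev2 p a b = ext (*) (\<lambda>\<phi> \<psi>. \<phi> a * \<psi> b) p"

lemma ev2_bil: "scl V = psc \<Longrightarrow> scl W = psc \<Longrightarrow> bil V W ground (\<lambda>\<phi> \<psi>. \<phi> a * \<psi> b)"
  by (intro bilI linI) (simp_all add: algebra_simps)

lemma ev2_class:
  assumes "kspace V" "kspace W" "scl V = psc" "scl W = psc" "Poly_Mapping.keys p \<subseteq> car V \<times> car W"
  shows "ev2 (ext fscl (ptens V W) p) a b = ev2 p a b"
  unfolding ev2_def ext_comp[OF vector_space_mult]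
  using assms by (intro ext_cong ext_ptens[OF _ _ kspace_ground ev2_bil]) auto

lemma ev2_ptens:
  assumes "kspace V" "kspace W" "scl V = psc" "scl W = psc" "\<phi> \<in> car V" "\<psi> \<in> car W"
  shows "ev2 (ptens V W \<phi> \<psi>) a b = \<phi> a * \<psi> b"
  unfolding ev2_def using assms by (intro ext_ptens[OF _ _ kspace_ground ev2_bil]) auto

lemma ev2_sum: "ev2 (sum p I) a b = (\<Sum>i\<in>I. ev2 (p i) a b)"
  unfolding ev2_def by (rule ext_setsum[OF vector_space_mult])

text \<open>With independent right factors, each left factor is a combination of sections of the
  bilinear form \<open>ev2 p\<close>. If the sections lie in a subspace \<open>V\<close>, so do the
  left factors.\<close>

lemma separate_left:
  assumes p: "Poly_Mapping.keys p \<subseteq> functionals B \<times> car W" and W: "kspace W" "scl W = psc"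
    "car W \<subseteq> functionals B" and V: "kspace V" "scl V = psc" "car V \<subseteq> functionals B"
    and sec: "\<And>b. b \<in> car B \<Longrightarrow> (\<lambda>a. if a \<in> car B then ev2 p a b else 0) \<in> car V"
  obtains q where "q \<in> car (tens V W)" "\<And>a b. a \<in> car B \<Longrightarrow> b \<in> car B \<Longrightarrow> ev2 q a b = ev2 p a b"
proof -
  interpret V: kspace V by fact
  interpret W: kspace W by fact
  let ?p = "ext fscl (ptens Fs W) p"
  have p': "?p \<in> car (tens Fs W)" using p by (intro ptens_class kspace_Fs W) simp
  obtain E g where E: "finite E" "E \<subseteq> car W" "W.vs.independent E" "\<And>e. e \<in> E \<Longrightarrow> g e \<in> functionals B"
    "?p = (\<Sum>e\<in>E. ptens Fs W (g e) e)"
    using tens_indep_repr[OF kspace_Fs W(1) p'] by auto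
  have ev: "ev2 p a b = (\<Sum>e\<in>E. g e a * e b)" for a b
  proof -
    have "ev2 p a b = ev2 ?p a b"
      using ev2_class[OF kspace_Fs W(1) _ W(2), of p a b] p by simp
    also have "\<dots> = (\<Sum>e\<in>E. ev2 (ptens Fs W (g e) e) a b)"
      by (simp only: E(5) ev2_sum)
    also have "\<dots> = (\<Sum>e\<in>E. g e a * e b)"
      using E(2,4) by (intro sum.cong ev2_ptens[OF kspace_Fs W(1) _ W(2)]) auto
    finally show ?thesis .
  qed
  \<comment> \<open>Extended by zero, so that the section at a point outside \<open>car B\<close> is
    0 and also lies in \<open>V\<close>.\<close>
  define \<beta> where "\<beta> a b = (if a \<in> car B \<and> b \<in> car B then ev2 p a b else 0)" for a b
  have eq: "(\<lambda>a. \<beta> a b) = (\<Sum>e\<in>E. psc (e b) (g e))" for b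
  proof
    fix a show "\<beta> a b = (\<Sum>e\<in>E. psc (e b) (g e)) a"
    proof (cases "a \<in> car B \<and> b \<in> car B")
      case False
      have 0: "e b * g e a = 0" if "e \<in> E" for e
      proof -
        have "e \<in> functionals B" using that E(2) W(3) by blast
        then show ?thesis using False functionals_off E(4)[OF that] by auto
      qed
      have "\<beta> a b = 0" using False by (auto simp: \<beta>_def)
      moreover have "(\<Sum>e\<in>E. psc (e b) (g e)) a = 0"
        unfolding sum_fun_apply by (intro sum.neutral ballI 0)
      ultimately show ?thesis by simp
    qed (simp add: \<beta>_def ev sum_fun_apply mult.commute)
  qed
  have "range (\<lambda>b a. \<beta> a b) \<subseteq> car V"
  proof clarify
    fix b show "(\<lambda>a. \<beta> a b) \<in> car V"
    proof (cases "b \<in> car B")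
      case True
      have "(\<lambda>a. \<beta> a b) = (\<lambda>a. if a \<in> car B then ev2 p a b else 0)"
        using True by (auto simp: \<beta>_def)
      then show ?thesis using sec[OF True] by simp
    next
      case False
      then have "(\<lambda>a. \<beta> a b) = 0" by (auto simp: \<beta>_def)
      then show ?thesis by simp
    qed
  qed
  then have "module.span psc (range (\<lambda>b a. \<beta> a b)) \<subseteq> car V"
    using V.vs.span_minimal V.subspace V(2) by metis
  then have gV: "g e \<in> car V" if "e \<in> E" for e
    using separated_left_span[OF E(1) _ eq that] E(3) W(2) by auto
  show ?thesis
  proof (rule that)
    show "(\<Sum>e\<in>E. ptens V W (g e) e) \<in> car (tens V W)"
      using gV E(2) by (intro kspace.sum_closed[OF kspace_tens[OF V(1) W(1)]] ptens_closed V W) auto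
    fix a b
    show "ev2 (\<Sum>e\<in>E. ptens V W (g e) e) a b = ev2 p a b"
      unfolding ev ev2_sum using gV E(2) V W by (intro sum.cong ev2_ptens) auto
  qed
qed

end

section \<open>Existence and uniqueness of the coproduct on the finite dual\<close>

context dual_setup
begin

lemma kspace_keys: "kspace \<lparr>car = {p :: 'x \<Rightarrow>\<^sub>0 'k. Poly_Mapping.keys p \<subseteq> K}, scl = fscl\<rparr>"
  using subspace_keys[of K] vector_space_fscl by (simp add: kspace_def)

lemma keys_ext:
  assumes "\<And>x y. (x, y) \<in> Poly_Mapping.keys p \<Longrightarrow> Poly_Mapping.keys (f x y) \<subseteq> K"
  shows "Poly_Mapping.keys (ext fscl f p :: 'x \<Rightarrow>\<^sub>0 'k) \<subseteq> K"
  using ext_closed[OF kspace_keys, of p f K] assms by simp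

lemma ev2_ext: "ev2 (ext fscl f p) a b = ext (*) (\<lambda>x y. ev2 (f x y) a b) p"
  unfolding ev2_def by (rule ext_comp[OF vector_space_mult])

lemma ev2_pair [simp]: "ev2 (pair \<phi> \<psi>) a b = \<phi> a * \<psi> b"
  unfolding ev2_def by (rule ext_pair_sc[OF vector_space_mult])

lemma ext_mult_right: "ext (*) f p * c = ext (*) (\<lambda>x y. f x y * c) p"
  by (simp add: ext_def sum_distrib_right mult.assoc)

text \<open>Translating the argument on the right by \<open>b\<close> translates only the second
  factor of a splitting; for \<open>aR_dual\<close> it is the first factor.\<close>

lemma aL_dual:
  assumes "\<beta> \<in> car Bd" "b \<in> car B"
  shows "aL b \<beta> \<in> car Bd"
proof -
  from assms obtain p where p: "Poly_Mapping.keys p \<subseteq> functionals B \<times> functionals B" "splits B \<beta> p"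
    by (auto simp: car_dual)
  let ?p = "ext fscl (\<lambda>\<phi> \<psi>. pair \<phi> (aL b \<psi>)) p"
  have "Poly_Mapping.keys ?p \<subseteq> functionals B \<times> functionals B"
    using p(1) assms(2) by (intro keys_ext) (auto intro: aL_functional)
  moreover have "splits B (aL b \<beta>) ?p"
    using p(2) assms(2) unfolding splits_def ev2_def[symmetric] ev2_ext
    by (auto simp: aL_def assoc ev2_def ext_pair)
  ultimately show ?thesis
    by (rule dualI[OF aL_functional[OF dual_functional[OF assms(1)] assms(2)]])
qed

lemma aR_dual:
  assumes "\<beta> \<in> car Bd" "b \<in> car B"
  shows "aR \<beta> b \<in> car Bd"
proof -
  from assms obtain p where p: "Poly_Mapping.keys p \<subseteq> functionals B \<times> functionals B" "splits B \<beta> p"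
    by (auto simp: car_dual)
  let ?p = "ext fscl (\<lambda>\<phi> \<psi>. pair (aR \<phi> b) \<psi>) p"
  have "Poly_Mapping.keys ?p \<subseteq> functionals B \<times> functionals B"
    using p(1) assms(2) by (intro keys_ext) (auto intro: aR_functional)
  moreover have "splits B (aR \<beta> b) ?p"
    using p(2) assms(2) unfolding splits_def ev2_def[symmetric] ev2_ext
    by (auto simp: aR_def assoc[symmetric] ev2_def ext_pair)
  ultimately show ?thesis
    by (rule dualI[OF aR_functional[OF dual_functional[OF assms(1)] assms(2)]])
qed

lemma dual_sub: "car Bd \<subseteq> functionals B"
  by (auto simp: car_dual)

text \<open>Two passes of \<open>separate_left\<close>. The sections of the pairing in the first
  variable are the functionals \<open>aL b \<beta>\<close>, those in the second variable the
  functionals \<open>aR \<beta> b\<close>, and both kinds belong to the finite dual.\<close>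

lemma dual_split:
  assumes "\<beta> \<in> car Bd"
  obtains q where "q \<in> car (tens Bd Bd)" "\<And>a b. a \<in> car B \<Longrightarrow> b \<in> car B \<Longrightarrow> ev2 q a b = \<beta> (a \<cdot>\<^bsub>B\<^esub> b)"
proof -
  from assms obtain p where p: "Poly_Mapping.keys p \<subseteq> functionals B \<times> functionals B" "splits B \<beta> p"
    by (auto simp: car_dual)
  have ev: "ev2 p a b = \<beta> (a \<cdot>\<^bsub>B\<^esub> b)" if "a \<in> car B" "b \<in> car B" for a b
    using p(2) that by (simp add: splits_def ev2_def)
  have flip: "ev2 (ext fscl (\<lambda>\<phi> \<psi>. pair \<psi> \<phi>) r) a b = ev2 r b a" for r a b
    by (simp add: ev2_ext) (simp add: ev2_def mult.commute)
  have sec: "(\<lambda>a. if a \<in> car B then ev2 p a b else 0) = aL b \<beta>" if "b \<in> car B" for b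
    using that by (auto simp: aL_def ev)
  obtain q where q: "q \<in> car (tens Bd Fs)" "\<And>a b. a \<in> car B \<Longrightarrow> b \<in> car B \<Longrightarrow> ev2 q a b = ev2 p a b"
    by (rule separate_left[OF _ kspace_Fs _ _ kspace_dual, of p])
       (use p(1) dual_sub aL_dual[OF assms] in \<open>auto simp: sec\<close>)
  \<comment> \<open>\<open>separate_left\<close> improves left factors only, so the factors are
    exchanged before the second pass and exchanged back in \<open>?r\<close>.\<close>
  let ?q = "ext fscl (\<lambda>\<phi> \<psi>. pair \<psi> \<phi>) q"
  have kq: "Poly_Mapping.keys ?q \<subseteq> functionals B \<times> car Bd"
    using tens_keys[OF kspace_dual kspace_Fs q(1)] by (intro keys_ext) auto
  have sec': "(\<lambda>a. if a \<in> car B then ev2 ?q a b else 0) = aR \<beta> b" if "b \<in> car B" for b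
    using that by (auto simp: aR_def q flip ev)
  obtain r where r: "r \<in> car (tens Bd Bd)" "\<And>a b. a \<in> car B \<Longrightarrow> b \<in> car B \<Longrightarrow> ev2 r a b = ev2 ?q a b"
    by (rule separate_left[OF kq kspace_dual _ _ kspace_dual])
       (use dual_sub aR_dual[OF assms] in \<open>auto simp: sec'\<close>)
  let ?r = "ext fscl (\<lambda>\<phi> \<psi>. pair \<psi> \<phi>) r"
  have kr: "Poly_Mapping.keys ?r \<subseteq> car Bd \<times> car Bd"
    using tens_keys[OF kspace_dual kspace_dual r(1)] by (intro keys_ext) auto
  show ?thesis
    by (rule that[OF ptens_class[OF kspace_dual kspace_dual kr]])
       (simp add: ev2_class[OF kspace_dual kspace_dual _ _ kr] flip r q ev)
qed

lemma dual_off: "\<beta> \<in> car Bd \<Longrightarrow> y \<notin> car B \<Longrightarrow> \<beta> y = 0"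
  using functionals_off[OF dual_functional] .

lemma ext_eq_0: "(\<And>x y. (x, y) \<in> Poly_Mapping.keys p \<Longrightarrow> f x y = 0) \<Longrightarrow> ext (*) f p = (0 :: 'k)"
  unfolding ext_def by (rule sum.neutral) auto

lemma ev2_off:
  assumes "p \<in> car (tens Bd Bd)" "a \<notin> car B \<or> b \<notin> car B"
  shows "ev2 p a b = 0"
proof -
  have "\<phi> a = 0 \<or> \<psi> b = 0" if "(\<phi>, \<psi>) \<in> Poly_Mapping.keys p" for \<phi> \<psi>
    using tens_keys[OF kspace_dual kspace_dual assms(1) that] assms(2) dual_off by metis
  then show ?thesis unfolding ev2_def by (intro ext_eq_0) auto
qed

text \<open>Gives the uniqueness behind the \<open>THE\<close> in the coproduct of
  \<open>dual\<close>, and lets identities in the tensor square of the dual be proved by pairing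
  with elements of \<open>B\<close>.\<close>

lemma dual_tens_eqI:
  assumes p: "p \<in> car (tens Bd Bd)" and q: "q \<in> car (tens Bd Bd)"
    and eq: "\<And>a b. a \<in> car B \<Longrightarrow> b \<in> car B \<Longrightarrow> ev2 p a b = ev2 q a b"
  shows "p = q"
proof (rule tens_eval_eqI[OF kspace_dual scl_dual kspace_dual p q])
  fix y
  have "ev2 p y b = ev2 q y b" for b
    using eq ev2_off[OF p] ev2_off[OF q] by (cases "y \<in> car B \<and> b \<in> car B") auto
  then show "ext (scl Bd) (\<lambda>\<beta> w. scl Bd (\<beta> y) w) p = ext (scl Bd) (\<lambda>\<beta> w. scl Bd (\<beta> y) w) q"
    by (auto simp: ext_apply ev2_def)
qed

text \<open>The record \<open>dual B\<close> states its coproduct with \<open>dual_space B\<close>,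
  since it cannot refer to itself. Tensor products see only carrier and scalars, on which the two
  agree.\<close>

lemma over_k_dual: "over_k (dual_space B) = over_k Bd"
  by (simp add: over_k_def dual_def)

lemma cop_dual_ex1: "\<beta> \<in> car Bd \<Longrightarrow> \<exists>!p. p \<in> car (tens Bd Bd) \<and> splits B \<beta> p"
proof -
  assume b: "\<beta> \<in> car Bd"
  have splits: "splits B \<beta> p \<longleftrightarrow> (\<forall>a\<in>car B. \<forall>b\<in>car B. ev2 p a b = \<beta> (a \<cdot>\<^bsub>B\<^esub> b))" for p
    by (simp add: splits_def ev2_def)
  obtain q where "q \<in> car (tens Bd Bd)" "splits B \<beta> q"
    by (rule dual_split[OF b], rule that) (auto simp: splits)
  then show ?thesis
    by (intro ex1I[of _ q] dual_tens_eqI) (auto simp: splits)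
qed

lemma cop_dual_closed: "\<beta> \<in> car Bd \<Longrightarrow> cop Bd \<beta> \<in> car (tens Bd Bd)"
  and cop_dual_splits: "\<beta> \<in> car Bd \<Longrightarrow> splits B \<beta> (cop Bd \<beta>)"
proof -
  have "cop Bd \<beta> = (THE p. p \<in> car (tens Bd Bd) \<and> splits B \<beta> p)"
    unfolding tens_def[of Bd] over_k_dual[symmetric] by (simp add: dual_def tens_def)
  then show "\<beta> \<in> car Bd \<Longrightarrow> cop Bd \<beta> \<in> car (tens Bd Bd)" "\<beta> \<in> car Bd \<Longrightarrow> splits B \<beta> (cop Bd \<beta>)"
    using theI'[OF cop_dual_ex1, of \<beta>] by simp_all
qed

lemma cop_dual [simp]: "\<beta> \<in> car Bd \<Longrightarrow> a \<in> car B \<Longrightarrow> b \<in> car B \<Longrightarrow> ev2 (cop Bd \<beta>) a b = \<beta> (a \<cdot>\<^bsub>B\<^esub> b)"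
  using cop_dual_splits by (simp add: splits_def ev2_def)

lemma cop_dual_eqI:
  assumes "\<beta> \<in> car Bd" "p \<in> car (tens Bd Bd)"
    "\<And>a b. a \<in> car B \<Longrightarrow> b \<in> car B \<Longrightarrow> ev2 p a b = \<beta> (a \<cdot>\<^bsub>B\<^esub> b)"
  shows "cop Bd \<beta> = p"
  using assms by (intro dual_tens_eqI cop_dual_closed) simp_all

sublocale d: kcoprod Bd
proof (intro kcoprod.intro kspace_dual kcoprod_axioms.intro)
  interpret D: kspace Bd by (rule kspace_dual)
  interpret DD: kspace "tens Bd Bd" by (rule kspace_tens[OF kspace_dual kspace_dual])
  note v = vector_space_mult
  show "lin Bd (tens Bd Bd) (cop Bd)"
  proof (rule linI)
    show "cop Bd (x + y) = cop Bd x + cop Bd y" if "x \<in> car Bd" "y \<in> car Bd" for x y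
    proof (rule cop_dual_eqI)
      fix a b assume ab: "a \<in> car B" "b \<in> car B"
      have "ev2 (cop Bd x + cop Bd y) a b = ev2 (cop Bd x) a b + ev2 (cop Bd y) a b"
        unfolding ev2_def by (rule ext_add[OF v])
      then show "ev2 (cop Bd x + cop Bd y) a b = (x + y) (a \<cdot>\<^bsub>B\<^esub> b)" using that ab by simp
    qed (use that in \<open>simp_all add: cop_dual_closed\<close>)
    show "cop Bd (scl Bd c x) = scl (tens Bd Bd) c (cop Bd x)" if "x \<in> car Bd" for x c
    proof (rule cop_dual_eqI)
      fix a b assume ab: "a \<in> car B" "b \<in> car B"
      have "ev2 (fscl c (cop Bd x)) a b = c * ev2 (cop Bd x) a b"
        unfolding ev2_def by (rule ext_fscl[OF v])
      then show "ev2 (scl (tens Bd Bd) c (cop Bd x)) a b = scl Bd c x (a \<cdot>\<^bsub>B\<^esub> b)" using that ab by simp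
    qed (use that D.scl_closed DD.scl_closed cop_dual_closed in simp_all)
  qed (simp add: cop_dual_closed)
qed

lemma sw_ev: "\<beta> \<in> car Bd \<Longrightarrow> a \<in> car B \<Longrightarrow> b \<in> car B \<Longrightarrow> sw Bd (*) \<beta> (\<lambda>\<phi> \<psi>. \<phi> a * \<psi> b) = \<beta> (a \<cdot>\<^bsub>B\<^esub> b)"
  using cop_dual by (simp add: sw_def sw2_def ev2_def)

lemma sw_ev': "\<beta> \<in> car Bd \<Longrightarrow> a \<in> car B \<Longrightarrow> b \<in> car B \<Longrightarrow> sw Bd (*) \<beta> (\<lambda>\<phi> \<psi>. \<psi> b * \<phi> a) = \<beta> (a \<cdot>\<^bsub>B\<^esub> b)"
  using sw_ev by (simp add: mult.commute)

lemma act_left_eq: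
  assumes "\<beta> \<in> car Bd" "b \<in> car B"
  shows "act_left B b \<beta> = aL b \<beta>"
proof
  fix y
  have eq: "act_left B b \<beta> y = sw Bd (*) \<beta> (\<lambda>\<phi> \<psi>. \<psi> b * \<phi> y)"
    unfolding act_left_def sw2_eq_sw scl_dual sw_apply ..
  show "act_left B b \<beta> y = aL b \<beta> y"
  proof (cases "y \<in> car B")
    case True
    then show ?thesis using sw_ev'[OF assms(1)] assms(2) by (simp add: eq aL_def)
  next
    case False
    have "sw Bd (*) \<beta> (\<lambda>\<phi> \<psi>. \<psi> b * \<phi> y) = 0"
      unfolding sw_def sw2_def
    proof (rule ext_eq_0)
      fix \<phi> \<psi> assume "(\<phi>, \<psi>) \<in> Poly_Mapping.keys (cop Bd \<beta>)"
      then have "\<phi> y = 0" using d.cop_keys[OF assms(1)] False by (intro dual_off) auto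
      then show "\<psi> b * \<phi> y = 0" by simp
    qed
    then show ?thesis using False by (simp add: eq aL_def)
  qed
qed

lemma act_right_eq:
  assumes "\<beta> \<in> car Bd" "b \<in> car B"
  shows "act_right B \<beta> b = aR \<beta> b"
proof
  fix y
  have eq: "act_right B \<beta> b y = sw Bd (*) \<beta> (\<lambda>\<phi> \<psi>. \<phi> b * \<psi> y)"
    unfolding act_right_def sw2_eq_sw scl_dual sw_apply ..
  show "act_right B \<beta> b y = aR \<beta> b y"
  proof (cases "y \<in> car B")
    case True
    then show ?thesis using sw_ev[OF assms(1)] assms(2) by (simp add: eq aR_def)
  next
    case False
    have "sw Bd (*) \<beta> (\<lambda>\<phi> \<psi>. \<phi> b * \<psi> y) = 0"
      unfolding sw_def sw2_def
    proof (rule ext_eq_0)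
      fix \<phi> \<psi> assume "(\<phi>, \<psi>) \<in> Poly_Mapping.keys (cop Bd \<beta>)"
      then have "\<psi> y = 0" using d.cop_keys[OF assms(1)] False by (intro dual_off) auto
      then show "\<phi> b * \<psi> y = 0" by simp
    qed
    then show ?thesis using False by (simp add: eq aR_def)
  qed
qed

lemma dual_mul: "(\<alpha> \<cdot>\<^bsub>Bd\<^esub> \<beta>) b = (if b \<in> car B then sw B (*) b (\<lambda>x y. \<alpha> x * \<beta> y) else 0)"
  and dual_unt: "unt Bd b = (if b \<in> car B then cou B b else 0)"
  and dual_cou [simp]: "cou Bd \<beta> = \<beta> (unt B)"
  and dual_ant: "ant Bd \<beta> b = (if b \<in> car B then \<beta> (ant B b) else 0)"
  by (simp_all add: dual_def sw2_eq_sw)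

end

lemma sw_mult_right: "sw H (*) h f * (c :: 'k :: field) = sw H (*) h (\<lambda>x y. f x y * c)"
  and sw_mult_left: "c * sw H (*) h f = sw H (*) h (\<lambda>x y. c * f x y)"
  by (simp_all add: sw_def sw2_def ext_def sum_distrib_left sum_distrib_right ac_simps)

lemma fscl_0 [simp]: "fscl 0 p = 0" "fscl c 0 = 0"
  by (rule poly_mapping_eqI, simp add: lookup_fscl)+

section \<open>The algebra and the coalgebra structure of the dual\<close>

context dual_setup
begin

lemma lin_at: "lin Bd ground (\<lambda>\<alpha>. \<alpha> y)"
  by (simp add: lin_def)

lemma dual_lin: "\<alpha> \<in> car Bd \<Longrightarrow> lin B ground \<alpha>"
  using functionals_lin[OF dual_functional] .

lemma dual_lin_comp: "\<alpha> \<in> car Bd \<Longrightarrow> lin V B f \<Longrightarrow> lin V ground (\<lambda>x. \<alpha> (f x))"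
  using lin_comp[OF dual_lin] .

lemma lin_pointwise:
  assumes "\<And>v. v \<in> car V \<Longrightarrow> F v \<in> car Bd" "\<And>b. b \<in> car B \<Longrightarrow> lin V ground (\<lambda>v. F v b)" "kspace V"
  shows "lin V Bd F"
proof (rule linI)
  interpret V: kspace V by fact
  fix x y c assume x: "x \<in> car V"
  show "F (scl V c x) = scl Bd c (F x)"
    by (rule functionals_eqI)
       (use x assms(1) d.scl_closed lin_scl[OF assms(2)] in \<open>auto intro!: dual_functional simp del: scl_dual, simp\<close>)
  assume y: "y \<in> car V"
  show "F (x + y) = F x + F y"
    by (rule functionals_eqI)
       (use x y assms(1) d.add_closed lin_add[OF assms(2)] in \<open>auto intro!: dual_functional\<close>)
qed (rule assms)

lemmas B_axs = kspace_axioms kalgebra_axioms kcoprod_axioms cou_lin kspace_dual d.kcoprod_axioms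
  kspace_ground lin_S dual_lin dual_lin_comp

lemma mul_functional:
  assumes "\<alpha> \<in> functionals B" "\<beta> \<in> functionals B"
  shows "\<alpha> \<cdot>\<^bsub>Bd\<^esub> \<beta> \<in> functionals B"
proof -
  have "lin B ground (\<lambda>b. sw B (*) b (\<lambda>x y. \<alpha> x * \<beta> y))"
    by (rule sw_lin_arg) (simp_all add: lin_id)
  then show ?thesis
    unfolding dual_mul[abs_def] by (rule functionals_restrict)
qed

text \<open>Multiplicativity of the coproduct of \<open>B\<close>, transposed: \<open>sw_mul\<close>
  splits the product of \<open>a\<close> and \<open>b\<close>, \<open>sw_ev\<close> splits the two
  functionals, and the sums over \<open>B\<close> and over the dual are exchanged.\<close>

lemma mul_splits:
  assumes "\<alpha> \<in> car Bd" "\<beta> \<in> car Bd" "a \<in> car B" "b \<in> car B"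
  shows "sw Bd (*) \<alpha> (\<lambda>\<alpha>1 \<alpha>2. sw Bd (*) \<beta> (\<lambda>\<beta>1 \<beta>2. (\<alpha>1 \<cdot>\<^bsub>Bd\<^esub> \<beta>1) a * (\<alpha>2 \<cdot>\<^bsub>Bd\<^esub> \<beta>2) b)) =
    (\<alpha> \<cdot>\<^bsub>Bd\<^esub> \<beta>) (a \<cdot>\<^bsub>B\<^esub> b)" (is "?L = _")
proof -
  have "(\<alpha> \<cdot>\<^bsub>Bd\<^esub> \<beta>) (a \<cdot>\<^bsub>B\<^esub> b) =
    sw B (*) a (\<lambda>a1 a2. sw B (*) b (\<lambda>b1 b2. \<alpha> (a1 \<cdot>\<^bsub>B\<^esub> b1) * \<beta> (a2 \<cdot>\<^bsub>B\<^esub> b2)))"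
    using assms by (simp add: dual_mul sw_mul[of ground] bilI lins B_axs)
  also have "\<dots> = sw B (*) a (\<lambda>a1 a2. sw B (*) b (\<lambda>b1 b2.
      sw Bd (*) \<alpha> (\<lambda>\<alpha>1 \<alpha>2. \<alpha>1 a1 * \<alpha>2 b1) * sw Bd (*) \<beta> (\<lambda>\<beta>1 \<beta>2. \<beta>1 a2 * \<beta>2 b2)))"
    using assms by (simp add: sw_ev cong: sw_cong)
  also have "\<dots> = sw B (*) a (\<lambda>a1 a2. sw B (*) b (\<lambda>b1 b2.
      sw Bd (*) \<alpha> (\<lambda>\<alpha>1 \<alpha>2. sw Bd (*) \<beta> (\<lambda>\<beta>1 \<beta>2. (\<alpha>1 a1 * \<beta>1 a2) * (\<alpha>2 b1 * \<beta>2 b2)))))"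
    by (simp only: sw_mult_right, simp only: sw_mult_left) (simp add: mult_ac)
  also have "\<dots> = ?L"
    using assms by (simp add: dual_mul sw_mult_right)
      (simp add: sw_mult_left sw_swap[OF vector_space_mult, where H=Bd and G=B])
  finally show ?thesis ..
qed

text \<open>The product of two splittings splits the product. Its factors are only required to be
  functionals, which avoids a circular appeal to closure under products.\<close>

lemma mul_dual_closed:
  assumes "\<alpha> \<in> car Bd" "\<beta> \<in> car Bd"
  shows "\<alpha> \<cdot>\<^bsub>Bd\<^esub> \<beta> \<in> car Bd"
proof (rule dualI)
  show "\<alpha> \<cdot>\<^bsub>Bd\<^esub> \<beta> \<in> functionals B" using assms by (intro mul_functional dual_functional)
  let ?p = "sw Bd fscl \<alpha> (\<lambda>\<alpha>1 \<alpha>2. sw Bd fscl \<beta> (\<lambda>\<beta>1 \<beta>2. pair (\<alpha>1 \<cdot>\<^bsub>Bd\<^esub> \<beta>1) (\<alpha>2 \<cdot>\<^bsub>Bd\<^esub> \<beta>2)))"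
  show "Poly_Mapping.keys ?p \<subseteq> functionals B \<times> functionals B"
    unfolding sw_def sw2_def using d.cop_keys[OF assms(1)] d.cop_keys[OF assms(2)]
    by (intro keys_ext) (simp add: mul_functional dual_functional)
  have "ev2 ?p a b = sw Bd (*) \<alpha> (\<lambda>\<alpha>1 \<alpha>2. sw Bd (*) \<beta> (\<lambda>\<beta>1 \<beta>2. (\<alpha>1 \<cdot>\<^bsub>Bd\<^esub> \<beta>1) a * (\<alpha>2 \<cdot>\<^bsub>Bd\<^esub> \<beta>2) b))" for a b
    by (simp add: sw_def sw2_def ev2_ext)
  then show "splits B (\<alpha> \<cdot>\<^bsub>Bd\<^esub> \<beta>) ?p"
    using assms by (simp add: splits_def mul_splits flip: ev2_def)
qed

lemma unt_dual_closed: "unt Bd \<in> car Bd"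
proof (rule dualI)
  show *: "unt Bd \<in> functionals B"
    unfolding dual_unt[abs_def] by (rule functionals_restrict[OF cou_lin])
  show "Poly_Mapping.keys (pair (unt Bd) (unt Bd) :: _ \<Rightarrow>\<^sub>0 'k) \<subseteq> functionals B \<times> functionals B"
    using * by simp
  show "splits B (unt Bd) (pair (unt Bd) (unt Bd))"
    by (simp add: splits_def dual_unt ext_pair)
qed

lemma mul_dual_apply: "b \<in> car B \<Longrightarrow> (\<alpha> \<cdot>\<^bsub>Bd\<^esub> \<beta>) b = sw B (*) b (\<lambda>x y. \<alpha> x * \<beta> y)"
  by (simp add: dual_mul)

lemma unt_dual_apply [simp]: "b \<in> car B \<Longrightarrow> unt Bd b = cou B b"
  by (simp add: dual_unt)

lemma dual_eqI:
  "\<alpha> \<in> car Bd \<Longrightarrow> \<beta> \<in> car Bd \<Longrightarrow> (\<And>y. y \<in> car B \<Longrightarrow> \<alpha> y = \<beta> y) \<Longrightarrow> \<alpha> = \<beta>"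
  by (intro functionals_eqI dual_functional)

text \<open>Evaluated at a point, associativity and the unit laws become coassociativity and the
  counit laws of \<open>B\<close>.\<close>

lemma kalgebra_dual: "kalgebra Bd"
proof (intro kalgebra.intro kspace_dual kalgebra_axioms.intro)
  note [simp] = mul_dual_closed unt_dual_closed mul_dual_apply lins B_axs lin_at
  show "lin Bd Bd (\<lambda>\<alpha>. \<alpha> \<cdot>\<^bsub>Bd\<^esub> \<beta>)" if "\<beta> \<in> car Bd" for \<beta>
    using that by (intro lin_pointwise kspace_dual) simp_all
  show "lin Bd Bd (\<lambda>\<beta>. \<alpha> \<cdot>\<^bsub>Bd\<^esub> \<beta>)" if "\<alpha> \<in> car Bd" for \<alpha>
    using that by (intro lin_pointwise kspace_dual) simp_all
  show "(\<alpha> \<cdot>\<^bsub>Bd\<^esub> \<beta>) \<cdot>\<^bsub>Bd\<^esub> \<gamma> = \<alpha> \<cdot>\<^bsub>Bd\<^esub> (\<beta> \<cdot>\<^bsub>Bd\<^esub> \<gamma>)"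
    if "\<alpha> \<in> car Bd" "\<beta> \<in> car Bd" "\<gamma> \<in> car Bd" for \<alpha> \<beta> \<gamma>
    using that by (intro dual_eqI) (simp_all add: sw_mult_right sw_mult_left sw_coassoc[of ground] mult.assoc cong: sw_cong)
  show "unt Bd \<cdot>\<^bsub>Bd\<^esub> \<alpha> = \<alpha>" if "\<alpha> \<in> car Bd" for \<alpha>
    using that by (intro dual_eqI) (simp_all add: sw_counit_left[of ground _ "(*)"] cong: sw_cong)
  show "\<alpha> \<cdot>\<^bsub>Bd\<^esub> unt Bd = \<alpha>" if "\<alpha> \<in> car Bd" for \<alpha>
    using that sw_counit_right[of ground \<alpha> "(*)"]
    by (intro dual_eqI) (simp_all add: mult.commute cong: sw_cong)
qed (rule unt_dual_closed)

lemma ev2_sw: "ev2 (sw H fscl h f) a b = sw H (*) h (\<lambda>x y. ev2 (f x y) a b)"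
  by (simp add: sw_def sw2_def ev2_ext)

lemma ev2_dual_ptens [simp]: "\<phi> \<in> car Bd \<Longrightarrow> \<psi> \<in> car Bd \<Longrightarrow> ev2 (ptens Bd Bd \<phi> \<psi>) a b = \<phi> a * \<psi> b"
  by (rule ev2_ptens[OF kspace_dual kspace_dual scl_dual scl_dual])

lemma ev2_fscl [simp]: "ev2 (fscl c p) a b = c * ev2 p a b"
  unfolding ev2_def by (rule ext_fscl[OF vector_space_mult])

text \<open>Coassociativity is tested by evaluating the first tensor factor at \<open>y\<close> and
  pairing the remaining two with \<open>a \<otimes> b\<close>; both sides become the value of
  \<open>h\<close> on the triple product.\<close>

lemma kcoalgebra_dual: "kcoalgebra Bd"
proof (intro kcoalgebra.intro d.kcoprod_axioms kcoalgebra_axioms.intro)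
  let ?TT = "tens Bd Bd"
  note TT = kspace_tens[OF kspace_dual kspace_dual]
  note TTT = kspace_tens[OF kspace_dual TT]
  note [simp] = lins clo B_axs lin_at TT TTT d.cop_closed
  show "lin Bd ground (cou Bd)"
    by (simp add: lin_def)
  show "sw Bd (scl Bd) h (\<lambda>x y. scl Bd (cou Bd x) y) = h" if "h \<in> car Bd" for h
    using that by (intro dual_eqI d.sw_closed)
      (simp_all add: sw_apply sw_ev kspace.scl_closed[OF kspace_dual, simplified])
  show "sw Bd (scl Bd) h (\<lambda>x y. scl Bd (cou Bd y) x) = h" if "h \<in> car Bd" for h
    using that by (intro dual_eqI d.sw_closed)
      (simp_all add: sw_apply sw_ev' kspace.scl_closed[OF kspace_dual, simplified])
  show "sw Bd fscl h (\<lambda>x z. sw Bd fscl x (\<lambda>x' x''. ptens Bd ?TT x' (ptens Bd Bd x'' z))) =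
      sw Bd fscl h (\<lambda>x y. ptens Bd ?TT x (cop Bd y))" (is "?L = ?R") if h: "h \<in> car Bd" for h
  proof (rule tens_eval_eqI[OF kspace_dual scl_dual TT])
    show L: "?L \<in> car (tens Bd ?TT)" and R: "?R \<in> car (tens Bd ?TT)" using h by simp_all
    fix y :: 'b
    let ?e = "ext fscl (\<lambda>\<phi> q. fscl (\<phi> y) q)"
    have b: "bil Bd ?TT ?TT (\<lambda>\<phi> q. fscl (\<phi> y) q)"
      by (intro bilI) simp_all
    have e: "?e (ptens Bd ?TT \<phi> q) = fscl (\<phi> y) q" if "\<phi> \<in> car Bd" "q \<in> car ?TT" for \<phi> q
      using ext_ptens[OF kspace_dual TT TT b that] by simp
    have el: "lin (tens Bd ?TT) ?TT ?e"
      by (rule lin_tens_ext[OF kspace_dual TT TT]) simp_all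
    note out = d.sw_out[OF el TTT, where sc=fscl and sc'=fscl]
    have L': "?e ?L = sw Bd fscl h (\<lambda>x z. sw Bd fscl x (\<lambda>x' x''. fscl (x' y) (ptens Bd Bd x'' z)))"
      using h by (simp add: out e cong: d.sw_cong)
    have R': "?e ?R = sw Bd fscl h (\<lambda>x z. fscl (x y) (cop Bd z))"
      using h by (simp add: out e cong: d.sw_cong)
    \<comment> \<open>The test points range over the whole type. Inside \<open>car B\<close> the
      claim is associativity in \<open>B\<close>; outside it both sides vanish.\<close>
    have "?e ?L = ?e ?R"
    proof (cases "y \<in> car B")
      case True
      show ?thesis
        unfolding L' R'
      proof (rule dual_tens_eqI)
        fix a b assume ab: "a \<in> car B" "b \<in> car B"
        have "sw Bd (*) h (\<lambda>x z. sw Bd (*) x (\<lambda>x' x''. x' y * (x'' a * z b))) =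
            sw Bd (*) h (\<lambda>x z. sw Bd (*) x (\<lambda>x' x''. x' y * x'' a) * z b)"
          by (simp add: sw_mult_right mult.assoc)
        also have "\<dots> = h (y \<cdot>\<^bsub>B\<^esub> (a \<cdot>\<^bsub>B\<^esub> b))"
          using h True ab by (simp add: sw_ev assoc cong: d.sw_cong)
        also have "\<dots> = sw Bd (*) h (\<lambda>x z. x y * z (a \<cdot>\<^bsub>B\<^esub> b))"
          using h True ab by (simp add: sw_ev)
        finally show "ev2 (sw Bd fscl h (\<lambda>x z. sw Bd fscl x (\<lambda>x' x''. fscl (x' y) (ptens Bd Bd x'' z)))) a b =
            ev2 (sw Bd fscl h (\<lambda>x z. fscl (x y) (cop Bd z))) a b"
          using h ab by (simp add: ev2_sw cong: d.sw_cong)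
      qed (use h in \<open>auto intro!: d.sw_closed[OF TT]\<close>)
    next
      case False
      have z: "\<phi> y = 0" if "\<phi> \<in> car Bd" for \<phi>
        using dual_off[OF that False] .
      have "sw Bd fscl x (\<lambda>x' x''. fscl (x' y) (ptens Bd Bd x'' u)) = 0" if "x \<in> car Bd" for x u
        using that z by (subst d.sw_cong[where g="\<lambda>_ _. 0"]) (simp_all add: sw_def sw2_def ext_def)
      then show ?thesis
        unfolding L' R' using h z by (intro d.sw_cong[OF h]) simp
    qed
    then show "ext (scl ?TT) (\<lambda>\<phi> q. scl ?TT (\<phi> y) q) ?L = ext (scl ?TT) (\<lambda>\<phi> q. scl ?TT (\<phi> y) q) ?R"
      by simp
  qed
qed

end

section \<open>The bialgebra axioms and the antipode of the dual\<close>

context dual_setup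
begin

lemma kbialgebra_dual: "kbialgebra Bd"
proof (intro kbialgebra.intro kalgebra_dual kbialgebra_axioms.intro)
  interpret c: kcoalgebra Bd by (rule kcoalgebra_dual)
  interpret a: kalgebra Bd by (rule kalgebra_dual)
  show "lin Bd (tens Bd Bd) (cop Bd)" by (rule d.cop_lin)
  show "lin Bd ground (cou Bd)" by (rule c.cou_lin)
  show "sw2 Bd fscl (\<lambda>x z. sw2 Bd fscl (\<lambda>x' x''. ptens Bd (tens Bd Bd) x' (ptens Bd Bd x'' z)) x) h =
      sw2 Bd fscl (\<lambda>x y. ptens Bd (tens Bd Bd) x (cop Bd y)) h" if "h \<in> car Bd" for h
    using c.coassoc[OF that] by (simp only: sw2_eq_sw)
  show "sw2 Bd (scl Bd) (\<lambda>x y. scl Bd (cou Bd x) y) h = h" if "h \<in> car Bd" for h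
    using c.counit_left[OF that] by (simp only: sw2_eq_sw)
  show "sw2 Bd (scl Bd) (\<lambda>x y. scl Bd (cou Bd y) x) h = h" if "h \<in> car Bd" for h
    using c.counit_right[OF that] by (simp only: sw2_eq_sw)
  note [simp] = clo lins B_axs kalgebra_dual kspace_tens[OF kspace_dual kspace_dual]
  show "cop Bd (h \<cdot>\<^bsub>Bd\<^esub> g) = sw2 Bd fscl (\<lambda>h' h''. sw2 Bd fscl
      (\<lambda>g' g''. ptens Bd Bd (h' \<cdot>\<^bsub>Bd\<^esub> g') (h'' \<cdot>\<^bsub>Bd\<^esub> g'')) g) h"
    if "h \<in> car Bd" "g \<in> car Bd" for h g
    using that by (intro cop_dual_eqI)
      (simp_all add: sw2_eq_sw ev2_sw mul_splits cong: d.sw_cong)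
  show "cop Bd (unt Bd) = ptens Bd Bd (unt Bd) (unt Bd)"
    by (intro cop_dual_eqI) simp_all
  show "cou Bd (h \<cdot>\<^bsub>Bd\<^esub> g) = cou Bd h * cou Bd g" if "h \<in> car Bd" "g \<in> car Bd" for h g
    using that sw_unt[of ground "(*)" "\<lambda>x y. h x * g y"]
    by (simp add: mul_dual_apply bilI dual_lin)
  show "cou Bd (unt Bd) = 1" by simp
qed

text \<open>The transpose of \<open>f\<close>, cut off outside the carrier. It is used for the
  antipode of \<open>B\<close> and for its inverse.\<close>

definition pull :: "('b \<Rightarrow> 'b) \<Rightarrow> ('b \<Rightarrow> 'k) \<Rightarrow> 'b \<Rightarrow> 'k" where
  "pull f \<beta> = (\<lambda>b. if b \<in> car B then \<beta> (f b) else 0)"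

lemma pull_apply: "b \<in> car B \<Longrightarrow> pull f \<beta> b = \<beta> (f b)"
  by (simp add: pull_def)

lemma pull_functional: "lin B B f \<Longrightarrow> \<beta> \<in> functionals B \<Longrightarrow> pull f \<beta> \<in> functionals B"
  unfolding pull_def by (intro functionals_restrict lin_comp[OF functionals_lin])

context
  fixes f
  assumes f: "lin B B f" "\<And>x y. x \<in> car B \<Longrightarrow> y \<in> car B \<Longrightarrow> f (x \<cdot>\<^bsub>B\<^esub> y) = f y \<cdot>\<^bsub>B\<^esub> f x"
begin

text \<open>Since \<open>f\<close> reverses products, its transpose reverses splittings: the two
  factors change places.\<close>

lemma pull_closed:
  assumes "\<beta> \<in> car Bd"
  shows "pull f \<beta> \<in> car Bd"
proof (rule dualI)
  show "pull f \<beta> \<in> functionals B" by (intro pull_functional f dual_functional assms)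
  let ?p = "ext fscl (\<lambda>\<phi> \<psi>. pair (pull f \<psi>) (pull f \<phi>)) (cop Bd \<beta>)"
  show "Poly_Mapping.keys ?p \<subseteq> functionals B \<times> functionals B"
    using d.cop_keys[OF assms] by (intro keys_ext) (simp add: pull_functional f dual_functional)
  have "ev2 ?p a b = ev2 (cop Bd \<beta>) (f b) (f a)" if "a \<in> car B" "b \<in> car B" for a b
    using that by (simp add: ev2_ext pull_def mult.commute flip: ev2_def)
  then show "splits B (pull f \<beta>) ?p"
    using assms f by (simp add: splits_def pull_def lin_closed[OF f(1)] flip: ev2_def)
qed

lemma pull_lin: "lin Bd Bd (pull f)"
  by (rule lin_pointwise[OF pull_closed _ kspace_dual]) (auto simp: pull_def lin_def)

lemma sw_pull:
  assumes "kspace U" "sc = scl U" "bil Bd Bd U g" "\<beta> \<in> car Bd"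
  shows "sw Bd sc (pull f \<beta>) g = sw Bd sc \<beta> (\<lambda>x y. g (pull f y) (pull f x))"
proof -
  interpret U: kspace U by fact
  note K = kspace_dual
  note [simp] = clo lins B_axs K lin_comp[OF pull_lin]
  have e: "cop Bd (pull f \<beta>) = sw Bd fscl \<beta> (\<lambda>x y. ptens Bd Bd (pull f y) (pull f x))"
    using assms(4) by (intro cop_dual_eqI d.sw_closed[OF kspace_tens[OF K K]])
      (simp_all add: pull_closed ev2_sw pull_apply lin_closed[OF f(1)] f(2) sw_ev' cong: d.sw_cong)
  have "sw Bd sc (pull f \<beta>) g = sw Bd sc \<beta> (\<lambda>x y. ext sc g (ptens Bd Bd (pull f y) (pull f x)))"
    by (simp add: sw_def sw2_def e assms(2) ext_comp[OF U.ambient])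
  also have "\<dots> = sw Bd sc \<beta> (\<lambda>x y. g (pull f y) (pull f x))"
    using assms by (intro d.sw_cong ext_ptens[OF K K assms(1)]) (simp_all add: pull_closed)
  finally show ?thesis .
qed

end

lemma ant_dual: "ant Bd = pull (ant B)"
  by (auto simp: dual_ant pull_def fun_eq_iff)

lemma pull_S_closed: "\<beta> \<in> car Bd \<Longrightarrow> pull (ant B) \<beta> \<in> car Bd"
  using pull_closed[OF ant_lin S_mul] .

text \<open>After evaluation at \<open>b\<close> and an exchange of sums, \<open>sw_ev\<close>
  recombines the two legs of \<open>h\<close>, and each antipode identity is \<open>h\<close>
  applied to the corresponding identity of \<open>B\<close>.\<close>

lemma khopf_dual: "khopf_algebra Bd"
proof (intro khopf_algebra.intro kbialgebra_dual khopf_algebra_axioms.intro)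
  interpret b: kbialgebra Bd by (rule kbialgebra_dual)
  note [simp] = lins clo B_axs kalgebra_dual pull_S_closed
  show "lin Bd Bd (ant Bd)" unfolding ant_dual using pull_lin[OF ant_lin S_mul] .
  have psc: "psc c \<beta> \<in> car Bd" if "\<beta> \<in> car Bd" for c \<beta>
    using kspace.scl_closed[OF kspace_dual that, of c] by simp
  show "sw2 Bd (scl Bd) (\<lambda>x y. ant Bd x \<cdot>\<^bsub>Bd\<^esub> y) h = scl Bd (cou Bd h) (unt Bd)" if h: "h \<in> car Bd" for h
  proof (rule dual_eqI)
    fix b assume b: "b \<in> car B"
    have "sw Bd (*) h (\<lambda>x y. (pull (ant B) x \<cdot>\<^bsub>Bd\<^esub> y) b) =
        sw Bd (*) h (\<lambda>x y. sw B (*) b (\<lambda>b1 b2. x (ant B b1) * y b2))"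
      using h b by (simp add: mul_dual_apply pull_def cong: d.sw_cong sw_cong)
    also have "\<dots> = sw B (*) b (\<lambda>b1 b2. sw Bd (*) h (\<lambda>x y. x (ant B b1) * y b2))"
      by (rule sw_swap[OF vector_space_mult])
    also have "\<dots> = sw B (*) b (\<lambda>b1 b2. h (ant B b1 \<cdot>\<^bsub>B\<^esub> b2))"
      using h b by (simp add: sw_ev cong: sw_cong)
    also have "\<dots> = h (sw B (scl B) b (\<lambda>b1 b2. ant B b1 \<cdot>\<^bsub>B\<^esub> b2))"
      using h b by (intro sw_out[OF dual_lin, symmetric]) simp_all
    also have "\<dots> = h (unt B) * cou B b"
      using h b by (simp add: S_left lin_scl[OF dual_lin])
    finally show "sw2 Bd (scl Bd) (\<lambda>x y. ant Bd x \<cdot>\<^bsub>Bd\<^esub> y) h b = scl Bd (cou Bd h) (unt Bd) b"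
      using b by (simp add: sw2_eq_sw sw_apply ant_dual)
  qed (use h psc unt_dual_closed in \<open>simp_all add: sw2_eq_sw ant_dual\<close>)
  show "sw2 Bd (scl Bd) (\<lambda>x y. x \<cdot>\<^bsub>Bd\<^esub> ant Bd y) h = scl Bd (cou Bd h) (unt Bd)" if h: "h \<in> car Bd" for h
  proof (rule dual_eqI)
    fix b assume b: "b \<in> car B"
    have "sw Bd (*) h (\<lambda>x y. (x \<cdot>\<^bsub>Bd\<^esub> pull (ant B) y) b) =
        sw Bd (*) h (\<lambda>x y. sw B (*) b (\<lambda>b1 b2. x b1 * y (ant B b2)))"
      using h b by (simp add: mul_dual_apply pull_def cong: d.sw_cong sw_cong)
    also have "\<dots> = sw B (*) b (\<lambda>b1 b2. sw Bd (*) h (\<lambda>x y. x b1 * y (ant B b2)))"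
      by (rule sw_swap[OF vector_space_mult])
    also have "\<dots> = sw B (*) b (\<lambda>b1 b2. h (b1 \<cdot>\<^bsub>B\<^esub> ant B b2))"
      using h b by (simp add: sw_ev cong: sw_cong)
    also have "\<dots> = h (sw B (scl B) b (\<lambda>b1 b2. b1 \<cdot>\<^bsub>B\<^esub> ant B b2))"
      using h b by (intro sw_out[OF dual_lin, symmetric]) simp_all
    also have "\<dots> = h (unt B) * cou B b"
      using h b by (simp add: S_right lin_scl[OF dual_lin])
    finally show "sw2 Bd (scl Bd) (\<lambda>x y. x \<cdot>\<^bsub>Bd\<^esub> ant Bd y) h b = scl Bd (cou Bd h) (unt Bd) b"
      using b by (simp add: sw2_eq_sw sw_apply ant_dual)
  qed (use h psc unt_dual_closed in \<open>simp_all add: sw2_eq_sw ant_dual\<close>)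
qed

end

locale dual_setup_bij = dual_setup B + khopf_bij B
  for B :: "('k :: field, 'b :: ab_group_add) hopf"
begin

lemma pull_Si_closed: "\<beta> \<in> car Bd \<Longrightarrow> pull (ant_inv B) \<beta> \<in> car Bd"
  using pull_closed[OF Si_lin Si_mul] .

text \<open>The transpose of \<open>Si\<close> inverts the transpose of the antipode.\<close>

sublocale D: khopf_bij Bd
proof (intro khopf_bij.intro khopf_dual khopf_bij_axioms.intro)
  show "bij_betw (ant Bd) (car Bd) (car Bd)"
    unfolding ant_dual
  proof (rule bij_betw_byWitness[where f'="pull (ant_inv B)"])
    show "\<forall>\<beta>\<in>car Bd. pull (ant_inv B) (pull (ant B) \<beta>) = \<beta>"
      "\<forall>\<beta>\<in>car Bd. pull (ant B) (pull (ant_inv B) \<beta>) = \<beta>"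
      by (auto intro!: dual_eqI pull_Si_closed pull_S_closed simp: pull_apply)
  qed (auto intro: pull_Si_closed pull_S_closed)
qed

lemma ant_inv_dual: "\<beta> \<in> car Bd \<Longrightarrow> ant_inv Bd \<beta> = pull (ant_inv B) \<beta>"
proof (rule D.S_inj)
  assume b: "\<beta> \<in> car Bd"
  have "ant Bd (pull (ant_inv B) \<beta>) = \<beta>"
    unfolding ant_dual using b
    by (intro dual_eqI pull_S_closed pull_Si_closed) (simp_all add: pull_apply)
  then show "ant Bd (ant_inv Bd \<beta>) = ant Bd (pull (ant_inv B) \<beta>)"
    by (simp only: D.S_Si[OF b])
qed (simp_all add: pull_Si_closed)

end

section \<open>The Hopf algebroid on an algebra isomorphic to the enveloping algebra\<close>

text \<open>\<open>F\<close> is the inverse of the map \<open>a \<otimes> b \<mapsto> s(a) t(b)\<close>, which is thus an isomorphism from the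
  enveloping algebra of \<open>A\<close> onto \<open>X\<close>.\<close>

locale enveloping_iso = A: kalgebra A + X: kalgebra X
  for A :: "('k :: field, 'a :: ab_group_add, 'm) alg_scheme"
    and X :: "('k, 'x :: ab_group_add, 'n) alg_scheme"
    and s :: "'a \<Rightarrow> 'x" and t :: "'a \<Rightarrow> 'x" and F :: "'x \<Rightarrow> ('a \<times> 'a \<Rightarrow>\<^sub>0 'k)" +
  assumes source: "algebra_map A X s"
    and target: "algebra_antimap A X t"
    and commute: "\<lbrakk>a \<in> car A; b \<in> car A\<rbrakk> \<Longrightarrow> s a \<cdot>\<^bsub>X\<^esub> t b = t b \<cdot>\<^bsub>X\<^esub> s a"
    and F_lin: "lin X (tens A A) F"
    and F_st: "\<lbrakk>a \<in> car A; b \<in> car A\<rbrakk> \<Longrightarrow> F (s a \<cdot>\<^bsub>X\<^esub> t b) = ptens A A a b"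
    and st_F: "x \<in> car X \<Longrightarrow> ext (scl X) (\<lambda>a b. s a \<cdot>\<^bsub>X\<^esub> t b) (F x) = x"
begin

lemmas [simp] = A.kspace_axioms A.kalgebra_axioms X.kspace_axioms X.kalgebra_axioms

lemma s_lin: "lin A X s" and s_unt [simp]: "s (unt A) = unt X"
  and s_mul: "a \<in> car A \<Longrightarrow> b \<in> car A \<Longrightarrow> s (a \<cdot>\<^bsub>A\<^esub> b) = s a \<cdot>\<^bsub>X\<^esub> s b"
  using source by (auto simp: algebra_map_def)

lemma t_lin: "lin A X t" and t_unt [simp]: "t (unt A) = unt X"
  and t_mul: "a \<in> car A \<Longrightarrow> b \<in> car A \<Longrightarrow> t (a \<cdot>\<^bsub>A\<^esub> b) = t b \<cdot>\<^bsub>X\<^esub> t a"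
  using target by (auto simp: algebra_antimap_def)

lemma s_closed [simp]: "a \<in> car A \<Longrightarrow> s a \<in> car X"
  and t_closed [simp]: "a \<in> car A \<Longrightarrow> t a \<in> car X"
  using s_lin t_lin by (auto simp: lin_def)

lemma lin_s: "lin V A f \<Longrightarrow> lin V X (\<lambda>x. s (f x))"
  and lin_t: "lin V A f \<Longrightarrow> lin V X (\<lambda>x. t (f x))"
  using lin_comp[OF s_lin] lin_comp[OF t_lin] by auto

lemma ts: "\<lbrakk>a \<in> car A; b \<in> car A\<rbrakk> \<Longrightarrow> t b \<cdot>\<^bsub>X\<^esub> s a = s a \<cdot>\<^bsub>X\<^esub> t b"
  using commute by simp

lemma ts_left: "\<lbrakk>a \<in> car A; b \<in> car A; x \<in> car X\<rbrakk> \<Longrightarrow> t b \<cdot>\<^bsub>X\<^esub> (s a \<cdot>\<^bsub>X\<^esub> x) = s a \<cdot>\<^bsub>X\<^esub> (t b \<cdot>\<^bsub>X\<^esub> x)"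
  by (simp add: ts flip: X.assoc)

lemma st_product:
  "\<lbrakk>a \<in> car A; b \<in> car A; c \<in> car A; d \<in> car A\<rbrakk> \<Longrightarrow>
    (s a \<cdot>\<^bsub>X\<^esub> t b) \<cdot>\<^bsub>X\<^esub> (s c \<cdot>\<^bsub>X\<^esub> t d) = s (a \<cdot>\<^bsub>A\<^esub> c) \<cdot>\<^bsub>X\<^esub> t (d \<cdot>\<^bsub>A\<^esub> b)"
  by (simp add: X.assoc s_mul t_mul ts_left)

lemma F_keys: "x \<in> car X \<Longrightarrow> (a, b) \<in> Poly_Mapping.keys (F x) \<Longrightarrow> a \<in> car A \<and> b \<in> car A"
  using tens_keys[OF _ _ lin_closed[OF F_lin]] by simp

text \<open>By \<open>st_F\<close> the products \<open>s a \<cdot> t b\<close> span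
  \<open>X\<close>. This plays for \<open>X\<close> the part that pure tensors play for a tensor
  product.\<close>

lemma X_eqI:
  assumes "lin X U f" "lin X U g" "x \<in> car X"
    and "\<And>a b. a \<in> car A \<Longrightarrow> b \<in> car A \<Longrightarrow> f (s a \<cdot>\<^bsub>X\<^esub> t b) = g (s a \<cdot>\<^bsub>X\<^esub> t b)"
  shows "f x = g x"
proof -
  have *: "h x = ext (scl U) (\<lambda>a b. h (s a \<cdot>\<^bsub>X\<^esub> t b)) (F x)" if "lin X U h" for h
    using F_keys[OF assms(3)] ext_lin_out[OF that X.kspace_axioms, of "F x" "\<lambda>a b. s a \<cdot>\<^bsub>X\<^esub> t b"]
    by (simp add: st_F assms(3))
  show ?thesis
    unfolding *[OF assms(1)] *[OF assms(2)] using F_keys[OF assms(3)]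
    by (intro ext_cong assms(4)) auto
qed

lemma ext_F_lin:
  assumes "kspace U" "\<And>a b. a \<in> car A \<Longrightarrow> b \<in> car A \<Longrightarrow> f a b \<in> car U" "sc = scl U"
  shows "lin X U (\<lambda>x. ext sc f (F x))"
  using lin_comp[OF lin_tens_ext[OF A.kspace_axioms A.kspace_axioms assms] F_lin] .

lemma ext_F_st:
  assumes "kspace U" "bil A A U f" "a \<in> car A" "b \<in> car A" "sc = scl U"
  shows "ext sc f (F (s a \<cdot>\<^bsub>X\<^esub> t b)) = f a b"
  using assms by (simp add: F_st ext_ptens)

section \<open>Tensor powers of X over A\<close>

abbreviation "M \<equiv> st_bimod X s t"
abbreviation "T \<equiv> st_tens A X s t"
abbreviation "pt \<equiv> st_ptens A X s t"
abbreviation "pt3 \<equiv> st_ptens3 A X s t"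

lemma M_simps [simp]: "car M = car X" "scl M = scl X" "lact M = (\<lambda>a x. s a \<cdot>\<^bsub>X\<^esub> x)"
  "ract M = (\<lambda>x b. t b \<cdot>\<^bsub>X\<^esub> x)"
  by (simp_all add: st_bimod_def)

lemma lin_M [simp]: "lin M U f = lin X U f" and bil_M_right [simp]: "bil V' M U g = bil V' X U g"
  and bil_M_left [simp]: "bil M V U h = bil X V U h" and kspace_M [simp]: "kspace M"
  using X.kspace_axioms by (simp_all add: lin_def bil_def kspace_def)

sublocale b2: balanced_pair "car A" M M
  by (intro balanced_pair.intro balanced_pair_axioms.intro kspace_M) simp_all

lemma T_eq: "T = tensor_over (car A) M M" and pt_eq: "pt = ptens_over (car A) M M"
  by (simp_all add: st_tens_def st_ptens_def fun_eq_iff)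

lemma kspace_T [simp]: "kspace T" and scl_T [simp]: "scl T = fscl"
  using b2.kspace_T by (simp_all add: T_eq)

lemma pt_bil: "bil X X T pt"
  using b2.ptens_bil by (simp add: T_eq pt_eq)

lemma pt_closed [simp]: "x \<in> car X \<Longrightarrow> y \<in> car X \<Longrightarrow> pt x y \<in> car T"
  using pt_bil by (rule bil_closed)

lemma pt_bal: "a \<in> car A \<Longrightarrow> x \<in> car X \<Longrightarrow> y \<in> car X \<Longrightarrow> pt (t a \<cdot>\<^bsub>X\<^esub> x) y = pt x (s a \<cdot>\<^bsub>X\<^esub> y)"
  using b2.ptens_balanced by (simp add: pt_eq)

lemma ext_pt:
  assumes "kspace U" "bil X X U f" "x \<in> car X" "y \<in> car X" "sc = scl U"
    "\<And>a x y. a \<in> car A \<Longrightarrow> x \<in> car X \<Longrightarrow> y \<in> car X \<Longrightarrow> f (t a \<cdot>\<^bsub>X\<^esub> x) y = f x (s a \<cdot>\<^bsub>X\<^esub> y)"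
  shows "ext sc f (pt x y) = f x y"
  using b2.ext_ptens[OF assms(1), of f x y] assms by (simp add: pt_eq)

lemma T_lin:
  assumes "kspace U" "\<And>x y. x \<in> car X \<Longrightarrow> y \<in> car X \<Longrightarrow> f x y \<in> car U" "sc = scl U"
  shows "lin T U (ext sc f)"
  using b2.lin_ext[OF assms(1), of f] assms by (simp add: T_eq)

lemma T_eqI:
  assumes "lin T U f" "lin T U g" "p \<in> car T"
    and "\<And>x y. x \<in> car X \<Longrightarrow> y \<in> car X \<Longrightarrow> f (pt x y) = g (pt x y)"
  shows "f p = g p"
  using b2.lin_eqI[of U f g p] assms by (simp add: T_eq pt_eq)

lemma T_keys: "p \<in> car T \<Longrightarrow> (x, y) \<in> Poly_Mapping.keys p \<Longrightarrow> x \<in> car X \<and> y \<in> car X"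
  using b2.T_keys by (simp add: T_eq)

lemma lin_pt_left: "lin V X f \<Longrightarrow> y \<in> car X \<Longrightarrow> lin V T (\<lambda>v. pt (f v) y)"
  and lin_pt_right: "lin V X f \<Longrightarrow> y \<in> car X \<Longrightarrow> lin V T (\<lambda>v. pt y (f v))"
  using lin_comp[OF bil_left[OF pt_bil]] lin_comp[OF bil_right[OF pt_bil]] by blast+

lemma lin_T_arg:
  "lin V T g \<Longrightarrow> kspace U \<Longrightarrow> (\<And>x y. x \<in> car X \<Longrightarrow> y \<in> car X \<Longrightarrow> f x y \<in> car U) \<Longrightarrow> sc = scl U \<Longrightarrow>
    lin V U (\<lambda>v. ext sc f (g v))"
  using lin_comp[OF T_lin] .

lemma lin_T_body:
  "p \<in> car T \<Longrightarrow> kspace V \<Longrightarrow> kspace U \<Longrightarrow> sc = scl U \<Longrightarrow>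
   (\<And>x y. x \<in> car X \<Longrightarrow> y \<in> car X \<Longrightarrow> lin V U (\<lambda>v. f v x y)) \<Longrightarrow> lin V U (\<lambda>v. ext sc (f v) p)"
  using T_keys lin_ext_body[of U V p f] by blast

lemma ext_T_closed:
  "p \<in> car T \<Longrightarrow> kspace U \<Longrightarrow> sc = scl U \<Longrightarrow>
   (\<And>x y. x \<in> car X \<Longrightarrow> y \<in> car X \<Longrightarrow> f x y \<in> car U) \<Longrightarrow> ext sc f p \<in> car U"
  using lin_closed[OF T_lin] by blast

lemmas ls = lins clo lin_s lin_t lin_pt_left lin_pt_right lin_T_arg lin_T_body ext_T_closed

lemma lactT: "lact T a = ext fscl (\<lambda>x y. pt (s a \<cdot>\<^bsub>X\<^esub> x) y)"
  and ractT: "ract T p a = ext fscl (\<lambda>x y. pt x (t a \<cdot>\<^bsub>X\<^esub> y)) p"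
  by (simp_all add: T_eq pt_eq tensor_over_def)

text \<open>Well defined on classes because \<open>s a\<close> commutes with every
  \<open>t c\<close>; the same holds for \<open>t a\<close> and \<open>s c\<close> in
  \<open>ractT_pt\<close>.\<close>

lemma lactT_pt [simp]: "a \<in> car A \<Longrightarrow> x \<in> car X \<Longrightarrow> y \<in> car X \<Longrightarrow> lact T a (pt x y) = pt (s a \<cdot>\<^bsub>X\<^esub> x) y"
  unfolding lactT by (rule ext_pt[OF kspace_T]) (simp_all add: bilI ls pt_bal flip: ts_left)

lemma ractT_pt [simp]: "a \<in> car A \<Longrightarrow> x \<in> car X \<Longrightarrow> y \<in> car X \<Longrightarrow> ract T (pt x y) a = pt x (t a \<cdot>\<^bsub>X\<^esub> y)"
  unfolding ractT by (rule ext_pt[OF kspace_T]) (simp_all add: bilI ls pt_bal ts_left)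

lemma lactT_lin: "a \<in> car A \<Longrightarrow> lin T T (lact T a)"
  and ractT_lin: "a \<in> car A \<Longrightarrow> lin T T (\<lambda>p. ract T p a)"
  unfolding lactT ractT by (simp_all add: T_lin)

lemma lin_lactT: "a \<in> car A \<Longrightarrow> lin V T f \<Longrightarrow> lin V T (\<lambda>v. lact T a (f v))"
  and lin_ractT: "a \<in> car A \<Longrightarrow> lin V T f \<Longrightarrow> lin V T (\<lambda>v. ract T (f v) a)"
  using lin_comp[OF lactT_lin] lin_comp[OF ractT_lin] by auto

sublocale b3: balanced_pair "car A" M T
  by (intro balanced_pair.intro balanced_pair_axioms.intro kspace_M kspace_T)
     (simp_all add: lin_closed[OF lactT_lin])

abbreviation "T3 \<equiv> tensor_over (car A) M T"

lemma pt3_eq: "pt3 = ptens_over (car A) M T"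
  by (simp add: st_ptens3_def fun_eq_iff)

lemma kspace_T3 [simp]: "kspace T3" and scl_T3 [simp]: "scl T3 = fscl"
  using b3.kspace_T by simp_all

lemma pt3_bil: "bil X T T3 pt3"
  using b3.ptens_bil by (simp add: pt3_eq)

lemma pt3_closed [simp]: "x \<in> car X \<Longrightarrow> q \<in> car T \<Longrightarrow> pt3 x q \<in> car T3"
  using pt3_bil by (rule bil_closed)

lemma pt3_bal: "a \<in> car A \<Longrightarrow> x \<in> car X \<Longrightarrow> q \<in> car T \<Longrightarrow> pt3 (t a \<cdot>\<^bsub>X\<^esub> x) q = pt3 x (lact T a q)"
  using b3.ptens_balanced by (simp add: pt3_eq)

lemma lin_pt3_left: "lin V X f \<Longrightarrow> q \<in> car T \<Longrightarrow> lin V T3 (\<lambda>v. pt3 (f v) q)"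
  and lin_pt3_right: "lin V T g \<Longrightarrow> y \<in> car X \<Longrightarrow> lin V T3 (\<lambda>v. pt3 y (g v))"
  using lin_comp[OF bil_left[OF pt3_bil]] lin_comp[OF bil_right[OF pt3_bil]] by blast+

section \<open>Structure maps and axioms of the Hopf algebroid\<close>

definition \<Delta> :: "'x \<Rightarrow> ('x \<times> 'x \<Rightarrow>\<^sub>0 'k)" where
  "\<Delta> x = ext fscl (\<lambda>a b. pt (s a) (t b)) (F x)"

definition \<epsilon> :: "'x \<Rightarrow> 'a" where
  "\<epsilon> x = ext (scl A) (\<lambda>a b. a \<cdot>\<^bsub>A\<^esub> b) (F x)"

definition \<tau> :: "'x \<Rightarrow> 'x" where
  "\<tau> x = ext (scl X) (\<lambda>a b. s b \<cdot>\<^bsub>X\<^esub> t a) (F x)"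

lemma D_lin: "lin X T \<Delta>" and e_lin: "lin X A \<epsilon>" and tau_lin: "lin X X \<tau>"
  unfolding \<Delta>_def[abs_def] \<epsilon>_def[abs_def] \<tau>_def[abs_def] by (simp_all add: ext_F_lin)

lemma lin_D: "lin V X f \<Longrightarrow> lin V T (\<lambda>v. \<Delta> (f v))"
  and lin_e: "lin V X f \<Longrightarrow> lin V A (\<lambda>v. \<epsilon> (f v))"
  and lin_tau: "lin V X f \<Longrightarrow> lin V X (\<lambda>v. \<tau> (f v))"
  using lin_comp[OF D_lin] lin_comp[OF e_lin] lin_comp[OF tau_lin] by auto

lemma D_closed [simp]: "x \<in> car X \<Longrightarrow> \<Delta> x \<in> car T"
  and e_closed [simp]: "x \<in> car X \<Longrightarrow> \<epsilon> x \<in> car A"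
  and tau_closed [simp]: "x \<in> car X \<Longrightarrow> \<tau> x \<in> car X"
  using D_lin e_lin tau_lin by (auto simp: lin_def)

lemma D_st [simp]: "a \<in> car A \<Longrightarrow> b \<in> car A \<Longrightarrow> \<Delta> (s a \<cdot>\<^bsub>X\<^esub> t b) = pt (s a) (t b)"
  unfolding \<Delta>_def by (simp add: ext_F_st[OF kspace_T] bilI ls)

lemma e_st [simp]: "a \<in> car A \<Longrightarrow> b \<in> car A \<Longrightarrow> \<epsilon> (s a \<cdot>\<^bsub>X\<^esub> t b) = a \<cdot>\<^bsub>A\<^esub> b"
  unfolding \<epsilon>_def by (simp add: ext_F_st[OF A.kspace_axioms] bilI ls)

lemma tau_st [simp]: "a \<in> car A \<Longrightarrow> b \<in> car A \<Longrightarrow> \<tau> (s a \<cdot>\<^bsub>X\<^esub> t b) = s b \<cdot>\<^bsub>X\<^esub> t a"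
  unfolding \<tau>_def by (simp add: ext_F_st[OF X.kspace_axioms] bilI ls)

lemma D_s [simp]: "a \<in> car A \<Longrightarrow> \<Delta> (s a) = pt (s a) (unt X)"
  and D_t [simp]: "a \<in> car A \<Longrightarrow> \<Delta> (t a) = pt (unt X) (t a)"
  and e_s [simp]: "a \<in> car A \<Longrightarrow> \<epsilon> (s a) = a"
  and e_t [simp]: "a \<in> car A \<Longrightarrow> \<epsilon> (t a) = a"
  and tau_s [simp]: "a \<in> car A \<Longrightarrow> \<tau> (s a) = t a"
  and tau_t [simp]: "a \<in> car A \<Longrightarrow> \<tau> (t a) = s a"
  using D_st[of a "unt A"] D_st[of "unt A" a] e_st[of a "unt A"] e_st[of "unt A" a]
    tau_st[of a "unt A"] tau_st[of "unt A" a] by simp_all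


lemmas ls3 = ls lin_D lin_e lin_tau lin_pt3_left lin_pt3_right lin_lactT lin_ractT

text \<open>On a generator both sides are the class of
  \<open>s a \<otimes> (1 \<otimes> t b)\<close>. The work lies in showing that each summand is
  balanced, so that \<open>ext\<close> may be evaluated on the class of a pair.\<close>

lemma coassociative:
  assumes "x \<in> car X"
  shows "ext fscl (\<lambda>y z. ext fscl (\<lambda>y' y''. pt3 y' (pt y'' z)) (\<Delta> y)) (\<Delta> x) =
      ext fscl (\<lambda>y z. pt3 y (\<Delta> z)) (\<Delta> x)"
proof (rule X_eqI[where U=T3, OF _ _ assms])
  have pure: "ext fscl (\<lambda>y' y''. pt3 y' (pt y'' z)) (pt y y2) = pt3 y (pt y2 z)"
    if "y \<in> car X" "y2 \<in> car X" "z \<in> car X" for y y2 z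
    using that by (intro ext_pt[OF kspace_T3]) (simp_all add: bilI ls3 pt3_bal pt_bal)
  show "lin X T3 (\<lambda>x. ext fscl (\<lambda>y z. ext fscl (\<lambda>y' y''. pt3 y' (pt y'' z)) (\<Delta> y)) (\<Delta> x))"
    "lin X T3 (\<lambda>x. ext fscl (\<lambda>y z. pt3 y (\<Delta> z)) (\<Delta> x))"
    by (simp_all add: ls3)
  fix a b assume ab: "a \<in> car A" "b \<in> car A"
  \<comment> \<open>Balancedness of the outer summand: multiplying \<open>y\<close> by
    \<open>t c\<close> changes only the second leg of its coproduct, where \<open>t c\<close>
    crosses the tensor sign as \<open>s c\<close>.\<close>
  have bal: "ext fscl (\<lambda>y' y''. pt3 y' (pt y'' z)) (\<Delta> (t c \<cdot>\<^bsub>X\<^esub> y)) =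
      ext fscl (\<lambda>y' y''. pt3 y' (pt y'' (s c \<cdot>\<^bsub>X\<^esub> z))) (\<Delta> y)"
    if "c \<in> car A" "y \<in> car X" "z \<in> car X" for c y z
  proof (rule X_eqI[where U=T3, OF _ _ that(2)])
    fix p q assume pq: "p \<in> car A" "q \<in> car A"
    have "t c \<cdot>\<^bsub>X\<^esub> (s p \<cdot>\<^bsub>X\<^esub> t q) = s p \<cdot>\<^bsub>X\<^esub> t (q \<cdot>\<^bsub>A\<^esub> c)"
      using that pq by (simp add: ts_left t_mul)
    then show "ext fscl (\<lambda>y' y''. pt3 y' (pt y'' z)) (\<Delta> (t c \<cdot>\<^bsub>X\<^esub> (s p \<cdot>\<^bsub>X\<^esub> t q))) =
      ext fscl (\<lambda>y' y''. pt3 y' (pt y'' (s c \<cdot>\<^bsub>X\<^esub> z))) (\<Delta> (s p \<cdot>\<^bsub>X\<^esub> t q))"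
      using that pq by (simp add: pure) (simp add: t_mul pt_bal)
  qed (use that in \<open>simp_all add: ls3\<close>)
  have "ext fscl (\<lambda>y z. ext fscl (\<lambda>y' y''. pt3 y' (pt y'' z)) (\<Delta> y)) (pt (s a) (t b)) =
      ext fscl (\<lambda>y' y''. pt3 y' (pt y'' (t b))) (\<Delta> (s a))"
    using ab by (intro ext_pt[OF kspace_T3]) (simp_all add: bilI ls3 bal)
  moreover have "ext fscl (\<lambda>y z. pt3 y (\<Delta> z)) (pt (s a) (t b)) = pt3 (s a) (\<Delta> (t b))"
  proof (rule ext_pt[OF kspace_T3])
    fix c x y assume *: "c \<in> car A" "x \<in> car X" "y \<in> car X"
    have "lact T c (\<Delta> y) = \<Delta> (s c \<cdot>\<^bsub>X\<^esub> y)"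
    proof (rule X_eqI[where U=T, OF _ _ *(3)])
      fix p q assume pq: "p \<in> car A" "q \<in> car A"
      show "lact T c (\<Delta> (s p \<cdot>\<^bsub>X\<^esub> t q)) = \<Delta> (s c \<cdot>\<^bsub>X\<^esub> (s p \<cdot>\<^bsub>X\<^esub> t q))"
        using * pq D_st[of "c \<cdot>\<^bsub>A\<^esub> p" q] by (simp add: s_mul X.assoc)
    qed (use * in \<open>simp_all add: ls3\<close>)
    then show "pt3 (t c \<cdot>\<^bsub>X\<^esub> x) (\<Delta> y) = pt3 x (\<Delta> (s c \<cdot>\<^bsub>X\<^esub> y))"
      using * by (simp add: pt3_bal)
  qed (use ab in \<open>simp_all add: bilI ls3\<close>)
  ultimately show "ext fscl (\<lambda>y z. ext fscl (\<lambda>y' y''. pt3 y' (pt y'' z)) (\<Delta> y)) (\<Delta> (s a \<cdot>\<^bsub>X\<^esub> t b)) =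
      ext fscl (\<lambda>y z. pt3 y (\<Delta> z)) (\<Delta> (s a \<cdot>\<^bsub>X\<^esub> t b))"
    using ab by (simp add: pure)
qed

text \<open>Right multiplications commute with the left multiplications that occur in the balancing
  relation.\<close>

lemma takeuchi_pt:
  assumes "a \<in> car A" "y \<in> car X" "z \<in> car X"
  shows "ext fscl (\<lambda>y z. pt (y \<cdot>\<^bsub>X\<^esub> t a) z) (pt y z) = pt (y \<cdot>\<^bsub>X\<^esub> t a) z"
    and "ext fscl (\<lambda>y z. pt y (z \<cdot>\<^bsub>X\<^esub> s a)) (pt y z) = pt y (z \<cdot>\<^bsub>X\<^esub> s a)"
  using assms by (auto intro!: ext_pt[OF kspace_T] simp: bilI ls3 X.assoc pt_bal)

text \<open>In \<open>s p \<cdot> t a \<otimes> t q\<close> the factor \<open>t a\<close> moves to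
  the front, crosses the tensor sign as \<open>s a\<close>, and moves behind \<open>t q\<close>.
  This uses only that source and target commute.\<close>

lemma takeuchi_D:
  assumes x: "x \<in> car X" and a: "a \<in> car A"
  shows "ext fscl (\<lambda>y z. pt (y \<cdot>\<^bsub>X\<^esub> t a) z) (\<Delta> x) = ext fscl (\<lambda>y z. pt y (z \<cdot>\<^bsub>X\<^esub> s a)) (\<Delta> x)"
proof (rule X_eqI[where U=T, OF _ _ x])
  fix p q assume pq: "p \<in> car A" "q \<in> car A"
  have "pt (s p \<cdot>\<^bsub>X\<^esub> t a) (t q) = pt (t a \<cdot>\<^bsub>X\<^esub> s p) (t q)"
    using a pq by (simp add: ts)
  also have "\<dots> = pt (s p) (t q \<cdot>\<^bsub>X\<^esub> s a)"
    using a pq by (simp only: pt_bal s_closed t_closed) (simp add: ts)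
  finally show "ext fscl (\<lambda>y z. pt (y \<cdot>\<^bsub>X\<^esub> t a) z) (\<Delta> (s p \<cdot>\<^bsub>X\<^esub> t q)) =
      ext fscl (\<lambda>y z. pt y (z \<cdot>\<^bsub>X\<^esub> s a)) (\<Delta> (s p \<cdot>\<^bsub>X\<^esub> t q))"
    using pq a by (simp add: takeuchi_pt)
qed (use a in \<open>simp_all add: ls3\<close>)

text \<open>The sums are swapped so that for fixed \<open>y'\<close>, \<open>y''\<close> the summand is balanced in \<open>(x', x'')\<close>; only
  after \<open>\<Delta> x\<close> has been evaluated is the remaining summand balanced in \<open>(y', y'')\<close>.\<close>

lemma D_mul:
  assumes x: "x \<in> car X" and y: "y \<in> car X"
  shows "\<Delta> (x \<cdot>\<^bsub>X\<^esub> y) = ext fscl (\<lambda>x' x''. ext fscl (\<lambda>y' y''. pt (x' \<cdot>\<^bsub>X\<^esub> y') (x'' \<cdot>\<^bsub>X\<^esub> y'')) (\<Delta> y)) (\<Delta> x)"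
proof -
  let ?R = "\<lambda>x y. ext fscl (\<lambda>y' y''. ext fscl (\<lambda>x' x''. pt (x' \<cdot>\<^bsub>X\<^esub> y') (x'' \<cdot>\<^bsub>X\<^esub> y'')) (\<Delta> x)) (\<Delta> y)"
  have st: "\<Delta> ((s a \<cdot>\<^bsub>X\<^esub> t b) \<cdot>\<^bsub>X\<^esub> (s c \<cdot>\<^bsub>X\<^esub> t d)) = ?R (s a \<cdot>\<^bsub>X\<^esub> t b) (s c \<cdot>\<^bsub>X\<^esub> t d)"
    if "a \<in> car A" "b \<in> car A" "c \<in> car A" "d \<in> car A" for a b c d
  proof -
    have 1: "ext fscl (\<lambda>x' x''. pt (x' \<cdot>\<^bsub>X\<^esub> y') (x'' \<cdot>\<^bsub>X\<^esub> y'')) (pt (s a) (t b)) =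
        pt (s a \<cdot>\<^bsub>X\<^esub> y') (t b \<cdot>\<^bsub>X\<^esub> y'')" if "y' \<in> car X" "y'' \<in> car X" for y' y''
      using that \<open>a \<in> car A\<close> \<open>b \<in> car A\<close>
      by (intro ext_pt[OF kspace_T]) (simp_all add: bilI ls3 X.assoc pt_bal)
    have "?R (s a \<cdot>\<^bsub>X\<^esub> t b) (s c \<cdot>\<^bsub>X\<^esub> t d) = ext fscl (\<lambda>y' y''. pt (s a \<cdot>\<^bsub>X\<^esub> y') (t b \<cdot>\<^bsub>X\<^esub> y'')) (pt (s c) (t d))"
      using that T_keys[of "pt (s c) (t d)"] by (auto intro!: ext_cong 1)
    also have "\<dots> = pt (s a \<cdot>\<^bsub>X\<^esub> s c) (t b \<cdot>\<^bsub>X\<^esub> t d)"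
      using that by (intro ext_pt[OF kspace_T], simp_all add: bilI ls3 flip: ts_left)
        (simp only: pt_bal X.mul_closed s_closed t_closed, simp add: ts_left)
    also have "\<dots> = \<Delta> ((s a \<cdot>\<^bsub>X\<^esub> t b) \<cdot>\<^bsub>X\<^esub> (s c \<cdot>\<^bsub>X\<^esub> t d))"
      using that by (simp add: st_product) (simp add: s_mul t_mul)
    finally show ?thesis ..
  qed
  have "\<Delta> (x \<cdot>\<^bsub>X\<^esub> y) = ?R x y"
  proof (rule X_eqI[OF _ _ x, where U=T and g="\<lambda>x. ?R x y" and f="\<lambda>x. \<Delta> (x \<cdot>\<^bsub>X\<^esub> y)"])
    fix a b assume ab: "a \<in> car A" "b \<in> car A"
    show "\<Delta> (s a \<cdot>\<^bsub>X\<^esub> t b \<cdot>\<^bsub>X\<^esub> y) = ?R (s a \<cdot>\<^bsub>X\<^esub> t b) y"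
      by (rule X_eqI[OF _ _ y, where U=T and f="\<lambda>y. \<Delta> (s a \<cdot>\<^bsub>X\<^esub> t b \<cdot>\<^bsub>X\<^esub> y)"])
         (use ab in \<open>simp_all add: ls3 st del: D_st\<close>)
  qed (use y in \<open>simp_all add: ls3\<close>)
  also have "\<dots> = ext fscl (\<lambda>x' x''. ext fscl (\<lambda>y' y''. pt (x' \<cdot>\<^bsub>X\<^esub> y') (x'' \<cdot>\<^bsub>X\<^esub> y'')) (\<Delta> y)) (\<Delta> x)"
    by (rule ext_swap[OF vector_space_fscl])
  finally show ?thesis .
qed

text \<open>Every class has a representative whose left factors are in the image of
  \<open>s\<close>: a factor \<open>t b\<close> crosses the tensor sign and becomes
  \<open>s b\<close>. The isomorphism \<open>F\<close> makes this choice linear.\<close>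

definition \<gamma> :: "('x \<times> 'x \<Rightarrow>\<^sub>0 'k) \<Rightarrow> ('x \<times> 'x \<Rightarrow>\<^sub>0 'k)" where
  "\<gamma> = ext fscl (\<lambda>y z. ext fscl (\<lambda>a b. ptens X X (s a) (s b \<cdot>\<^bsub>X\<^esub> z)) (F y))"

lemma lin_F: "lin V X f \<Longrightarrow> kspace U \<Longrightarrow> (\<And>a b. a \<in> car A \<Longrightarrow> b \<in> car A \<Longrightarrow> g a b \<in> car U) \<Longrightarrow>
    sc = scl U \<Longrightarrow> lin V U (\<lambda>v. ext sc g (F (f v)))"
  using lin_comp[OF ext_F_lin] .

lemma lin_F_body:
  "y \<in> car X \<Longrightarrow> kspace V \<Longrightarrow> kspace U \<Longrightarrow> sc = scl U \<Longrightarrow>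
   (\<And>a b. a \<in> car A \<Longrightarrow> b \<in> car A \<Longrightarrow> lin V U (\<lambda>v. f v a b)) \<Longrightarrow> lin V U (\<lambda>v. ext sc (f v) (F y))"
  using F_keys lin_ext_body[of U V "F y" f] by blast

lemma ext_F_closed:
  "y \<in> car X \<Longrightarrow> kspace U \<Longrightarrow> sc = scl U \<Longrightarrow>
   (\<And>a b. a \<in> car A \<Longrightarrow> b \<in> car A \<Longrightarrow> f a b \<in> car U) \<Longrightarrow> ext sc f (F y) \<in> car U"
  using lin_closed[OF ext_F_lin] by blast

lemmas ls4 = ls3 lin_F lin_F_body ext_F_closed

lemma gamma_st:
  assumes "a \<in> car A" "b \<in> car A" "z \<in> car X"
  shows "\<gamma> (pt (s a \<cdot>\<^bsub>X\<^esub> t b) z) = ptens X X (s a) (s b \<cdot>\<^bsub>X\<^esub> z)"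
proof -
  note K = kspace_tens[OF X.kspace_axioms X.kspace_axioms]
  have F: "ext fscl (\<lambda>a b. ptens X X (s a) (s b \<cdot>\<^bsub>X\<^esub> z)) (F (s a \<cdot>\<^bsub>X\<^esub> t b)) = ptens X X (s a) (s b \<cdot>\<^bsub>X\<^esub> z)"
    if "a \<in> car A" "b \<in> car A" "z \<in> car X" for a b z
    using that by (intro ext_F_st[OF K]) (simp_all add: bilI ls4)
  have "\<gamma> (pt (s a \<cdot>\<^bsub>X\<^esub> t b) z) = ext fscl (\<lambda>a b. ptens X X (s a) (s b \<cdot>\<^bsub>X\<^esub> z)) (F (s a \<cdot>\<^bsub>X\<^esub> t b))"
    unfolding \<gamma>_def
  proof (rule ext_pt[OF K])
    \<comment> \<open>Well-definedness on classes: on \<open>s p \<cdot> t q\<close>, multiplication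
      by \<open>t c\<close> gives \<open>t (q \<cdot> c)\<close>, which crosses over as
      \<open>s q \<cdot> s c\<close>.\<close>
    fix c x y assume *: "c \<in> car A" "x \<in> car X" "y \<in> car X"
    show "ext fscl (\<lambda>a b. ptens X X (s a) (s b \<cdot>\<^bsub>X\<^esub> y)) (F (t c \<cdot>\<^bsub>X\<^esub> x)) =
      ext fscl (\<lambda>a b. ptens X X (s a) (s b \<cdot>\<^bsub>X\<^esub> (s c \<cdot>\<^bsub>X\<^esub> y))) (F x)"
    proof (rule X_eqI[where U="tens X X", OF _ _ *(2)])
      fix p q assume pq: "p \<in> car A" "q \<in> car A"
      have "t c \<cdot>\<^bsub>X\<^esub> (s p \<cdot>\<^bsub>X\<^esub> t q) = s p \<cdot>\<^bsub>X\<^esub> t (q \<cdot>\<^bsub>A\<^esub> c)"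
        using * pq by (simp add: ts_left t_mul)
      then show "ext fscl (\<lambda>a b. ptens X X (s a) (s b \<cdot>\<^bsub>X\<^esub> y)) (F (t c \<cdot>\<^bsub>X\<^esub> (s p \<cdot>\<^bsub>X\<^esub> t q))) =
        ext fscl (\<lambda>a b. ptens X X (s a) (s b \<cdot>\<^bsub>X\<^esub> (s c \<cdot>\<^bsub>X\<^esub> y))) (F (s p \<cdot>\<^bsub>X\<^esub> t q))"
        using * pq by (simp add: F) (simp add: s_mul X.assoc)
    qed (use * in \<open>simp_all add: ls4\<close>)
  qed (use assms in \<open>simp_all add: bilI ls4\<close>)
  then show ?thesis using F assms by simp
qed

lemma gamma_lin: "lin T (tens X X) \<gamma>"
  unfolding \<gamma>_def by (rule T_lin) (simp_all add: ls4)

lemma pt_section: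
  assumes "p \<in> car T"
  shows "ext fscl pt (\<gamma> p) = p"
proof (rule T_eqI[where U=T, OF _ lin_id assms])
  have l: "lin (tens X X) T (ext fscl pt)"
    by (rule lin_tens_ext) simp_all
  show "lin T T (\<lambda>p. ext fscl pt (\<gamma> p))"
    using lin_comp[OF l gamma_lin] .
  fix x y assume x: "x \<in> car X" and y: "y \<in> car X"
  show "ext fscl pt (\<gamma> (pt x y)) = pt x y"
  proof (rule X_eqI[where U=T, OF _ _ x])
    fix a b assume ab: "a \<in> car A" "b \<in> car A"
    have "ext fscl pt (\<gamma> (pt (s a \<cdot>\<^bsub>X\<^esub> t b) y)) = pt (s a) (s b \<cdot>\<^bsub>X\<^esub> y)"
      using ab y by (simp only: gamma_st) (intro ext_ptens[OF _ _ kspace_T], simp_all add: pt_bil)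
    then show "ext fscl pt (\<gamma> (pt (s a \<cdot>\<^bsub>X\<^esub> t b) y)) = pt (s a \<cdot>\<^bsub>X\<^esub> t b) y"
      using ab y by (simp add: commute pt_bal)
  qed (use y in \<open>simp_all add: ls4 lin_comp[OF l] lin_comp[OF gamma_lin]\<close>)
qed

lemma is_hopf_algebroid: "hopf_algebroid A X s t \<Delta> \<epsilon> \<tau>"
proof unfold_locales
  fix x y a b assume x: "x \<in> car X"
  {
    assume y: "y \<in> car X"
    show "\<Delta> (x \<cdot>\<^bsub>X\<^esub> y) = ext fscl (\<lambda>x' x''. ext fscl (\<lambda>y' y''. pt (x' \<cdot>\<^bsub>X\<^esub> y') (x'' \<cdot>\<^bsub>X\<^esub> y'')) (\<Delta> y)) (\<Delta> x)"
      by (rule D_mul[OF x y])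
    \<comment> \<open>For \<open>y = s c \<cdot> t d\<close>, all three counits equal the product of
      \<open>a\<close>, \<open>c\<close>, \<open>d\<close>, \<open>b\<close> in this order.\<close>
    have e: "\<epsilon> ((s a \<cdot>\<^bsub>X\<^esub> t b) \<cdot>\<^bsub>X\<^esub> y) = \<epsilon> ((s a \<cdot>\<^bsub>X\<^esub> t b) \<cdot>\<^bsub>X\<^esub> s (\<epsilon> y)) \<and>
        \<epsilon> ((s a \<cdot>\<^bsub>X\<^esub> t b) \<cdot>\<^bsub>X\<^esub> y) = \<epsilon> ((s a \<cdot>\<^bsub>X\<^esub> t b) \<cdot>\<^bsub>X\<^esub> t (\<epsilon> y))" if "a \<in> car A" "b \<in> car A" for a b
    proof (intro conjI; rule X_eqI[where U=A, OF _ _ y])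
      fix c d assume cd: "c \<in> car A" "d \<in> car A"
      have "(s a \<cdot>\<^bsub>X\<^esub> t b) \<cdot>\<^bsub>X\<^esub> s (c \<cdot>\<^bsub>A\<^esub> d) = s (a \<cdot>\<^bsub>A\<^esub> (c \<cdot>\<^bsub>A\<^esub> d)) \<cdot>\<^bsub>X\<^esub> t b"
        using that cd st_product[of a b "c \<cdot>\<^bsub>A\<^esub> d" "unt A"] by simp
      then show "\<epsilon> ((s a \<cdot>\<^bsub>X\<^esub> t b) \<cdot>\<^bsub>X\<^esub> (s c \<cdot>\<^bsub>X\<^esub> t d)) = \<epsilon> ((s a \<cdot>\<^bsub>X\<^esub> t b) \<cdot>\<^bsub>X\<^esub> s (\<epsilon> (s c \<cdot>\<^bsub>X\<^esub> t d)))"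
        using that cd by (simp add: st_product) (simp add: A.assoc)
      have "(s a \<cdot>\<^bsub>X\<^esub> t b) \<cdot>\<^bsub>X\<^esub> t (c \<cdot>\<^bsub>A\<^esub> d) = s a \<cdot>\<^bsub>X\<^esub> t (c \<cdot>\<^bsub>A\<^esub> d \<cdot>\<^bsub>A\<^esub> b)"
        using that cd st_product[of a b "unt A" "c \<cdot>\<^bsub>A\<^esub> d"] by simp
      then show "\<epsilon> ((s a \<cdot>\<^bsub>X\<^esub> t b) \<cdot>\<^bsub>X\<^esub> (s c \<cdot>\<^bsub>X\<^esub> t d)) = \<epsilon> ((s a \<cdot>\<^bsub>X\<^esub> t b) \<cdot>\<^bsub>X\<^esub> t (\<epsilon> (s c \<cdot>\<^bsub>X\<^esub> t d)))"
        using that cd by (simp add: st_product) (simp add: A.assoc)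
    qed (use that in \<open>simp_all add: ls4\<close>)
    show "\<epsilon> (x \<cdot>\<^bsub>X\<^esub> y) = \<epsilon> (x \<cdot>\<^bsub>X\<^esub> s (\<epsilon> y))"
      by (rule X_eqI[where U=A, OF _ _ x]) (use y conjunct1[OF e] in \<open>simp_all add: ls4\<close>)
    show "\<epsilon> (x \<cdot>\<^bsub>X\<^esub> y) = \<epsilon> (x \<cdot>\<^bsub>X\<^esub> t (\<epsilon> y))"
      by (rule X_eqI[where U=A, OF _ _ x]) (use y conjunct2[OF e] in \<open>simp_all add: ls4\<close>)
  }
  {
    assume a: "a \<in> car A"
    show "ext fscl (\<lambda>y z. pt (y \<cdot>\<^bsub>X\<^esub> t a) z) (\<Delta> x) = ext fscl (\<lambda>y z. pt y (z \<cdot>\<^bsub>X\<^esub> s a)) (\<Delta> x)"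
      by (rule takeuchi_D[OF x a])
    assume b: "b \<in> car A"
    have st: "s a \<cdot>\<^bsub>X\<^esub> (t b \<cdot>\<^bsub>X\<^esub> (s c \<cdot>\<^bsub>X\<^esub> t d)) = s (a \<cdot>\<^bsub>A\<^esub> c) \<cdot>\<^bsub>X\<^esub> t (d \<cdot>\<^bsub>A\<^esub> b)"
      if "c \<in> car A" "d \<in> car A" for c d
      using a b that by (simp add: s_mul t_mul X.assoc ts_left)
    show "\<Delta> (s a \<cdot>\<^bsub>X\<^esub> (t b \<cdot>\<^bsub>X\<^esub> x)) = lact T a (ract T (\<Delta> x) b)"
      by (rule X_eqI[where U=T, OF _ _ x]) (use a b in \<open>simp_all add: ls4 st\<close>, simp add: s_mul t_mul)
    show "\<epsilon> (s a \<cdot>\<^bsub>X\<^esub> (t b \<cdot>\<^bsub>X\<^esub> x)) = a \<cdot>\<^bsub>A\<^esub> (\<epsilon> x \<cdot>\<^bsub>A\<^esub> b)"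
      by (rule X_eqI[where U=A, OF _ _ x]) (use a b in \<open>simp_all add: ls4 st\<close>, simp add: A.assoc)
  }
  \<comment> \<open>The summands of the two counit laws and of the antipode law are balanced, which
    permits evaluation on \<open>pt (s a) (t b)\<close>.\<close>
  have bal: "s (\<epsilon> (t c \<cdot>\<^bsub>X\<^esub> y)) \<cdot>\<^bsub>X\<^esub> z = s (\<epsilon> y) \<cdot>\<^bsub>X\<^esub> (s c \<cdot>\<^bsub>X\<^esub> z)"
     "t (\<epsilon> z) \<cdot>\<^bsub>X\<^esub> (t c \<cdot>\<^bsub>X\<^esub> y) = t (\<epsilon> (s c \<cdot>\<^bsub>X\<^esub> z)) \<cdot>\<^bsub>X\<^esub> y"
     "\<tau> (t c \<cdot>\<^bsub>X\<^esub> y) \<cdot>\<^bsub>X\<^esub> z = \<tau> y \<cdot>\<^bsub>X\<^esub> (s c \<cdot>\<^bsub>X\<^esub> z)"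
    if "c \<in> car A" "y \<in> car X" "z \<in> car X" for c y z
  proof -
    have t: "t c \<cdot>\<^bsub>X\<^esub> (s p \<cdot>\<^bsub>X\<^esub> t q) = s p \<cdot>\<^bsub>X\<^esub> t (q \<cdot>\<^bsub>A\<^esub> c)" "s c \<cdot>\<^bsub>X\<^esub> (s p \<cdot>\<^bsub>X\<^esub> t q) = s (c \<cdot>\<^bsub>A\<^esub> p) \<cdot>\<^bsub>X\<^esub> t q"
      if "p \<in> car A" "q \<in> car A" for p q
      using \<open>c \<in> car A\<close> that by (simp_all add: ts_left t_mul s_mul X.assoc)
    show "s (\<epsilon> (t c \<cdot>\<^bsub>X\<^esub> y)) \<cdot>\<^bsub>X\<^esub> z = s (\<epsilon> y) \<cdot>\<^bsub>X\<^esub> (s c \<cdot>\<^bsub>X\<^esub> z)"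
      by (rule X_eqI[where U=X, OF _ _ that(2)]) (use that in \<open>simp_all add: ls4 t\<close>, simp add: s_mul X.assoc)
    show "t (\<epsilon> z) \<cdot>\<^bsub>X\<^esub> (t c \<cdot>\<^bsub>X\<^esub> y) = t (\<epsilon> (s c \<cdot>\<^bsub>X\<^esub> z)) \<cdot>\<^bsub>X\<^esub> y"
      by (rule X_eqI[where U=X, OF _ _ that(3)]) (use that in \<open>simp_all add: ls4 t\<close>, simp add: t_mul X.assoc)
    show "\<tau> (t c \<cdot>\<^bsub>X\<^esub> y) \<cdot>\<^bsub>X\<^esub> z = \<tau> y \<cdot>\<^bsub>X\<^esub> (s c \<cdot>\<^bsub>X\<^esub> z)"
      by (rule X_eqI[where U=X, OF _ _ that(2)])
         (use that in \<open>simp_all add: ls4 t\<close>, simp add: s_mul X.assoc ts_left flip: commute)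
  qed
  note pure = ext_pt[OF X.kspace_axioms, where sc="scl X"]
  show "ext (scl X) (\<lambda>y z. s (\<epsilon> y) \<cdot>\<^bsub>X\<^esub> z) (\<Delta> x) = x"
    by (rule X_eqI[where U=X, OF _ _ x]) (simp_all add: ls4 pure bilI bal)
  show "ext (scl X) (\<lambda>y z. t (\<epsilon> z) \<cdot>\<^bsub>X\<^esub> y) (\<Delta> x) = x"
    by (rule X_eqI[where U=X, OF _ _ x]) (simp_all add: ls4 pure bilI bal ts)
  show "ext (scl X) (\<lambda>y z. \<tau> y \<cdot>\<^bsub>X\<^esub> z) (\<Delta> x) = t (\<epsilon> (\<tau> x))"
    by (rule X_eqI[where U=X, OF _ _ x]) (simp_all add: ls4 pure bilI bal t_mul)
  show "ext fscl (\<lambda>y z. ext fscl (\<lambda>y' y''. pt3 y' (pt y'' z)) (\<Delta> y)) (\<Delta> x) =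
      ext fscl (\<lambda>y z. pt3 y (\<Delta> z)) (\<Delta> x)"
    by (rule coassociative[OF x])
next
  show "lin X T \<Delta>" "lin X A \<epsilon>" by (rule D_lin e_lin)+
  show "\<Delta> (unt X) = pt (unt X) (unt X)" "\<epsilon> (unt X) = unt A"
    using D_s[of "unt A"] e_s[of "unt A"] by simp_all
  show "\<And>a. a \<in> car A \<Longrightarrow> \<tau> (t a) = s a" by simp
  \<comment> \<open>Exchanging the two labels twice is the identity, so bijectivity is
    immediate.\<close>
  have inv: "\<tau> (\<tau> x) = x" if "x \<in> car X" for x
    by (rule X_eqI[where U=X, OF _ _ that]) (simp_all add: ls4 flip: commute)
  show "bij_betw \<tau> (car X) (car X)"
    by (rule bij_betw_byWitness[where f'=\<tau>]) (auto simp: inv)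
  have "\<tau> (x \<cdot>\<^bsub>X\<^esub> y) = \<tau> y \<cdot>\<^bsub>X\<^esub> \<tau> x" if x: "x \<in> car X" and y: "y \<in> car X" for x y
  proof (rule X_eqI[where U=X, OF _ _ x])
    fix a b assume ab: "a \<in> car A" "b \<in> car A"
    show "\<tau> (s a \<cdot>\<^bsub>X\<^esub> t b \<cdot>\<^bsub>X\<^esub> y) = \<tau> y \<cdot>\<^bsub>X\<^esub> \<tau> (s a \<cdot>\<^bsub>X\<^esub> t b)"
    proof (rule X_eqI[where U=X, OF _ _ y])
      fix c d assume cd: "c \<in> car A" "d \<in> car A"
      show "\<tau> (s a \<cdot>\<^bsub>X\<^esub> t b \<cdot>\<^bsub>X\<^esub> (s c \<cdot>\<^bsub>X\<^esub> t d)) = \<tau> (s c \<cdot>\<^bsub>X\<^esub> t d) \<cdot>\<^bsub>X\<^esub> \<tau> (s a \<cdot>\<^bsub>X\<^esub> t b)"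
        using ab cd by (simp add: st_product)
    qed (use ab in \<open>simp_all add: ls4\<close>)
  qed (use y in \<open>simp_all add: ls4\<close>)
  then show "algebra_antimap X X \<tau>"
    using tau_s[of "unt A"] tau_lin by (simp add: algebra_antimap_def)
  \<comment> \<open>The representative of the coproduct selected by \<open>\<gamma>\<close> is
    \<open>s a \<otimes> t b\<close>. As \<open>\<tau>\<close> sends \<open>t b\<close> to
    \<open>s b\<close>, the product is the source of \<open>a \<cdot> b\<close>.\<close>
  have "ext (scl X) (\<lambda>y z. y \<cdot>\<^bsub>X\<^esub> \<tau> z) (\<gamma> (\<Delta> x)) = s (\<epsilon> x)" if x: "x \<in> car X" for x
  proof (rule X_eqI[where U=X, OF _ _ x])
    have l: "lin (tens X X) X (ext (scl X) (\<lambda>y z. y \<cdot>\<^bsub>X\<^esub> \<tau> z))"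
      by (rule lin_tens_ext) simp_all
    show "lin X X (\<lambda>x. ext (scl X) (\<lambda>y z. y \<cdot>\<^bsub>X\<^esub> \<tau> z) (\<gamma> (\<Delta> x)))"
      by (rule lin_comp[OF l lin_comp[OF gamma_lin D_lin]])
    fix a b assume ab: "a \<in> car A" "b \<in> car A"
    show "ext (scl X) (\<lambda>y z. y \<cdot>\<^bsub>X\<^esub> \<tau> z) (\<gamma> (\<Delta> (s a \<cdot>\<^bsub>X\<^esub> t b))) = s (\<epsilon> (s a \<cdot>\<^bsub>X\<^esub> t b))"
      using ab gamma_st[of a "unt A" "t b"] by (simp add: ext_ptens[of X X X] bilI ls4 s_mul)
  qed (simp add: ls4)
  then show "\<exists>\<gamma>. lin T (tens X X) \<gamma> \<and> (\<forall>p\<in>car T. ext fscl pt (\<gamma> p) = p) \<and>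
      (\<forall>x\<in>car X. ext (scl X) (\<lambda>y z. y \<cdot>\<^bsub>X\<^esub> \<tau> z) (\<gamma> (\<Delta> x)) = s (\<epsilon> x))"
    using gamma_lin pt_section by blast
qed (fact source target commute)+

end

section \<open>Tensor products of algebras\<close>

definition talg :: "('k :: field, 'v :: ab_group_add, 'm) alg_scheme \<Rightarrow>
    ('k, 'w :: ab_group_add, 'n) alg_scheme \<Rightarrow> ('k, 'v \<times> 'w \<Rightarrow>\<^sub>0 'k) alg" where
  "talg V W = \<lparr>car = car (tens V W), scl = fscl,
     mul = (\<lambda>x y. ext fscl (\<lambda>a b. ext fscl (\<lambda>c d. ptens V W (a \<cdot>\<^bsub>V\<^esub> c) (b \<cdot>\<^bsub>W\<^esub> d)) y) x),
     unt = ptens V W (unt V) (unt W)\<rparr>"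

lemma talg_simps [simp]: "car (talg V W) = car (tens V W)" "scl (talg V W) = fscl"
  "unt (talg V W) = ptens V W (unt V) (unt W)"
  by (simp_all add: talg_def)

lemma talg_mul:
  "x \<cdot>\<^bsub>talg V W\<^esub> y = ext fscl (\<lambda>a b. ext fscl (\<lambda>c d. ptens V W (a \<cdot>\<^bsub>V\<^esub> c) (b \<cdot>\<^bsub>W\<^esub> d)) y) x"
  by (simp add: talg_def)

lemma lin_talg [simp]: "lin (talg V W) U f = lin (tens V W) U f" "lin Z (talg V W) g = lin Z (tens V W) g"
  by (simp_all add: lin_def)

lemma lin_tens_body:
  "kspace V \<Longrightarrow> kspace W \<Longrightarrow> p \<in> car (tens V W) \<Longrightarrow> kspace Z \<Longrightarrow> kspace U \<Longrightarrow> sc = scl U \<Longrightarrow>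
   (\<And>x y. x \<in> car V \<Longrightarrow> y \<in> car W \<Longrightarrow> lin Z U (\<lambda>v. f v x y)) \<Longrightarrow> lin Z U (\<lambda>v. ext sc (f v) p)"
  using tens_keys lin_ext_body[of U Z p f] by blast

lemma lin_tens_arg:
  "kspace V \<Longrightarrow> kspace W \<Longrightarrow> lin Z (tens V W) g \<Longrightarrow> kspace U \<Longrightarrow> sc = scl U \<Longrightarrow>
   (\<And>x y. x \<in> car V \<Longrightarrow> y \<in> car W \<Longrightarrow> f x y \<in> car U) \<Longrightarrow> lin Z U (\<lambda>v. ext sc f (g v))"
  using lin_comp[OF lin_tens_ext] by metis

lemma ext_tens_closed:
  "kspace V \<Longrightarrow> kspace W \<Longrightarrow> p \<in> car (tens V W) \<Longrightarrow> kspace U \<Longrightarrow> sc = scl U \<Longrightarrow>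
   (\<And>x y. x \<in> car V \<Longrightarrow> y \<in> car W \<Longrightarrow> f x y \<in> car U) \<Longrightarrow> ext sc f p \<in> car U"
  using lin_closed[OF lin_tens_ext] by metis

context
  fixes V :: "('k :: field, 'v :: ab_group_add, 'm) alg_scheme"
    and W :: "('k, 'w :: ab_group_add, 'n) alg_scheme"
  assumes V: "kalgebra V" and W: "kalgebra W"
begin

interpretation V: kalgebra V by (rule V)
interpretation W: kalgebra W by (rule W)

private lemma K: "kspace V" "kspace W" "kspace (tens V W)"
  using kspace_tens V.kspace_axioms W.kspace_axioms by auto

lemma talg_lin_left: "lin (tens V W) (tens V W) (\<lambda>x. x \<cdot>\<^bsub>talg V W\<^esub> y)" if "y \<in> car (tens V W)"
  unfolding talg_mul using that V W K
  by (intro lin_tens_ext[of V W "tens V W"]) (auto intro!: ext_tens_closed[of V W] ptens_closed)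

lemma talg_lin_right: "lin (tens V W) (tens V W) (\<lambda>y. x \<cdot>\<^bsub>talg V W\<^esub> y)" if "x \<in> car (tens V W)"
  unfolding talg_mul using that V W K
  by (intro lin_tens_body[of V W x "tens V W"]) (auto intro!: lin_tens_arg[of V W] lin_id ptens_closed)

lemma talg_mul_closed: "x \<in> car (tens V W) \<Longrightarrow> y \<in> car (tens V W) \<Longrightarrow> x \<cdot>\<^bsub>talg V W\<^esub> y \<in> car (tens V W)"
  using talg_lin_left lin_closed by blast

lemma talg_ptens:
  assumes "a \<in> car V" "b \<in> car W" "c \<in> car V" "d \<in> car W"
  shows "ptens V W a b \<cdot>\<^bsub>talg V W\<^esub> ptens V W c d = ptens V W (a \<cdot>\<^bsub>V\<^esub> c) (b \<cdot>\<^bsub>W\<^esub> d)"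
proof -
  note [simp] = V W K lins clo
  have 1: "ext fscl (\<lambda>c d. ptens V W (a \<cdot>\<^bsub>V\<^esub> c) (b \<cdot>\<^bsub>W\<^esub> d)) (ptens V W c d) =
      ptens V W (a \<cdot>\<^bsub>V\<^esub> c) (b \<cdot>\<^bsub>W\<^esub> d)" if "a \<in> car V" "b \<in> car W" for a b
    using assms that by (intro ext_ptens[of V W "tens V W"]) (simp_all add: bilI)
  have "ptens V W a b \<cdot>\<^bsub>talg V W\<^esub> ptens V W c d =
      ext fscl (\<lambda>a b. ptens V W (a \<cdot>\<^bsub>V\<^esub> c) (b \<cdot>\<^bsub>W\<^esub> d)) (ptens V W a b)"
    unfolding talg_mul using tens_keys[OF K(1,2) ptens_closed[OF K(1,2) assms(1,2)]]
    by (auto intro!: ext_cong 1)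
  also have "\<dots> = ptens V W (a \<cdot>\<^bsub>V\<^esub> c) (b \<cdot>\<^bsub>W\<^esub> d)"
    using assms by (intro ext_ptens[of V W "tens V W"]) (simp_all add: bilI)
  finally show ?thesis .
qed

lemma kalgebra_talg: "kalgebra (talg V W)"
proof (intro kalgebra.intro kalgebra_axioms.intro)
  note [simp] = K V W clo talg_mul_closed talg_ptens V.assoc W.assoc
    lin_comp[OF talg_lin_left] lin_comp[OF talg_lin_right] lin_id
  note eqI = tens_lin_eqI[OF K(1,2), where U="tens V W"]
  show "kspace (talg V W)"
    using K(3) by (simp add: kspace_def)
  show "lin (talg V W) (talg V W) (\<lambda>x. x \<cdot>\<^bsub>talg V W\<^esub> y)" if "y \<in> car (talg V W)" for y
    using talg_lin_left that by simp
  show "lin (talg V W) (talg V W) (\<lambda>y. x \<cdot>\<^bsub>talg V W\<^esub> y)" if "x \<in> car (talg V W)" for x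
    using talg_lin_right that by simp
  show "unt (talg V W) \<cdot>\<^bsub>talg V W\<^esub> x = x" if "x \<in> car (talg V W)" for x
    by (rule eqI[where p=x and g="\<lambda>x. x"]) (use that in simp_all)
  show "x \<cdot>\<^bsub>talg V W\<^esub> unt (talg V W) = x" if "x \<in> car (talg V W)" for x
    by (rule eqI[where p=x and g="\<lambda>x. x"]) (use that in simp_all)
  show "unt (talg V W) \<in> car (talg V W)" by simp
  \<comment> \<open>Associativity is reduced to pure tensors one argument at a time, from the last
    to the first.\<close>
  have 1: "(ptens V W a b \<cdot>\<^bsub>talg V W\<^esub> ptens V W c d) \<cdot>\<^bsub>talg V W\<^esub> z =
      ptens V W a b \<cdot>\<^bsub>talg V W\<^esub> (ptens V W c d \<cdot>\<^bsub>talg V W\<^esub> z)"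
    if "a \<in> car V" "b \<in> car W" "c \<in> car V" "d \<in> car W" "z \<in> car (tens V W)" for a b c d z
    by (rule eqI[OF that(5)]) (use that in simp_all)
  have 2: "(ptens V W a b \<cdot>\<^bsub>talg V W\<^esub> y) \<cdot>\<^bsub>talg V W\<^esub> z =
      ptens V W a b \<cdot>\<^bsub>talg V W\<^esub> (y \<cdot>\<^bsub>talg V W\<^esub> z)"
    if "a \<in> car V" "b \<in> car W" "y \<in> car (tens V W)" "z \<in> car (tens V W)" for a b y z
    by (rule eqI[OF that(3)]) (use that in \<open>simp_all add: 1 del: talg_ptens\<close>)
  show "(x \<cdot>\<^bsub>talg V W\<^esub> y) \<cdot>\<^bsub>talg V W\<^esub> z = x \<cdot>\<^bsub>talg V W\<^esub> (y \<cdot>\<^bsub>talg V W\<^esub> z)"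
    if "x \<in> car (talg V W)" "y \<in> car (talg V W)" "z \<in> car (talg V W)" for x y z
    by (rule eqI[where p=x]) (use that in \<open>simp_all add: 2\<close>)
qed

end

definition opp :: "('k, 'v, 'm) alg_scheme \<Rightarrow> ('k, 'v, 'm) alg_scheme" where
  "opp A = A\<lparr>mul := (\<lambda>x y. y \<cdot>\<^bsub>A\<^esub> x)\<rparr>"

lemma opp_simps [simp]: "car (opp A) = car A" "scl (opp A) = scl A" "unt (opp A) = unt A"
  "x \<cdot>\<^bsub>opp A\<^esub> y = y \<cdot>\<^bsub>A\<^esub> x"
  by (simp_all add: opp_def)

lemma lin_opp [simp]: "lin (opp A) U f = lin A U f" "lin Z (opp A) g = lin Z A g"
  by (simp_all add: lin_def)

lemma kalgebra_opp: "kalgebra A \<Longrightarrow> kalgebra (opp A)"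
proof -
  assume "kalgebra A"
  then interpret kalgebra A .
  show ?thesis
    using kspace_axioms
    by (intro kalgebra.intro kalgebra_axioms.intro) (simp_all add: kspace_def mul_left mul_right assoc)
qed

definition env :: "('k :: field, 'v :: ab_group_add, 'm) alg_scheme \<Rightarrow> ('k, 'v \<times> 'v \<Rightarrow>\<^sub>0 'k) alg" where
  "env A = talg A (opp A)"

text \<open>Tensor products see only carrier and scalars, so \<open>env A\<close> has the carrier of
  the ordinary tensor square.\<close>

lemma tens_opp [simp]: "tens A (opp A) = tens A A" "ptens A (opp A) = ptens A A"
proof -
  have "over_k (opp A) = over_k A" by (simp add: over_k_def)
  then show "tens A (opp A) = tens A A" "ptens A (opp A) = ptens A A"
    unfolding tens_def ptens_def by (simp_all only:)
qed

lemma env_simps [simp]: "car (env A) = car (tens A A)" "scl (env A) = fscl"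
  "unt (env A) = ptens A A (unt A) (unt A)"
  "lin (env A) U f = lin (tens A A) U f" "lin Z (env A) g = lin Z (tens A A) g"
  by (simp_all add: env_def)

lemma kalgebra_env: "kalgebra A \<Longrightarrow> kalgebra (env A)"
  unfolding env_def by (intro kalgebra_talg kalgebra_opp)

lemma env_ptens:
  "kalgebra A \<Longrightarrow> a \<in> car A \<Longrightarrow> b \<in> car A \<Longrightarrow> c \<in> car A \<Longrightarrow> d \<in> car A \<Longrightarrow>
    ptens A A a b \<cdot>\<^bsub>env A\<^esub> ptens A A c d = ptens A A (a \<cdot>\<^bsub>A\<^esub> c) (d \<cdot>\<^bsub>A\<^esub> b)"
  using talg_ptens[OF _ kalgebra_opp, of A A a b c d] by (simp add: env_def)

text \<open>Source and target are the preimages of \<open>a \<otimes> 1\<close> and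
  \<open>1 \<otimes> b\<close>. These commute in the enveloping algebra, and the second depends on
  \<open>b\<close> antimultiplicatively.\<close>

lemma enveloping_isoI:
  assumes A: "kalgebra A" and X: "kalgebra X"
    and F: "lin X (tens A A) F" "bij_betw F (car X) (car (tens A A))"
    and mul: "\<And>x y. x \<in> car X \<Longrightarrow> y \<in> car X \<Longrightarrow> F (x \<cdot>\<^bsub>X\<^esub> y) = F x \<cdot>\<^bsub>env A\<^esub> F y"
    and unt: "F (unt X) = unt (env A)"
  shows "\<exists>s t. enveloping_iso A X s t F"
proof -
  interpret A: kalgebra A by fact
  interpret X: kalgebra X by fact
  note K = A.kspace_axioms
  note [simp] = K A clo
  define G where "G = inv_into (car X) F"
  define s where "s a = G (ptens A A a (unt A))" for a
  define t where "t b = G (ptens A A (unt A) b)" for b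
  have G: "G p \<in> car X" "F (G p) = p" if "p \<in> car (tens A A)" for p
    using that F(2) by (auto simp: bij_betw_def G_def f_inv_into_f inv_into_into)
  have inj: "x = y" if "F x = F y" "x \<in> car X" "y \<in> car X" for x y
    using that F(2) by (auto simp: bij_betw_def inj_on_def)
  have G_lin: "lin (tens A A) X G"
    unfolding G_def by (rule lin_inv_into[OF F(1) X.kspace_axioms F(2)])
  have st: "s a \<in> car X" "t a \<in> car X" "F (s a) = ptens A A a (unt A)" "F (t a) = ptens A A (unt A) a"
    if "a \<in> car A" for a
    using that by (simp_all add: s_def t_def G)
  have "enveloping_iso A X s t F"
  proof (intro enveloping_iso.intro enveloping_iso_axioms.intro A X F(1))
    show "algebra_map A X s"
      using lin_comp[OF G_lin lin_ptens_left[OF K K lin_id A.unt_closed]]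
      by (auto simp: algebra_map_def s_def[abs_def, symmetric] st mul unt env_ptens intro!: inj)
    show "algebra_antimap A X t"
      using lin_comp[OF G_lin lin_ptens_right[OF K K lin_id A.unt_closed]]
      by (auto simp: algebra_antimap_def t_def[abs_def, symmetric] st mul unt env_ptens intro!: inj)
    fix a b assume ab: "a \<in> car A" "b \<in> car A"
    show "s a \<cdot>\<^bsub>X\<^esub> t b = t b \<cdot>\<^bsub>X\<^esub> s a"
      using ab by (intro inj) (simp_all add: st mul env_ptens)
    show "F (s a \<cdot>\<^bsub>X\<^esub> t b) = ptens A A a b"
      using ab by (simp add: st mul env_ptens)
  next
    fix x assume x: "x \<in> car X"
    have Fst: "F (s a \<cdot>\<^bsub>X\<^esub> t b) = ptens A A a b" if "a \<in> car A" "b \<in> car A" for a b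
      using that by (simp add: st mul env_ptens)
    have Fx: "F x \<in> car (tens A A)" using F(1) x by (rule lin_closed)
    note keys = tens_keys[OF K K Fx]
    show "ext (scl X) (\<lambda>a b. s a \<cdot>\<^bsub>X\<^esub> t b) (F x) = x"
    proof (rule inj)
      have "F (ext (scl X) (\<lambda>a b. s a \<cdot>\<^bsub>X\<^esub> t b) (F x)) = ext fscl (\<lambda>a b. F (s a \<cdot>\<^bsub>X\<^esub> t b)) (F x)"
        using keys st by (subst ext_lin_out[OF F(1) X.kspace_axioms]) auto
      also have "\<dots> = ext fscl (ptens A A) (F x)"
        using keys Fst by (intro ext_cong) auto
      finally show "F (ext (scl X) (\<lambda>a b. s a \<cdot>\<^bsub>X\<^esub> t b) (F x)) = F x"
        by (simp add: tens_expand[OF K K Fx])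
      show "ext (scl X) (\<lambda>a b. s a \<cdot>\<^bsub>X\<^esub> t b) (F x) \<in> car X"
        using keys st by (intro ext_closed X.kspace_axioms) auto
    qed (rule x)
  qed
  then show ?thesis by blast
qed

section \<open>Smash products with inner actions\<close>

text \<open>\<open>\<phi>\<close> need not be multiplicative; it is enough that \<open>h \<mapsto> \<phi>(h') \<otimes> \<phi>'(h'')\<close>, with \<open>\<phi>'\<close> the
  convolution inverse of \<open>\<phi>\<close>, is multiplicative as a map into the enveloping algebra.\<close>

locale inner_action = H: kcoalgebra H + A: kalgebra A
  for H :: "('k :: field, 'h :: ab_group_add, 'm) bialg_scheme"
    and A :: "('k, 'v :: ab_group_add, 'n) alg_scheme"
    and \<phi> \<phi>' :: "'h \<Rightarrow> 'v" and act :: "'h \<Rightarrow> 'v \<Rightarrow> 'v" +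
  assumes phi_lin: "lin H A \<phi>" and phi'_lin: "lin H A \<phi>'"
    and phi_inj: "inj_on \<phi> (car H)" and phi'_bij: "bij_betw \<phi>' (car H) (car A)"
    and conv_right: "h \<in> car H \<Longrightarrow> sw H (scl A) h (\<lambda>x y. \<phi> x \<cdot>\<^bsub>A\<^esub> \<phi>' y) = scl A (cou H h) (unt A)"
    and conv_left: "h \<in> car H \<Longrightarrow> sw H (scl A) h (\<lambda>x y. \<phi>' x \<cdot>\<^bsub>A\<^esub> \<phi> y) = scl A (cou H h) (unt A)"
    and unt_H: "unt H \<in> car H" "cop H (unt H) = ptens H H (unt H) (unt H)"
    and phi_unt: "\<phi> (unt H) = unt A" "\<phi>' (unt H) = unt A"
    and mul_H: "h \<in> car H \<Longrightarrow> g \<in> car H \<Longrightarrow> h \<cdot>\<^bsub>H\<^esub> g \<in> car H"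
    and theta_mul: "h \<in> car H \<Longrightarrow> g \<in> car H \<Longrightarrow>
      sw H fscl (h \<cdot>\<^bsub>H\<^esub> g) (\<lambda>x y. ptens A A (\<phi> x) (\<phi>' y)) =
      sw H fscl h (\<lambda>x y. ptens A A (\<phi> x) (\<phi>' y)) \<cdot>\<^bsub>env A\<^esub> sw H fscl g (\<lambda>x y. ptens A A (\<phi> x) (\<phi>' y))"
    and act_eq: "h \<in> car H \<Longrightarrow> c \<in> car A \<Longrightarrow> act h c = sw H (scl A) h (\<lambda>x y. \<phi> x \<cdot>\<^bsub>A\<^esub> c \<cdot>\<^bsub>A\<^esub> \<phi>' y)"
begin

definition \<theta> :: "'h \<Rightarrow> ('v \<times> 'v \<Rightarrow>\<^sub>0 'k)" where
  "\<theta> h = sw H fscl h (\<lambda>x y. ptens A A (\<phi> x) (\<phi>' y))"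

lemma phi_closed: "h \<in> car H \<Longrightarrow> \<phi> h \<in> car A" "h \<in> car H \<Longrightarrow> \<phi>' h \<in> car A"
  using phi_lin phi'_lin by (auto simp: lin_def)

lemma lin_phi: "lin V H f \<Longrightarrow> lin V A (\<lambda>x. \<phi> (f x))" "lin V H f \<Longrightarrow> lin V A (\<lambda>x. \<phi>' (f x))"
  using lin_comp[OF phi_lin] lin_comp[OF phi'_lin] by auto

lemmas kspaces = H.kspace_axioms A.kspace_axioms kspace_tens[OF A.kspace_axioms A.kspace_axioms]
  kspace_tens[OF A.kspace_axioms H.kspace_axioms]

lemmas env_A = kalgebra_env[OF A.kalgebra_axioms]

lemmas rls = lins clo kspaces A.kalgebra_axioms H.kcoprod_axioms phi_closed lin_phi unt_H(1) H.cou_lin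

lemma theta_lin: "lin H (tens A A) \<theta>"
  unfolding \<theta>_def[abs_def] by (simp add: rls)

lemma theta_closed [simp]: "h \<in> car H \<Longrightarrow> \<theta> h \<in> car (tens A A)"
  using theta_lin by (rule lin_closed)

lemma theta_unt: "\<theta> (unt H) = unt (env A)"
proof -
  have b: "bil H H (tens A A) (\<lambda>x y. ptens A A (\<phi> x) (\<phi>' y))"
    by (rule bilI) (simp_all add: rls)
  show ?thesis
    using ext_ptens[OF H.kspace_axioms H.kspace_axioms kspaces(3) b unt_H(1) unt_H(1), of fscl]
    by (simp add: \<theta>_def sw_def sw2_def unt_H(2) phi_unt)
qed

lemma theta_mul': "h \<in> car H \<Longrightarrow> g \<in> car H \<Longrightarrow> \<theta> (h \<cdot>\<^bsub>H\<^esub> g) = \<theta> h \<cdot>\<^bsub>env A\<^esub> \<theta> g"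
  unfolding \<theta>_def by (rule theta_mul)

definition \<psi> :: "'v \<Rightarrow> 'h" where "\<psi> = inv_into (car H) \<phi>'"

lemma psi_closed: "a \<in> car A \<Longrightarrow> \<psi> a \<in> car H" and phi'_psi: "a \<in> car A \<Longrightarrow> \<phi>' (\<psi> a) = a"
  and psi_phi': "h \<in> car H \<Longrightarrow> \<psi> (\<phi>' h) = h"
  using phi'_bij by (auto simp: bij_betw_def \<psi>_def f_inv_into_f inv_into_into)

lemma psi_lin: "lin A H \<psi>"
  unfolding \<psi>_def by (rule lin_inv_into[OF phi'_lin H.kspace_axioms phi'_bij])

lemma lin_psi: "lin V A f \<Longrightarrow> lin V H (\<lambda>x. \<psi> (f x))"
  using lin_comp[OF psi_lin] .

text \<open>As \<open>\<phi>'\<close> is invertible, the counit of \<open>H\<close> can be applied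
  to the second factor through \<open>\<psi>\<close>. This recovers \<open>\<phi> h\<close> from
  \<open>\<theta> h\<close>, and \<open>\<phi>\<close> is injective.\<close>

lemma theta_inj: "inj_on \<theta> (car H)"
proof (rule inj_on_lin[OF theta_lin H.kspace_axioms])
  fix h assume h: "h \<in> car H" and 0: "\<theta> h = 0"
  let ?e = "ext (scl A) (\<lambda>a b. scl A (cou H (\<psi> b)) a)"
  note [simp] = rls psi_closed lin_psi lin_comp[OF H.cou_lin]
  have b: "bil A A A (\<lambda>a b. scl A (cou H (\<psi> b)) a)"
    by (rule bilI) simp_all
  have l: "lin (tens A A) A ?e"
    by (rule lin_tens_ext) simp_all
  have "?e (\<theta> h) = sw H (scl A) h (\<lambda>x y. ?e (ptens A A (\<phi> x) (\<phi>' y)))"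
    unfolding \<theta>_def using h by (intro H.sw_out[OF l kspaces(3)]) simp_all
  also have "\<dots> = sw H (scl A) h (\<lambda>x y. scl A (cou H y) (\<phi> x))"
    using h by (intro H.sw_cong) (simp_all add: ext_ptens[OF _ _ _ b] psi_phi')
  also have "\<dots> = \<phi> h"
    using h by (intro H.sw_counit_right[OF phi_lin]) simp_all
  finally have "\<phi> h = \<phi> 0" using 0 by (simp add: lin_0[OF phi_lin])
  then show "h = 0" using h phi_inj by (auto dest: inj_onD)
qed

lemma kalgebra_H: "kalgebra H"
  by (rule kalgebra_pullback[where f=\<theta>, OF H.kspace_axioms env_A _ theta_inj mul_H _ unt_H(1) theta_unt])
     (simp_all add: theta_lin theta_mul')

lemma act_lin: "c \<in> car A \<Longrightarrow> lin H A (\<lambda>h. act h c)" "h \<in> car H \<Longrightarrow> lin A A (act h)"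
proof -
  show "lin H A (\<lambda>h. act h c)" if "c \<in> car A"
    using that by (subst lin_cong[OF H.kspace_axioms act_eq]) (simp_all add: rls)
  show "lin A A (act h)" if "h \<in> car H"
    using that by (subst lin_cong[OF A.kspace_axioms act_eq]) (simp_all add: rls)
qed

lemma act_closed: "h \<in> car H \<Longrightarrow> c \<in> car A \<Longrightarrow> act h c \<in> car A"
  using act_lin lin_closed by blast

text \<open>The canonical action of the enveloping algebra on \<open>A\<close>. The action of
  \<open>H\<close> is its pullback along \<open>\<theta>\<close>, so its compatibility with products
  of \<open>H\<close> follows from multiplicativity of \<open>\<theta>\<close>.\<close>

definition sandwich :: "('v \<times> 'v \<Rightarrow>\<^sub>0 'k) \<Rightarrow> 'v \<Rightarrow> 'v" where
  "sandwich z c = ext (scl A) (\<lambda>a b. a \<cdot>\<^bsub>A\<^esub> c \<cdot>\<^bsub>A\<^esub> b) z"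

lemma sandwich_lin: "c \<in> car A \<Longrightarrow> lin (tens A A) A (\<lambda>z. sandwich z c)"
  "z \<in> car (tens A A) \<Longrightarrow> lin A A (sandwich z)"
  unfolding sandwich_def[abs_def]
  by (intro lin_tens_ext lin_tens_body[of A A]; simp add: rls)+

lemma sandwich_ptens: "a \<in> car A \<Longrightarrow> b \<in> car A \<Longrightarrow> c \<in> car A \<Longrightarrow> sandwich (ptens A A a b) c = a \<cdot>\<^bsub>A\<^esub> c \<cdot>\<^bsub>A\<^esub> b"
  unfolding sandwich_def by (rule ext_ptens[of A A A]) (simp_all add: bilI rls)

lemma sandwich_mul:
  assumes "z \<in> car (tens A A)" "w \<in> car (tens A A)" "c \<in> car A"
  shows "sandwich (z \<cdot>\<^bsub>env A\<^esub> w) c = sandwich z (sandwich w c)"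
proof -
  interpret E: kalgebra "env A" by (rule env_A)
  note [simp] = rls env_ptens sandwich_ptens A.assoc lin_closed[OF sandwich_lin(1)]
    lin_comp[OF sandwich_lin(1)] lin_comp[OF sandwich_lin(2)]
    E.mul_left[simplified] E.mul_right[simplified] E.mul_closed[simplified]
  note eqI = tens_lin_eqI[OF A.kspace_axioms A.kspace_axioms, where U=A]
  have "sandwich (ptens A A a b \<cdot>\<^bsub>env A\<^esub> w) c = sandwich (ptens A A a b) (sandwich w c)"
    if "a \<in> car A" "b \<in> car A" for a b
    by (rule eqI[where p=w, OF assms(2)]) (use that assms in simp_all)
  then show ?thesis
    using assms by - (rule eqI[where p=z, OF assms(1)], simp_all)
qed

lemma act_sandwich: "h \<in> car H \<Longrightarrow> c \<in> car A \<Longrightarrow> act h c = sandwich (\<theta> h) c"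
  unfolding \<theta>_def
  by (subst H.sw_out[OF sandwich_lin(1)])
     (simp_all add: rls act_eq sandwich_ptens cong: H.sw_cong)

text \<open>Coassociativity brings \<open>\<phi>' x2\<close> next to \<open>\<phi> y1\<close>
  between the factors \<open>a\<close> and \<open>c\<close>, where \<open>conv_left\<close> cancels
  them.\<close>

lemma act_on_product:
  assumes h: "h \<in> car H" and a: "a \<in> car A" and c: "c \<in> car A"
  shows "act h (a \<cdot>\<^bsub>A\<^esub> c) = sw H (scl A) h (\<lambda>x y. act x a \<cdot>\<^bsub>A\<^esub> act y c)"
proof -
  let ?s = "scl A"
  note [simp] = rls lin_mult_left
  have "sw H ?s h (\<lambda>x y. act x a \<cdot>\<^bsub>A\<^esub> act y c) = sw H ?s h (\<lambda>x y. sw H ?s x (\<lambda>x1 x2. sw H ?s y (\<lambda>y1 y2.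
      (\<phi> x1 \<cdot>\<^bsub>A\<^esub> a \<cdot>\<^bsub>A\<^esub> \<phi>' x2) \<cdot>\<^bsub>A\<^esub> (\<phi> y1 \<cdot>\<^bsub>A\<^esub> c \<cdot>\<^bsub>A\<^esub> \<phi>' y2))))"
    using h a c by (simp add: act_eq outs cong: H.sw_cong)
      (intro H.sw_cong sw_swap[OF A.ambient]; simp)
  also have "\<dots> = sw H ?s h (\<lambda>x1 z. sw H ?s z (\<lambda>x2 y. sw H ?s y (\<lambda>y1 y2.
      (\<phi> x1 \<cdot>\<^bsub>A\<^esub> a \<cdot>\<^bsub>A\<^esub> \<phi>' x2) \<cdot>\<^bsub>A\<^esub> (\<phi> y1 \<cdot>\<^bsub>A\<^esub> c \<cdot>\<^bsub>A\<^esub> \<phi>' y2))))"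
    using h a c by (simp add: H.sw_coassoc[of A])
  also have "\<dots> = sw H ?s h (\<lambda>x1 z. sw H ?s z (\<lambda>w y2. sw H ?s w (\<lambda>x2 y1.
      (\<phi> x1 \<cdot>\<^bsub>A\<^esub> a) \<cdot>\<^bsub>A\<^esub> (\<phi>' x2 \<cdot>\<^bsub>A\<^esub> \<phi> y1) \<cdot>\<^bsub>A\<^esub> (c \<cdot>\<^bsub>A\<^esub> \<phi>' y2))))"
    using h a c by (simp add: H.sw_coassoc[of A] A.assoc cong: H.sw_cong)
  also have "\<dots> = sw H ?s h (\<lambda>x1 z. sw H ?s z (\<lambda>w y2.
      (\<phi> x1 \<cdot>\<^bsub>A\<^esub> a) \<cdot>\<^bsub>A\<^esub> (sw H ?s w (\<lambda>x2 y1. \<phi>' x2 \<cdot>\<^bsub>A\<^esub> \<phi> y1)) \<cdot>\<^bsub>A\<^esub> (c \<cdot>\<^bsub>A\<^esub> \<phi>' y2)))"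
    using h a c by (simp add: outs cong: H.sw_cong)
  also have "\<dots> = sw H ?s h (\<lambda>x1 z. sw H ?s z (\<lambda>w y2.
      ?s (cou H w) (\<phi> x1 \<cdot>\<^bsub>A\<^esub> a \<cdot>\<^bsub>A\<^esub> (c \<cdot>\<^bsub>A\<^esub> \<phi>' y2))))"
    using h a c by (simp add: conv_left A.scl_mul_left A.scl_mul_right cong: H.sw_cong)
  also have "\<dots> = act h (a \<cdot>\<^bsub>A\<^esub> c)"
    using h a c by (simp add: H.sw_counit_left[of A _ ?s] act_eq A.assoc cong: H.sw_cong)
  finally show ?thesis ..
qed

text \<open>The bialgebra axioms enter as a premise because the locale does not state that the
  coproduct of \<open>H\<close> is multiplicative.\<close>

lemma module_algebraI: "kbialgebra H \<Longrightarrow> module_algebra H A act"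
proof (intro module_algebra.intro module_algebra_axioms.intro A.kalgebra_axioms act_lin)
  note [simp] = rls
  show "act (h \<cdot>\<^bsub>H\<^esub> g) a = act h (act g a)" if "h \<in> car H" "g \<in> car H" "a \<in> car A" for h g a
    using that by (simp add: act_sandwich mul_H theta_mul' sandwich_mul lin_closed[OF sandwich_lin(1)])
  show "act (unt H) a = a" if "a \<in> car A" for a
    using that by (simp add: act_sandwich theta_unt sandwich_ptens)
  show "act h (a \<cdot>\<^bsub>A\<^esub> c) = sw2 H (scl A) (\<lambda>h' h''. act h' a \<cdot>\<^bsub>A\<^esub> act h'' c) h"
    if "h \<in> car H" "a \<in> car A" "c \<in> car A" for h a c
    unfolding sw2_eq_sw using that by (rule act_on_product)
  show "act h (unt A) = scl A (cou H h) (unt A)" if "h \<in> car H" for h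
    using that by (simp add: act_eq conv_right cong: H.sw_cong)
qed

end

text \<open>The products of both doubles and of the smash product, and the Drinfeld action, are
  double extensions of this form; the lemma gives their values on pure tensors.\<close>

lemma ext_ext_ptens:
  assumes "kspace V" "kspace W" "kspace V'" "kspace W'" "kspace U" "sc = scl U"
    and "\<And>a h. a \<in> car V \<Longrightarrow> h \<in> car W \<Longrightarrow> bil V' W' U (f a h)"
    and "bil V W U (\<lambda>a h. f a h c g)"
    and "a \<in> car V" "h \<in> car W" "c \<in> car V'" "g \<in> car W'"
  shows "ext sc (\<lambda>a h. ext sc (f a h) (ptens V' W' c g)) (ptens V W a h) = f a h c g"
proof -
  have "ext sc (\<lambda>a h. ext sc (f a h) (ptens V' W' c g)) (ptens V W a h) =
      ext sc (\<lambda>a h. f a h c g) (ptens V W a h)"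
    using tens_keys[OF assms(1,2) ptens_closed[OF assms(1,2,9,10)]] assms
    by (auto intro!: ext_cong ext_ptens)
  also have "\<dots> = f a h c g"
    using assms by (intro ext_ptens) auto
  finally show ?thesis .
qed

section \<open>The smash product as an enveloping algebra\<close>

context inner_action
begin

abbreviation "X \<equiv> smash A H act"

lemma smash_simps [simp]: "car X = car (tens A H)" "scl X = fscl" "unt X = ptens A H (unt A) (unt H)"
  and smash_mul: "x \<cdot>\<^bsub>X\<^esub> y = ext fscl (\<lambda>a h. ext fscl (\<lambda>c g. sw H fscl h (\<lambda>h' h''.
      ptens A H (a \<cdot>\<^bsub>A\<^esub> act h' c) (h'' \<cdot>\<^bsub>H\<^esub> g))) y) x"
  by (simp_all add: smash_def sw2_eq_sw)

lemma lin_act: "c \<in> car A \<Longrightarrow> lin V H f \<Longrightarrow> lin V A (\<lambda>v. act (f v) c)"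
  "h \<in> car H \<Longrightarrow> lin V A g \<Longrightarrow> lin V A (\<lambda>v. act h (g v))"
  using lin_comp[OF act_lin(1)] lin_comp[OF act_lin(2)] by auto

lemmas rls' = rls kalgebra_H act_closed lin_act mul_H

lemma smash_ptens:
  assumes "a \<in> car A" "h \<in> car H" "c \<in> car A" "g \<in> car H"
  shows "ptens A H a h \<cdot>\<^bsub>X\<^esub> ptens A H c g = sw H fscl h (\<lambda>h' h''. ptens A H (a \<cdot>\<^bsub>A\<^esub> act h' c) (h'' \<cdot>\<^bsub>H\<^esub> g))"
  unfolding smash_mul using assms
  by (intro ext_ext_ptens[OF _ _ _ _ kspaces(4), where f="\<lambda>a h c g. sw H fscl h (\<lambda>h' h''. ptens A H (a \<cdot>\<^bsub>A\<^esub> act h' c) (h'' \<cdot>\<^bsub>H\<^esub> g))"])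
     (simp_all add: bilI rls')

lemma smash_lin: "y \<in> car (tens A H) \<Longrightarrow> lin (tens A H) (tens A H) (\<lambda>x. x \<cdot>\<^bsub>X\<^esub> y)"
  "x \<in> car (tens A H) \<Longrightarrow> lin (tens A H) (tens A H) (\<lambda>y. x \<cdot>\<^bsub>X\<^esub> y)"
proof -
  note [simp] = rls'
  have 1: "lin (tens A H) (tens A H) (ext fscl (\<lambda>c g. sw H fscl h (\<lambda>h' h''. ptens A H (a \<cdot>\<^bsub>A\<^esub> act h' c) (h'' \<cdot>\<^bsub>H\<^esub> g))))"
    if "a \<in> car A" "h \<in> car H" for a h
    using that by (intro lin_tens_ext) simp_all
  show "lin (tens A H) (tens A H) (\<lambda>x. x \<cdot>\<^bsub>X\<^esub> y)" if "y \<in> car (tens A H)"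
    unfolding smash_mul by (intro lin_tens_ext) (use that lin_closed[OF 1] in simp_all)
  show "lin (tens A H) (tens A H) (\<lambda>y. x \<cdot>\<^bsub>X\<^esub> y)" if "x \<in> car (tens A H)"
    unfolding smash_mul by (rule lin_tens_body[of A H x]) (use that 1 in simp_all)
qed

lemma smash_closed: "x \<in> car (tens A H) \<Longrightarrow> y \<in> car (tens A H) \<Longrightarrow> x \<cdot>\<^bsub>X\<^esub> y \<in> car (tens A H)"
  using smash_lin lin_closed by blast

sublocale E: kalgebra "env A" by (rule env_A)

lemmas E_simps [simp] = E.mul_closed[simplified] E.unt_left[simplified] E.unt_right[simplified]
lemmas E_lin = E.lin_mul_left[simplified] E.lin_mul_right[simplified]

definition \<Theta> :: "('v \<times> 'h \<Rightarrow>\<^sub>0 'k) \<Rightarrow> ('v \<times> 'v \<Rightarrow>\<^sub>0 'k)" where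
  "\<Theta> = ext fscl (\<lambda>a h. ptens A A a (unt A) \<cdot>\<^bsub>env A\<^esub> \<theta> h)"

lemma Theta_lin: "lin (tens A H) (tens A A) \<Theta>"
  unfolding \<Theta>_def by (intro lin_tens_ext) (simp_all add: rls)

lemma lin_theta: "lin V H f \<Longrightarrow> lin V (tens A A) (\<lambda>v. \<theta> (f v))"
  using lin_comp[OF theta_lin] .

lemma Theta_ptens: "a \<in> car A \<Longrightarrow> h \<in> car H \<Longrightarrow> \<Theta> (ptens A H a h) = ptens A A a (unt A) \<cdot>\<^bsub>env A\<^esub> \<theta> h"
  unfolding \<Theta>_def by (intro ext_ptens[of A H "tens A A"]) (simp_all add: rls bilI E_lin lin_theta)

text \<open>The defining relation of the smash product, realised in the enveloping algebra.
  Expanding action and \<open>\<theta>\<close> gives legs \<open>x1, x2, y1, y2\<close>, and the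
  middle pair \<open>\<phi>' x2\<close>, \<open>\<phi> y1\<close> cancels.\<close>

lemma act_theta:
  assumes h: "h \<in> car H" and c: "c \<in> car A"
  shows "sw H fscl h (\<lambda>x y. ptens A A (act x c) (unt A) \<cdot>\<^bsub>env A\<^esub> \<theta> y) = \<theta> h \<cdot>\<^bsub>env A\<^esub> ptens A A c (unt A)"
proof -
  note [simp] = rls' env_ptens E.kalgebra_axioms
  note T = H.sw_coassoc[of "tens A A" fscl]
  have "sw H fscl h (\<lambda>x y. ptens A A (act x c) (unt A) \<cdot>\<^bsub>env A\<^esub> \<theta> y) =
      sw H fscl h (\<lambda>x y. sw H fscl y (\<lambda>y1 y2. ptens A A (act x c \<cdot>\<^bsub>A\<^esub> \<phi> y1) (\<phi>' y2)))"
    using h c by (simp add: \<theta>_def outs cong: H.sw_cong)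
  also have "\<dots> = sw H fscl h (\<lambda>x y. sw H fscl x (\<lambda>x1 x2. sw H fscl y (\<lambda>y1 y2.
       ptens A A (\<phi> x1 \<cdot>\<^bsub>A\<^esub> c \<cdot>\<^bsub>A\<^esub> \<phi>' x2 \<cdot>\<^bsub>A\<^esub> \<phi> y1) (\<phi>' y2))))"
    using h c by (simp add: act_eq outs cong: H.sw_cong)
      (intro H.sw_cong sw_swap[OF vector_space_fscl]; simp)
  also have "\<dots> = sw H fscl h (\<lambda>x1 z. sw H fscl z (\<lambda>x2 y. sw H fscl y (\<lambda>y1 y2.
       ptens A A (\<phi> x1 \<cdot>\<^bsub>A\<^esub> c \<cdot>\<^bsub>A\<^esub> \<phi>' x2 \<cdot>\<^bsub>A\<^esub> \<phi> y1) (\<phi>' y2))))"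
    using h c by (simp add: T)
  also have "\<dots> = sw H fscl h (\<lambda>x1 z. sw H fscl z (\<lambda>w y2. sw H fscl w (\<lambda>x2 y1.
       ptens A A ((\<phi> x1 \<cdot>\<^bsub>A\<^esub> c) \<cdot>\<^bsub>A\<^esub> (\<phi>' x2 \<cdot>\<^bsub>A\<^esub> \<phi> y1)) (\<phi>' y2))))"
    using h c by (simp add: T A.assoc cong: H.sw_cong)
  also have "\<dots> = sw H fscl h (\<lambda>x1 z. sw H fscl z (\<lambda>w y2.
       ptens A A ((\<phi> x1 \<cdot>\<^bsub>A\<^esub> c) \<cdot>\<^bsub>A\<^esub> (sw H (scl A) w (\<lambda>x2 y1. \<phi>' x2 \<cdot>\<^bsub>A\<^esub> \<phi> y1))) (\<phi>' y2)))"
    using h c by (simp add: outs cong: H.sw_cong)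
  also have "\<dots> = sw H fscl h (\<lambda>x1 z. sw H fscl z (\<lambda>w y2.
       fscl (cou H w) (ptens A A (\<phi> x1 \<cdot>\<^bsub>A\<^esub> c) (\<phi>' y2))))"
    using h c by (simp add: conv_left A.scl_mul_right lin_scl[OF bil_left[OF ptens_bil]] cong: H.sw_cong)
  also have "\<dots> = sw H fscl h (\<lambda>x1 z. ptens A A (\<phi> x1 \<cdot>\<^bsub>A\<^esub> c) (\<phi>' z))"
    using h c by (simp add: H.sw_counit_left[of "tens A A" _ fscl] cong: H.sw_cong)
  also have "\<dots> = \<theta> h \<cdot>\<^bsub>env A\<^esub> ptens A A c (unt A)"
    using h c by (simp add: \<theta>_def outs cong: H.sw_cong)
  finally show ?thesis .
qed

text \<open>The images of \<open>A\<close> and of \<open>H\<close> multiply correctly by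
  \<open>env_ptens\<close> and \<open>theta_mul'\<close>, and \<open>act_theta\<close> supplies the
  relation between them.\<close>

lemma Theta_mul:
  assumes x: "x \<in> car (tens A H)" and y: "y \<in> car (tens A H)"
  shows "\<Theta> (x \<cdot>\<^bsub>X\<^esub> y) = \<Theta> x \<cdot>\<^bsub>env A\<^esub> \<Theta> y"
proof -
  note [simp] = rls' E.kalgebra_axioms
  have pure: "\<Theta> (ptens A H a h \<cdot>\<^bsub>X\<^esub> ptens A H c g) = \<Theta> (ptens A H a h) \<cdot>\<^bsub>env A\<^esub> \<Theta> (ptens A H c g)"
    if [simp]: "a \<in> car A" "h \<in> car H" "c \<in> car A" "g \<in> car H" for a h c g
  proof -
    have "\<Theta> (ptens A H a h \<cdot>\<^bsub>X\<^esub> ptens A H c g) = sw H fscl h (\<lambda>h' h''. \<Theta> (ptens A H (a \<cdot>\<^bsub>A\<^esub> act h' c) (h'' \<cdot>\<^bsub>H\<^esub> g)))"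
      unfolding smash_ptens[OF that] by (intro H.sw_out[OF Theta_lin kspaces(4)]) simp_all
    also have "\<dots> = sw H fscl h (\<lambda>h' h''. ptens A A a (unt A) \<cdot>\<^bsub>env A\<^esub>
        (ptens A A (act h' c) (unt A) \<cdot>\<^bsub>env A\<^esub> \<theta> h'') \<cdot>\<^bsub>env A\<^esub> \<theta> g)"
      by (intro H.sw_cong) (simp_all add: Theta_ptens theta_mul' E.assoc[simplified, symmetric] env_ptens)
    also have "\<dots> = ptens A A a (unt A) \<cdot>\<^bsub>env A\<^esub>
        (sw H fscl h (\<lambda>h' h''. ptens A A (act h' c) (unt A) \<cdot>\<^bsub>env A\<^esub> \<theta> h'')) \<cdot>\<^bsub>env A\<^esub> \<theta> g"
      by (simp add: mul_sw_left[OF E.kalgebra_axioms] mul_sw_right[OF E.kalgebra_axioms])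
    also have "\<dots> = \<Theta> (ptens A H a h) \<cdot>\<^bsub>env A\<^esub> \<Theta> (ptens A H c g)"
      by (simp add: act_theta Theta_ptens E.assoc[simplified])
    finally show ?thesis .
  qed
  note eqI = tens_lin_eqI[OF A.kspace_axioms H.kspace_axioms, where U="tens A A"]
  note l = lin_comp[OF Theta_lin] lin_comp[OF smash_lin(1)] lin_comp[OF smash_lin(2)] lin_closed[OF Theta_lin] smash_lin
     Theta_lin
  have "\<Theta> (ptens A H a h \<cdot>\<^bsub>X\<^esub> y) = \<Theta> (ptens A H a h) \<cdot>\<^bsub>env A\<^esub> \<Theta> y" if "a \<in> car A" "h \<in> car H" for a h
    by (rule eqI[where p=y, OF y]) (use that in \<open>simp_all add: pure l E_lin\<close>)
  then show ?thesis
    by - (rule eqI[where p=x, OF x], use y in \<open>simp_all add: l E_lin\<close>)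
qed

lemma Theta_bij: "bij_betw \<Theta> (car (tens A H)) (car (tens A A))"
proof -
  note [simp] = rls' E.kalgebra_axioms env_ptens psi_closed lin_psi
  \<comment> \<open>With \<open>b = \<phi>' k\<close>, the forward map produces
    \<open>a \<cdot> \<phi> k' \<otimes> \<phi>' k''\<close>. Its inverse reads \<open>k\<close> off
    the second factor and multiplies the first by \<open>\<phi>'\<close> of a leg of
    \<open>k\<close>, which undoes \<open>\<phi>\<close> by convolution.\<close>
  define \<Psi> where "\<Psi> = ext fscl (\<lambda>a b. sw H fscl (\<psi> b) (\<lambda>x y. ptens A H (a \<cdot>\<^bsub>A\<^esub> \<phi>' x) y))"
  have Psi_lin: "lin (tens A A) (tens A H) \<Psi>"
    unfolding \<Psi>_def by (intro lin_tens_ext) simp_all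
  have Psi: "\<Psi> (ptens A A a b) = sw H fscl (\<psi> b) (\<lambda>x y. ptens A H (a \<cdot>\<^bsub>A\<^esub> \<phi>' x) y)"
    if "a \<in> car A" "b \<in> car A" for a b
    unfolding \<Psi>_def using that by (intro ext_ptens[of A A "tens A H"]) (simp_all add: bilI)
  have Th: "\<Theta> (ptens A H a h) = sw H fscl h (\<lambda>x y. ptens A A (a \<cdot>\<^bsub>A\<^esub> \<phi> x) (\<phi>' y))"
    if "a \<in> car A" "h \<in> car H" for a h
    using that by (simp add: Theta_ptens \<theta>_def outs cong: H.sw_cong)
  have 1: "\<Psi> (\<Theta> p) = p" if "p \<in> car (tens A H)" for p
  proof (rule tens_lin_eqI[OF A.kspace_axioms H.kspace_axioms that, where U="tens A H"])
    fix a h assume [simp]: "a \<in> car A" "h \<in> car H"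
    have "\<Psi> (\<Theta> (ptens A H a h)) = sw H fscl h (\<lambda>x y. \<Psi> (ptens A A (a \<cdot>\<^bsub>A\<^esub> \<phi> x) (\<phi>' y)))"
      unfolding Th[OF \<open>a \<in> car A\<close> \<open>h \<in> car H\<close>] by (intro H.sw_out[OF Psi_lin kspaces(3)]) simp_all
    also have "\<dots> = sw H fscl h (\<lambda>x y. sw H fscl y (\<lambda>y1 y2. ptens A H (a \<cdot>\<^bsub>A\<^esub> (\<phi> x \<cdot>\<^bsub>A\<^esub> \<phi>' y1)) y2))"
      by (intro H.sw_cong, simp_all add: Psi psi_phi') (simp add: A.assoc cong: H.sw_cong)
    also have "\<dots> = sw H fscl h (\<lambda>x y2. ptens A H (a \<cdot>\<^bsub>A\<^esub> (sw H (scl A) x (\<lambda>x y1. \<phi> x \<cdot>\<^bsub>A\<^esub> \<phi>' y1))) y2)"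
      by (simp add: H.sw_coassoc[of "tens A H" fscl, symmetric] outs cong: H.sw_cong)
    also have "\<dots> = ptens A H a h"
      by (simp add: conv_right A.scl_mul_right lin_scl[OF bil_left[OF ptens_bil]] 
          H.sw_counit_left[of "tens A H" _ fscl] cong: H.sw_cong)
    finally show "\<Psi> (\<Theta> (ptens A H a h)) = ptens A H a h" .
  qed (simp_all add: lin_id lin_comp[OF Psi_lin] Theta_lin)
  have 2: "\<Theta> (\<Psi> p) = p" if "p \<in> car (tens A A)" for p
  proof (rule tens_lin_eqI[OF A.kspace_axioms A.kspace_axioms that, where U="tens A A"])
    fix a b assume [simp]: "a \<in> car A" "b \<in> car A"
    have "\<Theta> (\<Psi> (ptens A A a b)) = sw H fscl (\<psi> b) (\<lambda>x y. \<Theta> (ptens A H (a \<cdot>\<^bsub>A\<^esub> \<phi>' x) y))"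
      unfolding Psi[OF \<open>a \<in> car A\<close> \<open>b \<in> car A\<close>] by (intro H.sw_out[OF Theta_lin kspaces(4)]) simp_all
    also have "\<dots> = sw H fscl (\<psi> b) (\<lambda>x y. sw H fscl y (\<lambda>y1 y2. ptens A A (a \<cdot>\<^bsub>A\<^esub> (\<phi>' x \<cdot>\<^bsub>A\<^esub> \<phi> y1)) (\<phi>' y2)))"
      by (intro H.sw_cong) (simp_all add: Th A.assoc cong: H.sw_cong)
    also have "\<dots> = sw H fscl (\<psi> b) (\<lambda>x y2. ptens A A (a \<cdot>\<^bsub>A\<^esub> (sw H (scl A) x (\<lambda>x y1. \<phi>' x \<cdot>\<^bsub>A\<^esub> \<phi> y1))) (\<phi>' y2))"
      by (simp add: H.sw_coassoc[of "tens A A" fscl, symmetric] outs cong: H.sw_cong)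
    also have "\<dots> = ptens A A a b"
      by (simp add: conv_left A.scl_mul_right lin_scl[OF bil_left[OF ptens_bil]]
          H.sw_counit_left[of "tens A A" _ fscl] phi'_psi cong: H.sw_cong)
    finally show "\<Theta> (\<Psi> (ptens A A a b)) = ptens A A a b" .
  qed (simp_all add: lin_id lin_comp[OF Theta_lin] Psi_lin)
  show ?thesis
    by (rule bij_betw_byWitness[where f'=\<Psi>])
       (auto simp: 1 2 lin_closed[OF Theta_lin] lin_closed[OF Psi_lin])
qed

lemma smash_hopf_algebroid: "is_hopf_algebroid_over X A"
proof -
  note [simp] = rls'
  have lX': "lin X (tens A A) \<Theta>"
    using Theta_lin by (simp add: lin_def)
  have unt: "\<Theta> (unt X) = unt (env A)"
    by (simp add: Theta_ptens theta_unt env_ptens)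
  have X: "kalgebra X"
  proof (rule kalgebra_pullback[where f=\<Theta> and Y="env A"])
    show "kspace X" using kspaces(4) by (simp add: kspace_def)
    show "inj_on \<Theta> (car X)" using Theta_bij by (simp add: bij_betw_def)
  qed (use unt in \<open>simp_all add: lX' env_A smash_closed Theta_mul\<close>)
  have "\<exists>s t. enveloping_iso A X s t \<Theta>"
    by (rule enveloping_isoI[OF A.kalgebra_axioms X lX']) (simp_all add: Theta_bij Theta_mul unt[simplified])
  then show ?thesis
    unfolding is_hopf_algebroid_over_def using enveloping_iso.is_hopf_algebroid by blast
qed

end

section \<open>The Heisenberg double\<close>

text \<open>Both doubles have products of the form \<open>(\<alpha> \<otimes> a)(\<beta> \<otimes> b) = \<Sum> \<alpha> \<beta>\<^sub>i \<otimes> a\<^sub>i b\<close> with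
  \<open>R a \<beta> = \<Sum> \<beta>\<^sub>i \<otimes> a\<^sub>i\<close>.\<close>

lemma twisted_hom:
  assumes V: "kalgebra V" and W: "kalgebra W" and Y: "kalgebra Y"
    and P: "\<And>x. x \<in> car (tens V W) \<Longrightarrow> lin (tens V W) (tens V W) (\<lambda>y. x \<cdot>\<^bsub>P\<^esub> y)"
      "\<And>y. y \<in> car (tens V W) \<Longrightarrow> lin (tens V W) (tens V W) (\<lambda>x. x \<cdot>\<^bsub>P\<^esub> y)"
    and R: "\<And>a \<beta>. a \<in> car W \<Longrightarrow> \<beta> \<in> car V \<Longrightarrow> R a \<beta> \<in> car (tens V W)"
    and pure: "\<And>\<alpha> a \<beta> b. \<alpha> \<in> car V \<Longrightarrow> a \<in> car W \<Longrightarrow> \<beta> \<in> car V \<Longrightarrow> b \<in> car W \<Longrightarrow>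
      ptens V W \<alpha> a \<cdot>\<^bsub>P\<^esub> ptens V W \<beta> b = ext fscl (\<lambda>\<beta>' a'. ptens V W (\<alpha> \<cdot>\<^bsub>V\<^esub> \<beta>') (a' \<cdot>\<^bsub>W\<^esub> b)) (R a \<beta>)"
    and l: "lin V Y l" "\<And>\<alpha> \<beta>. \<alpha> \<in> car V \<Longrightarrow> \<beta> \<in> car V \<Longrightarrow> l (\<alpha> \<cdot>\<^bsub>V\<^esub> \<beta>) = l \<alpha> \<cdot>\<^bsub>Y\<^esub> l \<beta>"
    and r: "lin W Y r" "\<And>a b. a \<in> car W \<Longrightarrow> b \<in> car W \<Longrightarrow> r (a \<cdot>\<^bsub>W\<^esub> b) = r a \<cdot>\<^bsub>Y\<^esub> r b"
    and F: "lin (tens V W) Y F" "\<And>\<alpha> a. \<alpha> \<in> car V \<Longrightarrow> a \<in> car W \<Longrightarrow> F (ptens V W \<alpha> a) = l \<alpha> \<cdot>\<^bsub>Y\<^esub> r a"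
    and comm: "\<And>a \<beta>. a \<in> car W \<Longrightarrow> \<beta> \<in> car V \<Longrightarrow> r a \<cdot>\<^bsub>Y\<^esub> l \<beta> = F (R a \<beta>)"
    and xy: "x \<in> car (tens V W)" "y \<in> car (tens V W)"
  shows "F (x \<cdot>\<^bsub>P\<^esub> y) = F x \<cdot>\<^bsub>Y\<^esub> F y"
proof -
  interpret V: kalgebra V by fact
  interpret W: kalgebra W by fact
  interpret Y: kalgebra Y by fact
  note K = V.kspace_axioms W.kspace_axioms
  note [simp] = K Y.kspace_axioms V W Y clo lins lin_closed[OF l(1)] lin_closed[OF r(1)] lin_closed[OF F(1)]
  have p: "F (ptens V W \<alpha> a \<cdot>\<^bsub>P\<^esub> ptens V W \<beta> b) = F (ptens V W \<alpha> a) \<cdot>\<^bsub>Y\<^esub> F (ptens V W \<beta> b)"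
    if [simp]: "\<alpha> \<in> car V" "a \<in> car W" "\<beta> \<in> car V" "b \<in> car W" for \<alpha> a \<beta> b
  proof -
    \<comment> \<open>The outer factors \<open>\<alpha>\<close> and \<open>b\<close> can be pulled
      out of \<open>F\<close> for any middle tensor \<open>p\<close>, since the claim is linear in
      \<open>p\<close>; taking \<open>p = R a \<beta>\<close> brings in \<open>comm\<close>.\<close>
    have q: "F (ext fscl (\<lambda>\<beta>' a'. ptens V W (\<alpha> \<cdot>\<^bsub>V\<^esub> \<beta>') (a' \<cdot>\<^bsub>W\<^esub> b)) p) = l \<alpha> \<cdot>\<^bsub>Y\<^esub> F p \<cdot>\<^bsub>Y\<^esub> r b"
      if "p \<in> car (tens V W)" for p
    proof (rule tens_lin_eqI[OF K that, where U=Y and f="\<lambda>p. F (ext fscl (\<lambda>\<beta>' a'. ptens V W (\<alpha> \<cdot>\<^bsub>V\<^esub> \<beta>') (a' \<cdot>\<^bsub>W\<^esub> b)) p)"])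
      have l': "lin (tens V W) (tens V W) (ext fscl (\<lambda>\<beta>' a'. ptens V W (\<alpha> \<cdot>\<^bsub>V\<^esub> \<beta>') (a' \<cdot>\<^bsub>W\<^esub> b)))"
        by (rule lin_tens_ext) simp_all
      show "lin (tens V W) Y (\<lambda>p. F (ext fscl (\<lambda>\<beta>' a'. ptens V W (\<alpha> \<cdot>\<^bsub>V\<^esub> \<beta>') (a' \<cdot>\<^bsub>W\<^esub> b)) p))"
        by (rule lin_comp[OF F(1) l'])
      fix \<beta>' a' assume *[simp]: "\<beta>' \<in> car V" "a' \<in> car W"
      have "ext fscl (\<lambda>\<beta>' a'. ptens V W (\<alpha> \<cdot>\<^bsub>V\<^esub> \<beta>') (a' \<cdot>\<^bsub>W\<^esub> b)) (ptens V W \<beta>' a') = ptens V W (\<alpha> \<cdot>\<^bsub>V\<^esub> \<beta>') (a' \<cdot>\<^bsub>W\<^esub> b)"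
        by (intro ext_ptens[of V W "tens V W"]) (simp_all add: bilI)
      then show "F (ext fscl (\<lambda>\<beta>' a'. ptens V W (\<alpha> \<cdot>\<^bsub>V\<^esub> \<beta>') (a' \<cdot>\<^bsub>W\<^esub> b)) (ptens V W \<beta>' a')) =
          l \<alpha> \<cdot>\<^bsub>Y\<^esub> F (ptens V W \<beta>' a') \<cdot>\<^bsub>Y\<^esub> r b"
        by (simp add: F(2) l(2) r(2) Y.assoc)
    qed (simp add: F(1))
    show ?thesis
      by (simp add: pure q R comm[symmetric]) (simp add: F(2) Y.assoc)
  qed
  note eqI = tens_lin_eqI[OF K, where U=Y]
  note PF = lin_comp[OF F(1) P(1)] lin_comp[OF F(1) P(2)]
  have "F (ptens V W \<alpha> a \<cdot>\<^bsub>P\<^esub> y) = F (ptens V W \<alpha> a) \<cdot>\<^bsub>Y\<^esub> F y" if "\<alpha> \<in> car V" "a \<in> car W" for \<alpha> a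
    by (rule eqI[where p=y, OF xy(2)]) (use that in \<open>simp_all add: p PF F(1)\<close>)
  then show ?thesis
    by - (rule eqI[where p=x, OF xy(1)], use xy in \<open>simp_all add: PF F(1)\<close>)
qed

text \<open>Composition is reversed so that right actions become homomorphisms. Maps vanish off the
  carrier so that agreement on it implies equality.\<close>

definition end_alg :: "('k :: field, 'b :: ab_group_add, 'm) space_scheme \<Rightarrow> ('k, 'b \<Rightarrow> 'b) alg" where
  "end_alg V = \<lparr>car = {f. lin V V f \<and> (\<forall>x. x \<notin> car V \<longrightarrow> f x = 0)}, scl = (\<lambda>c f x. scl V c (f x)),
     mul = (\<lambda>f g x. g (f x)), unt = (\<lambda>x. if x \<in> car V then x else 0)\<rparr>"

lemma end_alg_simps [simp]: "car (end_alg V) = {f. lin V V f \<and> (\<forall>x. x \<notin> car V \<longrightarrow> f x = 0)}"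
  "scl (end_alg V) = (\<lambda>c f x. scl V c (f x))" "(f \<cdot>\<^bsub>end_alg V\<^esub> g) = (\<lambda>x. g (f x))"
  "unt (end_alg V) = (\<lambda>x. if x \<in> car V then x else 0)"
  by (simp_all add: end_alg_def)

lemma kspace_end:
  assumes "kspace V"
  shows "kspace (end_alg V)"
proof -
  interpret kspace V by fact
  show ?thesis
  proof (rule kspaceI)
    show "vector_space (scl (end_alg V))"
      by unfold_locales (auto simp: fun_eq_iff vs.scale_right_distrib vs.scale_left_distrib)
    show "scl (end_alg V) c f \<in> car (end_alg V)" if "f \<in> car (end_alg V)" for c f
      using that lin_scale[OF assms] by auto
    show "f + g \<in> car (end_alg V)" if "f \<in> car (end_alg V)" "g \<in> car (end_alg V)" for f g
      using that lin_plus[OF assms] by (auto simp: plus_fun_def)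
    show "0 \<in> car (end_alg V)" by (simp add: lin_def)
  qed
qed

lemma end_eqI:
  assumes "f \<in> car (end_alg V)" "g \<in> car (end_alg V)" "\<And>x. x \<in> car V \<Longrightarrow> f x = g x"
  shows "f = g"
proof
  fix x show "f x = g x" using assms by (cases "x \<in> car V") auto
qed

lemma kalgebra_end:
  assumes "kspace V"
  shows "kalgebra (end_alg V)"
proof -
  interpret kspace V by fact
  interpret E: kspace "end_alg V" by (rule kspace_end[OF assms])
  have mc: "(\<lambda>x. g (f x)) \<in> car (end_alg V)" if "f \<in> car (end_alg V)" "g \<in> car (end_alg V)" for f g
    using that lin_comp[of V V g V f] assms by auto
  show ?thesis
  proof (intro kalgebra.intro kalgebra_axioms.intro E.kspace_axioms)
    show "lin (end_alg V) (end_alg V) (\<lambda>f. f \<cdot>\<^bsub>end_alg V\<^esub> g)" if "g \<in> car (end_alg V)" for g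
    proof (rule linI)
      show "f \<cdot>\<^bsub>end_alg V\<^esub> g \<in> car (end_alg V)" if "f \<in> car (end_alg V)" for f
        using mc that \<open>g \<in> car (end_alg V)\<close> by simp
      show "(f + f') \<cdot>\<^bsub>end_alg V\<^esub> g = f \<cdot>\<^bsub>end_alg V\<^esub> g + f' \<cdot>\<^bsub>end_alg V\<^esub> g"
        if "f \<in> car (end_alg V)" "f' \<in> car (end_alg V)" for f f'
      proof (rule ext)
        fix x show "((f + f') \<cdot>\<^bsub>end_alg V\<^esub> g) x = (f \<cdot>\<^bsub>end_alg V\<^esub> g + f' \<cdot>\<^bsub>end_alg V\<^esub> g) x"
          using that \<open>g \<in> car (end_alg V)\<close> by (cases "x \<in> car V") (auto simp: lin_add lin_closed assms)
      qed
      show "scl (end_alg V) c f \<cdot>\<^bsub>end_alg V\<^esub> g = scl (end_alg V) c (f \<cdot>\<^bsub>end_alg V\<^esub> g)"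
        if "f \<in> car (end_alg V)" for c f
      proof (rule ext)
        fix x show "(scl (end_alg V) c f \<cdot>\<^bsub>end_alg V\<^esub> g) x = scl (end_alg V) c (f \<cdot>\<^bsub>end_alg V\<^esub> g) x"
          using that \<open>g \<in> car (end_alg V)\<close> by (cases "x \<in> car V") (auto simp: lin_scl lin_closed assms)
      qed
    qed
    show "lin (end_alg V) (end_alg V) (\<lambda>g. f \<cdot>\<^bsub>end_alg V\<^esub> g)" if "f \<in> car (end_alg V)" for f
    proof (rule linI)
      show "f \<cdot>\<^bsub>end_alg V\<^esub> g \<in> car (end_alg V)" if "g \<in> car (end_alg V)" for g
        using mc that \<open>f \<in> car (end_alg V)\<close> by simp
    qed auto
    show "unt (end_alg V) \<in> car (end_alg V)" by (simp add: lin_def)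
    show "unt (end_alg V) \<cdot>\<^bsub>end_alg V\<^esub> f = f" "f \<cdot>\<^bsub>end_alg V\<^esub> unt (end_alg V) = f"
      if "f \<in> car (end_alg V)" for f
      using that assms by (auto simp: fun_eq_iff) (metis lin_closed)+
  qed simp
qed

section \<open>The Heisenberg double as operators on B\<close>

context dual_setup_bij
begin

lemma act_left_closed: "b \<in> car B \<Longrightarrow> \<beta> \<in> car Bd \<Longrightarrow> act_left B b \<beta> \<in> car Bd"
  and act_right_closed: "b \<in> car B \<Longrightarrow> \<beta> \<in> car Bd \<Longrightarrow> act_right B \<beta> b \<in> car Bd"
  by (simp_all add: act_left_eq act_right_eq aL_dual aR_dual)

lemma act_left_apply: "b \<in> car B \<Longrightarrow> \<beta> \<in> car Bd \<Longrightarrow> y \<in> car B \<Longrightarrow> act_left B b \<beta> y = \<beta> (y \<cdot>\<^bsub>B\<^esub> b)"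
  and act_right_apply: "b \<in> car B \<Longrightarrow> \<beta> \<in> car Bd \<Longrightarrow> y \<in> car B \<Longrightarrow> act_right B \<beta> b y = \<beta> (b \<cdot>\<^bsub>B\<^esub> y)"
  by (simp_all add: act_left_eq act_right_eq aL_def aR_def)

lemma act_lin:
  "\<beta> \<in> car Bd \<Longrightarrow> lin B Bd (\<lambda>b. act_left B b \<beta>)" "b \<in> car B \<Longrightarrow> lin Bd Bd (\<lambda>\<beta>. act_left B b \<beta>)"
  "\<beta> \<in> car Bd \<Longrightarrow> lin B Bd (\<lambda>b. act_right B \<beta> b)" "b \<in> car B \<Longrightarrow> lin Bd Bd (\<lambda>\<beta>. act_right B \<beta> b)"
proof -
  note [simp] = act_left_closed act_right_closed B_axs lins clo kalgebra_axioms lin_at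
  show "lin B Bd (\<lambda>b. act_left B b \<beta>)" if "\<beta> \<in> car Bd"
  proof (rule lin_pointwise)
    show "lin B ground (\<lambda>b. act_left B b \<beta> y)" if "y \<in> car B" for y
      using that \<open>\<beta> \<in> car Bd\<close>
      by (subst lin_cong[OF kspace_axioms act_left_apply]) (simp_all add: dual_lin_comp[of \<beta>])
  qed (use that in simp_all)
  show "lin B Bd (\<lambda>b. act_right B \<beta> b)" if "\<beta> \<in> car Bd"
  proof (rule lin_pointwise)
    show "lin B ground (\<lambda>b. act_right B \<beta> b y)" if "y \<in> car B" for y
      using that \<open>\<beta> \<in> car Bd\<close>
      by (subst lin_cong[OF kspace_axioms act_right_apply]) (simp_all add: dual_lin_comp[of \<beta>])
  qed (use that in simp_all)
  show "lin Bd Bd (\<lambda>\<beta>. act_left B b \<beta>)" if "b \<in> car B"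
  proof (rule lin_pointwise)
    show "lin Bd ground (\<lambda>\<beta>. act_left B b \<beta> y)" if "y \<in> car B" for y
      using that \<open>b \<in> car B\<close>
      by (subst lin_cong[OF kspace_dual act_left_apply]) simp_all
  qed (use that in simp_all)
  show "lin Bd Bd (\<lambda>\<beta>. act_right B \<beta> b)" if "b \<in> car B"
  proof (rule lin_pointwise)
    show "lin Bd ground (\<lambda>\<beta>. act_right B \<beta> b y)" if "y \<in> car B" for y
      using that \<open>b \<in> car B\<close>
      by (subst lin_cong[OF kspace_dual act_right_apply]) simp_all
  qed (use that in simp_all)
qed

lemma lin_acts:
  "\<beta> \<in> car Bd \<Longrightarrow> lin V B f \<Longrightarrow> lin V Bd (\<lambda>v. act_left B (f v) \<beta>)"
  "b \<in> car B \<Longrightarrow> lin V Bd g \<Longrightarrow> lin V Bd (\<lambda>v. act_left B b (g v))"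
  "\<beta> \<in> car Bd \<Longrightarrow> lin V B f \<Longrightarrow> lin V Bd (\<lambda>v. act_right B \<beta> (f v))"
  "b \<in> car B \<Longrightarrow> lin V Bd g \<Longrightarrow> lin V Bd (\<lambda>v. act_right B (g v) b)"
  using lin_comp[OF act_lin(1)] lin_comp[OF act_lin(2)] lin_comp[OF act_lin(3)] lin_comp[OF act_lin(4)]
  by auto

abbreviation "A \<equiv> heisenberg B"
abbreviation "tt \<equiv> ptens Bd B"
abbreviation "TT \<equiv> tens Bd B"

lemma kspace_TT: "kspace TT" by (rule kspace_tens[OF kspace_dual kspace_axioms])

lemmas rls = lins clo B_axs kalgebra_dual kspace_TT
  act_left_closed act_right_closed lin_acts D.lin_S D.lin_Si lin_Si D.cou_lin
  kspace_tens[OF kspace_TT kspace_TT]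

lemma heis_simps [simp]: "car A = car TT" "scl A = fscl" "unt A = tt (unt Bd) (unt B)"
  and heis_mul: "x \<cdot>\<^bsub>A\<^esub> y = ext fscl (\<lambda>\<alpha> a. ext fscl (\<lambda>\<beta> b.
        sw B fscl a (\<lambda>a' a''. tt (\<alpha> \<cdot>\<^bsub>Bd\<^esub> act_left B a' \<beta>) (a'' \<cdot>\<^bsub>B\<^esub> b))) y) x"
  by (simp_all add: heisenberg_def sw2_eq_sw)

lemma lin_heis [simp]: "lin A U f = lin TT U f" "lin V A g = lin V TT g"
  by (simp_all add: lin_def)

lemma heis_ptens:
  assumes "\<alpha> \<in> car Bd" "a \<in> car B" "\<beta> \<in> car Bd" "b \<in> car B"
  shows "tt \<alpha> a \<cdot>\<^bsub>A\<^esub> tt \<beta> b = sw B fscl a (\<lambda>a' a''. tt (\<alpha> \<cdot>\<^bsub>Bd\<^esub> act_left B a' \<beta>) (a'' \<cdot>\<^bsub>B\<^esub> b))"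
  unfolding heis_mul using assms
  by (intro ext_ext_ptens[OF _ _ _ _ kspace_TT,
        where f="\<lambda>\<alpha> a \<beta> b. sw B fscl a (\<lambda>a' a''. tt (\<alpha> \<cdot>\<^bsub>Bd\<^esub> act_left B a' \<beta>) (a'' \<cdot>\<^bsub>B\<^esub> b))"])
     (simp_all add: bilI rls)

lemma heis_lin: "y \<in> car TT \<Longrightarrow> lin TT TT (\<lambda>x. x \<cdot>\<^bsub>A\<^esub> y)" "x \<in> car TT \<Longrightarrow> lin TT TT (\<lambda>y. x \<cdot>\<^bsub>A\<^esub> y)"
proof -
  note [simp] = rls
  have 1: "lin TT TT (ext fscl (\<lambda>\<beta> b. sw B fscl a (\<lambda>a' a''. tt (\<alpha> \<cdot>\<^bsub>Bd\<^esub> act_left B a' \<beta>) (a'' \<cdot>\<^bsub>B\<^esub> b))))"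
    if "\<alpha> \<in> car Bd" "a \<in> car B" for \<alpha> a
    using that by (intro lin_tens_ext) simp_all
  show "lin TT TT (\<lambda>x. x \<cdot>\<^bsub>A\<^esub> y)" if "y \<in> car TT"
    unfolding heis_mul by (intro lin_tens_ext) (use that lin_closed[OF 1] in simp_all)
  show "lin TT TT (\<lambda>y. x \<cdot>\<^bsub>A\<^esub> y)" if "x \<in> car TT"
    unfolding heis_mul by (rule lin_tens_body[of Bd B x]) (use that 1 in simp_all)
qed

text \<open>The Heisenberg double acts faithfully on \<open>B\<close> from the right: \<open>\<alpha> # a\<close> maps \<open>y\<close> to
  \<open>\<langle>\<alpha>,y'\<rangle> y'' a\<close>.\<close>

definition lop :: "('b \<Rightarrow> 'k) \<Rightarrow> 'b \<Rightarrow> 'b" where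
  "lop \<alpha> = (\<lambda>y. if y \<in> car B then sw B (scl B) y (\<lambda>y1 y2. scl B (\<alpha> y1) y2) else 0)"

definition rop :: "'b \<Rightarrow> 'b \<Rightarrow> 'b" where
  "rop a = (\<lambda>y. if y \<in> car B then y \<cdot>\<^bsub>B\<^esub> a else 0)"

abbreviation "EB \<equiv> end_alg B"

lemma lop_apply: "y \<in> car B \<Longrightarrow> lop \<alpha> y = sw B (scl B) y (\<lambda>y1 y2. scl B (\<alpha> y1) y2)"
  and rop_apply: "y \<in> car B \<Longrightarrow> rop a y = y \<cdot>\<^bsub>B\<^esub> a"
  by (simp_all add: lop_def rop_def)

lemma end_restrict: "lin B B f \<Longrightarrow> (\<lambda>y. if y \<in> car B then f y else 0) \<in> car EB"
  by (simp add: lin_def)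

lemma lop_closed: "\<alpha> \<in> car Bd \<Longrightarrow> lop \<alpha> \<in> car EB"
  and rop_closed: "a \<in> car B \<Longrightarrow> rop a \<in> car EB"
  unfolding lop_def rop_def by (intro end_restrict; simp add: rls)+

lemma lin_EB_pointwise:
  assumes "\<And>v. v \<in> car V \<Longrightarrow> f v \<in> car EB" "\<And>y. y \<in> car B \<Longrightarrow> lin V B (\<lambda>v. f v y)" "kspace V"
  shows "lin V EB f"
proof (rule linI)
  interpret V: kspace V by fact
  interpret E: kspace EB by (rule kspace_end[OF kspace_axioms])
  fix x y c assume x: "x \<in> car V"
  show "f (scl V c x) = scl EB c (f x)"
    by (rule end_eqI[OF assms(1) E.scl_closed[OF assms(1)]])
       (use x lin_scl[OF assms(2)] in auto)
  assume y: "y \<in> car V"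
  show "f (x + y) = f x + f y"
    by (rule end_eqI[OF assms(1) E.add_closed[OF assms(1) assms(1)]])
       (use x y lin_add[OF assms(2)] in auto)
qed (rule assms)

lemma lop_lin: "lin Bd EB lop" and rop_lin: "lin B EB rop"
proof -
  note [simp] = rls lin_at
  show "lin Bd EB lop"
    by (rule lin_EB_pointwise[OF lop_closed]) (simp_all add: lop_apply)
  show "lin B EB rop"
    by (rule lin_EB_pointwise[OF rop_closed]) (simp_all add: rop_apply)
qed

end

context dual_setup_bij
begin

lemmas EB_alg = kalgebra_end[OF kspace_axioms]
lemmas EB_space = kspace_end[OF kspace_axioms]

lemma end_lin: "f \<in> car EB \<Longrightarrow> lin B B f"
  by simp

lemma lop_in: "\<alpha> \<in> car Bd \<Longrightarrow> y \<in> car B \<Longrightarrow> lop \<alpha> y \<in> car B"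
  using end_lin[OF lop_closed] by (rule lin_closed)

lemma lop_mul:
  assumes "\<alpha> \<in> car Bd" "\<beta> \<in> car Bd"
  shows "lop (\<alpha> \<cdot>\<^bsub>Bd\<^esub> \<beta>) = lop \<alpha> \<cdot>\<^bsub>EB\<^esub> lop \<beta>"
proof (rule end_eqI[OF lop_closed])
  note [simp] = rls lin_at mul_dual_closed
  interpret E: kalgebra EB by (rule EB_alg)
  show "\<alpha> \<cdot>\<^bsub>Bd\<^esub> \<beta> \<in> car Bd" using assms by simp
  show "lop \<alpha> \<cdot>\<^bsub>EB\<^esub> lop \<beta> \<in> car EB" using assms by (intro E.mul_closed lop_closed)
  fix y assume y: "y \<in> car B"
  have "lop (\<alpha> \<cdot>\<^bsub>Bd\<^esub> \<beta>) y = sw B (scl B) y (\<lambda>w y3. sw B (scl B) w (\<lambda>y1 y2. scl B (\<alpha> y1 * \<beta> y2) y3))"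
    using assms y by (simp add: lop_apply mul_dual_apply sw_out[OF lin_scale_left[OF kspace_axioms _ lin_id], where sc'="scl B"] cong: sw_cong)
  also have "\<dots> = sw B (scl B) y (\<lambda>y1 w. sw B (scl B) w (\<lambda>y2 y3. scl B (\<alpha> y1 * \<beta> y2) y3))"
    using assms y by (intro sw_coassoc[of B "scl B"]) simp_all
  also have "\<dots> = sw B (scl B) y (\<lambda>y1 w. scl B (\<alpha> y1) (lop \<beta> w))"
    using assms y by (simp add: lop_apply outs cong: sw_cong)
  also have "\<dots> = lop \<beta> (sw B (scl B) y (\<lambda>y1 w. scl B (\<alpha> y1) w))"
    using assms y
    by (simp add: sw_out[OF end_lin[OF lop_closed], where sc'="scl B"] lin_scl[OF end_lin[OF lop_closed]] cong: sw_cong)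
  finally show "lop (\<alpha> \<cdot>\<^bsub>Bd\<^esub> \<beta>) y = (lop \<alpha> \<cdot>\<^bsub>EB\<^esub> lop \<beta>) y"
    using y by (simp add: lop_apply[of y \<alpha>])
qed

lemma rop_mul:
  assumes "a \<in> car B" "b \<in> car B"
  shows "rop (a \<cdot>\<^bsub>B\<^esub> b) = rop a \<cdot>\<^bsub>EB\<^esub> rop b"
  using assms lin_0[OF mul_left kspace_axioms] by (auto simp: rop_def fun_eq_iff assoc)

definition \<rho> :: "(('b \<Rightarrow> 'k) \<times> 'b \<Rightarrow>\<^sub>0 'k) \<Rightarrow> 'b \<Rightarrow> 'b" where
  "\<rho> = ext (scl EB) (\<lambda>\<alpha> a. lop \<alpha> \<cdot>\<^bsub>EB\<^esub> rop a)"

lemma rho_bil: "bil Bd B EB (\<lambda>\<alpha> a. lop \<alpha> \<cdot>\<^bsub>EB\<^esub> rop a)"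
proof -
  interpret E: kalgebra EB by (rule EB_alg)
  show ?thesis
    by (intro bilI E.lin_mul_left E.lin_mul_right lop_lin rop_lin lop_closed rop_closed)
qed

lemma rho_lin: "lin TT EB \<rho>"
  unfolding \<rho>_def using bil_closed[OF rho_bil]
  by (intro lin_tens_ext kspace_dual kspace_axioms EB_space) auto

lemma rho_ptens: "\<alpha> \<in> car Bd \<Longrightarrow> a \<in> car B \<Longrightarrow> \<rho> (tt \<alpha> a) = lop \<alpha> \<cdot>\<^bsub>EB\<^esub> rop a"
  unfolding \<rho>_def by (rule ext_ptens[OF kspace_dual kspace_axioms EB_space rho_bil]) auto

lemma rho_apply:
  assumes "\<alpha> \<in> car Bd" "a \<in> car B" "y \<in> car B"
  shows "\<rho> (tt \<alpha> a) y = sw B (scl B) y (\<lambda>y1 y2. scl B (\<alpha> y1) (y2 \<cdot>\<^bsub>B\<^esub> a))"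
  using assms lop_in
  by (simp add: rho_ptens rop_apply lop_apply outs rls scl_mul_left cong: sw_cong)

text \<open>The straightening rule of the Heisenberg double, valid for operators because the
  coproduct of a product \<open>y a\<close> is the product of the coproducts.\<close>

lemma rop_lop:
  assumes a: "a \<in> car B" and b: "\<beta> \<in> car Bd"
  shows "rop a \<cdot>\<^bsub>EB\<^esub> lop \<beta> = \<rho> (sw B fscl a (\<lambda>a1 a2. tt (act_left B a1 \<beta>) a2))"
proof (rule end_eqI)
  note [simp] = rls lin_at
  interpret E: kalgebra EB by (rule EB_alg)
  show "rop a \<cdot>\<^bsub>EB\<^esub> lop \<beta> \<in> car EB" using assms by (intro E.mul_closed lop_closed rop_closed)
  show "\<rho> (sw B fscl a (\<lambda>a1 a2. tt (act_left B a1 \<beta>) a2)) \<in> car EB"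
    using assms by (intro lin_closed[OF rho_lin]) simp
  fix y assume y: "y \<in> car B"
  have l: "lin TT B (\<lambda>p. \<rho> p y)"
    using rho_lin y by (auto simp: lin_def)
  have "(rop a \<cdot>\<^bsub>EB\<^esub> lop \<beta>) y = sw B (scl B) (y \<cdot>\<^bsub>B\<^esub> a) (\<lambda>z1 z2. scl B (\<beta> z1) z2)"
    using a b y by (simp add: lop_apply rop_apply)
  also have "\<dots> = sw B (scl B) y (\<lambda>y1 y2. sw B (scl B) a (\<lambda>a1 a2. scl B (\<beta> (y1 \<cdot>\<^bsub>B\<^esub> a1)) (y2 \<cdot>\<^bsub>B\<^esub> a2)))"
    using a b y by (intro sw_mul[of B "scl B"]) (simp_all add: bilI)
  also have "\<dots> = sw B (scl B) a (\<lambda>a1 a2. sw B (scl B) y (\<lambda>y1 y2. scl B (\<beta> (y1 \<cdot>\<^bsub>B\<^esub> a1)) (y2 \<cdot>\<^bsub>B\<^esub> a2)))"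
    by (rule sw_swap[OF ambient])
  also have "\<dots> = sw B (scl B) a (\<lambda>a1 a2. \<rho> (tt (act_left B a1 \<beta>) a2) y)"
    using a b y by (simp add: rho_apply act_left_apply cong: sw_cong)
  also have "\<dots> = \<rho> (sw B fscl a (\<lambda>a1 a2. tt (act_left B a1 \<beta>) a2)) y"
    using a b y by (simp add: sw_out[OF l, where sc'="scl B"])
  finally show "(rop a \<cdot>\<^bsub>EB\<^esub> lop \<beta>) y = \<rho> (sw B fscl a (\<lambda>a1 a2. tt (act_left B a1 \<beta>) a2)) y" .
qed

text \<open>Multiplying \<open>\<rho> p y1\<close> on the left by \<open>Si y2\<close> and summing
  cancels the leg of \<open>y\<close> that \<open>\<rho>\<close> leaves in \<open>B\<close>. What
  remains is the evaluation of the first tensor factor at \<open>y\<close>, and these evaluations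
  determine \<open>p\<close>.\<close>

lemma rho_inj: "inj_on \<rho> (car TT)"
proof (rule inj_on_lin[OF rho_lin kspace_TT])
  note [simp] = rls lin_at
  fix p assume p: "p \<in> car TT" and 0: "\<rho> p = 0"
  show "p = 0"
  proof (rule tens_eval_inj[OF kspace_dual scl_dual kspace_axioms p])
    fix y
    show "ext (scl B) (\<lambda>\<beta> w. scl B (\<beta> y) w) p = 0"
    proof (cases "y \<in> car B")
      case False
      have "ext (scl B) (\<lambda>\<beta> w. scl B (\<beta> y) w) p = ext (scl B) (\<lambda>_ _. 0) p"
      proof (rule ext_cong)
        fix \<beta> w assume "(\<beta>, w) \<in> Poly_Mapping.keys p"
        then have "\<beta> y = 0" using tens_keys[OF kspace_dual kspace_axioms p] dual_off False by blast
        then show "scl B (\<beta> y) w = 0" by simp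
      qed
      then show ?thesis by (simp add: ext_def)
    next
      case True
      have "ext (scl B) (\<lambda>\<beta> w. scl B (\<beta> y) w) p = sw B (scl B) y (\<lambda>y1 y2. Si y2 \<cdot>\<^bsub>B\<^esub> \<rho> p y1)"
      proof (rule tens_lin_eqI[OF kspace_dual kspace_axioms p, where U=B])
        have r: "lin TT B (\<lambda>p. \<rho> p y)" if "y \<in> car B" for y
          using rho_lin that by (auto simp: lin_def)
        show "lin TT B (ext (scl B) (\<lambda>\<beta> w. scl B (\<beta> y) w))"
          by (rule lin_tens_ext) simp_all
        show "lin TT B (\<lambda>p. sw B (scl B) y (\<lambda>y1 y2. Si y2 \<cdot>\<^bsub>B\<^esub> \<rho> p y1))"
          using True by (simp add: r)
        fix \<alpha> a assume [simp]: "\<alpha> \<in> car Bd" "a \<in> car B"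
        have "sw B (scl B) y (\<lambda>y1 y2. Si y2 \<cdot>\<^bsub>B\<^esub> \<rho> (tt \<alpha> a) y1) =
          sw B (scl B) y (\<lambda>w y3. sw B (scl B) w (\<lambda>y1 y2. scl B (\<alpha> y1) ((Si y3 \<cdot>\<^bsub>B\<^esub> y2) \<cdot>\<^bsub>B\<^esub> a)))"
          using True by (simp add: rho_apply outs scl_mul_right assoc cong: sw_cong)
        also have "\<dots> = sw B (scl B) y (\<lambda>y1 w. sw B (scl B) w (\<lambda>y2 y3. scl B (\<alpha> y1) ((Si y3 \<cdot>\<^bsub>B\<^esub> y2) \<cdot>\<^bsub>B\<^esub> a)))"
          using True by (intro sw_coassoc[of B "scl B"]) simp_all
        also have "\<dots> = sw B (scl B) y (\<lambda>y1 w. scl B (\<alpha> y1) ((sw B (scl B) w (\<lambda>y2 y3. Si y3 \<cdot>\<^bsub>B\<^esub> y2)) \<cdot>\<^bsub>B\<^esub> a))"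
          using True by (simp add: outs cong: sw_cong)
        also have "\<dots> = sw B (scl B) y (\<lambda>y1 w. scl B (cou B w) (scl B (\<alpha> y1) a))"
          using True by (simp add: Si_left scl_mul_left mult.commute cong: sw_cong)
        also have "\<dots> = scl B (\<alpha> y) a"
          using True by (intro sw_counit_right[of B]) simp_all
        also have "\<dots> = ext (scl B) (\<lambda>\<beta> w. scl B (\<beta> y) w) (tt \<alpha> a)"
          by (intro ext_ptens[symmetric, of Bd B B]) (simp_all add: bilI)
        finally show "ext (scl B) (\<lambda>\<beta> w. scl B (\<beta> y) w) (tt \<alpha> a) =
          sw B (scl B) y (\<lambda>y1 y2. Si y2 \<cdot>\<^bsub>B\<^esub> \<rho> (tt \<alpha> a) y1)" ..
      qed
      also have "\<dots> = 0"
        using True 0 lin_0[OF mul_right] by (subst sw_cong[where g="\<lambda>_ _. 0"]) (simp_all add: sw_def sw2_def ext_def)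
      finally show ?thesis .
    qed
  qed
qed

text \<open>Brings the product into the form that \<open>twisted_hom\<close> expects.\<close>

lemma heis_R:
  assumes "\<alpha> \<in> car Bd" "a \<in> car B" "\<beta> \<in> car Bd" "b \<in> car B"
  shows "tt \<alpha> a \<cdot>\<^bsub>A\<^esub> tt \<beta> b =
    ext fscl (\<lambda>\<beta>' a'. tt (\<alpha> \<cdot>\<^bsub>Bd\<^esub> \<beta>') (a' \<cdot>\<^bsub>B\<^esub> b)) (sw B fscl a (\<lambda>a1 a2. tt (act_left B a1 \<beta>) a2))"
proof -
  note [simp] = rls
  have l: "lin TT TT (ext fscl (\<lambda>\<beta>' a'. tt (\<alpha> \<cdot>\<^bsub>Bd\<^esub> \<beta>') (a' \<cdot>\<^bsub>B\<^esub> b)))"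
    using assms by (intro lin_tens_ext) simp_all
  have e: "ext fscl (\<lambda>\<beta>' a'. tt (\<alpha> \<cdot>\<^bsub>Bd\<^esub> \<beta>') (a' \<cdot>\<^bsub>B\<^esub> b)) (tt \<beta>' a') = tt (\<alpha> \<cdot>\<^bsub>Bd\<^esub> \<beta>') (a' \<cdot>\<^bsub>B\<^esub> b)"
    if "\<beta>' \<in> car Bd" "a' \<in> car B" for \<beta>' a'
    using assms that by (intro ext_ptens[of Bd B TT]) (simp_all add: bilI)
  show ?thesis
    using assms by (simp add: heis_ptens sw_out[OF l, where sc'=fscl] e cong: sw_cong)
qed

lemma heis_closed: "x \<in> car TT \<Longrightarrow> y \<in> car TT \<Longrightarrow> x \<cdot>\<^bsub>A\<^esub> y \<in> car TT"
  using heis_lin lin_closed by blast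

lemma kalgebra_heis: "kalgebra A"
proof (rule kalgebra_pullback[where f=\<rho> and Y=EB])
  note [simp] = rls
  show "kspace A" using kspace_TT by (simp add: kspace_def)
  show "\<rho> (x \<cdot>\<^bsub>A\<^esub> y) = \<rho> x \<cdot>\<^bsub>EB\<^esub> \<rho> y" if "x \<in> car A" "y \<in> car A" for x y
    by (rule twisted_hom[OF kalgebra_dual kalgebra_axioms EB_alg heis_lin(2) heis_lin(1) _ heis_R
          lop_lin lop_mul rop_lin rop_mul rho_lin rho_ptens rop_lop])
       (use that in simp_all)
  show "\<rho> (unt A) = unt EB"
  proof (rule end_eqI)
    fix y assume y: "y \<in> car B"
    then show "\<rho> (unt A) y = unt EB y"
      by (simp add: rho_apply unt_dual_closed sw_counit_left[of B "\<lambda>x. x" "scl B"] cong: sw_cong)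
  qed (auto intro!: lin_closed[OF rho_lin] simp: unt_dual_closed simp del: end_alg_simps(1), simp add: lin_def)
qed (use rho_lin rho_inj heis_closed EB_alg in \<open>simp_all add: rls del: end_alg_simps\<close>)

end

section \<open>Generators of the Heisenberg double and the convolution inverse\<close>

context dual_setup_bij
begin

lemma act_left_mul: "x \<in> car B \<Longrightarrow> y \<in> car B \<Longrightarrow> \<beta> \<in> car Bd \<Longrightarrow>
    act_left B x (act_left B y \<beta>) = act_left B (x \<cdot>\<^bsub>B\<^esub> y) \<beta>"
  by (rule dual_eqI) (simp_all add: rls act_left_apply assoc)

lemma act_left_unt: "\<beta> \<in> car Bd \<Longrightarrow> act_left B (unt B) \<beta> = \<beta>"
  by (rule dual_eqI) (simp_all add: rls act_left_apply)

lemma act_left_counit: "x \<in> car B \<Longrightarrow> act_left B x (unt Bd) = scl Bd (cou B x) (unt Bd)"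
  using kspace.scl_closed[OF kspace_dual unt_dual_closed, of "cou B x"]
  by (intro dual_eqI) (simp_all add: rls act_left_apply unt_dual_closed mult.commute)

text \<open>The embeddings of the dual and of \<open>B\<close> into the common space. They are
  multiplicative for the Heisenberg product and, by \<open>drin_lh_mul\<close> and
  \<open>drin_rh_mul\<close>, also for the Drinfeld product.\<close>

definition lh :: "('b \<Rightarrow> 'k) \<Rightarrow> ('b \<Rightarrow> 'k) \<times> 'b \<Rightarrow>\<^sub>0 'k" where "lh \<alpha> = tt \<alpha> (unt B)"
definition rh :: "'b \<Rightarrow> ('b \<Rightarrow> 'k) \<times> 'b \<Rightarrow>\<^sub>0 'k" where "rh a = tt (unt Bd) a"

lemma lh_closed: "\<alpha> \<in> car Bd \<Longrightarrow> lh \<alpha> \<in> car TT" and rh_closed: "a \<in> car B \<Longrightarrow> rh a \<in> car TT"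
  by (simp_all add: lh_def rh_def rls)

lemma lin_lh: "lin V Bd f \<Longrightarrow> lin V TT (\<lambda>v. lh (f v))" and lin_rh: "lin V B g \<Longrightarrow> lin V TT (\<lambda>v. rh (g v))"
  by (simp_all add: lh_def rh_def rls)

lemma heis_lins: "lin V TT f \<Longrightarrow> y \<in> car TT \<Longrightarrow> lin V TT (\<lambda>v. f v \<cdot>\<^bsub>A\<^esub> y)"
  "lin V TT f \<Longrightarrow> y \<in> car TT \<Longrightarrow> lin V TT (\<lambda>v. y \<cdot>\<^bsub>A\<^esub> f v)"
  using lin_comp[OF heis_lin(1)] lin_comp[OF heis_lin(2)] by blast+

sublocale A: kalgebra A by (rule kalgebra_heis)

lemmas hrls = rls lh_closed rh_closed lin_lh lin_rh heis_lins heis_closed kalgebra_heis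

lemmas h_assoc = A.assoc[simplified]

lemma heis_out:
  assumes "kcoprod C" "h \<in> car C" "x \<in> car TT" "\<And>u v. u \<in> car C \<Longrightarrow> v \<in> car C \<Longrightarrow> f u v \<in> car TT"
  shows "sw C fscl h f \<cdot>\<^bsub>A\<^esub> x = sw C fscl h (\<lambda>u v. f u v \<cdot>\<^bsub>A\<^esub> x)"
    and "x \<cdot>\<^bsub>A\<^esub> sw C fscl h f = sw C fscl h (\<lambda>u v. x \<cdot>\<^bsub>A\<^esub> f u v)"
  using mul_sw_left[OF kalgebra_heis assms(1), of fscl h x f] mul_sw_right[OF kalgebra_heis assms(1), of fscl h x f]
    assms by simp_all

lemma lh_rh: "\<alpha> \<in> car Bd \<Longrightarrow> a \<in> car B \<Longrightarrow> lh \<alpha> \<cdot>\<^bsub>A\<^esub> rh a = tt \<alpha> a"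
  using kalgebra.unt_right[OF kalgebra_dual, of \<alpha>]
  by (simp add: lh_def rh_def heis_ptens unt_dual_closed sw_unt[of TT] bilI hrls act_left_unt)

lemma lh_mul: "\<alpha> \<in> car Bd \<Longrightarrow> \<beta> \<in> car Bd \<Longrightarrow> lh (\<alpha> \<cdot>\<^bsub>Bd\<^esub> \<beta>) = lh \<alpha> \<cdot>\<^bsub>A\<^esub> lh \<beta>"
  by (simp add: lh_def heis_ptens sw_unt[of TT] bilI hrls act_left_unt)

lemma rh_lh: "a \<in> car B \<Longrightarrow> \<beta> \<in> car Bd \<Longrightarrow> rh a \<cdot>\<^bsub>A\<^esub> lh \<beta> = sw B fscl a (\<lambda>a1 a2. lh (act_left B a1 \<beta>) \<cdot>\<^bsub>A\<^esub> rh a2)"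
  using kalgebra.unt_left[OF kalgebra_dual]
  by (simp add: lh_rh hrls cong: sw_cong) (simp add: lh_def rh_def heis_ptens unt_dual_closed hrls cong: sw_cong)

lemma rh_mul:
  assumes "a \<in> car B" "b \<in> car B"
  shows "rh (a \<cdot>\<^bsub>B\<^esub> b) = rh a \<cdot>\<^bsub>A\<^esub> rh b"
proof -
  have u: "scl Bd c (unt Bd) \<in> car Bd" for c
    using kspace.scl_closed[OF kspace_dual unt_dual_closed] .
  have "rh a \<cdot>\<^bsub>A\<^esub> rh b = sw B fscl a (\<lambda>a1 a2. fscl (cou B a1) (tt (unt Bd) (a2 \<cdot>\<^bsub>B\<^esub> b)))"
    using assms u kalgebra.unt_left[OF kalgebra_dual u]
      lin_scl[OF bil_left[OF ptens_bil[OF kspace_dual kspace_axioms]] unt_dual_closed]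
    by (simp add: rh_def heis_ptens unt_dual_closed act_left_counit hrls del: scl_dual cong: sw_cong)
  also have "\<dots> = rh (a \<cdot>\<^bsub>B\<^esub> b)"
    using assms unt_dual_closed by (simp add: sw_counit_left[of TT _ fscl] hrls rh_def)
  finally show ?thesis ..
qed

lemma lh_unt: "lh (unt Bd) = unt A" and rh_unt: "rh (unt B) = unt A"
  by (simp_all add: lh_def rh_def)

lemma unt_A [simp]: "tt (unt Bd) (unt B) \<cdot>\<^bsub>A\<^esub> x = x" "x \<cdot>\<^bsub>A\<^esub> tt (unt Bd) (unt B) = x" if "x \<in> car TT"
  using A.unt_left[of x] A.unt_right[of x] that by simp_all

text \<open>The straightening rule in the other direction. A factor \<open>m3 \<cdot> S m4\<close>
  is inserted on the right, \<open>rh_lh\<close> is applied backwards to legs 2 and 3, and the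
  antipode on the left then cancels.\<close>

lemma lh_rh_S:
  assumes b: "\<beta> \<in> car Bd" and m: "m \<in> car B"
  shows "lh \<beta> \<cdot>\<^bsub>A\<^esub> rh (ant B m) = sw B fscl m (\<lambda>m1 m2. rh (ant B m1) \<cdot>\<^bsub>A\<^esub> lh (act_left B m2 \<beta>))"
proof -
  note [simp] = hrls
  note T = sw_coassoc[of TT fscl]
  have rc: "rh (scl B c a) = fscl c (rh a)" if "a \<in> car B" for c a
    using lin_scl[OF lin_rh[OF lin_id] that] by simp
  have "sw B fscl m (\<lambda>m1 m2. rh (ant B m1) \<cdot>\<^bsub>A\<^esub> lh (act_left B m2 \<beta>)) =
    sw B fscl m (\<lambda>m1 z. sw B fscl z (\<lambda>m2 w. fscl (cou B w) (rh (ant B m1) \<cdot>\<^bsub>A\<^esub> lh (act_left B m2 \<beta>))))"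
    using b m by (simp add: sw_counit_right[of TT _ fscl] cong: sw_cong)
  also have "\<dots> = sw B fscl m (\<lambda>m1 z. sw B fscl z (\<lambda>m2 w.
      (rh (ant B m1) \<cdot>\<^bsub>A\<^esub> lh (act_left B m2 \<beta>)) \<cdot>\<^bsub>A\<^esub> rh (sw B (scl B) w (\<lambda>m3 m4. m3 \<cdot>\<^bsub>B\<^esub> ant B m4))))"
    using b m A.scl_mul_right[simplified]
    by (simp add: S_right rc rh_unt cong: sw_cong)
  also have "\<dots> = sw B fscl m (\<lambda>m1 z. sw B fscl z (\<lambda>m2 w. sw B fscl w (\<lambda>m3 m4.
      rh (ant B m1) \<cdot>\<^bsub>A\<^esub> (lh (act_left B m2 \<beta>) \<cdot>\<^bsub>A\<^esub> rh m3) \<cdot>\<^bsub>A\<^esub> rh (ant B m4))))"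
    using b m by (simp add: sw_out[OF lin_rh[OF lin_id], where sc'=fscl] rh_mul heis_out h_assoc cong: sw_cong)
  also have "\<dots> = sw B fscl m (\<lambda>m1 z. sw B fscl z (\<lambda>u m4. sw B fscl u (\<lambda>m2 m3.
      rh (ant B m1) \<cdot>\<^bsub>A\<^esub> (lh (act_left B m2 \<beta>) \<cdot>\<^bsub>A\<^esub> rh m3) \<cdot>\<^bsub>A\<^esub> rh (ant B m4))))"
    using b m by (simp add: T cong: sw_cong)
  \<comment> \<open>\<open>rh_lh\<close> from right to left: legs \<open>m2\<close> and
    \<open>m3\<close> of \<open>u\<close> are absorbed into \<open>rh u\<close>, which now stands
    next to \<open>rh (ant B m1)\<close>.\<close>
  also have "\<dots> = sw B fscl m (\<lambda>m1 z. sw B fscl z (\<lambda>u m4.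
      rh (ant B m1) \<cdot>\<^bsub>A\<^esub> (rh u \<cdot>\<^bsub>A\<^esub> lh \<beta>) \<cdot>\<^bsub>A\<^esub> rh (ant B m4)))"
    using b m by (simp add: rh_lh heis_out cong: sw_cong)
  also have "\<dots> = sw B fscl m (\<lambda>v m4. sw B fscl v (\<lambda>m1 u.
      rh (ant B m1 \<cdot>\<^bsub>B\<^esub> u) \<cdot>\<^bsub>A\<^esub> (lh \<beta> \<cdot>\<^bsub>A\<^esub> rh (ant B m4))))"
    using b m by (simp add: T rh_mul h_assoc cong: sw_cong)
  also have "\<dots> = sw B fscl m (\<lambda>v m4. rh (sw B (scl B) v (\<lambda>m1 u. ant B m1 \<cdot>\<^bsub>B\<^esub> u)) \<cdot>\<^bsub>A\<^esub> (lh \<beta> \<cdot>\<^bsub>A\<^esub> rh (ant B m4)))"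
    using b m by (simp add: sw_out[OF lin_rh[OF lin_id], where sc'=fscl] heis_out cong: sw_cong)
  also have "\<dots> = sw B fscl m (\<lambda>v m4. fscl (cou B v) (lh \<beta> \<cdot>\<^bsub>A\<^esub> rh (ant B m4)))"
    using b m A.scl_mul_left[simplified] by (simp add: S_left rc rh_unt cong: sw_cong)
  also have "\<dots> = lh \<beta> \<cdot>\<^bsub>A\<^esub> rh (ant B m)"
    using b m by (simp add: sw_counit_left[of TT _ fscl])
  finally show ?thesis ..
qed

text \<open>Since \<open>tt \<mu> m\<close> is \<open>lh \<mu> \<cdot> rh m\<close>, the inverses
  appear in reverse order; \<open>D.Si\<close> is the antipode for the opposite coproduct that the
  double carries on the dual factor.\<close>

definition ph :: "(('b \<Rightarrow> 'k) \<times> 'b \<Rightarrow>\<^sub>0 'k) \<Rightarrow> ('b \<Rightarrow> 'k) \<times> 'b \<Rightarrow>\<^sub>0 'k" where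
  "ph = ext fscl (\<lambda>\<mu> m. rh (ant B m) \<cdot>\<^bsub>A\<^esub> lh (D.Si \<mu>))"

lemma ph_lin: "lin TT TT ph"
  unfolding ph_def by (intro lin_tens_ext) (simp_all add: hrls)

lemma ph_tt: "\<mu> \<in> car Bd \<Longrightarrow> m \<in> car B \<Longrightarrow> ph (tt \<mu> m) = rh (ant B m) \<cdot>\<^bsub>A\<^esub> lh (D.Si \<mu>)"
  unfolding ph_def by (intro ext_ptens[of Bd B TT]) (simp_all add: hrls bilI)

lemma ph_bij: "bij_betw ph (car TT) (car TT)"
proof -
  note [simp] = hrls
  note T = sw_coassoc[of TT fscl]
  \<comment> \<open>Straightened, \<open>ph\<close> sends \<open>tt \<mu> m\<close> to the sum of
    \<open>tt (act_left B a1 (D.Si \<mu>)) a2\<close> over the legs of \<open>a = ant B m\<close>.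
    Acting with \<open>Si\<close> of a leg removes \<open>a1\<close>, and the remaining antipodes
    are inverted factor by factor.\<close>
  define q where "q = ext fscl (\<lambda>\<alpha> a. sw B fscl a (\<lambda>a1 a2. tt (ant Bd (act_left B (Si a1) \<alpha>)) (Si a2)))"
  have q_lin: "lin TT TT q" unfolding q_def by (intro lin_tens_ext) simp_all
  have q: "q (tt \<alpha> a) = sw B fscl a (\<lambda>a1 a2. tt (ant Bd (act_left B (Si a1) \<alpha>)) (Si a2))"
    if "\<alpha> \<in> car Bd" "a \<in> car B" for \<alpha> a
    unfolding q_def using that by (intro ext_ptens[of Bd B TT]) (simp_all add: bilI)
  have ac: "act_left B (scl B c (unt B)) \<beta> = scl Bd c \<beta>" if "\<beta> \<in> car Bd" for c \<beta>
    using that lin_scl[OF act_lin(1)[OF that] unt_closed, of c] by (simp add: act_left_unt)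
  have 1: "q (ph p) = p" if "p \<in> car TT" for p
  proof (rule tens_lin_eqI[OF kspace_dual kspace_axioms that, where U=TT])
    fix \<mu> m assume [simp]: "\<mu> \<in> car Bd" "m \<in> car B"
    have "q (ph (tt \<mu> m)) = sw B fscl (ant B m) (\<lambda>a1 a2. q (tt (act_left B a1 (D.Si \<mu>)) a2))"
      by (simp add: ph_tt rh_lh lh_rh sw_out[OF q_lin, where sc'=fscl] cong: sw_cong)
    also have "\<dots> = sw B fscl (ant B m) (\<lambda>a1 w. sw B fscl w (\<lambda>a2 a3. tt (ant Bd (act_left B (Si a2 \<cdot>\<^bsub>B\<^esub> a1) (D.Si \<mu>))) (Si a3)))"
      by (simp add: q act_left_mul cong: sw_cong)
    also have "\<dots> = sw B fscl (ant B m) (\<lambda>w a3. sw B fscl w (\<lambda>a1 a2. tt (ant Bd (act_left B (Si a2 \<cdot>\<^bsub>B\<^esub> a1) (D.Si \<mu>))) (Si a3)))"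
      by (simp add: T)
    also have "\<dots> = sw B fscl (ant B m) (\<lambda>w a3. tt (ant Bd (act_left B (sw B (scl B) w (\<lambda>a1 a2. Si a2 \<cdot>\<^bsub>B\<^esub> a1)) (D.Si \<mu>))) (Si a3))"
    proof (rule sw_cong)
      fix w a3 assume [simp]: "w \<in> car B" "a3 \<in> car B"
      have l: "lin B TT (\<lambda>x. tt (ant Bd (act_left B x (D.Si \<mu>))) (Si a3))" by simp
      show "sw B fscl w (\<lambda>a1 a2. tt (ant Bd (act_left B (Si a2 \<cdot>\<^bsub>B\<^esub> a1) (D.Si \<mu>))) (Si a3)) =
        tt (ant Bd (act_left B (sw B (scl B) w (\<lambda>a1 a2. Si a2 \<cdot>\<^bsub>B\<^esub> a1)) (D.Si \<mu>))) (Si a3)"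
        by (simp add: sw_out[OF l, where sc'=fscl])
    qed simp
    also have "\<dots> = sw B fscl (ant B m) (\<lambda>w a3. fscl (cou B w) (tt \<mu> (Si a3)))"
      using lin_scl[OF bil_left[OF ptens_bil[OF kspace_dual kspace_axioms]]] lin_scl[OF D.ant_lin]
      by (simp add: Si_left ac del: scl_dual cong: sw_cong)
    also have "\<dots> = tt \<mu> m"
      by (simp add: sw_counit_left[of TT _ fscl])
    finally show "q (ph (tt \<mu> m)) = tt \<mu> m" .
  qed (simp_all add: lin_comp[OF q_lin] ph_lin)
  have 2: "ph (q p) = p" if "p \<in> car TT" for p
  proof (rule tens_lin_eqI[OF kspace_dual kspace_axioms that, where U=TT])
    fix \<alpha> a assume [simp]: "\<alpha> \<in> car Bd" "a \<in> car B"
    have "ph (q (tt \<alpha> a)) = sw B fscl a (\<lambda>a1 a2. rh a2 \<cdot>\<^bsub>A\<^esub> lh (act_left B (Si a1) \<alpha>))"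
      by (simp add: q sw_out[OF ph_lin, where sc'=fscl] ph_tt cong: sw_cong)
    also have "\<dots> = sw B fscl a (\<lambda>a1 w. sw B fscl w (\<lambda>a2 a3. tt (act_left B (a2 \<cdot>\<^bsub>B\<^esub> Si a1) \<alpha>) a3))"
      by (simp add: rh_lh lh_rh act_left_mul cong: sw_cong)
    also have "\<dots> = sw B fscl a (\<lambda>w a3. sw B fscl w (\<lambda>a1 a2. tt (act_left B (a2 \<cdot>\<^bsub>B\<^esub> Si a1) \<alpha>) a3))"
      by (simp add: T)
    also have "\<dots> = sw B fscl a (\<lambda>w a3. tt (act_left B (sw B (scl B) w (\<lambda>a1 a2. a2 \<cdot>\<^bsub>B\<^esub> Si a1)) \<alpha>) a3)"
    proof (rule sw_cong)
      fix w a3 assume [simp]: "w \<in> car B" "a3 \<in> car B"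
      have l: "lin B TT (\<lambda>x. tt (act_left B x \<alpha>) a3)" by simp
      show "sw B fscl w (\<lambda>a1 a2. tt (act_left B (a2 \<cdot>\<^bsub>B\<^esub> Si a1) \<alpha>) a3) =
        tt (act_left B (sw B (scl B) w (\<lambda>a1 a2. a2 \<cdot>\<^bsub>B\<^esub> Si a1)) \<alpha>) a3"
        by (simp add: sw_out[OF l, where sc'=fscl])
    qed simp
    also have "\<dots> = sw B fscl a (\<lambda>w a3. fscl (cou B w) (tt \<alpha> a3))"
      using lin_scl[OF bil_left[OF ptens_bil[OF kspace_dual kspace_axioms]]]
      by (simp add: Si_right ac del: scl_dual cong: sw_cong)
    also have "\<dots> = tt \<alpha> a"
      by (simp add: sw_counit_left[of TT _ fscl])
    finally show "ph (q (tt \<alpha> a)) = tt \<alpha> a" .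
  qed (simp_all add: lin_comp[OF ph_lin] q_lin lin_id)
  show ?thesis
    by (rule bij_betw_byWitness[where f'=q]) (auto simp: 1 2 lin_closed[OF ph_lin] lin_closed[OF q_lin])
qed

end

section \<open>The Drinfeld double\<close>

text \<open>The premise \<open>car H = C\<close> lets the simplifier normalise the carrier before the membership
  assumptions enter the context.\<close>

lemma sw_cong_car:
  "car H = C \<Longrightarrow> kcoprod H \<Longrightarrow> h \<in> C \<Longrightarrow> (\<And>x y. x \<in> C \<Longrightarrow> y \<in> C \<Longrightarrow> f x y = g x y) \<Longrightarrow>
    sw H sc h f = sw H sc h g"
  using kcoprod.sw_cong by blast

context dual_setup_bij
begin

abbreviation "Dr \<equiv> drinfeld B"
abbreviation "T2 \<equiv> tens TT TT"
abbreviation "p2 \<equiv> ptens TT TT"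

lemma drin_simps [simp]: "car Dr = car TT" "scl Dr = fscl" "unt Dr = tt (unt Bd) (unt B)"
  and drin_mul: "x \<cdot>\<^bsub>Dr\<^esub> y = ext fscl (\<lambda>\<mu> m. ext fscl (\<lambda>\<nu> n.
      sw B fscl m (\<lambda>m1 z. sw B fscl z (\<lambda>m2 m3.
        tt (\<mu> \<cdot>\<^bsub>Bd\<^esub> act_right B (act_left B m1 \<nu>) (Si m3)) (m2 \<cdot>\<^bsub>B\<^esub> n)))) y) x"
  and drin_cop: "cop Dr = ext fscl (\<lambda>\<mu> m. sw Bd fscl \<mu> (\<lambda>\<mu>1 \<mu>2. sw B fscl m (\<lambda>m1 m2. p2 (tt \<mu>2 m1) (tt \<mu>1 m2))))"
  and drin_cou: "cou Dr = ext (*) (\<lambda>\<mu> m. cou Bd \<mu> * cou B m)"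
  by (simp_all add: drinfeld_def drinfeld_space_def sw2_eq_sw sw3_def)

lemma lin_drin [simp]: "lin Dr U f = lin TT U f" "lin V Dr g = lin V TT g"
  by (simp_all add: lin_def)

text \<open>\<open>tens\<close> and \<open>ptens\<close> see only carrier and scalars, which are
  those of \<open>TT\<close>.\<close>

lemma tens_drin [simp]: "tens Dr Dr = T2" "ptens Dr Dr = p2"
  "tens Dr (tens Dr Dr) = tens TT T2" "ptens Dr T2 = ptens TT T2" "tens Dr T2 = tens TT T2"
proof -
  have "over_k Dr = over_k TT" by (simp add: over_k_def)
  then show "tens Dr Dr = T2" "ptens Dr Dr = p2" "ptens Dr T2 = ptens TT T2" "tens Dr T2 = tens TT T2"
    unfolding tens_def ptens_def by (simp_all only:)
  then show "tens Dr (tens Dr Dr) = tens TT T2" by (simp only:)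
qed

lemma tens_heis [simp]: "tens A A = T2" "ptens A A = p2"
proof -
  have "over_k A = over_k TT" by (simp add: over_k_def)
  then show "tens A A = T2" "ptens A A = p2"
    unfolding tens_def ptens_def by (simp_all only:)
qed

lemma kspace_drin: "kspace Dr"
  using kspace_TT by (simp add: kspace_def)

lemmas T2_space = kspace_tens[OF kspace_TT kspace_TT]

lemma drin_cop_tt:
  "\<mu> \<in> car Bd \<Longrightarrow> m \<in> car B \<Longrightarrow> cop Dr (tt \<mu> m) =
    sw Bd fscl \<mu> (\<lambda>\<mu>1 \<mu>2. sw B fscl m (\<lambda>m1 m2. p2 (tt \<mu>2 m1) (tt \<mu>1 m2)))"
  unfolding drin_cop by (intro ext_ptens[of Bd B T2]) (simp_all add: hrls bilI)

lemma drin_cop_lin: "lin TT T2 (cop Dr)"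
  unfolding drin_cop by (intro lin_tens_ext) (simp_all add: hrls)

lemma drin_cou_tt: "\<mu> \<in> car Bd \<Longrightarrow> m \<in> car B \<Longrightarrow> cou Dr (tt \<mu> m) = \<mu> (unt B) * cou B m"
  unfolding drin_cou by (subst ext_ptens[of Bd B ground]) (simp_all add: hrls bilI lin_at)

lemma drin_cou_lin: "lin TT ground (cou Dr)"
  unfolding drin_cou by (intro lin_tens_ext) (simp_all add: hrls)

sublocale c: kcoprod Dr
  by (intro kcoprod.intro kcoprod_axioms.intro kspace_drin) (simp add: drin_cop_lin)

lemmas drin_rules = c.sw_lin_arg[unfolded drin_simps(1) lin_drin] c.sw_lin_body[unfolded drin_simps(1)]
  c.sw_closed[unfolded drin_simps(1)]

text \<open>The crossed indices of \<open>\<mu>\<close> express the opposite coproduct on the dual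
  factor.\<close>

lemma sw_drin:
  assumes "kspace U" "sc = scl U" "bil TT TT U f" "\<mu> \<in> car Bd" "m \<in> car B"
  shows "sw Dr sc (tt \<mu> m) f = sw Bd sc \<mu> (\<lambda>\<mu>1 \<mu>2. sw B sc m (\<lambda>m1 m2. f (tt \<mu>2 m1) (tt \<mu>1 m2)))"
proof -
  interpret U: kspace U by fact
  have e: "ext sc f (p2 x y) = f x y" if "x \<in> car TT" "y \<in> car TT" for x y
    using that assms by (intro ext_ptens kspace_TT)
  have "sw Dr sc (tt \<mu> m) f = sw Bd sc \<mu> (\<lambda>\<mu>1 \<mu>2. sw B sc m (\<lambda>m1 m2. ext sc f (p2 (tt \<mu>2 m1) (tt \<mu>1 m2))))"
    by (simp add: sw_def sw2_def drin_cop_tt assms) (simp add: sw_def sw2_def ext_comp[OF U.ambient])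
  also have "\<dots> = sw Bd sc \<mu> (\<lambda>\<mu>1 \<mu>2. sw B sc m (\<lambda>m1 m2. f (tt \<mu>2 m1) (tt \<mu>1 m2)))"
    using assms(4,5) by (simp add: e hrls cong: kcoprod.sw_cong)
  finally show ?thesis .
qed

lemma coassoc_Bd:
  assumes "kspace U" "sc = scl U" "h \<in> car Bd"
    "\<And>y z. y \<in> car Bd \<Longrightarrow> z \<in> car Bd \<Longrightarrow> lin Bd U (\<lambda>x. f x y z)"
    "\<And>x z. x \<in> car Bd \<Longrightarrow> z \<in> car Bd \<Longrightarrow> lin Bd U (\<lambda>y. f x y z)"
    "\<And>x y. x \<in> car Bd \<Longrightarrow> y \<in> car Bd \<Longrightarrow> lin Bd U (\<lambda>z. f x y z)"
  shows "sw Bd sc h (\<lambda>x z. sw Bd sc x (\<lambda>x' x''. f x' x'' z)) =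
    sw Bd sc h (\<lambda>x y. sw Bd sc y (\<lambda>y' y''. f x y' y''))"
  by (rule D.sw_coassoc) (use assms in auto)

text \<open>As a coalgebra the double is the tensor product of the co-opposite dual with
  \<open>B\<close>. The sums over the two factors are separated, and the axioms of each factor are
  used independently.\<close>

lemma kcoalgebra_drin: "kcoalgebra Dr"
proof (intro kcoalgebra.intro c.kcoprod_axioms kcoalgebra_axioms.intro)
  note T3 = kspace_tens[OF kspace_TT T2_space]
  note [simp] = drin_rules hrls T2_space T3 c.kcoprod_axioms lin_at drin_cop_lin lin_comp[OF drin_cop_lin]
    lin_closed[OF drin_cop_lin] drin_cou_lin lin_comp[OF drin_cou_lin]
  note cg = sw_cong_car
  note eqI = tens_lin_eqI[OF kspace_dual kspace_axioms]
  show "lin Dr ground (cou Dr)" by simp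
  show "sw Dr fscl h (\<lambda>x z. sw Dr fscl x (\<lambda>x' x''. ptens Dr (tens Dr Dr) x' (ptens Dr Dr x'' z))) =
      sw Dr fscl h (\<lambda>x y. ptens Dr (tens Dr Dr) x (cop Dr y))" if h: "h \<in> car Dr" for h
    unfolding tens_drin
  proof (rule eqI[where p=h and U="tens TT T2"])
    show "h \<in> car TT" using h by simp
    fix \<mu> m assume [simp]: "\<mu> \<in> car Bd" "m \<in> car B"
    have "sw Dr fscl (tt \<mu> m) (\<lambda>x z. sw Dr fscl x (\<lambda>x' x''. ptens TT T2 x' (p2 x'' z))) =
      sw Bd fscl \<mu> (\<lambda>\<mu>1 v. sw B fscl m (\<lambda>u m3. sw Bd fscl v (\<lambda>\<mu>2 \<mu>3. sw B fscl u (\<lambda>m1 m2.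
        ptens TT T2 (tt \<mu>3 m1) (p2 (tt \<mu>2 m2) (tt \<mu>1 m3))))))"
      by (simp add: sw_drin[of "tens TT T2"] bilI cong: cg)
    also have "\<dots> = sw Bd fscl \<mu> (\<lambda>\<mu>1 v. sw Bd fscl v (\<lambda>\<mu>2 \<mu>3. sw B fscl m (\<lambda>u m3. sw B fscl u (\<lambda>m1 m2.
        ptens TT T2 (tt \<mu>3 m1) (p2 (tt \<mu>2 m2) (tt \<mu>1 m3))))))"
      by (intro d.sw_cong sw_swap[OF vector_space_fscl]) simp_all
    also have "\<dots> = sw Bd fscl \<mu> (\<lambda>v \<mu>3. sw Bd fscl v (\<lambda>\<mu>1 \<mu>2. sw B fscl m (\<lambda>m1 u. sw B fscl u (\<lambda>m2 m3.
        ptens TT T2 (tt \<mu>3 m1) (p2 (tt \<mu>2 m2) (tt \<mu>1 m3))))))"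
      by (simp add: coassoc_Bd[of "tens TT T2" fscl] sw_coassoc[of "tens TT T2" fscl] cong: cg)
    also have "\<dots> = sw Bd fscl \<mu> (\<lambda>v \<mu>3. sw B fscl m (\<lambda>m1 u. sw Bd fscl v (\<lambda>\<mu>1 \<mu>2. sw B fscl u (\<lambda>m2 m3.
        ptens TT T2 (tt \<mu>3 m1) (p2 (tt \<mu>2 m2) (tt \<mu>1 m3))))))"
      by (intro d.sw_cong sw_swap[OF vector_space_fscl]) simp_all
    also have "\<dots> = sw Dr fscl (tt \<mu> m) (\<lambda>x y. ptens TT T2 x (cop Dr y))"
      by (simp add: sw_drin[of "tens TT T2"] bilI drin_cop_tt outs cong: cg)
    finally show "sw Dr fscl (tt \<mu> m) (\<lambda>x z. sw Dr fscl x (\<lambda>x' x''. ptens TT T2 x' (p2 x'' z))) =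
      sw Dr fscl (tt \<mu> m) (\<lambda>x y. ptens TT T2 x (cop Dr y))" .
  qed simp_all
  have s: "fscl (a * c) (tt \<mu> m) = tt (scl Bd a \<mu>) (scl B c m)" if "\<mu> \<in> car Bd" "m \<in> car B" for a c \<mu> m
    using that lin_scl[OF bil_left[OF ptens_bil[OF kspace_dual kspace_axioms]]]
      lin_scl[OF bil_right[OF ptens_bil[OF kspace_dual kspace_axioms]]]
      vector_space.vector_space_assms(3)[OF vector_space_fscl, of a c "tt \<mu> m"]
      kspace.scl_closed[OF kspace_dual]
    by (simp del: scl_dual)
  have cl: "scl Bd c \<mu> \<in> car Bd" if "\<mu> \<in> car Bd" for c \<mu>
    using kspace.scl_closed[OF kspace_dual that] .
  note cl [simp]
  have out1: "tt (sw Bd (scl Bd) \<mu> f) m = sw Bd fscl \<mu> (\<lambda>x y. tt (f x y) m)"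
    if "\<mu> \<in> car Bd" "m \<in> car B" "\<And>x y. x \<in> car Bd \<Longrightarrow> y \<in> car Bd \<Longrightarrow> f x y \<in> car Bd" for \<mu> m f
    using that by (intro ptens_sw_left) simp_all
  show "sw Dr (scl Dr) h (\<lambda>x y. scl Dr (cou Dr x) y) = h" if h: "h \<in> car Dr" for h
    unfolding drin_simps
  proof (rule eqI[where p=h and U=TT and g="\<lambda>h. h"])
    show "h \<in> car TT" using h by simp
    fix \<mu> m assume *[simp]: "\<mu> \<in> car Bd" "m \<in> car B"
    have "sw Dr fscl (tt \<mu> m) (\<lambda>x y. fscl (cou Dr x) y) =
      sw Bd fscl \<mu> (\<lambda>\<mu>1 \<mu>2. sw B fscl m (\<lambda>m1 m2. tt (scl Bd (cou Bd \<mu>2) \<mu>1) (scl B (cou B m1) m2)))"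
      by (simp add: sw_drin[of TT] bilI drin_cou_tt s del: scl_dual cong: cg)
    also have "\<dots> = tt (sw Bd (scl Bd) \<mu> (\<lambda>\<mu>1 \<mu>2. scl Bd (cou Bd \<mu>2) \<mu>1)) (sw B (scl B) m (\<lambda>m1 m2. scl B (cou B m1) m2))"
      by (simp add: ptens_sw_right counit_left out1 del: scl_dual flip: ptens_sw_right cong: cg)
    \<comment> \<open>Because of the opposite coproduct, the left counit law of the double uses the
      right counit law of the dual.\<close>
    also have "\<dots> = tt \<mu> m"
      using D.counit_right[OF *(1)] counit_left[OF *(2)] by (simp only: sw2_eq_sw)
    finally show "sw Dr fscl (tt \<mu> m) (\<lambda>x y. fscl (cou Dr x) y) = tt \<mu> m" .
  qed (simp_all add: lin_id)
  show "sw Dr (scl Dr) h (\<lambda>x y. scl Dr (cou Dr y) x) = h" if h: "h \<in> car Dr" for h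
    unfolding drin_simps
  proof (rule eqI[where p=h and U=TT and g="\<lambda>h. h"])
    show "h \<in> car TT" using h by simp
    fix \<mu> m assume *[simp]: "\<mu> \<in> car Bd" "m \<in> car B"
    have "sw Dr fscl (tt \<mu> m) (\<lambda>x y. fscl (cou Dr y) x) =
      sw Bd fscl \<mu> (\<lambda>\<mu>1 \<mu>2. sw B fscl m (\<lambda>m1 m2. tt (scl Bd (cou Bd \<mu>1) \<mu>2) (scl B (cou B m2) m1)))"
      by (simp add: sw_drin[of TT] bilI drin_cou_tt s del: scl_dual cong: cg)
    also have "\<dots> = tt (sw Bd (scl Bd) \<mu> (\<lambda>\<mu>1 \<mu>2. scl Bd (cou Bd \<mu>1) \<mu>2)) (sw B (scl B) m (\<lambda>m1 m2. scl B (cou B m2) m1))"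
      by (simp add: ptens_sw_right counit_right out1 del: scl_dual flip: ptens_sw_right cong: cg)
    also have "\<dots> = tt \<mu> m"
      using D.counit_left[OF *(1)] counit_right[OF *(2)] by (simp only: sw2_eq_sw)
    finally show "sw Dr fscl (tt \<mu> m) (\<lambda>x y. fscl (cou Dr y) x) = tt \<mu> m" .
  qed (simp_all add: lin_id)
qed

text \<open>The product of \<open>m\<close> and \<open>\<nu>\<close> in the double with the
  functional moved to the front (\<open>drin_rh_lh\<close>); the map \<open>R\<close> of
  \<open>twisted_hom\<close> for the double.\<close>

definition RD :: "'b \<Rightarrow> ('b \<Rightarrow> 'k) \<Rightarrow> ('b \<Rightarrow> 'k) \<times> 'b \<Rightarrow>\<^sub>0 'k" where
  "RD m \<nu> = sw B fscl m (\<lambda>m1 z. sw B fscl z (\<lambda>m2 m3. tt (act_right B (act_left B m1 \<nu>) (Si m3)) m2))"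

lemma RD_closed: "m \<in> car B \<Longrightarrow> \<nu> \<in> car Bd \<Longrightarrow> RD m \<nu> \<in> car TT"
  by (simp add: RD_def hrls)

lemma drin_tt:
  assumes "\<mu> \<in> car Bd" "m \<in> car B" "\<nu> \<in> car Bd" "n \<in> car B"
  shows "tt \<mu> m \<cdot>\<^bsub>Dr\<^esub> tt \<nu> n = sw B fscl m (\<lambda>m1 z. sw B fscl z (\<lambda>m2 m3.
        tt (\<mu> \<cdot>\<^bsub>Bd\<^esub> act_right B (act_left B m1 \<nu>) (Si m3)) (m2 \<cdot>\<^bsub>B\<^esub> n)))"
  unfolding drin_mul using assms
  by (intro ext_ext_ptens[OF _ _ _ _ kspace_TT, where f="\<lambda>\<mu> m \<nu> n. sw B fscl m (\<lambda>m1 z. sw B fscl z (\<lambda>m2 m3.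
        tt (\<mu> \<cdot>\<^bsub>Bd\<^esub> act_right B (act_left B m1 \<nu>) (Si m3)) (m2 \<cdot>\<^bsub>B\<^esub> n)))"])
     (simp_all add: bilI hrls)

lemma drin_lin: "y \<in> car TT \<Longrightarrow> lin TT TT (\<lambda>x. x \<cdot>\<^bsub>Dr\<^esub> y)" "x \<in> car TT \<Longrightarrow> lin TT TT (\<lambda>y. x \<cdot>\<^bsub>Dr\<^esub> y)"
proof -
  note [simp] = hrls
  have 1: "lin TT TT (ext fscl (\<lambda>\<nu> n. sw B fscl m (\<lambda>m1 z. sw B fscl z (\<lambda>m2 m3.
        tt (\<mu> \<cdot>\<^bsub>Bd\<^esub> act_right B (act_left B m1 \<nu>) (Si m3)) (m2 \<cdot>\<^bsub>B\<^esub> n)))))"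
    if "\<mu> \<in> car Bd" "m \<in> car B" for \<mu> m
    using that by (intro lin_tens_ext) simp_all
  show "lin TT TT (\<lambda>x. x \<cdot>\<^bsub>Dr\<^esub> y)" if "y \<in> car TT"
    unfolding drin_mul by (intro lin_tens_ext) (use that lin_closed[OF 1] in simp_all)
  show "lin TT TT (\<lambda>y. x \<cdot>\<^bsub>Dr\<^esub> y)" if "x \<in> car TT"
    unfolding drin_mul by (rule lin_tens_body[of Bd B x]) (use that 1 in simp_all)
qed

lemma drin_closed: "x \<in> car TT \<Longrightarrow> y \<in> car TT \<Longrightarrow> x \<cdot>\<^bsub>Dr\<^esub> y \<in> car TT"
  using drin_lin lin_closed by blast

lemma drin_R:
  assumes "\<mu> \<in> car Bd" "m \<in> car B" "\<nu> \<in> car Bd" "n \<in> car B"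
  shows "tt \<mu> m \<cdot>\<^bsub>Dr\<^esub> tt \<nu> n = ext fscl (\<lambda>\<nu>' m'. tt (\<mu> \<cdot>\<^bsub>Bd\<^esub> \<nu>') (m' \<cdot>\<^bsub>B\<^esub> n)) (RD m \<nu>)"
proof -
  note [simp] = hrls
  have l: "lin TT TT (ext fscl (\<lambda>\<beta>' a'. tt (\<mu> \<cdot>\<^bsub>Bd\<^esub> \<beta>') (a' \<cdot>\<^bsub>B\<^esub> n)))"
    using assms by (intro lin_tens_ext) simp_all
  have e: "ext fscl (\<lambda>\<beta>' a'. tt (\<mu> \<cdot>\<^bsub>Bd\<^esub> \<beta>') (a' \<cdot>\<^bsub>B\<^esub> n)) (tt \<beta>' a') = tt (\<mu> \<cdot>\<^bsub>Bd\<^esub> \<beta>') (a' \<cdot>\<^bsub>B\<^esub> n)"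
    if "\<beta>' \<in> car Bd" "a' \<in> car B" for \<beta>' a'
    using assms that by (intro ext_ptens[of Bd B TT]) (simp_all add: bilI)
  show ?thesis
    using assms by (simp add: drin_tt RD_def sw_out[OF l, where sc'=fscl] e cong: sw_cong)
qed

end

section \<open>The homomorphism from the Drinfeld double to the enveloping algebra\<close>

context dual_setup_bij
begin

lemmas drls = drin_rules hrls T2_space c.kcoprod_axioms ph_lin lin_closed[OF ph_lin] lin_comp[OF ph_lin]

text \<open>A Sweedler sum over \<open>\<beta>\<close> may be computed from any presentation of its
  coproduct, and presentations are recognised by pairing with \<open>a \<otimes> b\<close>.\<close>

lemma sw_dual_transfer:
  assumes U: "kspace U" "sc = scl U" and f: "bil Bd Bd U f" and b: "\<beta> \<in> car Bd" "\<nu> \<in> car Bd"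
    and gh: "\<And>x y. x \<in> car Bd \<Longrightarrow> y \<in> car Bd \<Longrightarrow> g x y \<in> car Bd"
      "\<And>x y. x \<in> car Bd \<Longrightarrow> y \<in> car Bd \<Longrightarrow> h x y \<in> car Bd"
    and eq: "\<And>a b. a \<in> car B \<Longrightarrow> b \<in> car B \<Longrightarrow> sw Bd (*) \<nu> (\<lambda>x y. g x y a * h x y b) = \<beta> (a \<cdot>\<^bsub>B\<^esub> b)"
  shows "sw Bd sc \<beta> f = sw Bd sc \<nu> (\<lambda>x y. f (g x y) (h x y))"
proof -
  interpret U: kspace U by fact
  note K = kspace_dual
  have e: "cop Bd \<beta> = sw Bd fscl \<nu> (\<lambda>x y. ptens Bd Bd (g x y) (h x y))"
    using b by (intro cop_dual_eqI d.sw_closed[OF kspace_tens[OF K K]])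
      (simp_all add: ptens_closed K gh eq ev2_sw cong: d.sw_cong)
  have "sw Bd sc \<beta> f = sw Bd sc \<nu> (\<lambda>x y. ext sc f (ptens Bd Bd (g x y) (h x y)))"
    by (simp add: sw_def sw2_def e U(2) ext_comp[OF U.ambient])
  also have "\<dots> = sw Bd sc \<nu> (\<lambda>x y. f (g x y) (h x y))"
    using b U f by (intro d.sw_cong ext_ptens[OF K K U(1)]) (simp_all add: gh)
  finally show ?thesis .
qed

text \<open>Both sides of the coproduct identity pair with \<open>a \<otimes> b\<close> to the value
  of \<open>\<nu>\<close> on \<open>y a b x\<close>.\<close>

lemma sw_act:
  assumes "kspace U" "sc = scl U" "bil Bd Bd U f" "\<nu> \<in> car Bd" "x \<in> car B" "y \<in> car B"
  shows "sw Bd sc (act_right B (act_left B x \<nu>) y) f = sw Bd sc \<nu> (\<lambda>\<nu>1 \<nu>2. f (act_right B \<nu>1 y) (act_left B x \<nu>2))"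
  by (rule sw_dual_transfer[OF assms(1-3)])
     (use assms(4-6) in \<open>simp_all add: act_right_closed act_left_closed act_left_apply act_right_apply
        assoc sw_ev cong: d.sw_cong\<close>)

text \<open>Translating the first leg of \<open>\<nu>\<close> on its right or the second leg on its
  left inserts \<open>x\<close> at the same place: both pair with \<open>a \<otimes> b\<close> to
  the value of \<open>\<nu>\<close> on \<open>a x b\<close>.\<close>

lemma sw_act_shift:
  assumes "kspace U" "sc = scl U" "bil Bd Bd U f" "\<nu> \<in> car Bd" "x \<in> car B"
  shows "sw Bd sc \<nu> (\<lambda>\<nu>1 \<nu>2. f (act_left B x \<nu>1) \<nu>2) = sw Bd sc \<nu> (\<lambda>\<nu>1 \<nu>2. f \<nu>1 (act_right B \<nu>2 x))"
proof -
  interpret U: kspace U by fact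
  note K = kspace_dual
  note [simp] = rls
  have e: "sw Bd fscl \<nu> (\<lambda>\<nu>1 \<nu>2. ptens Bd Bd (act_left B x \<nu>1) \<nu>2) =
      sw Bd fscl \<nu> (\<lambda>\<nu>1 \<nu>2. ptens Bd Bd \<nu>1 (act_right B \<nu>2 x))"
    using assms(4,5)
    by (intro dual_tens_eqI d.sw_closed[OF kspace_tens[OF K K]])
       (simp_all add: ev2_sw act_left_apply act_right_apply sw_ev assoc cong: d.sw_cong)
  have *: "sw Bd sc \<nu> (\<lambda>\<nu>1 \<nu>2. ext sc f (F \<nu>1 \<nu>2)) = ext sc f (sw Bd fscl \<nu> F)" for F
    by (simp add: sw_def sw2_def ext_comp[OF U.ambient] assms(2))
  have "sw Bd sc \<nu> (\<lambda>\<nu>1 \<nu>2. ext sc f (ptens Bd Bd (act_left B x \<nu>1) \<nu>2)) =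
      sw Bd sc \<nu> (\<lambda>\<nu>1 \<nu>2. ext sc f (ptens Bd Bd \<nu>1 (act_right B \<nu>2 x)))"
    unfolding * e ..
  then show ?thesis
    using assms by (simp add: ext_ptens[OF K K assms(1,3)] cong: d.sw_cong)
qed

text \<open>\<open>Si\<close> reverses products, so its transpose exchanges left and right
  translations: both sides at \<open>y\<close> are the value of \<open>\<nu>\<close> at
  \<open>Si (y \<cdot> m)\<close>.\<close>

lemma Si_act_right:
  assumes "\<nu> \<in> car Bd" "m \<in> car B"
  shows "D.Si (act_right B \<nu> (Si m)) = act_left B m (D.Si \<nu>)"
  using assms
  by (intro dual_eqI) (simp_all add: rls ant_inv_dual act_left_apply act_right_apply pull_apply
      pull_Si_closed Si_mul)

lemma e_ptens: "x \<in> car TT \<Longrightarrow> y \<in> car TT \<Longrightarrow> z \<in> car TT \<Longrightarrow> w \<in> car TT \<Longrightarrow>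
    p2 x y \<cdot>\<^bsub>env A\<^esub> p2 z w = p2 (x \<cdot>\<^bsub>A\<^esub> z) (w \<cdot>\<^bsub>A\<^esub> y)"
  using env_ptens[OF kalgebra_heis] by simp

lemma env_out:
  assumes "kcoprod C" "h \<in> car C" "x \<in> car T2" "\<And>u v. u \<in> car C \<Longrightarrow> v \<in> car C \<Longrightarrow> f u v \<in> car T2"
  shows "sw C fscl h f \<cdot>\<^bsub>env A\<^esub> x = sw C fscl h (\<lambda>u v. f u v \<cdot>\<^bsub>env A\<^esub> x)"
    and "x \<cdot>\<^bsub>env A\<^esub> sw C fscl h f = sw C fscl h (\<lambda>u v. x \<cdot>\<^bsub>env A\<^esub> f u v)"
  using mul_sw_left[OF kalgebra_env[OF kalgebra_heis] assms(1), of fscl h x f]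
    mul_sw_right[OF kalgebra_env[OF kalgebra_heis] assms(1), of fscl h x f] assms by simp_all

text \<open>\<open>th\<close> is the map \<open>\<theta>\<close> of \<open>inner_action\<close> for
  the double, with \<open>\<phi>\<close> the identity; \<open>tl\<close> and \<open>tr\<close> are
  its parts on the dual and on \<open>B\<close>, separated for \<open>twisted_hom\<close>.\<close>

definition tl where "tl \<mu> = sw Bd fscl \<mu> (\<lambda>\<mu>1 \<mu>2. p2 (lh \<mu>2) (lh (D.Si \<mu>1)))"
definition tr where "tr m = sw B fscl m (\<lambda>m1 m2. p2 (rh m1) (rh (ant B m2)))"
definition th where "th h = sw Dr fscl h (\<lambda>x y. p2 x (ph y))"

lemma tl_lin: "lin Bd T2 tl" and tr_lin: "lin B T2 tr" and th_lin: "lin TT T2 th"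
  unfolding tl_def[abs_def] tr_def[abs_def] th_def[abs_def] by (simp_all add: drls)

text \<open>In the second factor two reversals cancel: the enveloping algebra uses the opposite
  product there, and \<open>D.Si\<close> is antimultiplicative. In \<open>tr_mul\<close> the
  antipode of \<open>B\<close> plays the same part.\<close>

lemma tl_mul:
  assumes "\<mu> \<in> car Bd" "\<nu> \<in> car Bd"
  shows "tl (\<mu> \<cdot>\<^bsub>Bd\<^esub> \<nu>) = tl \<mu> \<cdot>\<^bsub>env A\<^esub> tl \<nu>"
proof -
  note [simp] = drls
  have b: "bil Bd Bd T2 (\<lambda>\<mu>1 \<mu>2. p2 (lh \<mu>2) (lh (D.Si \<mu>1)))" by (rule bilI) simp_all
  have "tl (\<mu> \<cdot>\<^bsub>Bd\<^esub> \<nu>) = sw Bd fscl \<mu> (\<lambda>\<mu>1 \<mu>2. sw Bd fscl \<nu> (\<lambda>\<nu>1 \<nu>2.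
      p2 (lh (\<mu>2 \<cdot>\<^bsub>Bd\<^esub> \<nu>2)) (lh (D.Si (\<mu>1 \<cdot>\<^bsub>Bd\<^esub> \<nu>1)))))"
    unfolding tl_def using assms by (simp add: D.sw_mul[OF T2_space _ b])
  also have "\<dots> = tl \<mu> \<cdot>\<^bsub>env A\<^esub> tl \<nu>"
    using assms by (simp add: tl_def env_out e_ptens lh_mul D.Si_mul cong: sw_cong_car)
      (rule sw_swap[OF vector_space_fscl])
  finally show ?thesis .
qed

lemma tr_mul:
  assumes "m \<in> car B" "n \<in> car B"
  shows "tr (m \<cdot>\<^bsub>B\<^esub> n) = tr m \<cdot>\<^bsub>env A\<^esub> tr n"
proof -
  note [simp] = drls
  have b: "bil B B T2 (\<lambda>m1 m2. p2 (rh m1) (rh (ant B m2)))" by (rule bilI) simp_all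
  have "tr (m \<cdot>\<^bsub>B\<^esub> n) = sw B fscl m (\<lambda>m1 m2. sw B fscl n (\<lambda>n1 n2.
      p2 (rh (m1 \<cdot>\<^bsub>B\<^esub> n1)) (rh (ant B (m2 \<cdot>\<^bsub>B\<^esub> n2)))))"
    unfolding tr_def using assms by (simp add: sw_mul[OF T2_space _ b])
  also have "\<dots> = sw B fscl m (\<lambda>m1 m2. sw B fscl n (\<lambda>n1 n2.
      p2 (rh m1) (rh (ant B m2)) \<cdot>\<^bsub>env A\<^esub> p2 (rh n1) (rh (ant B n2))))"
    using assms by (simp add: e_ptens rh_mul S_mul cong: sw_cong_car)
  also have "\<dots> = tr m \<cdot>\<^bsub>env A\<^esub> tr n"
    using assms by (simp add: tr_def env_out cong: sw_cong_car) (rule sw_swap[OF vector_space_fscl])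
  finally show ?thesis .
qed

text \<open>The opposite product puts \<open>rh (ant B m2)\<close> in front of
  \<open>lh (D.Si \<mu>1)\<close>, which is the order in \<open>ph\<close>.\<close>

lemma th_tt:
  assumes "\<mu> \<in> car Bd" "m \<in> car B"
  shows "th (tt \<mu> m) = tl \<mu> \<cdot>\<^bsub>env A\<^esub> tr m"
proof -
  note [simp] = drls
  have "th (tt \<mu> m) = sw Bd fscl \<mu> (\<lambda>\<mu>1 \<mu>2. sw B fscl m (\<lambda>m1 m2. p2 (tt \<mu>2 m1) (ph (tt \<mu>1 m2))))"
    unfolding th_def using assms by (intro sw_drin[OF T2_space]) (simp_all add: bilI)
  also have "\<dots> = sw Bd fscl \<mu> (\<lambda>\<mu>1 \<mu>2. sw B fscl m (\<lambda>m1 m2.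
      p2 (lh \<mu>2) (lh (D.Si \<mu>1)) \<cdot>\<^bsub>env A\<^esub> p2 (rh m1) (rh (ant B m2))))"
    using assms by (simp add: e_ptens ph_tt lh_rh cong: sw_cong_car)
  also have "\<dots> = tl \<mu> \<cdot>\<^bsub>env A\<^esub> tr m"
    using assms by (simp add: tl_def tr_def env_out cong: sw_cong_car) (rule sw_swap[OF vector_space_fscl])
  finally show ?thesis .
qed

text \<open>The image of the straightening rule of the double. Both tensor factors are straightened
  in the Heisenberg double, which splits \<open>m\<close> into four legs. The middle two form
  \<open>tr\<close>; the outer two act on \<open>\<nu>\<close> as in \<open>RD\<close>.\<close>

lemma tr_tl:
  assumes m: "m \<in> car B" and n: "\<nu> \<in> car Bd"
  shows "tr m \<cdot>\<^bsub>env A\<^esub> tl \<nu> = th (RD m \<nu>)"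
proof -
  note [simp] = drls
  note T = sw_coassoc[of T2 fscl]
  \<comment> \<open>The summand after both straightenings; naming it lets coassociativity be applied
    to the legs of \<open>m\<close> with the sum over \<open>\<nu>\<close> kept inside.\<close>
  define f where "f m1 m2 m3 m4 = sw Bd fscl \<nu> (\<lambda>\<nu>1 \<nu>2. p2 (lh (act_left B m1 \<nu>2) \<cdot>\<^bsub>A\<^esub> rh m2)
      (rh (ant B m3) \<cdot>\<^bsub>A\<^esub> lh (act_left B m4 (D.Si \<nu>1))))" for m1 m2 m3 m4
  have f [simp]: "f m1 m2 m3 m4 \<in> car T2" if "m1 \<in> car B" "m2 \<in> car B" "m3 \<in> car B" "m4 \<in> car B" for m1 m2 m3 m4
    unfolding f_def using that n by simp
  have fl [simp]: "lin V T2 (\<lambda>v. f (g v) m2 m3 m4)" "lin V T2 (\<lambda>v. f m2 (g v) m3 m4)"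
      "lin V T2 (\<lambda>v. f m2 m3 (g v) m4)" "lin V T2 (\<lambda>v. f m2 m3 m4 (g v))"
    if "m4 \<in> car B" "m2 \<in> car B" "m3 \<in> car B" "lin V B g" "kspace V"
    for m2 m3 m4 and g and V :: "('k, 'b, 'c) space_scheme"
    unfolding f_def using that n by simp_all
  have "tr m \<cdot>\<^bsub>env A\<^esub> tl \<nu> = sw B fscl m (\<lambda>u v. sw Bd fscl \<nu> (\<lambda>\<nu>1 \<nu>2.
      p2 (rh u \<cdot>\<^bsub>A\<^esub> lh \<nu>2) (lh (D.Si \<nu>1) \<cdot>\<^bsub>A\<^esub> rh (ant B v))))"
    using m n by (simp add: tr_def tl_def env_out e_ptens cong: sw_cong_car)
      (rule sw_swap[OF vector_space_fscl])
  also have "\<dots> = sw B fscl m (\<lambda>u v. sw Bd fscl \<nu> (\<lambda>\<nu>1 \<nu>2. sw B fscl u (\<lambda>m1 m2. sw B fscl v (\<lambda>m3 m4.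
      p2 (lh (act_left B m1 \<nu>2) \<cdot>\<^bsub>A\<^esub> rh m2) (rh (ant B m3) \<cdot>\<^bsub>A\<^esub> lh (act_left B m4 (D.Si \<nu>1)))))))"
  \<comment> \<open>The left tensor factor is straightened by \<open>rh_lh\<close>, the right one,
    where the product is reversed, by \<open>lh_rh_S\<close>.\<close>
  proof (intro sw_cong d.sw_cong m n)
    fix u v \<nu>1 \<nu>2 assume *[simp]: "u \<in> car B" "v \<in> car B" "\<nu>1 \<in> car Bd" "\<nu>2 \<in> car Bd"
    show "p2 (rh u \<cdot>\<^bsub>A\<^esub> lh \<nu>2) (lh (D.Si \<nu>1) \<cdot>\<^bsub>A\<^esub> rh (ant B v)) = sw B fscl u (\<lambda>m1 m2. sw B fscl v (\<lambda>m3 m4.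
      p2 (lh (act_left B m1 \<nu>2) \<cdot>\<^bsub>A\<^esub> rh m2) (rh (ant B m3) \<cdot>\<^bsub>A\<^esub> lh (act_left B m4 (D.Si \<nu>1)))))"
      unfolding rh_lh[OF *(1,4)] lh_rh_S[OF D.Si_closed[OF *(3)] *(2)]
      by (simp add: ptens_sw_left ptens_sw_right cong: sw_cong_car) (rule sw_swap[OF vector_space_fscl])
  qed
  also have "\<dots> = sw B fscl m (\<lambda>u v. sw B fscl u (\<lambda>m1 m2. sw Bd fscl \<nu> (\<lambda>\<nu>1 \<nu>2. sw B fscl v (\<lambda>m3 m4.
      p2 (lh (act_left B m1 \<nu>2) \<cdot>\<^bsub>A\<^esub> rh m2) (rh (ant B m3) \<cdot>\<^bsub>A\<^esub> lh (act_left B m4 (D.Si \<nu>1)))))))"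
    using m by (intro sw_cong sw_swap[OF vector_space_fscl]) simp_all
  also have "\<dots> = sw B fscl m (\<lambda>u v. sw B fscl u (\<lambda>m1 m2. sw B fscl v (\<lambda>m3 m4. f m1 m2 m3 m4)))"
    unfolding f_def using m by (intro sw_cong sw_swap[OF vector_space_fscl]) simp_all
  also have "\<dots> = sw B fscl m (\<lambda>m1 z. sw B fscl z (\<lambda>u m4. sw B fscl u (\<lambda>m2 m3. f m1 m2 m3 m4)))"
    using m by (simp add: T cong: sw_cong)
  also have "\<dots> = sw B fscl m (\<lambda>m1 z. sw B fscl z (\<lambda>u m4.
      sw Bd fscl (act_right B (act_left B m1 \<nu>) (Si m4)) (\<lambda>\<nu>1 \<nu>2. p2 (lh \<nu>2) (lh (D.Si \<nu>1))) \<cdot>\<^bsub>env A\<^esub> tr u))"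
  proof (intro sw_cong m)
    fix m1 z u m4 assume [simp]: "m1 \<in> car B" "z \<in> car B" "u \<in> car B" "m4 \<in> car B"
    \<comment> \<open>By \<open>Si_act_right\<close> the fourth leg acts inside \<open>D.Si\<close>,
      so the sum over \<open>\<nu>\<close> is the coproduct of \<open>\<nu>\<close> translated by
      \<open>m1\<close> and \<open>Si m4\<close>.\<close>
    have "sw Bd fscl (act_right B (act_left B m1 \<nu>) (Si m4)) (\<lambda>\<nu>1 \<nu>2. p2 (lh \<nu>2) (lh (D.Si \<nu>1))) =
        sw Bd fscl \<nu> (\<lambda>\<nu>1 \<nu>2. p2 (lh (act_left B m1 \<nu>2)) (lh (D.Si (act_right B \<nu>1 (Si m4)))))"
      using n by (intro sw_act[OF T2_space]) (simp_all add: bilI)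
    then show "sw B fscl u (\<lambda>m2 m3. f m1 m2 m3 m4) =
      sw Bd fscl (act_right B (act_left B m1 \<nu>) (Si m4)) (\<lambda>\<nu>1 \<nu>2. p2 (lh \<nu>2) (lh (D.Si \<nu>1))) \<cdot>\<^bsub>env A\<^esub> tr u"
      using n by (simp add: f_def tr_def env_out e_ptens Si_act_right cong: sw_cong_car)
  qed
  also have "\<dots> = th (RD m \<nu>)"
    using m n
    by (simp add: RD_def sw_out[OF th_lin kspace_TT, where sc'=fscl] th_tt tl_def cong: sw_cong)
  finally show ?thesis .
qed

lemma th_mul:
  assumes "x \<in> car TT" "y \<in> car TT"
  shows "th (x \<cdot>\<^bsub>Dr\<^esub> y) = th x \<cdot>\<^bsub>env A\<^esub> th y"
  by (rule twisted_hom[OF kalgebra_dual kalgebra_axioms kalgebra_env[OF kalgebra_heis] drin_lin(2)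
        drin_lin(1) RD_closed drin_R _ tl_mul _ tr_mul _ th_tt tr_tl assms])
     (simp_all add: tl_lin tr_lin th_lin)

end

section \<open>The convolution inverse and the inner form of the action\<close>

context dual_setup_bij
begin

lemma drin_unt_cop: "cop Dr (unt Dr) = p2 (unt Dr) (unt Dr)"
proof -
  note [simp] = drls unt_dual_closed
  have "cop Dr (unt Dr) = sw Bd fscl (unt Bd) (\<lambda>\<mu>1 \<mu>2. p2 (tt \<mu>2 (unt B)) (tt \<mu>1 (unt B)))"
    by (simp add: drin_cop_tt sw_unt[of T2] bilI cong: sw_cong_car)
  also have "\<dots> = p2 (unt Dr) (unt Dr)"
    by (subst D.sw_unt[OF T2_space]) (simp_all add: bilI)
  finally show ?thesis .
qed

lemma lh_scl: "\<alpha> \<in> car Bd \<Longrightarrow> lh (scl Bd c \<alpha>) = fscl c (lh \<alpha>)"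
  and rh_scl: "a \<in> car B \<Longrightarrow> rh (scl B c a) = fscl c (rh a)"
  using lin_scl[OF lin_lh[OF lin_id]] lin_scl[OF lin_rh[OF lin_id]] by simp_all

lemmas h_scl = A.scl_mul_left[simplified] A.scl_mul_right[simplified]

text \<open>The legs of \<open>m\<close> meet in the middle as \<open>m1 \<cdot> S m2\<close> and
  cancel first; then \<open>\<mu>2\<close> meets \<open>D.Si \<mu>1\<close>.\<close>

lemma ph_conv_right:
  assumes "h \<in> car TT"
  shows "sw Dr fscl h (\<lambda>x y. x \<cdot>\<^bsub>A\<^esub> ph y) = fscl (cou Dr h) (unt A)"
proof (rule tens_lin_eqI[OF kspace_dual kspace_axioms assms, where U=TT])
  note [simp] = drls unt_dual_closed drin_cou_lin lin_comp[OF drin_cou_lin]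
  fix \<mu> m assume [simp]: "\<mu> \<in> car Bd" "m \<in> car B"
  have "sw Dr fscl (tt \<mu> m) (\<lambda>x y. x \<cdot>\<^bsub>A\<^esub> ph y) =
    sw Bd fscl \<mu> (\<lambda>\<mu>1 \<mu>2. sw B fscl m (\<lambda>m1 m2. tt \<mu>2 m1 \<cdot>\<^bsub>A\<^esub> ph (tt \<mu>1 m2)))"
    by (intro sw_drin[OF kspace_TT]) (simp_all add: bilI)
  also have "\<dots> = sw Bd fscl \<mu> (\<lambda>\<mu>1 \<mu>2. sw B fscl m (\<lambda>m1 m2.
      lh \<mu>2 \<cdot>\<^bsub>A\<^esub> rh (m1 \<cdot>\<^bsub>B\<^esub> ant B m2) \<cdot>\<^bsub>A\<^esub> lh (D.Si \<mu>1)))"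
    by (simp add: ph_tt cong: sw_cong_car) (simp add: rh_mul h_assoc flip: lh_rh cong: sw_cong_car)
  also have "\<dots> = sw Bd fscl \<mu> (\<lambda>\<mu>1 \<mu>2.
      lh \<mu>2 \<cdot>\<^bsub>A\<^esub> rh (sw B (scl B) m (\<lambda>m1 m2. m1 \<cdot>\<^bsub>B\<^esub> ant B m2)) \<cdot>\<^bsub>A\<^esub> lh (D.Si \<mu>1))"
    by (simp add: sw_out[OF lin_rh[OF lin_id], where sc'=fscl] heis_out cong: sw_cong_car)
  also have "\<dots> = sw Bd fscl \<mu> (\<lambda>\<mu>1 \<mu>2. fscl (cou B m) (lh (\<mu>2 \<cdot>\<^bsub>Bd\<^esub> D.Si \<mu>1)))"
    by (simp add: S_right rh_scl rh_unt h_scl lh_mul cong: sw_cong_car)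
  also have "\<dots> = fscl (cou B m) (lh (sw Bd (scl Bd) \<mu> (\<lambda>\<mu>1 \<mu>2. \<mu>2 \<cdot>\<^bsub>Bd\<^esub> D.Si \<mu>1)))"
  proof -
    have l: "lin Bd TT (\<lambda>x. fscl (cou B m) (lh x))" by (simp add: lin_id)
    show ?thesis
      by (subst d.sw_out[OF l kspace_dual refl, where sc'=fscl]) (simp_all del: scl_dual)
  qed
  also have "\<dots> = fscl (cou Dr (tt \<mu> m)) (unt A)"
    unfolding D.Si_right[OF \<open>\<mu> \<in> car Bd\<close>] lh_scl[OF unt_dual_closed]
    by (simp add: lh_unt drin_cou_tt mult.commute)
  finally show "sw Dr fscl (tt \<mu> m) (\<lambda>x y. x \<cdot>\<^bsub>A\<^esub> ph y) = fscl (cou Dr (tt \<mu> m)) (unt A)" .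
qed (simp_all add: drls unt_dual_closed drin_cou_lin lin_comp[OF drin_cou_lin])

text \<open>Here the legs of \<open>\<mu>\<close> are innermost and cancel first, so the sum over
  \<open>\<mu>\<close> is moved inside the sum over \<open>m\<close>.\<close>

lemma ph_conv_left:
  assumes "h \<in> car TT"
  shows "sw Dr fscl h (\<lambda>x y. ph x \<cdot>\<^bsub>A\<^esub> y) = fscl (cou Dr h) (unt A)"
proof (rule tens_lin_eqI[OF kspace_dual kspace_axioms assms, where U=TT])
  note [simp] = drls unt_dual_closed drin_cou_lin lin_comp[OF drin_cou_lin]
  fix \<mu> m assume [simp]: "\<mu> \<in> car Bd" "m \<in> car B"
  have "sw Dr fscl (tt \<mu> m) (\<lambda>x y. ph x \<cdot>\<^bsub>A\<^esub> y) =
    sw Bd fscl \<mu> (\<lambda>\<mu>1 \<mu>2. sw B fscl m (\<lambda>m1 m2. ph (tt \<mu>2 m1) \<cdot>\<^bsub>A\<^esub> tt \<mu>1 m2))"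
    by (intro sw_drin[OF kspace_TT]) (simp_all add: bilI)
  also have "\<dots> = sw B fscl m (\<lambda>m1 m2. sw Bd fscl \<mu> (\<lambda>\<mu>1 \<mu>2. ph (tt \<mu>2 m1) \<cdot>\<^bsub>A\<^esub> tt \<mu>1 m2))"
    by (rule sw_swap[OF vector_space_fscl])
  also have "\<dots> = sw B fscl m (\<lambda>m1 m2. sw Bd fscl \<mu> (\<lambda>\<mu>1 \<mu>2.
      rh (ant B m1) \<cdot>\<^bsub>A\<^esub> lh (D.Si \<mu>2 \<cdot>\<^bsub>Bd\<^esub> \<mu>1) \<cdot>\<^bsub>A\<^esub> rh m2))"
    by (simp add: ph_tt cong: sw_cong_car) (simp add: lh_mul h_assoc flip: lh_rh cong: sw_cong_car)
  also have "\<dots> = sw B fscl m (\<lambda>m1 m2.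
      rh (ant B m1) \<cdot>\<^bsub>A\<^esub> lh (sw Bd (scl Bd) \<mu> (\<lambda>\<mu>1 \<mu>2. D.Si \<mu>2 \<cdot>\<^bsub>Bd\<^esub> \<mu>1)) \<cdot>\<^bsub>A\<^esub> rh m2)"
    by (simp add: d.sw_out[OF lin_lh[OF lin_id], where sc'=fscl] heis_out cong: sw_cong_car)
  also have "\<dots> = sw B fscl m (\<lambda>m1 m2. fscl (\<mu> (unt B)) (rh (ant B m1 \<cdot>\<^bsub>B\<^esub> m2)))"
    unfolding D.Si_left[OF \<open>\<mu> \<in> car Bd\<close>] lh_scl[OF unt_dual_closed]
    by (simp add: lh_unt h_scl rh_mul cong: sw_cong_car)
  also have "\<dots> = fscl (\<mu> (unt B)) (rh (sw B (scl B) m (\<lambda>m1 m2. ant B m1 \<cdot>\<^bsub>B\<^esub> m2)))"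
  proof -
    have l: "lin B TT (\<lambda>x. fscl (\<mu> (unt B)) (rh x))" by (simp add: lin_id)
    show ?thesis
      by (subst sw_out[OF l kspace_axioms refl, where sc'=fscl]) simp_all
  qed
  also have "\<dots> = fscl (cou Dr (tt \<mu> m)) (unt A)"
    by (simp add: S_left rh_scl rh_unt drin_cou_tt)
  finally show "sw Dr fscl (tt \<mu> m) (\<lambda>x y. ph x \<cdot>\<^bsub>A\<^esub> y) = fscl (cou Dr (tt \<mu> m)) (unt A)" .
qed (simp_all add: drls unt_dual_closed drin_cou_lin lin_comp[OF drin_cou_lin])

lemma coact_closed: "c \<in> car B \<Longrightarrow> \<kappa> \<in> car Bd \<Longrightarrow> coact_right B c \<kappa> \<in> car B"
  by (simp add: coact_right_def sw2_eq_sw rls)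

lemma lin_coact: "\<kappa> \<in> car Bd \<Longrightarrow> lin V B f \<Longrightarrow> lin V B (\<lambda>v. coact_right B (f v) \<kappa>)"
  "c \<in> car B \<Longrightarrow> kspace V \<Longrightarrow> lin V Bd g \<Longrightarrow> lin V B (\<lambda>v. coact_right B c (g v))"
proof -
  note [simp] = rls lin_at
  show "lin V B (\<lambda>v. coact_right B (f v) \<kappa>)" if "\<kappa> \<in> car Bd" "lin V B f"
    using that by (simp add: coact_right_def sw2_eq_sw)
  have "lin Bd B (\<lambda>\<kappa>. coact_right B c \<kappa>)" if "c \<in> car B"
    using that by (simp add: coact_right_def sw2_eq_sw)
  then show "c \<in> car B \<Longrightarrow> kspace V \<Longrightarrow> lin V Bd g \<Longrightarrow> lin V B (\<lambda>v. coact_right B c (g v))"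
    using lin_comp by blast
qed

text \<open>The scalar pairing \<open>\<kappa>2\<close> with \<open>c1\<close> can be attached to
  the functional, giving \<open>act_left\<close>, or to the element of \<open>B\<close>, giving
  \<open>coact_right\<close>. The second reading produces the form in which the action is
  stated.\<close>

lemma rh_lh_coact:
  assumes c: "c \<in> car B" and k: "\<kappa> \<in> car Bd"
  shows "rh c \<cdot>\<^bsub>A\<^esub> lh \<kappa> = sw Bd fscl \<kappa> (\<lambda>\<kappa>1 \<kappa>2. tt \<kappa>1 (coact_right B c \<kappa>2))"
proof -
  note [simp] = rls
  have "rh c \<cdot>\<^bsub>A\<^esub> lh \<kappa> = sw B fscl c (\<lambda>c1 c2. tt (act_left B c1 \<kappa>) c2)"
    using assms by (simp add: rh_lh lh_rh cong: sw_cong)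
  also have "\<dots> = sw B fscl c (\<lambda>c1 c2. sw Bd fscl \<kappa> (\<lambda>\<kappa>1 \<kappa>2. fscl (\<kappa>2 c1) (tt \<kappa>1 c2)))"
  proof (rule sw_cong[OF c])
    fix c1 c2 assume [simp]: "c1 \<in> car B" "c2 \<in> car B"
    have s: "scl Bd x \<beta> \<in> car Bd" if "\<beta> \<in> car Bd" for x \<beta>
      using kspace.scl_closed[OF kspace_dual that] .
    have "tt (sw Bd (scl Bd) \<kappa> (\<lambda>\<kappa>1 \<kappa>2. scl Bd (\<kappa>2 c1) \<kappa>1)) c2 =
        sw Bd fscl \<kappa> (\<lambda>\<kappa>1 \<kappa>2. tt (scl Bd (\<kappa>2 c1) \<kappa>1) c2)"
      using k s by (intro ptens_sw_left) (simp_all del: scl_dual)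
    also have "\<dots> = sw Bd fscl \<kappa> (\<lambda>\<kappa>1 \<kappa>2. fscl (\<kappa>2 c1) (tt \<kappa>1 c2))"
      using k lin_scl[OF bil_left[OF ptens_bil[OF kspace_dual kspace_axioms]]]
      by (intro d.sw_cong) (simp_all del: scl_dual)
    finally show "tt (act_left B c1 \<kappa>) c2 = sw Bd fscl \<kappa> (\<lambda>\<kappa>1 \<kappa>2. fscl (\<kappa>2 c1) (tt \<kappa>1 c2))"
      by (simp only: act_left_def sw2_eq_sw)
  qed
  also have "\<dots> = sw Bd fscl \<kappa> (\<lambda>\<kappa>1 \<kappa>2. sw B fscl c (\<lambda>c1 c2. fscl (\<kappa>2 c1) (tt \<kappa>1 c2)))"
    by (rule sw_swap[OF vector_space_fscl])
  also have "\<dots> = sw Bd fscl \<kappa> (\<lambda>\<kappa>1 \<kappa>2. tt \<kappa>1 (coact_right B c \<kappa>2))"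
    using c k lin_scl[OF bil_right[OF ptens_bil[OF kspace_dual kspace_axioms]]]
    by (simp add: coact_right_def sw2_eq_sw ptens_sw_right cong: sw_cong_car)
  finally show ?thesis .
qed

text \<open>Straightening \<open>rh u \<cdot> lh \<beta>\<close> yields the action of
  \<open>m'\<close> on \<open>\<beta>\<close>; the remaining elements of \<open>B\<close> multiply
  to \<open>m'' b S(m''')\<close>, and \<open>rh_lh_coact\<close> moves them past the last
  functional.\<close>

lemma action_eq:
  assumes h: "h \<in> car TT" and x: "x \<in> car TT"
  shows "drinfeld_action B h x = sw Dr fscl h (\<lambda>y z. y \<cdot>\<^bsub>A\<^esub> x \<cdot>\<^bsub>A\<^esub> ph z)"
proof -
  note [simp] = drls coact_closed lin_coact
  define J where "J \<mu> m \<beta> b = sw Bd fscl \<mu> (\<lambda>\<mu>1 v. sw Bd fscl v (\<lambda>\<mu>2 \<mu>3.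
      sw B fscl m (\<lambda>m1 z. sw B fscl z (\<lambda>m2 m3. tt (\<mu>3 \<cdot>\<^bsub>Bd\<^esub> act_left B m1 \<beta> \<cdot>\<^bsub>Bd\<^esub> D.Si \<mu>2)
        (coact_right B (m2 \<cdot>\<^bsub>B\<^esub> b \<cdot>\<^bsub>B\<^esub> ant B m3) (D.Si \<mu>1))))))" for \<mu> m \<beta> b
  have act: "drinfeld_action B h x = ext fscl (\<lambda>\<mu> m. ext fscl (\<lambda>\<beta> b. J \<mu> m \<beta> b) x) h" for h x
    by (simp add: drinfeld_action_def J_def sw3_def sw2_eq_sw)
  have J [simp]: "J \<mu> m \<beta> b \<in> car TT" if "\<mu> \<in> car Bd" "m \<in> car B" "\<beta> \<in> car Bd" "b \<in> car B" for \<mu> m \<beta> b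
    unfolding J_def using that by simp
  have J1: "bil Bd B TT (J \<mu> m)" if "\<mu> \<in> car Bd" "m \<in> car B" for \<mu> m
    unfolding J_def[abs_def] using that by (intro bilI) simp_all
  have J2: "bil Bd B TT (\<lambda>\<mu> m. J \<mu> m \<beta> b)" if "\<beta> \<in> car Bd" "b \<in> car B" for \<beta> b
    unfolding J_def using that by (intro bilI) simp_all
  have pure: "drinfeld_action B (tt \<mu> m) (tt \<beta> b) = J \<mu> m \<beta> b"
    if "\<mu> \<in> car Bd" "m \<in> car B" "\<beta> \<in> car Bd" "b \<in> car B" for \<mu> m \<beta> b
    unfolding act using that by (intro ext_ext_ptens[OF _ _ _ _ kspace_TT, where f=J]) (simp_all add: J1 J2)
  have inner: "lin TT TT (ext fscl (J \<mu> m))" if "\<mu> \<in> car Bd" "m \<in> car B" for \<mu> m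
    using that by (intro lin_tens_ext) simp_all
  have l1: "lin TT TT (\<lambda>h. drinfeld_action B h x)" if "x \<in> car TT" for x
    unfolding act by (intro lin_tens_ext) (use that lin_closed[OF inner] in simp_all)
  have l2: "lin TT TT (\<lambda>x. drinfeld_action B h x)" if "h \<in> car TT" for h
    unfolding act by (rule lin_tens_body[of Bd B h]) (use that inner in simp_all)
  have eq: "drinfeld_action B (tt \<mu> m) (tt \<beta> b) = sw Dr fscl (tt \<mu> m) (\<lambda>y z. y \<cdot>\<^bsub>A\<^esub> tt \<beta> b \<cdot>\<^bsub>A\<^esub> ph z)"
    if *[simp]: "\<mu> \<in> car Bd" "m \<in> car B" "\<beta> \<in> car Bd" "b \<in> car B" for \<mu> m \<beta> b
  proof -
    have lt: "lh \<alpha> \<cdot>\<^bsub>A\<^esub> tt \<kappa> c = tt (\<alpha> \<cdot>\<^bsub>Bd\<^esub> \<kappa>) c" if "\<alpha> \<in> car Bd" "\<kappa> \<in> car Bd" "c \<in> car B" for \<alpha> \<kappa> c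
      using that by (simp add: lh_mul h_assoc flip: lh_rh)
    have "sw Dr fscl (tt \<mu> m) (\<lambda>y z. y \<cdot>\<^bsub>A\<^esub> tt \<beta> b \<cdot>\<^bsub>A\<^esub> ph z) =
      sw Bd fscl \<mu> (\<lambda>\<mu>1 \<mu>2. sw B fscl m (\<lambda>m1 m2. tt \<mu>2 m1 \<cdot>\<^bsub>A\<^esub> tt \<beta> b \<cdot>\<^bsub>A\<^esub> ph (tt \<mu>1 m2)))"
      by (intro sw_drin[OF kspace_TT]) (simp_all add: bilI)
    also have "\<dots> = sw Bd fscl \<mu> (\<lambda>v \<mu>3. sw B fscl m (\<lambda>u m3. sw B fscl u (\<lambda>m1 m2. sw Bd fscl v (\<lambda>\<mu>1 \<mu>2.
        tt (\<mu>3 \<cdot>\<^bsub>Bd\<^esub> act_left B m1 \<beta> \<cdot>\<^bsub>Bd\<^esub> D.Si \<mu>2) (coact_right B (m2 \<cdot>\<^bsub>B\<^esub> b \<cdot>\<^bsub>B\<^esub> ant B m3) (D.Si \<mu>1))))))"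
    proof (intro d.sw_cong sw_cong *)
      fix v \<mu>3 u m3 assume **[simp]: "v \<in> car Bd" "\<mu>3 \<in> car Bd" "u \<in> car B" "m3 \<in> car B"
      \<comment> \<open>\<open>D.Si\<close> reverses the coproduct, hence \<open>\<mu>2\<close> ends
        up in the product of functionals and \<open>\<mu>1\<close> in the coaction.\<close>
      have g: "sw Bd fscl (D.Si v) g = sw Bd fscl v (\<lambda>\<mu>1 \<mu>2. g (D.Si \<mu>2) (D.Si \<mu>1))"
        if "bil Bd Bd TT g" for g
        unfolding ant_inv_dual[OF **(1)] using sw_pull[OF Si_lin Si_mul kspace_TT _ that, of fscl v]
        by (simp add: ant_inv_dual cong: sw_cong_car)
      have "tt \<mu>3 u \<cdot>\<^bsub>A\<^esub> tt \<beta> b \<cdot>\<^bsub>A\<^esub> ph (tt v m3) =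
          lh \<mu>3 \<cdot>\<^bsub>A\<^esub> (rh u \<cdot>\<^bsub>A\<^esub> lh \<beta>) \<cdot>\<^bsub>A\<^esub> (rh b \<cdot>\<^bsub>A\<^esub> rh (ant B m3) \<cdot>\<^bsub>A\<^esub> lh (D.Si v))"
        by (simp add: ph_tt) (simp add: h_assoc flip: lh_rh)
      also have "\<dots> = sw B fscl u (\<lambda>m1 m2. (lh \<mu>3 \<cdot>\<^bsub>A\<^esub> lh (act_left B m1 \<beta>)) \<cdot>\<^bsub>A\<^esub>
          (rh (m2 \<cdot>\<^bsub>B\<^esub> b \<cdot>\<^bsub>B\<^esub> ant B m3) \<cdot>\<^bsub>A\<^esub> lh (D.Si v)))"
        unfolding rh_lh[OF **(3) *(3)]
        by (simp add: heis_out h_assoc rh_mul cong: sw_cong_car)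
      also have "\<dots> = sw B fscl u (\<lambda>m1 m2. sw Bd fscl v (\<lambda>\<mu>1 \<mu>2.
        tt (\<mu>3 \<cdot>\<^bsub>Bd\<^esub> act_left B m1 \<beta> \<cdot>\<^bsub>Bd\<^esub> D.Si \<mu>2) (coact_right B (m2 \<cdot>\<^bsub>B\<^esub> b \<cdot>\<^bsub>B\<^esub> ant B m3) (D.Si \<mu>1))))"
        by (simp add: rh_lh_coact heis_out g bilI lt flip: lh_mul cong: sw_cong_car)
      finally show "tt \<mu>3 u \<cdot>\<^bsub>A\<^esub> tt \<beta> b \<cdot>\<^bsub>A\<^esub> ph (tt v m3) = sw B fscl u (\<lambda>m1 m2. sw Bd fscl v (\<lambda>\<mu>1 \<mu>2.
        tt (\<mu>3 \<cdot>\<^bsub>Bd\<^esub> act_left B m1 \<beta> \<cdot>\<^bsub>Bd\<^esub> D.Si \<mu>2) (coact_right B (m2 \<cdot>\<^bsub>B\<^esub> b \<cdot>\<^bsub>B\<^esub> ant B m3) (D.Si \<mu>1))))" .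
    qed
    \<comment> \<open>Sums over the dual go outside those over \<open>B\<close>, so that
      coassociativity can turn each left-nested pair into the right-nested form of
      \<open>sw3\<close>.\<close>
    also have "\<dots> = sw Bd fscl \<mu> (\<lambda>v \<mu>3. sw Bd fscl v (\<lambda>\<mu>1 \<mu>2. sw B fscl m (\<lambda>u m3. sw B fscl u (\<lambda>m1 m2.
        tt (\<mu>3 \<cdot>\<^bsub>Bd\<^esub> act_left B m1 \<beta> \<cdot>\<^bsub>Bd\<^esub> D.Si \<mu>2) (coact_right B (m2 \<cdot>\<^bsub>B\<^esub> b \<cdot>\<^bsub>B\<^esub> ant B m3) (D.Si \<mu>1))))))"
      by (simp add: sw_swap[OF vector_space_fscl, where H=B and G=Bd])
    also have "\<dots> = J \<mu> m \<beta> b"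
      unfolding J_def
      by (simp add: coassoc_Bd[of TT fscl] sw_coassoc[of TT fscl] cong: sw_cong_car)
    finally show ?thesis using that by (simp add: pure)
  qed
  note eqI = tens_lin_eqI[OF kspace_dual kspace_axioms, where U=TT]
  have "drinfeld_action B (tt \<mu> m) x = sw Dr fscl (tt \<mu> m) (\<lambda>y z. y \<cdot>\<^bsub>A\<^esub> x \<cdot>\<^bsub>A\<^esub> ph z)"
    if "\<mu> \<in> car Bd" "m \<in> car B" for \<mu> m
    by (rule eqI[where p=x, OF x]) (use that in \<open>simp_all add: eq l2 lin_id\<close>)
  then show ?thesis
    by - (rule eqI[where p=h, OF h], use x in \<open>simp_all add: l1 lin_id\<close>)
qed

sublocale I: inner_action Dr A "\<lambda>x. x" ph "drinfeld_action B"
proof (intro inner_action.intro inner_action_axioms.intro kcoalgebra_drin kalgebra_heis)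
  note [simp] = drls unt_dual_closed
  show "lin Dr A (\<lambda>x. x)" "lin Dr A ph" by (simp_all add: lin_id)
  show "inj_on (\<lambda>x. x) (car Dr)" by simp
  show "bij_betw ph (car Dr) (car A)" by (simp add: ph_bij)
  show "sw Dr (scl A) h (\<lambda>x y. x \<cdot>\<^bsub>A\<^esub> ph y) = scl A (cou Dr h) (unt A)" if "h \<in> car Dr" for h
    using ph_conv_right that by simp
  show "sw Dr (scl A) h (\<lambda>x y. ph x \<cdot>\<^bsub>A\<^esub> y) = scl A (cou Dr h) (unt A)" if "h \<in> car Dr" for h
    using ph_conv_left that by simp
  show "unt Dr \<in> car Dr" by simp
  show "cop Dr (unt Dr) = ptens Dr Dr (unt Dr) (unt Dr)" using drin_unt_cop by simp
  show "unt Dr = unt A" by simp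
  show "ph (unt Dr) = unt A" by (simp add: ph_tt rh_unt lh_unt)
  show "h \<cdot>\<^bsub>Dr\<^esub> g \<in> car Dr" if "h \<in> car Dr" "g \<in> car Dr" for h g
    using that by (simp add: drin_closed)
  show "sw Dr fscl (h \<cdot>\<^bsub>Dr\<^esub> g) (\<lambda>x y. ptens A A x (ph y)) =
      sw Dr fscl h (\<lambda>x y. ptens A A x (ph y)) \<cdot>\<^bsub>env A\<^esub> sw Dr fscl g (\<lambda>x y. ptens A A x (ph y))"
    if "h \<in> car Dr" "g \<in> car Dr" for h g
    using that th_mul by (simp add: th_def)
  show "drinfeld_action B h c = sw Dr (scl A) h (\<lambda>x y. x \<cdot>\<^bsub>A\<^esub> c \<cdot>\<^bsub>A\<^esub> ph y)" if "h \<in> car Dr" "c \<in> car A" for h c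
    using that by (simp add: action_eq)
qed

end

section \<open>The bialgebra axioms of the Drinfeld double\<close>

context dual_setup_bij
begin

lemma kalgebra_drin: "kalgebra Dr"
  by (rule I.kalgebra_H)

lemma act_left_right: "x \<in> car B \<Longrightarrow> y \<in> car B \<Longrightarrow> \<nu> \<in> car Bd \<Longrightarrow>
    act_right B (act_left B x \<nu>) y = act_left B x (act_right B \<nu> y)"
  by (rule dual_eqI) (simp_all add: rls act_left_apply act_right_apply assoc)

lemma act_right_mul: "x \<in> car B \<Longrightarrow> y \<in> car B \<Longrightarrow> \<nu> \<in> car Bd \<Longrightarrow>
    act_right B (act_right B \<nu> x) y = act_right B \<nu> (x \<cdot>\<^bsub>B\<^esub> y)"
  by (rule dual_eqI) (simp_all add: rls act_right_apply assoc)

lemma act_right_unt: "\<nu> \<in> car Bd \<Longrightarrow> act_right B \<nu> (unt B) = \<nu>"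
  by (rule dual_eqI) (simp_all add: rls act_right_apply)

lemma drin_lh: "\<mu> \<in> car Bd \<Longrightarrow> \<nu> \<in> car Bd \<Longrightarrow> n \<in> car B \<Longrightarrow> lh \<mu> \<cdot>\<^bsub>Dr\<^esub> tt \<nu> n = tt (\<mu> \<cdot>\<^bsub>Bd\<^esub> \<nu>) n"
  by (simp add: lh_def drin_tt sw_unt[of TT] bilI drls act_left_unt act_right_unt)

lemma drin_lh_rh: "\<mu> \<in> car Bd \<Longrightarrow> m \<in> car B \<Longrightarrow> lh \<mu> \<cdot>\<^bsub>Dr\<^esub> rh m = tt \<mu> m"
  using kalgebra.unt_right[OF kalgebra_dual, of \<mu>] by (simp add: rh_def drin_lh unt_dual_closed)

lemma drin_lh_mul: "\<mu> \<in> car Bd \<Longrightarrow> \<nu> \<in> car Bd \<Longrightarrow> lh (\<mu> \<cdot>\<^bsub>Bd\<^esub> \<nu>) = lh \<mu> \<cdot>\<^bsub>Dr\<^esub> lh \<nu>"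
  using drin_lh[of \<mu> \<nu> "unt B"] by (simp add: lh_def)

lemma drin_rh_lh: "m \<in> car B \<Longrightarrow> \<nu> \<in> car Bd \<Longrightarrow> rh m \<cdot>\<^bsub>Dr\<^esub> lh \<nu> = RD m \<nu>"
  using kalgebra.unt_left[OF kalgebra_dual]
  by (simp add: rh_def lh_def drin_tt RD_def unt_dual_closed drls cong: sw_cong_car)

lemma drin_rh_mul:
  assumes "m \<in> car B" "n \<in> car B"
  shows "rh (m \<cdot>\<^bsub>B\<^esub> n) = rh m \<cdot>\<^bsub>Dr\<^esub> rh n"
proof -
  note [simp] = drls unt_dual_closed
  have u [simp]: "scl Bd c (unt Bd) \<in> car Bd" for c
    using kspace.scl_closed[OF kspace_dual unt_dual_closed] .
  \<comment> \<open>Translations multiply the counit functional by counits, so the outer two legs of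
    \<open>m\<close> disappear.\<close>
  have a: "act_right B (act_left B x (unt Bd)) y = scl Bd (cou B x * cou B y) (unt Bd)"
    if "x \<in> car B" "y \<in> car B" for x y
    using that act_right_apply[OF that(2) u, of _ "cou B x"] u
    by (intro dual_eqI) (simp_all add: act_left_counit mult_ac del: scl_dual, simp_all add: mult_ac)
  have "rh m \<cdot>\<^bsub>Dr\<^esub> rh n = sw B fscl m (\<lambda>m1 z. sw B fscl z (\<lambda>m2 m3.
      fscl (cou B m3) (fscl (cou B m1) (tt (unt Bd) (m2 \<cdot>\<^bsub>B\<^esub> n)))))"
    using assms kalgebra.unt_left[OF kalgebra_dual u]
      lin_scl[OF bil_left[OF ptens_bil[OF kspace_dual kspace_axioms]] unt_dual_closed]
      vector_space.vector_space_assms(3)[OF vector_space_fscl]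
    by (simp add: rh_def drin_tt a mult.commute del: scl_dual cong: sw_cong_car)
  also have "\<dots> = sw B fscl m (\<lambda>m1 z. fscl (cou B m1) (tt (unt Bd) (z \<cdot>\<^bsub>B\<^esub> n)))"
    using assms by (intro sw_cong sw_counit_right[where U=TT and f="\<lambda>z. fscl _ (tt (unt Bd) (z \<cdot>\<^bsub>B\<^esub> n))"]) simp_all
  also have "\<dots> = rh (m \<cdot>\<^bsub>B\<^esub> n)"
    unfolding rh_def using assms by (intro sw_counit_left[where U=TT]) simp_all
  finally show ?thesis ..
qed

abbreviation "DD \<equiv> talg Dr Dr"

lemma kalgebra_DD: "kalgebra DD"
  by (intro kalgebra_talg kalgebra_drin)

lemma dd_ptens: "x \<in> car TT \<Longrightarrow> y \<in> car TT \<Longrightarrow> z \<in> car TT \<Longrightarrow> w \<in> car TT \<Longrightarrow>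
    p2 x y \<cdot>\<^bsub>DD\<^esub> p2 z w = p2 (x \<cdot>\<^bsub>Dr\<^esub> z) (y \<cdot>\<^bsub>Dr\<^esub> w)"
  using talg_ptens[OF kalgebra_drin kalgebra_drin] by simp

lemma dd_out:
  assumes "kcoprod C" "h \<in> car C" "x \<in> car T2" "\<And>u v. u \<in> car C \<Longrightarrow> v \<in> car C \<Longrightarrow> f u v \<in> car T2"
  shows "sw C fscl h f \<cdot>\<^bsub>DD\<^esub> x = sw C fscl h (\<lambda>u v. f u v \<cdot>\<^bsub>DD\<^esub> x)"
    and "x \<cdot>\<^bsub>DD\<^esub> sw C fscl h f = sw C fscl h (\<lambda>u v. x \<cdot>\<^bsub>DD\<^esub> f u v)"
  using mul_sw_left[OF kalgebra_DD assms(1), of fscl h x f]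
    mul_sw_right[OF kalgebra_DD assms(1), of fscl h x f] assms by simp_all

text \<open>The parts of the coproduct on the dual and on \<open>B\<close>, again separated for
  \<open>twisted_hom\<close>.\<close>

definition cl where "cl \<mu> = sw Bd fscl \<mu> (\<lambda>\<mu>1 \<mu>2. p2 (lh \<mu>2) (lh \<mu>1))"
definition cr where "cr m = sw B fscl m (\<lambda>m1 m2. p2 (rh m1) (rh m2))"

lemma cl_lin: "lin Bd T2 cl" and cr_lin: "lin B T2 cr"
  unfolding cl_def[abs_def] cr_def[abs_def] by (simp_all add: drls)

lemma cl_mul:
  assumes "\<mu> \<in> car Bd" "\<nu> \<in> car Bd"
  shows "cl (\<mu> \<cdot>\<^bsub>Bd\<^esub> \<nu>) = cl \<mu> \<cdot>\<^bsub>DD\<^esub> cl \<nu>"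
proof -
  note [simp] = drls
  have "cl (\<mu> \<cdot>\<^bsub>Bd\<^esub> \<nu>) = sw Bd fscl \<mu> (\<lambda>\<mu>1 \<mu>2. sw Bd fscl \<nu> (\<lambda>\<nu>1 \<nu>2.
      p2 (lh (\<mu>2 \<cdot>\<^bsub>Bd\<^esub> \<nu>2)) (lh (\<mu>1 \<cdot>\<^bsub>Bd\<^esub> \<nu>1))))"
    unfolding cl_def using assms by (intro D.sw_mul[OF T2_space]) (simp_all add: bilI)
  also have "\<dots> = sw Bd fscl \<mu> (\<lambda>\<mu>1 \<mu>2. sw Bd fscl \<nu> (\<lambda>\<nu>1 \<nu>2. p2 (lh \<mu>2) (lh \<mu>1) \<cdot>\<^bsub>DD\<^esub> p2 (lh \<nu>2) (lh \<nu>1)))"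
    using assms by (simp add: dd_ptens drin_lh_mul cong: sw_cong_car)
  also have "\<dots> = cl \<mu> \<cdot>\<^bsub>DD\<^esub> cl \<nu>"
    using assms by (simp add: cl_def dd_out cong: sw_cong_car) (rule sw_swap[OF vector_space_fscl])
  finally show ?thesis .
qed

lemma cr_mul:
  assumes "m \<in> car B" "n \<in> car B"
  shows "cr (m \<cdot>\<^bsub>B\<^esub> n) = cr m \<cdot>\<^bsub>DD\<^esub> cr n"
proof -
  note [simp] = drls
  have "cr (m \<cdot>\<^bsub>B\<^esub> n) = sw B fscl m (\<lambda>m1 m2. sw B fscl n (\<lambda>n1 n2.
      p2 (rh (m1 \<cdot>\<^bsub>B\<^esub> n1)) (rh (m2 \<cdot>\<^bsub>B\<^esub> n2))))"
    unfolding cr_def using assms by (intro sw_mul[OF T2_space]) (simp_all add: bilI)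
  also have "\<dots> = sw B fscl m (\<lambda>m1 m2. sw B fscl n (\<lambda>n1 n2. p2 (rh m1) (rh m2) \<cdot>\<^bsub>DD\<^esub> p2 (rh n1) (rh n2)))"
    using assms by (simp add: dd_ptens drin_rh_mul cong: sw_cong_car)
  also have "\<dots> = cr m \<cdot>\<^bsub>DD\<^esub> cr n"
    using assms by (simp add: cr_def dd_out cong: sw_cong_car) (rule sw_swap[OF vector_space_fscl])
  finally show ?thesis .
qed

lemma cop_tt:
  assumes "\<mu> \<in> car Bd" "m \<in> car B"
  shows "cop Dr (tt \<mu> m) = cl \<mu> \<cdot>\<^bsub>DD\<^esub> cr m"
proof -
  note [simp] = drls
  have "cop Dr (tt \<mu> m) = sw Bd fscl \<mu> (\<lambda>\<mu>1 \<mu>2. sw B fscl m (\<lambda>m1 m2.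
      p2 (lh \<mu>2) (lh \<mu>1) \<cdot>\<^bsub>DD\<^esub> p2 (rh m1) (rh m2)))"
    using assms by (simp add: drin_cop_tt dd_ptens drin_lh_rh cong: sw_cong_car)
  also have "\<dots> = cl \<mu> \<cdot>\<^bsub>DD\<^esub> cr m"
    using assms by (simp add: cl_def cr_def dd_out cong: sw_cong_car) (rule sw_swap[OF vector_space_fscl])
  finally show ?thesis .
qed

text \<open>The coproduct respects the straightening rule. The product spreads \<open>m\<close> over
  six legs: \<open>m1\<close>, \<open>Si m3\<close> act on the second leg of \<open>\<nu>\<close>
  and \<open>m4\<close>, \<open>Si m6\<close> on the first. Moving \<open>m4\<close> across the
  coproduct of \<open>\<nu>\<close> makes \<open>m4 \<cdot> Si m3\<close> act on the second leg, and
  this cancels.\<close>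

lemma cr_cl:
  assumes m: "m \<in> car B" and n: "\<nu> \<in> car Bd"
  shows "cr m \<cdot>\<^bsub>DD\<^esub> cl \<nu> = cop Dr (RD m \<nu>)"
proof -
  note [simp] = drls
  note T = sw_coassoc[of T2 fscl]
  \<comment> \<open>The slot \<open>p\<close> holds the inner translation of \<open>\<nu>2\<close>:
    first \<open>m4 \<cdot> Si m3\<close>, and the unit after cancellation.\<close>
  define f where "f m1 m2 p m5 m6 = sw Bd fscl \<nu> (\<lambda>\<nu>1 \<nu>2.
      p2 (tt (act_left B m1 (act_right B \<nu>2 p)) m2) (tt (act_right B \<nu>1 (Si m6)) m5))" for m1 m2 p m5 m6
  have f [simp]: "f m1 m2 p m5 m6 \<in> car T2"
    if "m1 \<in> car B" "m2 \<in> car B" "p \<in> car B" "m5 \<in> car B" "m6 \<in> car B" for m1 m2 p m5 m6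
    unfolding f_def using that n by simp
  have fl [simp]: "lin V T2 (\<lambda>v. f (g v) x y z w)" "lin V T2 (\<lambda>v. f x (g v) y z w)"
      "lin V T2 (\<lambda>v. f x y (g v) z w)" "lin V T2 (\<lambda>v. f x y z (g v) w)" "lin V T2 (\<lambda>v. f x y z w (g v))"
    if "x \<in> car B" "y \<in> car B" "z \<in> car B" "w \<in> car B" "lin V B g" "kspace V"
    for x y z w and g and V :: "('k, 'b, 'c) space_scheme"
    unfolding f_def using that n by simp_all
  have "cr m \<cdot>\<^bsub>DD\<^esub> cl \<nu> = sw B fscl m (\<lambda>u v. sw Bd fscl \<nu> (\<lambda>\<nu>1 \<nu>2. p2 (RD u \<nu>2) (RD v \<nu>1)))"
    using m n by (simp add: cr_def cl_def dd_out dd_ptens drin_rh_lh cong: sw_cong_car)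
      (rule sw_swap[OF vector_space_fscl])
  also have "\<dots> = sw B fscl m (\<lambda>u v. sw B fscl u (\<lambda>m1 z. sw B fscl z (\<lambda>m2 m3.
      sw B fscl v (\<lambda>m4 w. sw B fscl w (\<lambda>m5 m6. f m1 m2 (m4 \<cdot>\<^bsub>B\<^esub> Si m3) m5 m6)))))"
  proof (intro sw_cong m)
    fix u v assume [simp]: "u \<in> car B" "v \<in> car B"
    have "sw Bd fscl \<nu> (\<lambda>\<nu>1 \<nu>2. p2 (RD u \<nu>2) (RD v \<nu>1)) =
      sw Bd fscl \<nu> (\<lambda>\<nu>1 \<nu>2. sw B fscl u (\<lambda>m1 z. sw B fscl z (\<lambda>m2 m3. sw B fscl v (\<lambda>m4 w. sw B fscl w (\<lambda>m5 m6.
        p2 (tt (act_right B (act_left B m1 \<nu>2) (Si m3)) m2) (tt (act_right B (act_left B m4 \<nu>1) (Si m6)) m5))))))"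
    proof (intro d.sw_cong n)
      fix \<nu>1 \<nu>2 assume [simp]: "\<nu>1 \<in> car Bd" "\<nu>2 \<in> car Bd"
      have 1: "p2 (RD u \<nu>2) x = sw B fscl u (\<lambda>m1 z. sw B fscl z (\<lambda>m2 m3.
          p2 (tt (act_right B (act_left B m1 \<nu>2) (Si m3)) m2) x))" if "x \<in> car TT" for x
        using that by (simp add: RD_def ptens_sw_left cong: sw_cong_car)
      have 2: "p2 x (RD v \<nu>1) = sw B fscl v (\<lambda>m4 w. sw B fscl w (\<lambda>m5 m6.
          p2 x (tt (act_right B (act_left B m4 \<nu>1) (Si m6)) m5)))" if "x \<in> car TT" for x
        using that by (simp add: RD_def ptens_sw_right cong: sw_cong_car)
      show "p2 (RD u \<nu>2) (RD v \<nu>1) = sw B fscl u (\<lambda>m1 z. sw B fscl z (\<lambda>m2 m3. sw B fscl v (\<lambda>m4 w. sw B fscl w (\<lambda>m5 m6.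
        p2 (tt (act_right B (act_left B m1 \<nu>2) (Si m3)) m2) (tt (act_right B (act_left B m4 \<nu>1) (Si m6)) m5)))))"
        by (subst 1) (auto simp: RD_closed intro!: sw_cong 2)
    qed
    also have "\<dots> = sw B fscl u (\<lambda>m1 z. sw B fscl z (\<lambda>m2 m3. sw B fscl v (\<lambda>m4 w. sw B fscl w (\<lambda>m5 m6.
        sw Bd fscl \<nu> (\<lambda>\<nu>1 \<nu>2. p2 (tt (act_left B m1 (act_right B \<nu>2 (Si m3))) m2) (tt (act_left B m4 (act_right B \<nu>1 (Si m6))) m5))))))"
      using n by (simp add: sw_swap[OF vector_space_fscl, where H=Bd and G=B] act_left_right cong: sw_cong_car)
    also have "\<dots> = sw B fscl u (\<lambda>m1 z. sw B fscl z (\<lambda>m2 m3. sw B fscl v (\<lambda>m4 w. sw B fscl w (\<lambda>m5 m6.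
        f m1 m2 (m4 \<cdot>\<^bsub>B\<^esub> Si m3) m5 m6))))"
    proof (intro sw_cong)
      fix m1 z m2 m3 m4 w m5 m6
      assume [simp]: "m1 \<in> car B" "z \<in> car B" "m2 \<in> car B" "m3 \<in> car B" "m4 \<in> car B" "w \<in> car B" "m5 \<in> car B" "m6 \<in> car B"
      have "sw Bd fscl \<nu> (\<lambda>\<nu>1 \<nu>2. p2 (tt (act_left B m1 (act_right B \<nu>2 (Si m3))) m2)
            (tt (act_left B m4 (act_right B \<nu>1 (Si m6))) m5)) =
          sw Bd fscl \<nu> (\<lambda>\<nu>1 \<nu>2. p2 (tt (act_left B m1 (act_right B \<nu>2 (Si m3))) m2)
            (tt (act_right B (act_left B m4 \<nu>1) (Si m6)) m5))"
        using n by (simp add: act_left_right cong: sw_cong_car)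
      \<comment> \<open>The translation by \<open>m4\<close> passes from the first leg of
        \<open>\<nu>\<close> to the second by \<open>sw_act_shift\<close>.\<close>
      also have "\<dots> = sw Bd fscl \<nu> (\<lambda>\<nu>1 \<nu>2. p2 (tt (act_left B m1 (act_right B (act_right B \<nu>2 m4) (Si m3))) m2)
            (tt (act_right B \<nu>1 (Si m6)) m5))"
        using n by (intro sw_act_shift[OF T2_space, where f="\<lambda>\<nu>1 \<nu>2. p2 (tt (act_left B m1 (act_right B \<nu>2 (Si m3))) m2)
            (tt (act_right B \<nu>1 (Si m6)) m5)"]) (simp_all add: bilI)
      also have "\<dots> = f m1 m2 (m4 \<cdot>\<^bsub>B\<^esub> Si m3) m5 m6"
        using n by (simp add: f_def act_right_mul cong: sw_cong_car)
      finally show "sw Bd fscl \<nu> (\<lambda>\<nu>1 \<nu>2. p2 (tt (act_left B m1 (act_right B \<nu>2 (Si m3))) m2)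
            (tt (act_left B m4 (act_right B \<nu>1 (Si m6))) m5)) = f m1 m2 (m4 \<cdot>\<^bsub>B\<^esub> Si m3) m5 m6" .
    qed simp_all
    finally show "sw Bd fscl \<nu> (\<lambda>\<nu>1 \<nu>2. p2 (RD u \<nu>2) (RD v \<nu>1)) =
      sw B fscl u (\<lambda>m1 z. sw B fscl z (\<lambda>m2 m3. sw B fscl v (\<lambda>m4 w. sw B fscl w (\<lambda>m5 m6.
        f m1 m2 (m4 \<cdot>\<^bsub>B\<^esub> Si m3) m5 m6))))" .
  qed
  also have "\<dots> = sw B fscl m (\<lambda>m1 w1. sw B fscl w1 (\<lambda>z v. sw B fscl z (\<lambda>m2 m3.
      sw B fscl v (\<lambda>m4 w. sw B fscl w (\<lambda>m5 m6. f m1 m2 (m4 \<cdot>\<^bsub>B\<^esub> Si m3) m5 m6)))))"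
    using m by (intro sw_coassoc[of T2 fscl m "\<lambda>m1 z v. sw B fscl z (\<lambda>m2 m3.
      sw B fscl v (\<lambda>m4 w. sw B fscl w (\<lambda>m5 m6. f m1 m2 (m4 \<cdot>\<^bsub>B\<^esub> Si m3) m5 m6)))"]) simp_all
  also have "\<dots> = sw B fscl m (\<lambda>m1 w1. sw B fscl w1 (\<lambda>m2 w2. sw B fscl w2 (\<lambda>m3 v.
      sw B fscl v (\<lambda>m4 w. sw B fscl w (\<lambda>m5 m6. f m1 m2 (m4 \<cdot>\<^bsub>B\<^esub> Si m3) m5 m6)))))"
  proof (rule sw_cong[OF m])
    fix m1 w1 assume [simp]: "m1 \<in> car B" "w1 \<in> car B"
    show "sw B fscl w1 (\<lambda>z v. sw B fscl z (\<lambda>m2 m3.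
      sw B fscl v (\<lambda>m4 w. sw B fscl w (\<lambda>m5 m6. f m1 m2 (m4 \<cdot>\<^bsub>B\<^esub> Si m3) m5 m6)))) =
      sw B fscl w1 (\<lambda>m2 w2. sw B fscl w2 (\<lambda>m3 v.
      sw B fscl v (\<lambda>m4 w. sw B fscl w (\<lambda>m5 m6. f m1 m2 (m4 \<cdot>\<^bsub>B\<^esub> Si m3) m5 m6))))"
      by (intro sw_coassoc[of T2 fscl w1 "\<lambda>m2 m3 v. 
      sw B fscl v (\<lambda>m4 w. sw B fscl w (\<lambda>m5 m6. f m1 m2 (m4 \<cdot>\<^bsub>B\<^esub> Si m3) m5 m6))"]) simp_all
  qed
  also have "\<dots> = sw B fscl m (\<lambda>m1 w1. sw B fscl w1 (\<lambda>m2 w2. sw B fscl w2 (\<lambda>m5 m6. f m1 m2 (unt B) m5 m6)))"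
  proof (rule sw_cong[OF m], rule sw_cong)
    fix m1 w1 m2 w2 assume [simp]: "m1 \<in> car B" "w1 \<in> car B" "m2 \<in> car B" "w2 \<in> car B"
    \<comment> \<open>Isolates the linear dependence on \<open>p\<close>, so that the sum over
      \<open>m3\<close> and \<open>m4\<close> can be moved inside and evaluated by
      \<open>Si_right\<close>.\<close>
    define K where "K p w = sw B fscl w (\<lambda>m5 m6. f m1 m2 p m5 m6)" for p w
    have K [simp]: "K p w \<in> car T2" if "p \<in> car B" "w \<in> car B" for p w
      unfolding K_def using that by simp
    have Kl: "lin B T2 (\<lambda>p. K p w)" "lin B T2 (\<lambda>p. K w p)" if "w \<in> car B" for w
      unfolding K_def using that by simp_all
    note lin_comp[OF Kl(1), simp] lin_comp[OF Kl(2), simp]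
    have "sw B fscl w2 (\<lambda>m3 v. sw B fscl v (\<lambda>m4 w. K (m4 \<cdot>\<^bsub>B\<^esub> Si m3) w)) =
        sw B fscl w2 (\<lambda>v w. sw B fscl v (\<lambda>m3 m4. K (m4 \<cdot>\<^bsub>B\<^esub> Si m3) w))"
      by (intro sw_coassoc[of T2 fscl w2 "\<lambda>m3 m4 w. K (m4 \<cdot>\<^bsub>B\<^esub> Si m3) w", symmetric]) simp_all
    also have "\<dots> = sw B fscl w2 (\<lambda>v w. K (sw B (scl B) v (\<lambda>m3 m4. m4 \<cdot>\<^bsub>B\<^esub> Si m3)) w)"
      by (intro sw_cong) (simp_all add: sw_out[OF Kl(1), where sc'=fscl])
    also have "\<dots> = sw B fscl w2 (\<lambda>v w. fscl (cou B v) (K (unt B) w))"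
      using lin_scl[OF Kl(1)] by (simp add: Si_right cong: sw_cong)
    also have "\<dots> = K (unt B) w2"
      by (simp add: sw_counit_left[of T2 _ fscl] Kl)
    finally show "sw B fscl w2 (\<lambda>m3 v. sw B fscl v (\<lambda>m4 w. sw B fscl w (\<lambda>m5 m6. f m1 m2 (m4 \<cdot>\<^bsub>B\<^esub> Si m3) m5 m6))) =
        sw B fscl w2 (\<lambda>m5 m6. f m1 m2 (unt B) m5 m6)"
      by (simp add: K_def)
  qed simp_all
  also have "\<dots> = sw B fscl m (\<lambda>m1 z. sw B fscl z (\<lambda>x m3. sw B fscl x (\<lambda>m2 m5. f m1 m2 (unt B) m5 m3)))"
    using m by (simp add: T cong: sw_cong)
  also have "\<dots> = cop Dr (RD m \<nu>)"
  proof -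
    have "cop Dr (RD m \<nu>) = sw B fscl m (\<lambda>m1 z. sw B fscl z (\<lambda>x m3. cop Dr (tt (act_right B (act_left B m1 \<nu>) (Si m3)) x)))"
      using m n by (simp add: RD_def sw_out[OF drin_cop_lin kspace_TT, where sc'=fscl] cong: sw_cong)
    also have "\<dots> = sw B fscl m (\<lambda>m1 z. sw B fscl z (\<lambda>x m3. sw B fscl x (\<lambda>m2 m5. f m1 m2 (unt B) m5 m3)))"
    proof (intro sw_cong m)
      fix m1 z x m3 assume [simp]: "m1 \<in> car B" "z \<in> car B" "x \<in> car B" "m3 \<in> car B"
      have "cop Dr (tt (act_right B (act_left B m1 \<nu>) (Si m3)) x) =
          sw Bd fscl (act_right B (act_left B m1 \<nu>) (Si m3)) (\<lambda>\<nu>1 \<nu>2. sw B fscl x (\<lambda>m2 m5. p2 (tt \<nu>2 m2) (tt \<nu>1 m5)))"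
        using n by (intro drin_cop_tt) simp_all
      also have "\<dots> = sw Bd fscl \<nu> (\<lambda>\<nu>1 \<nu>2. sw B fscl x (\<lambda>m2 m5. p2 (tt (act_left B m1 \<nu>2) m2) (tt (act_right B \<nu>1 (Si m3)) m5)))"
        using n by (intro sw_act[OF T2_space]) (simp_all add: bilI)
      also have "\<dots> = sw B fscl x (\<lambda>m2 m5. f m1 m2 (unt B) m5 m3)"
        using n by (subst sw_swap[OF vector_space_fscl]) (simp add: f_def act_right_unt cong: sw_cong_car)
      finally show "cop Dr (tt (act_right B (act_left B m1 \<nu>) (Si m3)) x) = sw B fscl x (\<lambda>m2 m5. f m1 m2 (unt B) m5 m3)" .
    qed
    finally show ?thesis ..
  qed
  finally show ?thesis .
qed

lemma drin_cop_mul: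
  assumes "x \<in> car TT" "y \<in> car TT"
  shows "cop Dr (x \<cdot>\<^bsub>Dr\<^esub> y) = cop Dr x \<cdot>\<^bsub>DD\<^esub> cop Dr y"
  by (rule twisted_hom[OF kalgebra_dual kalgebra_axioms kalgebra_DD drin_lin(2)
        drin_lin(1) RD_closed drin_R _ cl_mul _ cr_mul _ cop_tt cr_cl assms])
     (simp_all add: cl_lin cr_lin drin_cop_lin)

text \<open>The field as an algebra over itself, so that multiplicativity of the counit becomes an
  instance of \<open>twisted_hom\<close>.\<close>

definition kalg :: "('k, 'k) alg" where "kalg = \<lparr>car = UNIV, scl = (*), mul = (*), unt = 1\<rparr>"

lemma kalg_simps [simp]: "car kalg = UNIV" "scl kalg = (*)" "x \<cdot>\<^bsub>kalg\<^esub> y = x * y" "unt kalg = 1"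
  "lin V kalg f = lin V ground f" "lin kalg V g = lin ground V g"
  by (simp_all add: kalg_def lin_def)

lemma kalgebra_kalg: "kalgebra kalg"
proof (intro kalgebra.intro kalgebra_axioms.intro)
  show "kspace kalg" using kspace_ground by (simp add: kspace_def)
qed (simp_all add: lin_mult_left lin_mult_right lin_id mult.assoc)

lemma drin_cou_mul:
  assumes "x \<in> car TT" "y \<in> car TT"
  shows "cou Dr (x \<cdot>\<^bsub>Dr\<^esub> y) = cou Dr x * cou Dr y"
proof -
  note [simp] = drls lin_at
  \<comment> \<open>The counit removes the middle leg of \<open>RD\<close>, leaving
    \<open>\<nu>\<close> on \<open>Si z \<cdot> m1\<close> summed over the two legs of
    \<open>m\<close>, which \<open>Si_left\<close> evaluates.\<close>
  have R: "cou B m * \<nu> (unt B) = cou Dr (RD m \<nu>)" if m: "m \<in> car B" and n: "\<nu> \<in> car Bd" for m \<nu>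
  proof -
    have nl: "lin V ground (\<lambda>x. \<nu> (g x))" if "lin V B g" for V :: "('k, 'b, 'c) space_scheme" and g
      using dual_lin_comp[OF n that] .
    have "cou Dr (RD m \<nu>) = sw B (*) m (\<lambda>m1 z. sw B (*) z (\<lambda>m2 m3. cou B m2 * \<nu> (Si m3 \<cdot>\<^bsub>B\<^esub> m1)))"
      using m n by (simp add: RD_def sw_out[OF drin_cou_lin kspace_TT, where sc'="(*)"] drin_cou_tt
          act_left_apply act_right_apply mult.commute cong: sw_cong)
    also have "\<dots> = sw B (*) m (\<lambda>m1 z. \<nu> (Si z \<cdot>\<^bsub>B\<^esub> m1))"
      using m n by (simp add: sw_counit_left[of ground _ "(*)"] nl cong: sw_cong)
    also have "\<dots> = \<nu> (sw B (scl B) m (\<lambda>m1 z. Si z \<cdot>\<^bsub>B\<^esub> m1))"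
      using m n by (intro sw_out[OF dual_lin, symmetric]) simp_all
    also have "\<dots> = cou B m * \<nu> (unt B)"
      using m n by (simp add: Si_left lin_scl[OF dual_lin])
    finally show ?thesis ..
  qed
  have "cou Dr (x \<cdot>\<^bsub>Dr\<^esub> y) = cou Dr x \<cdot>\<^bsub>kalg\<^esub> cou Dr y"
    by (rule twisted_hom[OF kalgebra_dual kalgebra_axioms kalgebra_kalg drin_lin(2) drin_lin(1) RD_closed drin_R
          _ _ _ _ _ _ _ assms, where l="\<lambda>\<mu>. \<mu> (unt B)" and r="cou B"])
       (simp_all add: drin_cou_lin drin_cou_tt R D.cou_mul[unfolded dual_cou])
  then show ?thesis by simp
qed

lemma kbialgebra_drin: "kbialgebra Dr"
proof (intro kbialgebra.intro kbialgebra_axioms.intro kalgebra_drin)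
  show "lin Dr (tens Dr Dr) (cop Dr)" "lin Dr ground (cou Dr)" by (simp_all add: drin_cop_lin drin_cou_lin)
  show "sw2 Dr fscl (\<lambda>x z. sw2 Dr fscl (\<lambda>x' x''. ptens Dr (tens Dr Dr) x' (ptens Dr Dr x'' z)) x) h =
      sw2 Dr fscl (\<lambda>x y. ptens Dr (tens Dr Dr) x (cop Dr y)) h" if "h \<in> car Dr" for h
    using kcoalgebra.coassoc[OF kcoalgebra_drin that] by (simp only: sw2_eq_sw)
  show "sw2 Dr (scl Dr) (\<lambda>x y. scl Dr (cou Dr x) y) h = h" if "h \<in> car Dr" for h
    using kcoalgebra.counit_left[OF kcoalgebra_drin that] by (simp only: sw2_eq_sw)
  show "sw2 Dr (scl Dr) (\<lambda>x y. scl Dr (cou Dr y) x) h = h" if "h \<in> car Dr" for h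
    using kcoalgebra.counit_right[OF kcoalgebra_drin that] by (simp only: sw2_eq_sw)
  show "cop Dr (h \<cdot>\<^bsub>Dr\<^esub> g) = sw2 Dr fscl (\<lambda>h' h''. sw2 Dr fscl
      (\<lambda>g' g''. ptens Dr Dr (h' \<cdot>\<^bsub>Dr\<^esub> g') (h'' \<cdot>\<^bsub>Dr\<^esub> g'')) g) h" if "h \<in> car Dr" "g \<in> car Dr" for h g
    using drin_cop_mul[of h g] that by (simp add: sw2_def talg_mul)
  show "cop Dr (unt Dr) = ptens Dr Dr (unt Dr) (unt Dr)"
    using drin_unt_cop by simp
  show "cou Dr (h \<cdot>\<^bsub>Dr\<^esub> g) = cou Dr h * cou Dr g" if "h \<in> car Dr" "g \<in> car Dr" for h g
    using drin_cou_mul that by simp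
  show "cou Dr (unt Dr) = 1"
    by (simp add: drin_cou_tt unt_dual_closed)
qed

end

theorem mainTheorem3:
  fixes B :: "('k :: field, 'b :: ab_group_add) hopf"
  assumes "khopf_algebra B"
    and "bij_betw (ant B) (car B) (car B)"
  shows "module_algebra (drinfeld B) (heisenberg B) (drinfeld_action B) \<and>
    is_hopf_algebroid_over (smash (heisenberg B) (drinfeld B) (drinfeld_action B)) (heisenberg B)"
proof -
  interpret dual_setup_bij B
    using assms by (intro dual_setup_bij.intro dual_setup.intro khopf_bij.intro khopf_bij_axioms.intro)
  show ?thesis
    using I.module_algebraI[OF kbialgebra_drin] I.smash_hopf_algebroid by blast
qed

end
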